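(* Let $q\ge2$. For any $\beta>\beta_1(q)$ let $\mathcal A_N$ and $\mathcal B_N$ be chosen according to one of the regimes (i), (ii), (iii) described in the context. Then for any $k\ge1$, $$e^{-\beta^2v/4}\le\liminf_{N\to\infty}\frac{\mathbb E\Bigl[\mathrm E^N_{\nu_{\mathcal A_N,\mathcal B_N}}\bigl[\tau^N_{\mathcal B_N}\bigr]^k\Bigr]^{1/k}}{\widetilde{\mathrm E}^N_{\tilde\nu_{\mathcal A_N,\mathcal B_N}}\bigl[\tilde\tau^N_{\mathcal B_N}\bigr]}\le\limsup_{N\to\infty}\frac{\mathbb E\Bigl[\mathrm E^N_{\nu_{\mathcal A_N,\mathcal B_N}}\bigl[\tau^N_{\mathcal B_N}\bigr]^k\Bigr]^{1/k}}{\widetilde{\mathrm E}^N_{\tilde\nu_{\mathcal A_N,\mathcal B_N}}\bigl[\tilde\tau^N_{\mathcal B_N}\bigr]}\le e^{\beta^2vk} .$$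
   Context: **Models.** Let $v\in(0,\infty)$. On a probability space $(\Omega,\mathcal F,\mathbb P)$ with expectation $\mathbb E$ let $(J_{ij})_{1\le i<j<\infty}$ be i.i.d. real random variables with mean $1$ and variance $v$ such that $\{\lambda\in\mathbb R:\mathbb E[e^{\lambda J_{12}}]<\infty\}$ has non-empty interior containing $0$. $\mathcal S_N=\{1,\dots,q\}^N$. The disordered Curie--Weiss--Potts (DCWP) Hamiltonian is $H_N(\sigma)=-\frac1N\sum_{1\le i<j\le N}J_{ij}\mathbf 1_{\{\sigma_i=\sigma_j\}}$, with Gibbs measure $\mu_N(\sigma)=e^{-\beta H_N(\sigma)}/Z_N$. Given $J$, $(\Sigma^N(t))_{t\ge0}$ is the discrete-time Markov chain with transition probabilities $\pi_N(\sigma,\eta)=\frac1{Nq}e^{-\beta[H_N(\eta)-H_N(\sigma)]_+}$ if $\sigma,\eta$ differ in exactly one coordinate, $\pi_N(\sigma,\sigma)=1-\sum_{\eta\ne\sigma}\pi_N(\sigma,\eta)$, and $0$ otherwise ($[a]_+=\max\{0,a\}$). $\mathrm P^N_\nu,\mathrm E^N_\nu$ are its law and expectation with initial distribution $\nu$; $\tau^N_{\mathcal A}=\inf\{t>0:\Sigma^N(t)\in\mathcal A\}$. Quantities with a tilde are those of the Curie--Weiss--Potts (CWP) model, defined in the same way with $H_N$ replaced by $\widetilde H_N(\sigma)=-\frac1N\sum_{i<j}\mathbf 1_{\{\sigma_i=\sigma_j\}}$. For non-empty disjoint $\mathcal A,\mathcal B\subset\mathcal S_N$ the last-exit biased distribution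 is $$\nu_{\mathcal A,\mathcal B}(\sigma)=\frac{\mu_N(\sigma)\mathrm P^N_\sigma[\tau^N_{\mathcal B}<\tau^N_{\mathcal A}]}{\sum_{\sigma'\in\mathcal A}\mu_N(\sigma')\mathrm P^N_{\sigma'}[\tau^N_{\mathcal B}<\tau^N_{\mathcal A}]},\quad\sigma\in\mathcal A,$$ and $\tilde\nu_{\mathcal A,\mathcal B}$ is its CWP analogue. **Free energy and metastable sets.** $\mathcal P=\{x\in[0,1]^q:\sum_k x_k=1\}$, $\mathcal P_N=\mathcal P\cap\frac1N\mathbb N_0^q$, $L_N:\mathcal S_N\to\mathcal P_N$, $L_N(\sigma)_k=\frac1N\sum_{i=1}^N\mathbf 1_{\{\sigma_i=k\}}$. $\widetilde F_{\beta,q}(x)=-\frac12\|x\|_2^2+\frac1\beta\sum_{i=1}^q x_i\ln x_i$ on $\mathcal P$ ($0\ln0=0$). $\boldsymbol m_0=(1/q,\dots,1/q)$; for $i\in\{1,\dots,q\}$, $\boldsymbol m_i$ has $k$-th coordinate $(1-s)/q$ for $k\ne i$ and $(1+(q-1)s)/q$ for $k=i$, where $s\in[0,1)$ is the largest solution of $\ln(1+(q-1)s)-\ln(1-s)=\beta s$. $\beta_1(q)$ is the infimum of all $\beta>0$ for which $\widetilde F_{\beta,q}$ has a local minimizer in $\mathcal P$ other than $\boldsymbol m_0$; $\beta_2(q)$ is the supremum of all $\beta>0$ for which $\boldsymbol m_0$ is a global minimizer of $\widetilde F_{\beta,q}$. $\boldsymbol m_{i,N}\in\mathcal P_N$ is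 a closest lattice point to $\boldsymbol m_i$, and $\mathcal M_{i,N}=L_N^{-1}(\boldsymbol m_{i,N})$. **Regimes.** (i) $\mathcal A_N=\bigcup_{i=1}^q\mathcal M_{i,N}$, $\mathcal B_N=\mathcal M_{0,N}$ if $\beta_1(q)<\beta\le\beta_2(q)$; (ii) $\mathcal A_N=\mathcal M_{0,N}$, $\mathcal B_N=\bigcup_{i=1}^q\mathcal M_{i,N}$ if $\beta_2(q)<\beta<q$; (iii) $\mathcal A_N=\mathcal M_{1,N}$, $\mathcal B_N=\bigcup_{i=2}^q\mathcal M_{i,N}$ if $\beta_2(q)<\beta$. *)

theory Defs
  imports "HOL-Probability.Probability"
begin

section \<open>Discrete-time Markov chains on a finite state space\<close>

text \<open>
  \<open>markov_law S \<nu> p\<close> is the law on path space of the Markov chain on the finite set \<open>S\<close> with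
  initial distribution \<open>\<nu>\<close> and transition matrix \<open>p\<close>, obtained from the Ionescu-Tulcea
  construction of the library (see \<open>markov_law_finite_dim\<close> below for its characterisation).
\<close>

definition markov_kernel ::
  "'s set \<Rightarrow> ('s \<Rightarrow> real) \<Rightarrow> ('s \<Rightarrow> 's \<Rightarrow> real) \<Rightarrow> nat \<Rightarrow> (nat \<Rightarrow> 's) \<Rightarrow> 's measure" where
  "markov_kernel S \<nu> p n X =
     point_measure S (\<lambda>s. ennreal (case n of 0 \<Rightarrow> \<nu> s | Suc t \<Rightarrow> p (X t) s))"

definition markov_law ::
  "'s set \<Rightarrow> ('s \<Rightarrow> real) \<Rightarrow> ('s \<Rightarrow> 's \<Rightarrow> real) \<Rightarrow> (nat \<Rightarrow> 's) measure" where
  "markov_law S \<nu> p =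
     projective_family.lim UNIV
       (Ionescu_Tulcea.CI (markov_kernel S \<nu> p) (\<lambda>_. count_space S)) (\<lambda>_. count_space S)"

definition prob_vector :: "'s set \<Rightarrow> ('s \<Rightarrow> real) \<Rightarrow> bool" where
  "prob_vector S \<nu> \<longleftrightarrow> (\<forall>s\<in>S. 0 \<le> \<nu> s) \<and> (\<Sum>s\<in>S. \<nu> s) = 1"

lemma prob_space_point_measure_vector:
  assumes "finite S" "prob_vector S \<nu>"
  shows "prob_space (point_measure S (\<lambda>s. ennreal (\<nu> s)))"
  using assms
  by (intro prob_spaceI)
     (auto simp: space_point_measure emeasure_point_measure_finite prob_vector_def sum_ennreal)

lemma Ionescu_Tulcea_markov_kernel:
  assumes S: "finite S" and \<nu>: "prob_vector S \<nu>" and p: "\<And>s. s \<in> S \<Longrightarrow> prob_vector S (p s)"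
  shows "Ionescu_Tulcea (markov_kernel S \<nu> p) (\<lambda>_. count_space S)"
proof -
  have prob: "prob_space (markov_kernel S \<nu> p i x)"
    if "x \<in> space (PiM {0..<i} (\<lambda>_. count_space S))" for i x
  proof (cases i)
    case 0
    then show ?thesis
      using prob_space_point_measure_vector[OF S \<nu>] by (simp add: markov_kernel_def)
  next
    case (Suc t)
    with that have "x t \<in> S" by (auto simp: space_PiM PiE_iff)
    from prob_space_point_measure_vector[OF S p[OF this]] Suc show ?thesis
      by (simp add: markov_kernel_def)
  qed
  have "markov_kernel S \<nu> p i
      \<in> measurable (PiM {0..<i} (\<lambda>_. count_space S)) (subprob_algebra (count_space S))" for i
  proof (rule measurable_subprob_algebra)
    fix x assume "x \<in> space (PiM {0..<i} (\<lambda>_. count_space S))"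
    from prob[OF this] show "subprob_space (markov_kernel S \<nu> p i x)"
      by (rule prob_space_imp_subprob_space)
    show "sets (markov_kernel S \<nu> p i x) = sets (count_space S)"
      by (simp add: markov_kernel_def sets_point_measure)
  next
    fix A assume "A \<in> sets (count_space S)"
    then have A: "A \<subseteq> S" by simp
    show "(\<lambda>x. emeasure (markov_kernel S \<nu> p i x) A)
        \<in> borel_measurable (PiM {0..<i} (\<lambda>_. count_space S))"
    proof (cases i)
      case 0
      then show ?thesis by (simp add: markov_kernel_def)
    next
      case (Suc t)
      have [measurable]: "(\<lambda>x. x t) \<in> measurable (PiM {0..<i} (\<lambda>_. count_space S)) (count_space S)"
        using Suc by (intro measurable_component_singleton) auto
      have "(\<lambda>x. ennreal (p (x t) s)) \<in> borel_measurable (PiM {0..<i} (\<lambda>_. count_space S))" for s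
        by (rule measurable_compose[where g="\<lambda>y. ennreal (p y s)" and N="count_space S"]) auto
      then show ?thesis
        using Suc S A by (simp add: markov_kernel_def emeasure_point_measure_finite)
    qed
  qed
  with prob show ?thesis by (simp add: Ionescu_Tulcea_def)
qed

lemma markov_law_finite_dim:
  assumes S: "finite S" and \<nu>: "prob_vector S \<nu>" and p: "\<And>s. s \<in> S \<Longrightarrow> prob_vector S (p s)"
    and s: "\<And>t. s t \<in> S"
  shows "emeasure (markov_law S \<nu> p) {X \<in> space (markov_law S \<nu> p). \<forall>t\<le>n. X t = s t} =
    ennreal (\<nu> (s 0) * (\<Prod>t<n. p (s t) (s (Suc t))))"
proof -
  interpret IT: Ionescu_Tulcea "markov_kernel S \<nu> p" "\<lambda>_. count_space S"
    using S \<nu> p by (rule Ionescu_Tulcea_markov_kernel)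
  let ?M = "\<lambda>n. PiM {0..<n} (\<lambda>_. count_space S)"
  define c where "c m = PiE {0..<m} (\<lambda>t. {s t})" for m
  have c_sets[measurable]: "c m \<in> sets (?M m)" for m
    unfolding c_def by (intro sets_PiM_I_finite) (auto simp: s)
  have c_eq: "c m = {restrict s {0..<m}}" for m
    by (auto simp: c_def PiE_iff extensional_def restrict_def fun_eq_iff)
  have c_space: "restrict s {0..<m} \<in> space (?M m)" for m
    using s by (auto simp: space_PiM)
  define w where "w m = (\<Prod>t<m. ennreal (case t of 0 \<Rightarrow> \<nu> (s 0) | Suc r \<Rightarrow> p (s r) (s (Suc r))))" for m
  have step: "IT.C 0 m (\<lambda>_. undefined) (c m) = w m" for m
  proof (induction m)
    case 0
    then show ?case
      by (simp add: w_def c_eq PiM_empty space_PiM restrict_def)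
  next
    case (Suc m)
    have sp: "space (IT.C 0 m (\<lambda>_. undefined)) = space (?M m)"
      using IT.space_C[of "\<lambda>_. undefined" 0 m] by simp
    have st: "sets (IT.C 0 m (\<lambda>_. undefined)) = sets (?M m)"
      using IT.sets_C[of "\<lambda>_. undefined" 0 m] by simp
    have eP: "IT.eP m x (c (Suc m)) =
        ennreal (case m of 0 \<Rightarrow> \<nu> (s 0) | Suc r \<Rightarrow> p (s r) (s (Suc r))) * indicator (c m) x"
      if x: "x \<in> space (?M m)" for x
    proof -
      have ext: "x \<in> extensional {0..<m}" using x by (auto simp: space_PiM PiE_iff)
      have *: "(\<lambda>y. x(m := y)) -` c (Suc m) \<inter> S = (if x \<in> c m then {s m} else {})"
      proof -
        have "x(m := y) \<in> c (Suc m) \<longleftrightarrow> x \<in> c m \<and> y = s m" for y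
          using ext by (auto simp: c_def PiE_iff extensional_def less_Suc_eq split: if_splits)
        then show ?thesis using s by (auto split: if_splits)
      qed
      have cx: "x \<in> c m \<Longrightarrow> t < m \<Longrightarrow> x t = s t" for t
        by (auto simp: c_def PiE_iff)
      have "IT.eP m x (c (Suc m)) = markov_kernel S \<nu> p m x (if x \<in> c m then {s m} else {})"
        using IT.emeasure_eP[OF x c_sets, of ] * by simp
      also have "\<dots> = ennreal (case m of 0 \<Rightarrow> \<nu> (s 0) | Suc r \<Rightarrow> p (s r) (s (Suc r))) * indicator (c m) x"
        using S s cx by (auto simp: markov_kernel_def emeasure_point_measure_finite split: nat.splits)
      finally show ?thesis .
    qed
    have "IT.C 0 (Suc m) (\<lambda>_. undefined) (c (Suc m)) =
        (\<integral>\<^sup>+x. IT.eP m x (c (Suc m)) \<partial>IT.C 0 m (\<lambda>_. undefined))"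
    proof -
      have "IT.eP m \<in> measurable (IT.C 0 m (\<lambda>_. undefined)) (subprob_algebra (?M (Suc m)))"
        using IT.measurable_eP[of m] by (simp cong: measurable_cong_sets add: measurable_cong_sets[OF st refl])
      then show ?thesis
        using sp IT.space_PiM_not_empty c_space[of m]
        by (simp, subst emeasure_bind[where N="?M (Suc m)"]) auto
    qed
    also have "\<dots> = (\<integral>\<^sup>+x. ennreal (case m of 0 \<Rightarrow> \<nu> (s 0) | Suc r \<Rightarrow> p (s r) (s (Suc r)))
        * indicator (c m) x \<partial>IT.C 0 m (\<lambda>_. undefined))"
      by (intro nn_integral_cong eP) (simp add: sp)
    also have "\<dots> = ennreal (case m of 0 \<Rightarrow> \<nu> (s 0) | Suc r \<Rightarrow> p (s r) (s (Suc r))) * w m"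
      using Suc by (subst nn_integral_cmult_indicator) (auto simp: st)
    finally show ?case by (simp add: w_def mult.commute)
  qed
  have sets_law: "sets (markov_law S \<nu> p) = sets (PiM UNIV (\<lambda>_. count_space S))"
    unfolding markov_law_def by (rule IT.PF.sets_lim)
  have "{X \<in> space (markov_law S \<nu> p). \<forall>t\<le>n. X t = s t} =
      prod_emb UNIV (\<lambda>_. count_space S) {0..<Suc n} (c (Suc n))"
    unfolding sets_eq_imp_space_eq[OF sets_law]
    by (auto simp: prod_emb_def space_PiM c_def PiE_iff less_Suc_eq_le restrict_def)
  then have "emeasure (markov_law S \<nu> p) {X \<in> space (markov_law S \<nu> p). \<forall>t\<le>n. X t = s t} =
      IT.CI {0..<Suc n} (c (Suc n))"
    using IT.lim[of "{0..<Suc n}" "c (Suc n)"] by (simp add: markov_law_def)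
  also have "\<dots> = IT.C 0 (Suc n) (\<lambda>_. undefined) (c (Suc n))"
  proof -
    have "prod_emb {0..<Suc n} (\<lambda>_. count_space S) {0..<Suc n} (c (Suc n)) = c (Suc n)"
      by (rule prod_emb_id) (use s in \<open>auto simp: c_def PiE_iff\<close>)
    then show ?thesis
      using IT.emeasure_CI[of "{0..<Suc n}" "Suc n" "c (Suc n)"] c_sets[of "Suc n"] by simp
  qed
  also have "\<dots> = w (Suc n)" by (rule step)
  also have "\<dots> = ennreal (\<nu> (s 0)) * (\<Prod>t<n. ennreal (p (s t) (s (Suc t))))"
    unfolding w_def by (subst prod.lessThan_Suc_shift) simp
  also have "\<dots> = ennreal (\<nu> (s 0) * (\<Prod>t<n. p (s t) (s (Suc t))))"
  proof -
    have "0 \<le> p (s t) (s (Suc t))" for t using p[OF s] s by (auto simp: prob_vector_def)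
    moreover have "0 \<le> \<nu> (s 0)" using \<nu> s by (auto simp: prob_vector_def)
    ultimately show ?thesis by (simp add: prod_ennreal ennreal_mult prod_nonneg)
  qed
  finally show ?thesis .
qed

text \<open>The infimum over the empty set is \<open>\<infinity>\<close>.\<close>

definition hitting_time :: "'s set \<Rightarrow> (nat \<Rightarrow> 's) \<Rightarrow> enat" where
  "hitting_time A X = (INF t\<in>{t. 0 < t \<and> X t \<in> A}. enat t)"


section \<open>Spin systems and Glauber dynamics\<close>

text \<open>Configurations are functions on the sites \<open>{1..N}\<close> with values in \<open>{1..q}\<close>.\<close>

type_synonym config = "nat \<Rightarrow> nat"

definition configs :: "nat \<Rightarrow> nat \<Rightarrow> config set" where
  "configs q N = {1..N} \<rightarrow>\<^sub>E {1..q}"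

text \<open>
  The couplings \<open>c\<close> are arbitrary: a realisation of the disorder gives the disordered
  Curie-Weiss-Potts model, \<open>c = (\<lambda>_ _. 1)\<close> the Curie-Weiss-Potts model.
\<close>

definition hamiltonian :: "nat \<Rightarrow> (nat \<Rightarrow> nat \<Rightarrow> real) \<Rightarrow> config \<Rightarrow> real" where
  "hamiltonian N c \<sigma> =
     - (1 / real N) * (\<Sum>(i, j) \<in> {(i, j). 1 \<le> i \<and> i < j \<and> j \<le> N}. c i j * of_bool (\<sigma> i = \<sigma> j))"

definition gibbs :: "nat \<Rightarrow> nat \<Rightarrow> real \<Rightarrow> (config \<Rightarrow> real) \<Rightarrow> config \<Rightarrow> real" where
  "gibbs q N \<beta> H \<sigma> = exp (- \<beta> * H \<sigma>) / (\<Sum>\<eta>\<in>configs q N. exp (- \<beta> * H \<eta>))"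

definition flip_prob :: "nat \<Rightarrow> nat \<Rightarrow> real \<Rightarrow> (config \<Rightarrow> real) \<Rightarrow> config \<Rightarrow> config \<Rightarrow> real" where
  "flip_prob q N \<beta> H \<sigma> \<eta> =
     (if card {i \<in> {1..N}. \<sigma> i \<noteq> \<eta> i} = 1
      then 1 / (real N * real q) * exp (- \<beta> * max 0 (H \<eta> - H \<sigma>)) else 0)"

definition trans_prob :: "nat \<Rightarrow> nat \<Rightarrow> real \<Rightarrow> (config \<Rightarrow> real) \<Rightarrow> config \<Rightarrow> config \<Rightarrow> real" where
  "trans_prob q N \<beta> H \<sigma> \<eta> =
     (if \<eta> = \<sigma> then 1 - (\<Sum>\<eta>'\<in>configs q N - {\<sigma>}. flip_prob q N \<beta> H \<sigma> \<eta>')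
      else flip_prob q N \<beta> H \<sigma> \<eta>)"

definition glauber_law ::
  "nat \<Rightarrow> nat \<Rightarrow> real \<Rightarrow> (config \<Rightarrow> real) \<Rightarrow> (config \<Rightarrow> real) \<Rightarrow> (nat \<Rightarrow> config) measure" where
  "glauber_law q N \<beta> H \<nu> = markov_law (configs q N) \<nu> (trans_prob q N \<beta> H)"

definition mean_hitting_time ::
  "nat \<Rightarrow> nat \<Rightarrow> real \<Rightarrow> (config \<Rightarrow> real) \<Rightarrow> (config \<Rightarrow> real) \<Rightarrow> config set \<Rightarrow> ennreal" where
  "mean_hitting_time q N \<beta> H \<nu> B =
     (\<integral>\<^sup>+X. ennreal_of_enat (hitting_time B X) \<partial>glauber_law q N \<beta> H \<nu>)"

definition hit_before ::
  "nat \<Rightarrow> nat \<Rightarrow> real \<Rightarrow> (config \<Rightarrow> real) \<Rightarrow> config \<Rightarrow> config set \<Rightarrow> config set \<Rightarrow> real" where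
  "hit_before q N \<beta> H \<sigma> B A =
     (let P = glauber_law q N \<beta> H (\<lambda>\<eta>. of_bool (\<eta> = \<sigma>))
      in measure P {X \<in> space P. hitting_time B X < hitting_time A X})"

definition last_exit_distr ::
  "nat \<Rightarrow> nat \<Rightarrow> real \<Rightarrow> (config \<Rightarrow> real) \<Rightarrow> config set \<Rightarrow> config set \<Rightarrow> config \<Rightarrow> real" where
  "last_exit_distr q N \<beta> H A B \<sigma> =
     (if \<sigma> \<in> A
      then gibbs q N \<beta> H \<sigma> * hit_before q N \<beta> H \<sigma> B A /
           (\<Sum>\<sigma>'\<in>A. gibbs q N \<beta> H \<sigma>' * hit_before q N \<beta> H \<sigma>' B A)
      else 0)"

lemma finite_configs: "finite (configs q N)"
  by (simp add: configs_def finite_PiE)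

lemma prob_vector_trans_prob:
  assumes "0 < \<beta>" and \<sigma>: "\<sigma> \<in> configs q N"
  shows "prob_vector (configs q N) (trans_prob q N \<beta> H \<sigma>)"
proof -
  let ?S = "configs q N" and ?f = "flip_prob q N \<beta> H \<sigma>"
  define D where "D = {\<eta> \<in> ?S. card {i \<in> {1..N}. \<sigma> i \<noteq> \<eta> i} = 1}"
  have f_nonneg: "0 \<le> ?f \<eta>" for \<eta> by (simp add: flip_prob_def)
  have sub: "D \<subseteq> (\<lambda>(i, a). \<sigma>(i := a)) ` ({1..N} \<times> {1..q})"
  proof
    fix \<eta> assume "\<eta> \<in> D"
    then have \<eta>: "\<eta> \<in> ?S" and card: "card {i \<in> {1..N}. \<sigma> i \<noteq> \<eta> i} = 1"
      by (auto simp: D_def)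
    from card obtain i where i: "{i \<in> {1..N}. \<sigma> i \<noteq> \<eta> i} = {i}" by (rule card_1_singletonE)
    have same: "\<sigma> j = \<eta> j" if "j \<in> {1..N}" "j \<noteq> i" for j
      using i that by blast
    have eq: "(\<sigma>(i := \<eta> i)) j = \<eta> j" for j
    proof (cases "j \<in> {1..N}")
      case True
      with same[of j] show ?thesis by (cases "j = i") simp_all
    next
      case False
      then have "\<eta> j = undefined" "\<sigma> j = undefined"
        using PiE_arb[of \<eta> "{1..N}" "\<lambda>_. {1..q}" j] PiE_arb[of \<sigma> "{1..N}" "\<lambda>_. {1..q}" j] \<eta> \<sigma>
        unfolding configs_def by blast+
      then show ?thesis by (cases "j = i") simp_all
    qed
    have "(\<lambda>(i, a). \<sigma>(i := a)) (i, \<eta> i) = \<eta>"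
      unfolding prod.case by (rule ext) (rule eq)
    from this[symmetric] have "\<eta> = (\<lambda>(i, a). \<sigma>(i := a)) (i, \<eta> i)" .
    moreover have "i \<in> {1..N}" using i by blast
    moreover have "\<eta> i \<in> {1..q}"
      using \<eta> \<open>i \<in> {1..N}\<close> unfolding configs_def by (rule PiE_mem)
    ultimately show "\<eta> \<in> (\<lambda>(i, a). \<sigma>(i := a)) ` ({1..N} \<times> {1..q})" by (rule image_eqI[OF _ SigmaI])
  qed
  have "card D \<le> N * q"
    using surj_card_le[OF _ sub] by simp
  have "(\<Sum>\<eta>\<in>?S - {\<sigma>}. ?f \<eta>) \<le> (\<Sum>\<eta>\<in>?S. ?f \<eta>)"
    by (intro sum_mono2 finite_configs f_nonneg) auto
  also have "\<dots> = (\<Sum>\<eta>\<in>D. ?f \<eta>)"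
    by (rule sum.mono_neutral_right) (auto simp: D_def finite_configs flip_prob_def)
  also have "\<dots> \<le> (\<Sum>\<eta>\<in>D. 1 / (real N * real q))"
    using assms by (intro sum_mono) (auto simp: flip_prob_def intro!: divide_right_mono)
  also have "\<dots> \<le> 1"
    using \<open>card D \<le> N * q\<close>
    by (simp add: divide_le_eq_1 flip: of_nat_mult)
       (metis le_zero_eq not_gr_zero)
  finally have le: "(\<Sum>\<eta>\<in>?S - {\<sigma>}. ?f \<eta>) \<le> 1" .
  have "(\<Sum>\<eta>\<in>?S. trans_prob q N \<beta> H \<sigma> \<eta>) =
      trans_prob q N \<beta> H \<sigma> \<sigma> + (\<Sum>\<eta>\<in>?S - {\<sigma>}. trans_prob q N \<beta> H \<sigma> \<eta>)"
    using \<sigma> by (rule sum.remove[OF finite_configs])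
  also have "\<dots> = 1" by (simp add: trans_prob_def)
  finally show ?thesis using le f_nonneg by (auto simp: prob_vector_def trans_prob_def)
qed


section \<open>Free energy and metastable sets\<close>

text \<open>
  Vectors in \<open>\<real>\<^sup>q\<close> are functions on \<open>{1..q}\<close>, extensional so that equality is equality of the
  \<open>q\<close> coordinates; \<open>L2_set x {1..q}\<close> is their Euclidean norm.
\<close>

definition prob_simplex :: "nat \<Rightarrow> (nat \<Rightarrow> real) set" where
  "prob_simplex q = {x \<in> {1..q} \<rightarrow>\<^sub>E {0..1}. (\<Sum>k\<in>{1..q}. x k) = 1}"

definition lattice_simplex :: "nat \<Rightarrow> nat \<Rightarrow> (nat \<Rightarrow> real) set" where
  "lattice_simplex q N = {x \<in> prob_simplex q. \<forall>k\<in>{1..q}. \<exists>n::nat. x k = real n / real N}"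

definition empirical :: "nat \<Rightarrow> nat \<Rightarrow> config \<Rightarrow> nat \<Rightarrow> real" where
  "empirical q N \<sigma> = (\<lambda>k\<in>{1..q}. 1 / real N * (\<Sum>i\<in>{1..N}. of_bool (\<sigma> i = k)))"

definition free_energy :: "real \<Rightarrow> nat \<Rightarrow> (nat \<Rightarrow> real) \<Rightarrow> real" where
  "free_energy \<beta> q x =
     - (1 / 2) * (L2_set x {1..q})\<^sup>2 + 1 / \<beta> * (\<Sum>i\<in>{1..q}. x i * ln (x i))"

definition largest_s :: "nat \<Rightarrow> real \<Rightarrow> real" where
  "largest_s q \<beta> =
     (GREATEST s. 0 \<le> s \<and> s < 1 \<and> ln (1 + (real q - 1) * s) - ln (1 - s) = \<beta> * s)"

definition minimizer :: "nat \<Rightarrow> real \<Rightarrow> nat \<Rightarrow> nat \<Rightarrow> real" where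
  "minimizer q \<beta> i =
     (if i = 0 then (\<lambda>k\<in>{1..q}. 1 / real q)
      else (\<lambda>k\<in>{1..q}. if k = i then (1 + (real q - 1) * largest_s q \<beta>) / real q
                       else (1 - largest_s q \<beta>) / real q))"

definition local_minimizer ::
  "nat \<Rightarrow> ((nat \<Rightarrow> real) \<Rightarrow> real) \<Rightarrow> (nat \<Rightarrow> real) \<Rightarrow> bool" where
  "local_minimizer q F x \<longleftrightarrow> x \<in> prob_simplex q \<and>
     (\<exists>\<epsilon>>0. \<forall>y\<in>prob_simplex q. L2_set (\<lambda>k. y k - x k) {1..q} < \<epsilon> \<longrightarrow> F x \<le> F y)"

definition global_minimizer ::
  "nat \<Rightarrow> ((nat \<Rightarrow> real) \<Rightarrow> real) \<Rightarrow> (nat \<Rightarrow> real) \<Rightarrow> bool" where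
  "global_minimizer q F x \<longleftrightarrow> x \<in> prob_simplex q \<and> (\<forall>y\<in>prob_simplex q. F x \<le> F y)"

definition \<beta>\<^sub>1 :: "nat \<Rightarrow> real" where
  "\<beta>\<^sub>1 q = Inf {\<beta>. 0 < \<beta> \<and>
     (\<exists>x. x \<noteq> (\<lambda>k\<in>{1..q}. 1 / real q) \<and> local_minimizer q (free_energy \<beta> q) x)}"

definition \<beta>\<^sub>2 :: "nat \<Rightarrow> real" where
  "\<beta>\<^sub>2 q = Sup {\<beta>. 0 < \<beta> \<and>
     global_minimizer q (free_energy \<beta> q) (\<lambda>k\<in>{1..q}. 1 / real q)}"

definition closest_lattice_point :: "nat \<Rightarrow> nat \<Rightarrow> (nat \<Rightarrow> real) \<Rightarrow> (nat \<Rightarrow> real) \<Rightarrow> bool" where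
  "closest_lattice_point q N x y \<longleftrightarrow>
     is_arg_min (\<lambda>z. L2_set (\<lambda>k. z k - x k) {1..q}) (\<lambda>z. z \<in> lattice_simplex q N) y"

definition level_set :: "nat \<Rightarrow> nat \<Rightarrow> (nat \<Rightarrow> real) \<Rightarrow> config set" where
  "level_set q N x = {\<sigma> \<in> configs q N. empirical q N \<sigma> = x}"

text \<open>Here \<open>m i N\<close> is the chosen lattice point closest to \<open>minimizer q \<beta> i\<close>.\<close>

definition metastable_regime ::
  "nat \<Rightarrow> real \<Rightarrow> (nat \<Rightarrow> nat \<Rightarrow> nat \<Rightarrow> real) \<Rightarrow>
   (nat \<Rightarrow> config set) \<Rightarrow> (nat \<Rightarrow> config set) \<Rightarrow> bool" where
  "metastable_regime q \<beta> m A B \<longleftrightarrow>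
     (\<beta>\<^sub>1 q < \<beta> \<and> \<beta> \<le> \<beta>\<^sub>2 q \<and>
        A = (\<lambda>N. \<Union>i\<in>{1..q}. level_set q N (m i N)) \<and>
        B = (\<lambda>N. level_set q N (m 0 N))) \<or>
     (\<beta>\<^sub>2 q < \<beta> \<and> \<beta> < real q \<and>
        A = (\<lambda>N. level_set q N (m 0 N)) \<and>
        B = (\<lambda>N. \<Union>i\<in>{1..q}. level_set q N (m i N))) \<or>
     (\<beta>\<^sub>2 q < \<beta> \<and>
        A = (\<lambda>N. level_set q N (m 1 N)) \<and>
        B = (\<lambda>N. \<Union>i\<in>{2..q}. level_set q N (m i N)))"


section \<open>Powers of extended nonnegative reals\<close>

text \<open>Only meant for exponents \<open>p > 0\<close>.\<close>

definition ennreal_powr :: "ennreal \<Rightarrow> real \<Rightarrow> ennreal" where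
  "ennreal_powr x p = (if x = \<top> then \<top> else ennreal (enn2real x powr p))"

end

theory Submission
  imports Defs
begin

text \<open>
  By reversibility the mean hitting time started from the last-exit biased distribution is
  \<open>(\<Sum>\<sigma>. w \<sigma> * h \<sigma>) / cap\<close>, where \<open>h\<close> is the equilibrium potential between the two wells and \<open>cap\<close> is
  its energy. The logarithmic inequality \<open>(sqrt a - sqrt b)\<^sup>2 \<le> (a - b) * (ln a - ln b) / 2\<close> and the landscape
  of the free energy (all local minimizers are the \<open>m\<^sub>i\<close>, so descending lattice paths end near one
  of them) show that the numerator is \<open>w V\<close> for a fixed union \<open>V\<close> of valleys, up to a relative error
  \<open>exp (3 * D - \<epsilon> * N)\<close> where \<open>D\<close> is the maximal energy fluctuation; this holds with and without disorder.
  Capacities are compared by inserting the equilibrium potential and the equilibrium flow of the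
  pure model into the Dirichlet and Thomson principles. Hence the ratio of the mean hitting times
  is controlled by averages, with deterministic weights, of exponentials of single fluctuations,
  whose moments are asymptotically Gaussian: \<open>exp (v * c\<^sup>2 / 4)\<close>. For the upper bound,
  \<open>(x * y) powr k \<le> (x powr (2 * k) + y powr (2 * k)) / 2\<close> and convexity are used; for the lower
  bound, \<open>2 * l * sqrt x - l\<^sup>2 * y \<le> x / y\<close> and the tangent of \<open>x powr k\<close>.
\<close>

section \<open>Hitting times of finite Markov chains\<close>

text \<open>The disorder destroys the symmetry between the configurations of one level, so only the
  pure model is analysed on levels, and the disorder enters through the ratio of the two weights.
  The crude bound of this ratio by \<open>exp D\<close> is used only where it meets a factor exp (-
  \<epsilon> N): each exponential moment of D is eventually below any exp (a N) with a > 0, so the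
  product vanishes in mean. What survives in the limit are averages over single configurations or
  single edges. The constants arise as follows. Numerator and capacity are dependent, and separating
  them doubles the exponent: the 2k-th moment of exp (\<beta> * fluctuation) is about exp (v (2 k
  \<beta>)^2 / 4) = exp (\<beta>^2 v k^2), whose k-th root is exp (\<beta>^2 v k). From below, the
  numerator contributes at least 1 by Jensen's inequality, the fluctuations being centred, and the
  capacity has mean at most about exp (\<beta>^2 v / 4), so l is taken as nearly the reciprocal of
  that bound.\<close>

lemma sets_markov_law:
  assumes "finite S" "prob_vector S \<nu>" "\<And>s. s \<in> S \<Longrightarrow> prob_vector S (p s)"
  shows "sets (markov_law S \<nu> p) = sets (PiM UNIV (\<lambda>_. count_space S))"
proof -
  interpret IT: Ionescu_Tulcea "markov_kernel S \<nu> p" "\<lambda>_. count_space S"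
    using assms by (rule Ionescu_Tulcea_markov_kernel)
  show ?thesis unfolding markov_law_def by (rule IT.PF.sets_lim)
qed

lemma measurable_markov_law_component:
  assumes "finite S" "prob_vector S \<nu>" "\<And>s. s \<in> S \<Longrightarrow> prob_vector S (p s)"
  shows "(\<lambda>X. X t) \<in> measurable (markov_law S \<nu> p) (count_space S)"
proof -
  note sets_markov_law[of S \<nu> p, OF assms]
  moreover have "(\<lambda>X. X t) \<in> measurable (PiM UNIV (\<lambda>_. count_space S)) (count_space S)"
    by (rule measurable_component_singleton) simp
  ultimately show ?thesis by (simp cong: measurable_cong_sets)
qed

text \<open>The constraint set may depend on time because hitting times look only at positive times:
  the state at time 0 stays free while later ones are confined, and the last one may be prescribed
  separately.\<close>

lemma markov_law_cylinder:
  assumes S: "finite S" and \<nu>: "prob_vector S \<nu>" and p: "\<And>s. s \<in> S \<Longrightarrow> prob_vector S (p s)"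
    and D: "\<And>t. D t \<subseteq> S"
  shows "emeasure (markov_law S \<nu> p) {X \<in> space (markov_law S \<nu> p). \<forall>t\<le>n. X t \<in> D t} =
    ennreal (\<Sum>s\<in>PiE {..n} D. \<nu> (s 0) * (\<Prod>t<n. p (s t) (s (Suc t))))"
proof -
  let ?P = "markov_law S \<nu> p"
  let ?E = "\<lambda>s. {X \<in> space ?P. \<forall>t\<le>n. X t = s t}"
  have [measurable]: "(\<lambda>X. X t) \<in> measurable ?P (count_space S)" for t
    using S \<nu> p by (rule measurable_markov_law_component)
  have sE: "?E s \<in> sets ?P" if "s \<in> PiE {..n} D" for s
  proof -
    have "s t \<in> S" if "t \<le> n" for t
      using that \<open>s \<in> PiE {..n} D\<close> D[of t] by (auto simp: PiE_iff)
    then have [simp]: "(\<lambda>X. X t) -` {s t} \<inter> space ?P \<in> sets ?P" if "t \<le> n" for t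
      using that by (intro measurable_sets[of _ _ "count_space S"]) auto
    have "?E s = (\<Inter>t\<in>{..n}. (\<lambda>X. X t) -` {s t} \<inter> space ?P)" by auto
    also have "\<dots> \<in> sets ?P" by (intro sets.finite_INT) auto
    finally show ?thesis .
  qed
  have fin: "finite (PiE {..n} D)"
    by (intro finite_PiE) (auto intro: finite_subset[OF D S])
  have eq: "{X \<in> space ?P. \<forall>t\<le>n. X t \<in> D t} = (\<Union>s\<in>PiE {..n} D. ?E s)"
  proof (intro set_eqI iffI)
    fix X assume "X \<in> {X \<in> space ?P. \<forall>t\<le>n. X t \<in> D t}"
    then show "X \<in> (\<Union>s\<in>PiE {..n} D. ?E s)"
      by (intro UN_I[of "restrict X {..n}"]) (auto simp: PiE_iff)
  qed (auto simp: PiE_iff)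
  have disj: "disjoint_family_on ?E (PiE {..n} D)"
    unfolding disjoint_family_on_def
  proof (intro ballI impI)
    fix s s' assume s: "s \<in> PiE {..n} D" "s' \<in> PiE {..n} D" "s \<noteq> s'"
    then obtain t where "t \<le> n" "s t \<noteq> s' t"
      by (metis PiE_ext atMost_iff)
    then show "?E s \<inter> ?E s' = {}" by auto
  qed
  have val: "emeasure ?P (?E s) = ennreal (\<nu> (s 0) * (\<Prod>t<n. p (s t) (s (Suc t))))"
    if s: "s \<in> PiE {..n} D" for s
  proof -
    \<comment> \<open>\<open>markov_law_finite_dim\<close> asks for a path that lies in
      \<open>S\<close> at all times, whereas \<open>s\<close> is undefined after time n; the values
      filled in there do not enter the product.\<close>
    define s' where "s' t = (if t \<le> n then s t else s 0)" for t
    have "s' t \<in> S" for t using s D by (auto simp: s'_def PiE_iff)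
    from markov_law_finite_dim[OF S \<nu> p this, where n=n]
    have "emeasure ?P {X \<in> space ?P. \<forall>t\<le>n. X t = s' t} =
      ennreal (\<nu> (s' 0) * (\<Prod>t<n. p (s' t) (s' (Suc t))))" by simp
    moreover have "{X \<in> space ?P. \<forall>t\<le>n. X t = s' t} = ?E s" by (auto simp: s'_def)
    moreover have "(\<Prod>t<n. p (s' t) (s' (Suc t))) = (\<Prod>t<n. p (s t) (s (Suc t)))"
      by (intro prod.cong) (auto simp: s'_def)
    ultimately show ?thesis by (simp add: s'_def)
  qed
  have nn: "0 \<le> \<nu> (s 0) * (\<Prod>t<n. p (s t) (s (Suc t)))" if s: "s \<in> PiE {..n} D" for s
  proof -
    have "s t \<in> S" if "t \<le> n" for t
      using that s D[of t] by (auto simp: PiE_iff)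
    then show ?thesis using \<nu> p by (intro mult_nonneg_nonneg prod_nonneg) (auto simp: prob_vector_def)
  qed
  have "emeasure ?P {X \<in> space ?P. \<forall>t\<le>n. X t \<in> D t} = (\<Sum>s\<in>PiE {..n} D. emeasure ?P (?E s))"
    unfolding eq using sE disj fin by (subst sum_emeasure) auto
  also have "\<dots> = (\<Sum>s\<in>PiE {..n} D. ennreal (\<nu> (s 0) * (\<Prod>t<n. p (s t) (s (Suc t)))))"
    by (intro sum.cong val refl)
  also have "\<dots> = ennreal (\<Sum>s\<in>PiE {..n} D. \<nu> (s 0) * (\<Prod>t<n. p (s t) (s (Suc t))))"
    by (intro sum_ennreal nn)
  finally show ?thesis .
qed

lemma prob_space_markov_law:
  assumes S: "finite S" and \<nu>: "prob_vector S \<nu>" and p: "\<And>s. s \<in> S \<Longrightarrow> prob_vector S (p s)"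
  shows "prob_space (markov_law S \<nu> p)"
proof
  let ?P = "markov_law S \<nu> p"
  have sp: "X 0 \<in> S" if "X \<in> space ?P" for X
    using measurable_space[OF measurable_markov_law_component[OF S \<nu> p] that] by simp
  have "space ?P = {X \<in> space ?P. \<forall>t\<le>0. X t \<in> S}" using sp by auto
  then have "emeasure ?P (space ?P) = emeasure ?P {X \<in> space ?P. \<forall>t\<le>0::nat. X t \<in> S}" by simp
  also have "\<dots> = ennreal (\<Sum>s\<in>PiE {..0::nat} (\<lambda>_. S). \<nu> (s 0))"
    by (subst markov_law_cylinder[OF S \<nu> p]) auto
  also have "(\<Sum>s\<in>PiE {..0::nat} (\<lambda>_. S). \<nu> (s 0)) = (\<Sum>x\<in>S. \<nu> x)"
    by (rule sum.reindex_bij_witness[of _ "\<lambda>x. \<lambda>t\<in>{..0}. x" "\<lambda>s. s 0"])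
       (auto simp: PiE_iff extensional_def fun_eq_iff)
  finally show "emeasure ?P (space ?P) = 1" using \<nu> by (simp add: prob_vector_def)
qed

text \<open>The substochastic operator of the chain killed on leaving \<open>E\<close>. Its n-th
  iterate applied to the constant 1 is the probability that the states at times 1, ..., n all lie in
  \<open>E\<close>.\<close>

definition killed_step :: "('s \<Rightarrow> 's \<Rightarrow> real) \<Rightarrow> 's set \<Rightarrow> ('s \<Rightarrow> real) \<Rightarrow> 's \<Rightarrow> real" where
  "killed_step p E \<phi> y = (\<Sum>x\<in>E. p y x * \<phi> x)"

lemma sum_PiE_Suc:
  assumes "\<And>t. finite (D t)"
  shows "(\<Sum>s\<in>PiE {..Suc n} D. g s) = (\<Sum>s\<in>PiE {..n} D. \<Sum>x\<in>D (Suc n). g (s(Suc n := x)))"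
proof -
  have "(\<Sum>s\<in>PiE {..Suc n} D. g s)
      = (\<Sum>s\<in>(\<lambda>(y, s). s(Suc n := y)) ` (D (Suc n) \<times> PiE {..n} D). g s)"
    by (simp add: atMost_Suc PiE_insert_eq)
  also have "\<dots> = (\<Sum>(y, s)\<in>D (Suc n) \<times> PiE {..n} D. g (s(Suc n := y)))"
  proof (subst sum.reindex)
    show "inj_on (\<lambda>(y, s). s(Suc n := y)) (D (Suc n) \<times> PiE {..n} D)"
    proof (rule inj_onI, clarify)
      fix y s y' s'
      assume *: "s \<in> PiE {..n} D" "s' \<in> PiE {..n} D" and eq: "s(Suc n := y) = s'(Suc n := y')"
      have "y = y'" using fun_cong[OF eq, of "Suc n"] by simp
      moreover have "s = s'"
      proof (rule PiE_ext[OF *])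
        fix t assume "t \<in> {..n}" then show "s t = s' t" using fun_cong[OF eq, of t] by auto
      qed
      ultimately show "y = y' \<and> s = s'" by simp
    qed
  qed (simp add: case_prod_unfold)
  also have "\<dots> = (\<Sum>y\<in>D (Suc n). \<Sum>s\<in>PiE {..n} D. g (s(Suc n := y)))"
    by (simp add: sum.cartesian_product)
  finally show ?thesis by (simp add: sum.swap[of _ "D (Suc n)"])
qed

text \<open>Summing out the last state replaces \<phi> by \<open>killed_step p E \<phi>\<close>,
  which is why the induction keeps \<phi> arbitrary.\<close>

lemma sum_PiE_killed:
  assumes S: "finite S" "E \<subseteq> S"
  shows "(\<Sum>s\<in>PiE {..n} (\<lambda>t. if t = 0 then S else E). \<nu> (s 0) * (\<Prod>t<n. p (s t) (s (Suc t))) * \<phi> (s n))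
    = (\<Sum>x\<in>S. \<nu> x * (killed_step p E ^^ n) \<phi> x)"
proof (induction n arbitrary: \<phi>)
  case 0
  show ?case
    by (rule sum.reindex_bij_witness[of _ "\<lambda>x. \<lambda>t\<in>{..0}. x" "\<lambda>s. s 0"])
       (auto simp: PiE_iff extensional_def fun_eq_iff)
next
  case (Suc n)
  let ?D = "\<lambda>t. if t = 0 then S else E"
  have fin: "finite (?D t)" for t using S finite_subset by auto
  have "(\<Sum>s\<in>PiE {..Suc n} ?D. \<nu> (s 0) * (\<Prod>t<Suc n. p (s t) (s (Suc t))) * \<phi> (s (Suc n)))
    = (\<Sum>s\<in>PiE {..n} ?D. \<Sum>x\<in>E. \<nu> (s 0) * (\<Prod>t<n. p (s t) (s (Suc t))) * (p (s n) x * \<phi> x))"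
    by (subst sum_PiE_Suc[OF fin]) (auto intro!: sum.cong prod.cong)
  also have "\<dots> = (\<Sum>s\<in>PiE {..n} ?D. \<nu> (s 0) * (\<Prod>t<n. p (s t) (s (Suc t))) * killed_step p E \<phi> (s n))"
    by (simp add: killed_step_def sum_distrib_left)
  also have "\<dots> = (\<Sum>x\<in>S. \<nu> x * (killed_step p E ^^ n) (killed_step p E \<phi>) x)" by (rule Suc)
  finally show ?case by (simp add: funpow_swap1)
qed

lemma emeasure_stay:
  assumes S: "finite S" and \<nu>: "prob_vector S \<nu>" and p: "\<And>s. s \<in> S \<Longrightarrow> prob_vector S (p s)"
    and "E \<subseteq> S"
  shows "emeasure (markov_law S \<nu> p) {X \<in> space (markov_law S \<nu> p). \<forall>t. 0 < t \<and> t \<le> n \<longrightarrow> X t \<in> E} =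
    ennreal (\<Sum>x\<in>S. \<nu> x * (killed_step p E ^^ n) (\<lambda>_. 1) x)"
proof -
  let ?P = "markov_law S \<nu> p"
  have sp: "X 0 \<in> S" if "X \<in> space ?P" for X
    using measurable_space[OF measurable_markov_law_component[OF S \<nu> p] that] by simp
  have "{X \<in> space ?P. \<forall>t. 0 < t \<and> t \<le> n \<longrightarrow> X t \<in> E}
      = {X \<in> space ?P. \<forall>t\<le>n. X t \<in> (if t = 0 then S else E)}" using sp by auto
  then show ?thesis
    using markov_law_cylinder[OF S \<nu> p, where D="\<lambda>t. if t = 0 then S else E"] assms(4)
      sum_PiE_killed[OF S assms(4), of \<nu> p n "\<lambda>_. 1"] by auto
qed

lemma emeasure_stay_then:
  assumes S: "finite S" and \<nu>: "prob_vector S \<nu>" and p: "\<And>s. s \<in> S \<Longrightarrow> prob_vector S (p s)"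
    and "E \<subseteq> S" "C \<subseteq> S"
  shows "emeasure (markov_law S \<nu> p) {X \<in> space (markov_law S \<nu> p).
      (\<forall>t. 0 < t \<and> t \<le> n \<longrightarrow> X t \<in> E) \<and> X (Suc n) \<in> C} =
    ennreal (\<Sum>x\<in>S. \<nu> x * (killed_step p E ^^ n) (\<lambda>y. \<Sum>x\<in>C. p y x) x)"
proof -
  let ?P = "markov_law S \<nu> p"
  let ?D = "\<lambda>t. if t = 0 then S else E"
  let ?D' = "\<lambda>t. if t = Suc n then C else ?D t"
  have sp: "X 0 \<in> S" if "X \<in> space ?P" for X
    using measurable_space[OF measurable_markov_law_component[OF S \<nu> p] that] by simp
  have fin: "finite (?D' t)" for t using S assms finite_subset by auto
  have "{X \<in> space ?P. (\<forall>t. 0 < t \<and> t \<le> n \<longrightarrow> X t \<in> E) \<and> X (Suc n) \<in> C}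
      = {X \<in> space ?P. \<forall>t\<le>Suc n. X t \<in> ?D' t}"
    using sp by (auto simp: le_Suc_eq split: if_splits)
  moreover have "emeasure ?P {X \<in> space ?P. \<forall>t\<le>Suc n. X t \<in> ?D' t}
      = ennreal (\<Sum>s\<in>PiE {..Suc n} ?D'. \<nu> (s 0) * (\<Prod>t<Suc n. p (s t) (s (Suc t))))"
    using assms by (intro markov_law_cylinder) auto
  moreover have "(\<Sum>s\<in>PiE {..Suc n} ?D'. \<nu> (s 0) * (\<Prod>t<Suc n. p (s t) (s (Suc t))))
      = (\<Sum>s\<in>PiE {..n} ?D'. \<nu> (s 0) * (\<Prod>t<n. p (s t) (s (Suc t))) * (\<Sum>x\<in>C. p (s n) x))"
    by (subst sum_PiE_Suc[OF fin]) (auto simp: sum_distrib_left intro!: sum.cong prod.cong)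
  moreover have "PiE {..n} ?D' = PiE {..n} ?D" by (intro PiE_cong) auto
  ultimately show ?thesis
    using sum_PiE_killed[OF S assms(4), of \<nu> p n "\<lambda>y. \<Sum>x\<in>C. p y x"] by simp
qed

section \<open>Hitting times expressed through the killed operator\<close>

lemma less_hitting_time_iff: "enat n < hitting_time B X \<longleftrightarrow> (\<forall>t. 0 < t \<and> t \<le> n \<longrightarrow> X t \<notin> B)"
proof
  assume "enat n < hitting_time B X"
  then show "\<forall>t. 0 < t \<and> t \<le> n \<longrightarrow> X t \<notin> B"
    unfolding hitting_time_def by (auto dest!: less_INF_D)
next
  assume *: "\<forall>t. 0 < t \<and> t \<le> n \<longrightarrow> X t \<notin> B"
  have "enat (Suc n) \<le> hitting_time B X"
    unfolding hitting_time_def using * by (intro INF_greatest) (auto simp: not_less_eq_eq[symmetric])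
  then show "enat n < hitting_time B X" by (meson Suc_ile_eq)
qed

text \<open>Decomposition by the first positive time at which the chain visits
  \<open>A \<union> B\<close>. Disjointness ensures that the state found in \<open>B\<close> at that
  time is not at once a visit to \<open>A\<close>.\<close>

lemma hitting_time_less_iff:
  assumes "A \<inter> B = {}"
  shows "hitting_time B X < hitting_time A X \<longleftrightarrow>
    (\<exists>n. (\<forall>t. 0 < t \<and> t \<le> n \<longrightarrow> X t \<notin> A \<union> B) \<and> X (Suc n) \<in> B)"
proof
  assume lt: "hitting_time B X < hitting_time A X"
  then obtain m where m: "hitting_time B X = enat m" by (cases "hitting_time B X") auto
  have "m \<noteq> 0" using less_hitting_time_iff[of 0 B X] m by (auto simp: zero_enat_def)
  then obtain n where n: "m = Suc n" by (cases m) auto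
  have "\<not> enat m < hitting_time B X" "enat n < hitting_time B X" using m n by auto
  then have "X (Suc n) \<in> B" "\<forall>t. 0 < t \<and> t \<le> n \<longrightarrow> X t \<notin> B"
    unfolding less_hitting_time_iff n by (auto simp: le_Suc_eq)
  moreover have "\<forall>t. 0 < t \<and> t \<le> n \<longrightarrow> X t \<notin> A"
    using lt unfolding m n by (auto simp: less_hitting_time_iff)
  ultimately show "\<exists>n. (\<forall>t. 0 < t \<and> t \<le> n \<longrightarrow> X t \<notin> A \<union> B) \<and> X (Suc n) \<in> B" by auto
next
  assume "\<exists>n. (\<forall>t. 0 < t \<and> t \<le> n \<longrightarrow> X t \<notin> A \<union> B) \<and> X (Suc n) \<in> B"
  then obtain n where n: "\<forall>t. 0 < t \<and> t \<le> n \<longrightarrow> X t \<notin> A \<union> B" "X (Suc n) \<in> B" by auto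
  have "\<not> enat (Suc n) < hitting_time B X" using n by (auto simp: less_hitting_time_iff)
  moreover have "enat (Suc n) < hitting_time A X"
    using n assms by (auto simp: less_hitting_time_iff le_Suc_eq)
  ultimately show "hitting_time B X < hitting_time A X" by (meson le_less_trans not_le)
qed

text \<open>The mean of a variable with values in the extended naturals is the sum of its tail
  probabilities, and the tail after n is the event of staying off \<open>B\<close> at the times 1,
  ..., n.\<close>

lemma nn_integral_hitting_time:
  assumes S: "finite S" and \<nu>: "prob_vector S \<nu>" and p: "\<And>s. s \<in> S \<Longrightarrow> prob_vector S (p s)"
  shows "(\<integral>\<^sup>+X. ennreal_of_enat (hitting_time B X) \<partial>markov_law S \<nu> p)
    = (\<Sum>n. ennreal (\<Sum>x\<in>S. \<nu> x * (killed_step p (S - B) ^^ n) (\<lambda>_. 1) x))"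
proof -
  let ?P = "markov_law S \<nu> p"
  have sp: "X t \<in> S" if "X \<in> space ?P" for X t
    using measurable_space[OF measurable_markov_law_component[OF S \<nu> p] that] by simp
  have [measurable]: "(\<lambda>X. X t) \<in> measurable ?P (count_space S)" for t
    using S \<nu> p by (rule measurable_markov_law_component)
  have gt: "{X \<in> space ?P. enat n < hitting_time B X}
      = {X \<in> space ?P. \<forall>t. 0 < t \<and> t \<le> n \<longrightarrow> X t \<in> S - B}" for n
    using sp by (auto simp: less_hitting_time_iff)
  have gs: "{X \<in> space ?P. enat n < hitting_time B X} \<in> sets ?P" for n
  proof -
    have "{X \<in> space ?P. enat n < hitting_time B X}
       = space ?P \<inter> (\<Inter>t\<in>{0<..n}. (\<lambda>X. X t) -` (S - B) \<inter> space ?P)"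
      unfolding gt by auto
    also have "\<dots> \<in> sets ?P"
    \<comment> \<open>For n = 0 the intersection runs over no index and is the universal set, so it
      is treated apart.\<close>
    proof (cases "n = 0")
      case False
      then show ?thesis
        by (intro sets.Int[OF sets.top] sets.finite_INT
          measurable_sets[OF measurable_markov_law_component[OF S \<nu> p]]) auto
    qed simp
    finally show ?thesis .
  qed
  have meas: "hitting_time B \<in> measurable ?P (count_space UNIV)"
  proof (subst measurable_count_space_eq_countable, safe)
    show "countable (UNIV :: enat set)" by simp
    fix a :: enat
    have inf: "{X \<in> space ?P. hitting_time B X = \<infinity>} \<in> sets ?P"
    proof -
      have "{X \<in> space ?P. hitting_time B X = \<infinity>} = (\<Inter>n. {X \<in> space ?P. enat n < hitting_time B X})"
        by (auto; metis enat_iless less_irrefl not_infinity_eq)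
      then show ?thesis using gs by auto
    qed
    have "{X \<in> space ?P. hitting_time B X = enat n} \<in> sets ?P" for n
    proof (cases n)
      case 0
      have "{X \<in> space ?P. hitting_time B X = enat n} = space ?P - {X \<in> space ?P. enat 0 < hitting_time B X}"
        using 0 by (auto simp: zero_enat_def[symmetric])
      then show ?thesis using gs by auto
    next
      case (Suc m)
      have "{X \<in> space ?P. hitting_time B X = enat n} =
        {X \<in> space ?P. enat m < hitting_time B X} - {X \<in> space ?P. enat n < hitting_time B X}"
        using Suc by (auto simp: not_less Suc_ile_eq intro: antisym)
      then show ?thesis using gs by auto
    qed
    with inf have "{X \<in> space ?P. hitting_time B X = a} \<in> sets ?P" by (cases a) auto
    then show "hitting_time B -` {a} \<inter> space ?P \<in> sets ?P"
      by (simp add: vimage_def Int_def conj_commute)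
  qed auto
  have "(\<integral>\<^sup>+X. ennreal_of_enat (hitting_time B X) \<partial>?P)
    = (\<Sum>n. emeasure ?P {X \<in> space ?P. enat n < hitting_time B X})"
    by (rule nn_integral_enat_function[OF meas])
  also have "\<dots> = (\<Sum>n. ennreal (\<Sum>x\<in>S. \<nu> x * (killed_step p (S - B) ^^ n) (\<lambda>_. 1) x))"
    unfolding gt by (intro suminf_cong emeasure_stay[OF S \<nu> p]) auto
  finally show ?thesis .
qed

text \<open>The events of entering \<open>B\<close> at step n + 1 after n steps outside
  \<open>A \<union> B\<close> are disjoint for different n and exhaust the event in
  question.\<close>

lemma measure_hit_before:
  assumes S: "finite S" and \<nu>: "prob_vector S \<nu>" and p: "\<And>s. s \<in> S \<Longrightarrow> prob_vector S (p s)"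
    and AB: "A \<inter> B = {}" "B \<subseteq> S"
  shows "(\<lambda>n. \<Sum>x\<in>S. \<nu> x * (killed_step p (S - A - B) ^^ n) (\<lambda>y. \<Sum>x\<in>B. p y x) x) sums
    measure (markov_law S \<nu> p) {X \<in> space (markov_law S \<nu> p). hitting_time B X < hitting_time A X}"
proof -
  let ?P = "markov_law S \<nu> p"
  interpret prob_space ?P using S \<nu> p by (rule prob_space_markov_law)
  let ?F = "\<lambda>n. {X \<in> space ?P. (\<forall>t. 0 < t \<and> t \<le> n \<longrightarrow> X t \<in> S - A - B) \<and> X (Suc n) \<in> B}"
  have sp: "X t \<in> S" if "X \<in> space ?P" for X t
    using measurable_space[OF measurable_markov_law_component[OF S \<nu> p] that] by simp
  have [measurable]: "(\<lambda>X. X t) \<in> measurable ?P (count_space S)" for t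
    using S \<nu> p by (rule measurable_markov_law_component)
  have Fs: "?F n \<in> sets ?P" for n
  proof -
    have "?F n = (\<lambda>X. X (Suc n)) -` B \<inter> space ?P \<inter> (space ?P \<inter> (\<Inter>t\<in>{0<..n}. (\<lambda>X. X t) -` (S - A - B) \<inter> space ?P))"
      by auto
    also have "\<dots> \<in> sets ?P"
    proof (rule sets.Int)
        show "(\<lambda>X. X (Suc n)) -` B \<inter> space ?P \<in> sets ?P"
          using AB by (intro measurable_sets[OF measurable_markov_law_component[OF S \<nu> p]]) auto
        show "space ?P \<inter> (\<Inter>t\<in>{0<..n}. (\<lambda>X. X t) -` (S - A - B) \<inter> space ?P) \<in> sets ?P"
      proof (cases "n = 0")
        case False
        then show ?thesis
          by (intro sets.Int[OF sets.top] sets.finite_INT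
            measurable_sets[OF measurable_markov_law_component[OF S \<nu> p]]) auto
      qed simp
    qed
    finally show ?thesis .
  qed
  have disj: "disjoint_family ?F"
    unfolding disjoint_family_on_def
  proof (safe, goal_cases)
    case (1 m n X)
    then show ?case
    proof (cases m n rule: linorder_cases)
      case less then have "0 < Suc m \<and> Suc m \<le> n" by auto
      with 1 show ?thesis by blast
    next
      case greater then have "0 < Suc n \<and> Suc n \<le> m" by auto
      with 1 show ?thesis by blast
    qed auto
  qed
  have eq: "{X \<in> space ?P. hitting_time B X < hitting_time A X} = (\<Union>n. ?F n)"
    using sp by (auto simp: hitting_time_less_iff[OF AB(1)])
  have nn: "0 \<le> (killed_step p (S - A - B) ^^ n) (\<lambda>y. \<Sum>x\<in>B. p y x) x" if "x \<in> S" for n x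
    using that
  proof (induction n arbitrary: x)
    case 0 then show ?case using p AB by (auto simp: prob_vector_def intro!: sum_nonneg)
  next
    case (Suc n) then show ?case using p
      by (auto simp: killed_step_def prob_vector_def intro!: sum_nonneg)
  qed
  have "measure ?P (?F n) = (\<Sum>x\<in>S. \<nu> x * (killed_step p (S - A - B) ^^ n) (\<lambda>y. \<Sum>x\<in>B. p y x) x)" for n
  proof -
    have "emeasure ?P (?F n) = ennreal (\<Sum>x\<in>S. \<nu> x * (killed_step p (S - A - B) ^^ n) (\<lambda>y. \<Sum>x\<in>B. p y x) x)"
      by (rule emeasure_stay_then[OF S \<nu> p _ AB(2)]) auto
    moreover have "0 \<le> (\<Sum>x\<in>S. \<nu> x * (killed_step p (S - A - B) ^^ n) (\<lambda>y. \<Sum>x\<in>B. p y x) x)"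
      using nn \<nu> by (intro sum_nonneg mult_nonneg_nonneg) (auto simp: prob_vector_def)
    ultimately show ?thesis by (simp only: measure_def enn2real_ennreal)
  qed
  moreover have "range ?F \<subseteq> sets ?P" using Fs by blast
  ultimately show ?thesis
    using finite_measure_UNION[OF _ disj] unfolding eq by simp
qed

section \<open>Networks and capacities\<close>

text \<open>The Dirichlet form of the network with conductances \<open>c\<close>; the sum over
  ordered pairs meets every edge twice.\<close>

definition energy :: "'s set \<Rightarrow> ('s \<Rightarrow> 's \<Rightarrow> real) \<Rightarrow> ('s \<Rightarrow> real) \<Rightarrow> ('s \<Rightarrow> real) \<Rightarrow> real" where
  "energy S c f g = (\<Sum>\<sigma>\<in>S. \<Sum>\<eta>\<in>S. c \<sigma> \<eta> * (f \<sigma> - f \<eta>) * (g \<sigma> - g \<eta>)) / 2"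

text \<open>Sign convention of the positive operator: for a reversible chain this is the weight
  times (identity minus transition operator).\<close>

definition laplacian :: "'s set \<Rightarrow> ('s \<Rightarrow> 's \<Rightarrow> real) \<Rightarrow> ('s \<Rightarrow> real) \<Rightarrow> 's \<Rightarrow> real" where
  "laplacian S c f \<sigma> = (\<Sum>\<eta>\<in>S. c \<sigma> \<eta> * (f \<sigma> - f \<eta>))"

definition equilibrium ::
  "'s set \<Rightarrow> ('s \<Rightarrow> 's \<Rightarrow> real) \<Rightarrow> 's set \<Rightarrow> 's set \<Rightarrow> ('s \<Rightarrow> real) \<Rightarrow> bool" where
  "equilibrium S c A B h \<longleftrightarrow> (\<forall>\<sigma>\<in>A. h \<sigma> = 1) \<and> (\<forall>\<sigma>\<in>B. h \<sigma> = 0) \<and> (\<forall>\<sigma>\<in>S. 0 \<le> h \<sigma> \<and> h \<sigma> \<le> 1) \<and>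
     (\<forall>\<sigma>\<in>S - A - B. laplacian S c h \<sigma> = 0)"

text \<open>Connectivity in the form in which it is applied: a function of zero energy agrees across
  every edge of positive conductance and must then be constant.\<close>

definition connected_network :: "'s set \<Rightarrow> ('s \<Rightarrow> 's \<Rightarrow> real) \<Rightarrow> bool" where
  "connected_network S c \<longleftrightarrow> (\<forall>f :: 's \<Rightarrow> real. (\<forall>\<sigma>\<in>S. \<forall>\<eta>\<in>S. 0 < c \<sigma> \<eta> \<longrightarrow> f \<sigma> = f \<eta>) \<longrightarrow>
     (\<forall>\<sigma>\<in>S. \<forall>\<eta>\<in>S. f \<sigma> = f \<eta>))"

locale network =
  fixes S :: "'s set" and c :: "'s \<Rightarrow> 's \<Rightarrow> real"
  assumes fin: "finite S"
    and sym: "\<And>\<sigma> \<eta>. \<sigma> \<in> S \<Longrightarrow> \<eta> \<in> S \<Longrightarrow> c \<sigma> \<eta> = c \<eta> \<sigma>"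
    and nonneg: "\<And>\<sigma> \<eta>. \<sigma> \<in> S \<Longrightarrow> \<eta> \<in> S \<Longrightarrow> 0 \<le> c \<sigma> \<eta>"
begin

lemma energy_commute: "energy S c f g = energy S c g f"
  unfolding energy_def by (simp add: mult_ac)

text \<open>Summation by parts: exchanging the two endpoints and using the symmetry of
  \<open>c\<close> turns the term with \<open>f \<eta>\<close> into minus the term with
  \<open>f \<sigma>\<close>.\<close>

lemma energy_eq_laplacian: "energy S c f g = (\<Sum>\<sigma>\<in>S. f \<sigma> * laplacian S c g \<sigma>)"
proof -
  have "(\<Sum>\<sigma>\<in>S. \<Sum>\<eta>\<in>S. c \<sigma> \<eta> * f \<eta> * (g \<sigma> - g \<eta>)) = (\<Sum>\<eta>\<in>S. \<Sum>\<sigma>\<in>S. c \<sigma> \<eta> * f \<eta> * (g \<sigma> - g \<eta>))"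
    by (rule sum.swap)
  also have "\<dots> = (\<Sum>\<eta>\<in>S. \<Sum>\<sigma>\<in>S. - (c \<eta> \<sigma> * f \<eta> * (g \<eta> - g \<sigma>)))"
    by (intro sum.cong refl) (simp add: sym algebra_simps)
  finally have sw: "(\<Sum>\<sigma>\<in>S. \<Sum>\<eta>\<in>S. c \<sigma> \<eta> * f \<eta> * (g \<sigma> - g \<eta>))
      = - (\<Sum>\<sigma>\<in>S. \<Sum>\<eta>\<in>S. c \<sigma> \<eta> * f \<sigma> * (g \<sigma> - g \<eta>))" by (simp add: sum_negf)
  have "2 * energy S c f g = (\<Sum>\<sigma>\<in>S. \<Sum>\<eta>\<in>S. c \<sigma> \<eta> * f \<sigma> * (g \<sigma> - g \<eta>))
      - (\<Sum>\<sigma>\<in>S. \<Sum>\<eta>\<in>S. c \<sigma> \<eta> * f \<eta> * (g \<sigma> - g \<eta>))"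
    unfolding energy_def by (simp add: sum_subtractf[symmetric] algebra_simps)
  also have "\<dots> = 2 * (\<Sum>\<sigma>\<in>S. \<Sum>\<eta>\<in>S. c \<sigma> \<eta> * f \<sigma> * (g \<sigma> - g \<eta>))" using sw by simp
  finally have "energy S c f g = (\<Sum>\<sigma>\<in>S. \<Sum>\<eta>\<in>S. c \<sigma> \<eta> * f \<sigma> * (g \<sigma> - g \<eta>))" by simp
  then show ?thesis
    unfolding laplacian_def by (simp add: sum_distrib_left mult_ac)
qed

lemma energy_nonneg: "0 \<le> energy S c f f"
  unfolding energy_def using nonneg by (intro divide_nonneg_nonneg sum_nonneg) (auto simp: mult.assoc)

lemma energy_eq_0_imp:
  assumes "energy S c f f = 0" "connected_network S c" "\<sigma> \<in> S" "\<eta> \<in> S"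
  shows "f \<sigma> = f \<eta>"
proof -
  have t: "0 \<le> c \<sigma> \<eta> * (f \<sigma> - f \<eta>) * (f \<sigma> - f \<eta>)" if "\<sigma> \<in> S" "\<eta> \<in> S" for \<sigma> \<eta>
    using nonneg[OF that] by (auto simp: mult.assoc)
  have "(\<Sum>\<sigma>\<in>S. \<Sum>\<eta>\<in>S. c \<sigma> \<eta> * (f \<sigma> - f \<eta>) * (f \<sigma> - f \<eta>)) = 0"
    using assms by (simp add: energy_def)
  then have "c \<sigma> \<eta> * (f \<sigma> - f \<eta>) * (f \<sigma> - f \<eta>) = 0" if "\<sigma> \<in> S" "\<eta> \<in> S" for \<sigma> \<eta>
    using that t fin by (subst (asm) sum_nonneg_eq_0_iff) (auto simp: sum_nonneg_eq_0_iff intro!: sum_nonneg)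
  then have "\<forall>\<sigma>\<in>S. \<forall>\<eta>\<in>S. 0 < c \<sigma> \<eta> \<longrightarrow> f \<sigma> = f \<eta>" by force
  then show ?thesis using assms(2-) unfolding connected_network_def by blast
qed

text \<open>Writing \<open>c\<close> as (c / sqrt c') * sqrt c' on every edge. The first factor on
  the right is the energy dissipated in the network \<open>c'\<close> by the flow
  \<open>c * (f \<sigma> - f \<eta>)\<close>, which is what the Thomson principle needs.\<close>

lemma energy_cauchy_schwarz:
  assumes "\<And>\<sigma> \<eta>. \<sigma> \<in> S \<Longrightarrow> \<eta> \<in> S \<Longrightarrow> 0 \<le> c' \<sigma> \<eta>"
    and "\<And>\<sigma> \<eta>. \<sigma> \<in> S \<Longrightarrow> \<eta> \<in> S \<Longrightarrow> 0 < c \<sigma> \<eta> \<Longrightarrow> 0 < c' \<sigma> \<eta>"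
  shows "(energy S c f g)\<^sup>2 \<le> energy S (\<lambda>\<sigma> \<eta>. (c \<sigma> \<eta>)\<^sup>2 / c' \<sigma> \<eta>) f f * energy S c' g g"
proof -
  let ?a = "\<lambda>(\<sigma>, \<eta>). c \<sigma> \<eta> / sqrt (c' \<sigma> \<eta>) * (f \<sigma> - f \<eta>)"
  let ?b = "\<lambda>(\<sigma>, \<eta>). sqrt (c' \<sigma> \<eta>) * (g \<sigma> - g \<eta>)"
  have E: "energy S d u v = (\<Sum>(\<sigma>, \<eta>)\<in>S \<times> S. d \<sigma> \<eta> * (u \<sigma> - u \<eta>) * (v \<sigma> - v \<eta>)) / 2" for d u v
    unfolding energy_def by (simp add: sum.cartesian_product)
  have 1: "(\<Sum>x\<in>S \<times> S. ?a x * ?b x) = 2 * energy S c f g"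
  proof -
    have "?a (\<sigma>, \<eta>) * ?b (\<sigma>, \<eta>) = c \<sigma> \<eta> * (f \<sigma> - f \<eta>) * (g \<sigma> - g \<eta>)" if "\<sigma> \<in> S" "\<eta> \<in> S" for \<sigma> \<eta>
    proof (cases "c \<sigma> \<eta> = 0")
      case False
      then have "0 < c' \<sigma> \<eta>" using nonneg[OF that] assms(2)[OF that] by simp
      then show ?thesis by simp
    qed simp
    then show ?thesis unfolding E by (auto intro!: sum.cong)
  qed
  have 2: "(\<Sum>x\<in>S \<times> S. (?a x)\<^sup>2) = 2 * energy S (\<lambda>\<sigma> \<eta>. (c \<sigma> \<eta>)\<^sup>2 / c' \<sigma> \<eta>) f f"
    unfolding E using assms(1)
    by (auto intro!: sum.cong simp: power_mult_distrib power_divide power2_eq_square[of "_ - _"])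
  have 3: "(\<Sum>x\<in>S \<times> S. (?b x)\<^sup>2) = 2 * energy S c' g g"
    unfolding E using assms(1)
    by (auto intro!: sum.cong simp: power_mult_distrib power2_eq_square[of "_ - _"])
  from Cauchy_Schwarz_ineq_sum[of ?a ?b "S \<times> S"] show ?thesis
    unfolding 1 2 3 by (simp add: power2_eq_square)
qed

lemma sum_split_AB:
  assumes "A \<subseteq> S" "B \<subseteq> S" "A \<inter> B = {}" and "\<forall>\<sigma>\<in>S - A - B. F \<sigma> = (0::real)"
  shows "sum F S = sum F A + sum F B"
proof -
  have "sum F S = sum F (A \<union> B)"
    using assms by (intro sum.mono_neutral_right fin) auto
  also have "\<dots> = sum F A + sum F B"
    using assms by (intro sum.union_disjoint) (auto intro: finite_subset[OF _ fin])
  finally show ?thesis .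
qed

text \<open>After summation by parts only \<open>A\<close> and \<open>B\<close> carry charge, since
  \<open>h\<close> is harmonic elsewhere; a test function that is constant on each of the two sets
  therefore enters only through these constants.\<close>

lemma energy_equilibrium:
  assumes AB: "A \<subseteq> S" "B \<subseteq> S" "A \<inter> B = {}" and h: "equilibrium S c A B h"
    and g: "\<And>\<sigma>. \<sigma> \<in> A \<Longrightarrow> g \<sigma> = a" "\<And>\<sigma>. \<sigma> \<in> B \<Longrightarrow> g \<sigma> = b"
  shows "energy S c h g = (a - b) * energy S c h h"
    and "energy S c h h = sum (laplacian S c h) A"
proof -
  have *: "energy S c h g = a * sum (laplacian S c h) A + b * sum (laplacian S c h) B"
    if "\<And>\<sigma>. \<sigma> \<in> A \<Longrightarrow> g \<sigma> = a" "\<And>\<sigma>. \<sigma> \<in> B \<Longrightarrow> g \<sigma> = b" for g a b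
  proof -
    have "energy S c h g = (\<Sum>\<sigma>\<in>S. g \<sigma> * laplacian S c h \<sigma>)"
      by (subst energy_commute) (rule energy_eq_laplacian)
    also have "\<dots> = (\<Sum>\<sigma>\<in>A. g \<sigma> * laplacian S c h \<sigma>) + (\<Sum>\<sigma>\<in>B. g \<sigma> * laplacian S c h \<sigma>)"
      using h by (intro sum_split_AB AB) (auto simp: equilibrium_def)
    finally show ?thesis using that by (simp add: sum_distrib_left)
  qed
  \<comment> \<open>Testing with the constant function 1 shows that the total charges of
    \<open>A\<close> and \<open>B\<close> cancel.\<close>
  have 1: "sum (laplacian S c h) B = - sum (laplacian S c h) A"
    using *[of "\<lambda>_. 1" 1 1] by (simp add: energy_def)
  show 2: "energy S c h h = sum (laplacian S c h) A"
    using *[of h 1 0] h by (simp add: equilibrium_def)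
  show "energy S c h g = (a - b) * energy S c h h"
    using *[of g a b, OF g] 2 unfolding 1 by (simp add: algebra_simps)
qed

text \<open>The energy of \<open>g - h\<close> is nonnegative, and its cross term equals the energy
  of \<open>h\<close>.\<close>

lemma dirichlet_principle:
  assumes AB: "A \<subseteq> S" "B \<subseteq> S" "A \<inter> B = {}" and h: "equilibrium S c A B h"
    and g: "\<And>\<sigma>. \<sigma> \<in> A \<Longrightarrow> g \<sigma> = 1" "\<And>\<sigma>. \<sigma> \<in> B \<Longrightarrow> g \<sigma> = 0"
  shows "energy S c h h \<le> energy S c g g"
proof -
  have "0 \<le> energy S c (\<lambda>x. g x - h x) (\<lambda>x. g x - h x)" by (rule energy_nonneg)
  also have "\<dots> = energy S c g g - 2 * energy S c h g + energy S c h h"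
    unfolding energy_def
    by (simp add: sum_subtractf[symmetric] sum.distrib[symmetric] sum_distrib_left field_simps)
  also have "energy S c h g = energy S c h h" using energy_equilibrium(1)[OF AB h g] by simp
  finally show ?thesis by simp
qed

text \<open>The equilibrium flow of \<open>c\<close> serves as test flow in the network
  \<open>c'\<close>. With \<open>g\<close> the equilibrium potential of \<open>c'\<close> this
  bounds the capacity of \<open>c'\<close> from below by quantities of the network
  \<open>c\<close>.\<close>

lemma thomson_principle:
  assumes AB: "A \<subseteq> S" "B \<subseteq> S" "A \<inter> B = {}" and h: "equilibrium S c A B h"
    and g: "\<And>\<sigma>. \<sigma> \<in> A \<Longrightarrow> g \<sigma> = 1" "\<And>\<sigma>. \<sigma> \<in> B \<Longrightarrow> g \<sigma> = 0"
    and c': "\<And>\<sigma> \<eta>. \<sigma> \<in> S \<Longrightarrow> \<eta> \<in> S \<Longrightarrow> 0 \<le> c' \<sigma> \<eta>"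
     "\<And>\<sigma> \<eta>. \<sigma> \<in> S \<Longrightarrow> \<eta> \<in> S \<Longrightarrow> 0 < c \<sigma> \<eta> \<Longrightarrow> 0 < c' \<sigma> \<eta>"
  shows "(energy S c h h)\<^sup>2 \<le> energy S (\<lambda>\<sigma> \<eta>. (c \<sigma> \<eta>)\<^sup>2 / c' \<sigma> \<eta>) h h * energy S c' g g"
proof -
  have "energy S c h g = energy S c h h" using energy_equilibrium(1)[OF AB h g] by simp
  then show ?thesis using energy_cauchy_schwarz[of c' h g, OF c'] by simp
qed

lemma equilibrium_swap:
  assumes "equilibrium S c A B h"
  shows "equilibrium S c B A (\<lambda>x. 1 - h x)"
proof -
  have "laplacian S c (\<lambda>x. 1 - h x) \<sigma> = - laplacian S c h \<sigma>" for \<sigma>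
    unfolding laplacian_def by (simp add: sum_negf[symmetric] algebra_simps)
  with assms show ?thesis by (auto simp: equilibrium_def)
qed

lemma energy_one_minus: "energy S c (\<lambda>x. 1 - h x) (\<lambda>x. 1 - h x) = energy S c h h"
  unfolding energy_def by (simp add: algebra_simps)

text \<open>A Poincare inequality applied to \<open>h\<close> itself would only control the sum of
  \<open>w * h^2\<close>. The function f = sqrt (h + d) - sqrt d also vanishes on \<open>B\<close>,
  its square is comparable to \<open>h\<close>, and its energy is at most half of the form between
  \<open>h\<close> and ln (h + d). That form is explicit because \<open>h\<close> is harmonic off
  the two sets. The shift d keeps the logarithm finite; taken exponentially small, it costs only a
  logarithm of linear size.\<close>

lemma sum_equilibrium_le:
  assumes AB: "A \<subseteq> S" "B \<subseteq> S" "A \<inter> B = {}" and h: "equilibrium S c A B h"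
    and X: "X \<subseteq> S" and w: "\<And>\<sigma>. \<sigma> \<in> X \<Longrightarrow> 0 \<le> w \<sigma>" and K: "0 \<le> K"
    and poincare: "\<And>f. (\<And>\<sigma>. \<sigma> \<in> B \<Longrightarrow> f \<sigma> = 0) \<Longrightarrow> (\<Sum>\<sigma>\<in>X. w \<sigma> * (f \<sigma>)\<^sup>2) \<le> K * energy S c f f"
    and d: "0 < d"
  shows "(\<Sum>\<sigma>\<in>X. w \<sigma> * h \<sigma>) \<le> K * energy S c h h * ln ((1 + d) / d) + d * (\<Sum>\<sigma>\<in>X. w \<sigma>)"
proof -
  define f where "f \<sigma> = sqrt (h \<sigma> + d) - sqrt d" for \<sigma>
  have h01: "0 \<le> h \<sigma>" "h \<sigma> \<le> 1" if "\<sigma> \<in> S" for \<sigma> using h that by (auto simp: equilibrium_def)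
  \<comment> \<open>With x = sqrt a and y = sqrt b this is (x - y)^2 \<le> (x^2 - y^2) * (ln x - ln
    y); the factor 1/2 is ln (sqrt a) = ln a / 2.\<close>
  have key: "(sqrt a - sqrt b)\<^sup>2 \<le> (a - b) * (ln a - ln b) / 2" if ab: "0 < a" "0 < b" for a b :: real
  proof -
    have *: "(x - y)\<^sup>2 \<le> (x\<^sup>2 - y\<^sup>2) * (ln x - ln y)" if xy: "0 < y" "y \<le> x" for x y :: real
    proof -
      have "ln (y / x) \<le> y / x - 1" using xy by (intro ln_le_minus_one) auto
      then have "(x - y) / x \<le> ln x - ln y" using xy by (simp add: ln_div field_simps)
      moreover have "(x - y) * x \<le> x\<^sup>2 - y\<^sup>2" using xy
        by (simp add: power2_eq_square algebra_simps)
      ultimately have "((x - y) * x) * ((x - y) / x) \<le> (x\<^sup>2 - y\<^sup>2) * (ln x - ln y)"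
        using xy by (intro mult_mono) auto
      then show ?thesis using xy by (simp add: power2_eq_square)
    qed
    have "(sqrt a - sqrt b)\<^sup>2 \<le> ((sqrt a)\<^sup>2 - (sqrt b)\<^sup>2) * (ln (sqrt a) - ln (sqrt b))"
    proof (cases "b \<le> a")
      case True
      then show ?thesis using ab by (intro *) auto
    next
      case False
      then have "(sqrt b - sqrt a)\<^sup>2 \<le> ((sqrt b)\<^sup>2 - (sqrt a)\<^sup>2) * (ln (sqrt b) - ln (sqrt a))"
        using ab by (intro *) auto
      then show ?thesis by (simp add: power2_eq_square algebra_simps)
    qed
    then show ?thesis using ab by (simp add: ln_sqrt diff_divide_distrib[symmetric])
  qed
  have "energy S c f f \<le> energy S c h (\<lambda>\<sigma>. ln (h \<sigma> + d)) / 2"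
  proof -
    have "c \<sigma> \<eta> * (f \<sigma> - f \<eta>) * (f \<sigma> - f \<eta>)
        \<le> c \<sigma> \<eta> * (h \<sigma> - h \<eta>) * (ln (h \<sigma> + d) - ln (h \<eta> + d)) / 2" if "\<sigma> \<in> S" "\<eta> \<in> S" for \<sigma> \<eta>
      using mult_left_mono[OF key[of "h \<sigma> + d" "h \<eta> + d"] nonneg[OF that]] h01[OF that(1)] h01[OF that(2)] d
      by (simp add: f_def power2_eq_square mult.assoc)
    then have "(\<Sum>\<sigma>\<in>S. \<Sum>\<eta>\<in>S. c \<sigma> \<eta> * (f \<sigma> - f \<eta>) * (f \<sigma> - f \<eta>))
      \<le> (\<Sum>\<sigma>\<in>S. \<Sum>\<eta>\<in>S. c \<sigma> \<eta> * (h \<sigma> - h \<eta>) * (ln (h \<sigma> + d) - ln (h \<eta> + d)) / 2)"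
      by (intro sum_mono) auto
    then show ?thesis unfolding energy_def by (simp add: sum_divide_distrib[symmetric])
  qed
  \<comment> \<open>Only the boundary values ln (1 + d) on \<open>A\<close> and ln d on
    \<open>B\<close> enter.\<close>
  also have "energy S c h (\<lambda>\<sigma>. ln (h \<sigma> + d)) = (ln (1 + d) - ln d) * energy S c h h"
    using h by (intro energy_equilibrium(1)[OF AB h]) (auto simp: equilibrium_def)
  also have "ln (1 + d) - ln d = ln ((1 + d) / d)" using d by (simp add: ln_div)
  finally have Ef: "energy S c f f \<le> ln ((1 + d) / d) * energy S c h h / 2" .
  \<comment> \<open>From (x + y)^2 \<le> 2 x^2 + 2 y^2 with x = f and y = sqrt d.\<close>
  have pt: "h \<sigma> \<le> 2 * (f \<sigma>)\<^sup>2 + d" if "\<sigma> \<in> X" for \<sigma>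
  proof -
    have "h \<sigma> + d = (f \<sigma> + sqrt d)\<^sup>2" using h01[of \<sigma>] that X d by (auto simp: f_def)
    also have "\<dots> \<le> 2 * (f \<sigma>)\<^sup>2 + 2 * (sqrt d)\<^sup>2"
      using zero_le_power2[of "f \<sigma> - sqrt d"] by (simp add: power2_sum power2_diff algebra_simps)
    finally show ?thesis using d by simp
  qed
  have "(\<Sum>\<sigma>\<in>X. w \<sigma> * h \<sigma>) \<le> (\<Sum>\<sigma>\<in>X. w \<sigma> * (2 * (f \<sigma>)\<^sup>2 + d))"
    using pt w by (intro sum_mono mult_left_mono) auto
  also have "\<dots> = 2 * (\<Sum>\<sigma>\<in>X. w \<sigma> * (f \<sigma>)\<^sup>2) + d * (\<Sum>\<sigma>\<in>X. w \<sigma>)"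
    by (simp add: sum.distrib algebra_simps sum_distrib_left)
  also have "(\<Sum>\<sigma>\<in>X. w \<sigma> * (f \<sigma>)\<^sup>2) \<le> K * energy S c f f"
    using h by (intro poincare) (auto simp: f_def equilibrium_def)
  also have "\<dots> \<le> K * (ln ((1 + d) / d) * energy S c h h / 2)" by (intro mult_left_mono Ef K)
  finally show ?thesis by (simp add: algebra_simps)
qed

end

section \<open>Reversible chains: mean hitting times by potential theory\<close>

locale reversible_chain = network +
  fixes w :: "'a \<Rightarrow> real" and p :: "'a \<Rightarrow> 'a \<Rightarrow> real"
  assumes w_pos: "\<And>\<sigma>. \<sigma> \<in> S \<Longrightarrow> 0 < w \<sigma>"
    and stochastic: "\<And>\<sigma>. \<sigma> \<in> S \<Longrightarrow> prob_vector S (p \<sigma>)"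
    and conductance: "\<And>\<sigma> \<eta>. \<sigma> \<in> S \<Longrightarrow> \<eta> \<in> S \<Longrightarrow> \<sigma> \<noteq> \<eta> \<Longrightarrow> c \<sigma> \<eta> = w \<sigma> * p \<sigma> \<eta>"
    and conn: "connected_network S c"
begin

text \<open>The diagonal of \<open>c\<close> multiplies a zero difference, so the holding
  probabilities need not match any conductance; they are accounted for by the rows of
  \<open>p\<close> having sum 1.\<close>

lemma laplacian_eq:
  assumes "\<sigma> \<in> S"
  shows "laplacian S c f \<sigma> = w \<sigma> * (f \<sigma> - (\<Sum>\<eta>\<in>S. p \<sigma> \<eta> * f \<eta>))"
proof -
  have "laplacian S c f \<sigma> = (\<Sum>\<eta>\<in>S. w \<sigma> * (p \<sigma> \<eta> * (f \<sigma> - f \<eta>)))"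
    unfolding laplacian_def by (intro sum.cong) (use conductance[OF assms] in auto)
  also have "\<dots> = w \<sigma> * ((\<Sum>\<eta>\<in>S. p \<sigma> \<eta>) * f \<sigma> - (\<Sum>\<eta>\<in>S. p \<sigma> \<eta> * f \<eta>))"
    by (simp add: sum_distrib_left sum_distrib_right sum_subtractf algebra_simps)
  finally show ?thesis using stochastic[OF assms] by (simp add: prob_vector_def)
qed

text \<open>The tail probabilities decrease to a limit. Set to 0 on \<open>B\<close>, this limit is
  harmonic off \<open>B\<close>, so its energy is zero; by connectivity it is constant, and the
  constant is its value 0 on the non-empty set \<open>B\<close>.\<close>

lemma killed_tendsto_0:
  assumes "B \<subseteq> S" "B \<noteq> {}" "\<sigma> \<in> S - B"
  shows "(\<lambda>n. (killed_step p (S - B) ^^ n) (\<lambda>_. 1) \<sigma>) \<longlonglongrightarrow> 0"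
proof -
  define g where "g n = (killed_step p (S - B) ^^ n) (\<lambda>_. 1)" for n
  have gS: "g (Suc n) \<sigma> = (\<Sum>\<eta>\<in>S - B. p \<sigma> \<eta> * g n \<eta>)" for n \<sigma>
    by (simp add: g_def killed_step_def)
  have p0: "0 \<le> p \<sigma> \<eta>" if "\<sigma> \<in> S" "\<eta> \<in> S" for \<sigma> \<eta>
    using stochastic[OF that(1)] that by (auto simp: prob_vector_def)
  have g0: "0 \<le> g n \<sigma>" if "\<sigma> \<in> S" for n \<sigma>
    using that by (induction n arbitrary: \<sigma>)
      (auto simp: g_def killed_step_def p0 intro!: sum_nonneg mult_nonneg_nonneg)
  have dec: "g (Suc n) \<sigma> \<le> g n \<sigma>" if "\<sigma> \<in> S" for n \<sigma>
    using that
  proof (induction n arbitrary: \<sigma>)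
    case 0
    have "(\<Sum>\<eta>\<in>S - B. p \<sigma> \<eta>) \<le> (\<Sum>\<eta>\<in>S. p \<sigma> \<eta>)"
      by (intro sum_mono2 fin) (auto simp: p0 0)
    also have "\<dots> = 1" using stochastic[OF 0] by (simp add: prob_vector_def)
    finally show ?case by (simp add: g_def killed_step_def)
  next
    case (Suc n)
    have "(\<Sum>\<eta>\<in>S - B. p \<sigma> \<eta> * g (Suc n) \<eta>) \<le> (\<Sum>\<eta>\<in>S - B. p \<sigma> \<eta> * g n \<eta>)"
      using Suc by (intro sum_mono mult_left_mono p0) auto
    then show ?case by (simp only: gS)
  qed
  have "\<exists>l. (\<lambda>n. g n \<sigma>) \<longlonglongrightarrow> l" if "\<sigma> \<in> S" for \<sigma>
  proof -
    have "decseq (\<lambda>n. g n \<sigma>)" using dec[OF that] by (rule decseq_SucI)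
    then show ?thesis using decseq_convergent[of "\<lambda>n. g n \<sigma>" 0] g0[OF that] by blast
  qed
  then obtain l where l: "\<And>\<sigma>. \<sigma> \<in> S \<Longrightarrow> (\<lambda>n. g n \<sigma>) \<longlonglongrightarrow> l \<sigma>" by metis
  \<comment> \<open>The iterates do not look at the starting state, so \<open>l\<close> is not 0 on
    \<open>B\<close> by construction; the boundary value has to be imposed.\<close>
  define f where "f \<sigma> = (if \<sigma> \<in> B then 0 else l \<sigma>)" for \<sigma>
  have "l \<sigma> = (\<Sum>\<eta>\<in>S. p \<sigma> \<eta> * f \<eta>)" if "\<sigma> \<in> S" for \<sigma>
  proof (rule LIMSEQ_unique)
    show "(\<lambda>n. g (Suc n) \<sigma>) \<longlonglongrightarrow> l \<sigma>" using l[OF that] by (rule LIMSEQ_Suc)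
    have "(\<lambda>n. g (Suc n) \<sigma>) \<longlonglongrightarrow> (\<Sum>\<eta>\<in>S - B. p \<sigma> \<eta> * l \<eta>)"
      unfolding gS by (intro tendsto_sum tendsto_mult tendsto_const l) auto
    also have "(\<Sum>\<eta>\<in>S - B. p \<sigma> \<eta> * l \<eta>) = (\<Sum>\<eta>\<in>S. p \<sigma> \<eta> * f \<eta>)"
      by (intro sum.mono_neutral_cong_left fin) (auto simp: f_def)
    finally show "(\<lambda>n. g (Suc n) \<sigma>) \<longlonglongrightarrow> (\<Sum>\<eta>\<in>S. p \<sigma> \<eta> * f \<eta>)" .
  qed
  then have "laplacian S c f \<sigma> = 0" if "\<sigma> \<in> S - B" for \<sigma>
    using that laplacian_eq[of \<sigma> f] by (auto simp: f_def)
  then have "energy S c f f = 0"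
    unfolding energy_eq_laplacian by (intro sum.neutral) (auto simp: f_def)
  with conn have "f \<sigma> = f \<eta>" if "\<sigma> \<in> S" "\<eta> \<in> S" for \<sigma> \<eta> using that energy_eq_0_imp by blast
  moreover obtain b where "b \<in> B" using assms by auto
  ultimately have "f \<sigma> = f b" using assms by auto
  then have "l \<sigma> = 0" using \<open>b \<in> B\<close> assms by (auto simp: f_def)
  with l[of \<sigma>] assms show ?thesis by (auto simp: g_def)
qed

text \<open>The last-exit distribution is the equilibrium charge of \<open>h\<close> on
  \<open>A\<close>, normalised by the capacity. Pairing \<open>h\<close> with the truncated sums of
  the tail probabilities in the Dirichlet form, once with the Laplacian on each factor, expresses
  the mean hitting time through the sum of \<open>w * h\<close>.\<close>

lemma mean_hitting_time_last_exit:
  assumes AB: "A \<subseteq> S" "B \<subseteq> S" "A \<inter> B = {}" "A \<noteq> {}" "B \<noteq> {}"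
  defines "hit \<equiv> (\<lambda>\<sigma>. let P = markov_law S (\<lambda>\<eta>. of_bool (\<eta> = \<sigma>)) p in
      measure P {X \<in> space P. hitting_time B X < hitting_time A X})"
  obtains h where "equilibrium S c A B h" "0 < energy S c h h"
    and "\<And>g z. 0 < z \<Longrightarrow> (\<And>\<sigma>. \<sigma> \<in> A \<Longrightarrow> g \<sigma> = w \<sigma> / z) \<Longrightarrow>
      (\<integral>\<^sup>+X. ennreal_of_enat (hitting_time B X) \<partial>markov_law S
        (\<lambda>\<sigma>. if \<sigma> \<in> A then g \<sigma> * hit \<sigma> / (\<Sum>\<sigma>'\<in>A. g \<sigma>' * hit \<sigma>') else 0) p)
      = ennreal ((\<Sum>\<sigma>\<in>S. w \<sigma> * h \<sigma>) / energy S c h h)"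
proof -
  let ?E = "S - A - B"
  define \<phi> where "\<phi> y = (\<Sum>x\<in>B. p y x)" for y
  have pv: "prob_vector S (\<lambda>\<eta>. of_bool (\<eta> = \<sigma>))" if "\<sigma> \<in> S" for \<sigma>
    using that fin by (auto simp: prob_vector_def)
  have hs: "(\<lambda>n. (killed_step p ?E ^^ n) \<phi> \<sigma>) sums hit \<sigma>" if "\<sigma> \<in> S" for \<sigma>
  proof -
    have *: "(\<Sum>x\<in>S. of_bool (x = \<sigma>) * F x) = (F \<sigma> :: real)" for F
    proof -
      have "(\<Sum>x\<in>S. of_bool (x = \<sigma>) * F x) = (\<Sum>x\<in>S. if x = \<sigma> then F x else 0)"
        by (intro sum.cong) auto
      then show ?thesis using that fin by simp
    qed
    show ?thesis
      using measure_hit_before[where p=p, OF fin pv[OF that] stochastic AB(3,2)]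
      unfolding * hit_def Let_def \<phi>_def by simp
  qed
  have hit01: "0 \<le> hit \<sigma>" "hit \<sigma> \<le> 1" if "\<sigma> \<in> S" for \<sigma>
  proof -
    interpret prob_space "markov_law S (\<lambda>\<eta>. of_bool (\<eta> = \<sigma>)) p"
      by (rule prob_space_markov_law[OF fin pv[OF that] stochastic])
    show "0 \<le> hit \<sigma>" "hit \<sigma> \<le> 1" by (auto simp: hit_def Let_def)
  qed
  \<comment> \<open>Hitting times ignore time 0, so on \<open>A\<close> the number
    \<open>hit \<sigma>\<close> is the escape probability and not a boundary value; the values on
    \<open>A\<close> and \<open>B\<close> are set by hand.\<close>
  define h where "h \<sigma> = (if \<sigma> \<in> A then 1 else if \<sigma> \<in> B then 0 else 1 - hit \<sigma>)" for \<sigma>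
  have hitE: "hit \<sigma> = \<phi> \<sigma> + (\<Sum>\<eta>\<in>?E. p \<sigma> \<eta> * hit \<eta>)" if "\<sigma> \<in> S" for \<sigma>
  proof -
    have "(\<lambda>n. (killed_step p ?E ^^ Suc n) \<phi> \<sigma>) sums (\<Sum>\<eta>\<in>?E. p \<sigma> \<eta> * hit \<eta>)"
      by (simp add: killed_step_def) (intro sums_sum sums_mult hs, auto)
    then have "(\<lambda>n. (killed_step p ?E ^^ n) \<phi> \<sigma>) sums ((\<Sum>\<eta>\<in>?E. p \<sigma> \<eta> * hit \<eta>) + \<phi> \<sigma>)"
      by (subst (asm) sums_Suc_iff) simp
    with hs[OF that] show ?thesis by (metis sums_unique2 add.commute)
  qed
  have hit_h: "hit \<sigma> = 1 - (\<Sum>\<eta>\<in>S. p \<sigma> \<eta> * h \<eta>)" if "\<sigma> \<in> S" for \<sigma>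
  proof -
    have "(\<Sum>\<eta>\<in>S. p \<sigma> \<eta> * (1 - h \<eta>)) = (\<Sum>\<eta>\<in>B \<union> ?E. p \<sigma> \<eta> * (1 - h \<eta>))"
      using AB by (intro sum.mono_neutral_right fin) (auto simp: h_def)
    also have "\<dots> = (\<Sum>\<eta>\<in>B. p \<sigma> \<eta> * (1 - h \<eta>)) + (\<Sum>\<eta>\<in>?E. p \<sigma> \<eta> * (1 - h \<eta>))"
      using AB fin by (intro sum.union_disjoint) (auto intro: finite_subset)
    also have "\<dots> = \<phi> \<sigma> + (\<Sum>\<eta>\<in>?E. p \<sigma> \<eta> * hit \<eta>)"
      unfolding \<phi>_def by (intro arg_cong2[of _ _ _ _ "(+)"] sum.cong) (use AB in \<open>auto simp: h_def\<close>)
    finally have "hit \<sigma> = (\<Sum>\<eta>\<in>S. p \<sigma> \<eta> * (1 - h \<eta>))" using hitE[OF that] by simp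
    also have "\<dots> = (\<Sum>\<eta>\<in>S. p \<sigma> \<eta>) - (\<Sum>\<eta>\<in>S. p \<sigma> \<eta> * h \<eta>)"
      by (simp add: algebra_simps sum_subtractf)
    finally show ?thesis using stochastic[OF that] by (simp add: prob_vector_def)
  qed
  \<comment> \<open>Off \<open>A\<close> and \<open>B\<close> the bracket vanishes; on
    \<open>A\<close> it is the escape probability, hence the equilibrium charge is
    \<open>w * hit\<close>.\<close>
  have lap: "laplacian S c h \<sigma> = w \<sigma> * (h \<sigma> - 1 + hit \<sigma>)" if "\<sigma> \<in> S" for \<sigma>
    using laplacian_eq[OF that, of h] hit_h[OF that] by simp
  have eq: "equilibrium S c A B h"
    unfolding equilibrium_def using AB hit01 lap by (auto simp: h_def)
  have pos: "0 < energy S c h h"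
  proof (rule ccontr)
    assume "\<not> 0 < energy S c h h"
    then have "energy S c h h = 0" using energy_nonneg[of h] by simp
    then have "h \<sigma> = h \<eta>" if "\<sigma> \<in> S" "\<eta> \<in> S" for \<sigma> \<eta>
      using energy_eq_0_imp conn that by blast
    moreover obtain a b where "a \<in> A" "b \<in> B" using AB by auto
    ultimately have "h a = h b" using AB by blast
    moreover have "b \<notin> A" using AB \<open>b \<in> B\<close> by auto
    ultimately show False using \<open>a \<in> A\<close> \<open>b \<in> B\<close> by (simp add: h_def)
  qed
  have cap: "energy S c h h = (\<Sum>\<sigma>\<in>A. w \<sigma> * hit \<sigma>)"
    using energy_equilibrium(2)[OF AB(1-3) eq, of h 1 0] eq AB(1) lap
    by (auto simp: equilibrium_def intro!: sum.cong)
  show thesis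
  proof (rule that[OF eq pos])
    \<comment> \<open>\<open>z\<close> plays the role of the partition function and cancels in the
      normalised distribution.\<close>
    fix g :: "'a \<Rightarrow> real" and z :: real assume z: "0 < z" and g: "\<And>\<sigma>. \<sigma> \<in> A \<Longrightarrow> g \<sigma> = w \<sigma> / z"
    let ?\<nu> = "\<lambda>\<sigma>. if \<sigma> \<in> A then g \<sigma> * hit \<sigma> / (\<Sum>\<sigma>'\<in>A. g \<sigma>' * hit \<sigma>') else 0"
    define \<nu> where "\<nu> \<sigma> = (if \<sigma> \<in> A then w \<sigma> * hit \<sigma> / energy S c h h else 0)" for \<sigma>
    have "(\<Sum>\<sigma>'\<in>A. g \<sigma>' * hit \<sigma>') = energy S c h h / z"
      unfolding cap sum_divide_distrib by (intro sum.cong) (auto simp: g)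
    then have \<nu>_eq: "?\<nu> = \<nu>" using z by (auto simp: fun_eq_iff \<nu>_def g)
    have \<nu>: "prob_vector S \<nu>"
    proof -
      have "(\<Sum>\<sigma>\<in>S. \<nu> \<sigma>) = (\<Sum>\<sigma>\<in>A. \<nu> \<sigma>)"
        using AB by (intro sum.mono_neutral_right fin) (auto simp: \<nu>_def)
      also have "\<dots> = 1" using pos by (simp add: \<nu>_def sum_divide_distrib[symmetric] cap)
      finally show ?thesis using w_pos hit01 pos
        by (auto simp: prob_vector_def \<nu>_def less_imp_le)
    qed
    define gg where "gg n = (killed_step p (S - B) ^^ n) (\<lambda>_. 1)" for n
    have gS: "gg (Suc n) \<sigma> = (\<Sum>\<eta>\<in>S - B. p \<sigma> \<eta> * gg n \<eta>)" for n \<sigma>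
      by (simp add: gg_def killed_step_def)
    have p0: "0 \<le> p \<sigma> \<eta>" if "\<sigma> \<in> S" "\<eta> \<in> S" for \<sigma> \<eta>
      using stochastic[OF that(1)] that by (auto simp: prob_vector_def)
    have g0: "0 \<le> gg n \<sigma>" if "\<sigma> \<in> S" for n \<sigma>
      using that by (induction n arbitrary: \<sigma>)
        (auto simp: gg_def killed_step_def p0 intro!: sum_nonneg mult_nonneg_nonneg)
    \<comment> \<open>\<open>u\<close> is the truncated sum of the tail probabilities with boundary
      value 0 on \<open>B\<close>; its Laplacian telescopes to \<open>w * (1 - gg n)\<close>, while
      that of \<open>h\<close> lives on \<open>A\<close> in this pairing. The identity is the
      symmetry of the form.\<close>
    have part: "(\<Sum>k<n. \<Sum>x\<in>S. \<nu> x * gg k x) = (\<Sum>\<sigma>\<in>S. w \<sigma> * h \<sigma> * (1 - gg n \<sigma>)) / energy S c h h" for n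
    proof -
      define u where "u \<sigma> = (if \<sigma> \<in> B then 0 else \<Sum>k<n. gg k \<sigma>)" for \<sigma>
      have "(\<Sum>\<eta>\<in>S. p \<sigma> \<eta> * u \<eta>) = (\<Sum>k<n. gg (Suc k) \<sigma>)" for \<sigma>
      proof -
        have "(\<Sum>\<eta>\<in>S. p \<sigma> \<eta> * u \<eta>) = (\<Sum>\<eta>\<in>S - B. p \<sigma> \<eta> * (\<Sum>k<n. gg k \<eta>))"
          by (intro sum.mono_neutral_cong_right fin) (auto simp: u_def)
        then show ?thesis unfolding gS by (simp add: sum_distrib_left sum.swap[of _ "S - B"])
      qed
      then have lu: "laplacian S c u \<sigma> = w \<sigma> * (1 - gg n \<sigma>)" if "\<sigma> \<in> S - B" for \<sigma>
        using that laplacian_eq[of \<sigma> u] sum_lessThan_telescope'[of "\<lambda>k. gg k \<sigma>" n]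
        by (auto simp: u_def sum_subtractf gg_def)
      have "energy S c h u = (\<Sum>\<sigma>\<in>S. w \<sigma> * h \<sigma> * (1 - gg n \<sigma>))"
        unfolding energy_eq_laplacian
        by (rule sum.cong[OF refl]) (use lu AB in \<open>auto simp: h_def\<close>)
      moreover have "energy S c u h = (\<Sum>\<sigma>\<in>A. u \<sigma> * laplacian S c h \<sigma>)"
        unfolding energy_eq_laplacian using AB eq
        by (intro sum.mono_neutral_right fin) (auto simp: u_def equilibrium_def)
      moreover have "(\<Sum>\<sigma>\<in>A. u \<sigma> * laplacian S c h \<sigma>) = energy S c h h * (\<Sum>k<n. \<Sum>x\<in>S. \<nu> x * gg k x)"
      proof -
        have "(\<Sum>k<n. \<Sum>x\<in>S. \<nu> x * gg k x) = (\<Sum>x\<in>S. \<nu> x * (\<Sum>k<n. gg k x))"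
          by (subst sum.swap) (simp add: sum_distrib_left)
        also have "\<dots> = (\<Sum>x\<in>A. \<nu> x * (\<Sum>k<n. gg k x))"
          using AB by (intro sum.mono_neutral_right fin) (auto simp: \<nu>_def)
        finally have "energy S c h h * (\<Sum>k<n. \<Sum>x\<in>S. \<nu> x * gg k x)
          = (\<Sum>x\<in>A. energy S c h h * \<nu> x * (\<Sum>k<n. gg k x))" by (simp add: sum_distrib_left mult.assoc)
        also have "\<dots> = (\<Sum>\<sigma>\<in>A. u \<sigma> * laplacian S c h \<sigma>)"
          by (intro sum.cong refl) (use AB lap pos in \<open>auto simp: \<nu>_def u_def h_def subset_iff\<close>)
        finally show ?thesis ..
      qed
      ultimately show ?thesis using pos energy_commute[of h u] by (simp add: field_simps)
    qed
    have "(\<lambda>n. (\<Sum>\<sigma>\<in>S. w \<sigma> * h \<sigma> * (1 - gg n \<sigma>)) / energy S c h h)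
        \<longlonglongrightarrow> (\<Sum>\<sigma>\<in>S. w \<sigma> * h \<sigma> * (1 - 0)) / energy S c h h"
    proof (intro tendsto_divide tendsto_sum)
      fix \<sigma> assume "\<sigma> \<in> S"
      show "(\<lambda>n. w \<sigma> * h \<sigma> * (1 - gg n \<sigma>)) \<longlonglongrightarrow> w \<sigma> * h \<sigma> * (1 - 0)"
      proof (cases "\<sigma> \<in> B")
        case True
        then show ?thesis using AB by (auto simp: h_def)
      next
        case False
        then show ?thesis using killed_tendsto_0[OF AB(2,5), of \<sigma>] \<open>\<sigma> \<in> S\<close> unfolding gg_def
          by (intro tendsto_intros) auto
      qed
    qed (use pos in auto)
    then have "(\<lambda>n. \<Sum>x\<in>S. \<nu> x * gg n x) sums ((\<Sum>\<sigma>\<in>S. w \<sigma> * h \<sigma>) / energy S c h h)"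
      unfolding sums_def part by simp
    moreover have "0 \<le> (\<Sum>x\<in>S. \<nu> x * gg n x)" for n
      using \<nu> g0 by (auto simp: prob_vector_def intro!: sum_nonneg)
    ultimately have "(\<Sum>n. ennreal (\<Sum>x\<in>S. \<nu> x * gg n x)) = ennreal ((\<Sum>\<sigma>\<in>S. w \<sigma> * h \<sigma>) / energy S c h h)"
      by (intro suminf_ennreal_eq)
    moreover have "(\<integral>\<^sup>+X. ennreal_of_enat (hitting_time B X) \<partial>markov_law S \<nu> p)
        = (\<Sum>n. ennreal (\<Sum>x\<in>S. \<nu> x * gg n x))"
      unfolding gg_def by (rule nn_integral_hitting_time[OF fin \<nu> stochastic])
    ultimately show "(\<integral>\<^sup>+X. ennreal_of_enat (hitting_time B X) \<partial>markov_law S ?\<nu> p)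
      = ennreal ((\<Sum>\<sigma>\<in>S. w \<sigma> * h \<sigma>) / energy S c h h)"
      unfolding \<nu>_eq by simp
  qed
qed

end

section \<open>The Metropolis chain on level sets\<close>

definition differ_once :: "nat \<Rightarrow> config \<Rightarrow> config \<Rightarrow> bool" where
  "differ_once N \<sigma> \<eta> \<longleftrightarrow> card {i \<in> {1..N}. \<sigma> i \<noteq> \<eta> i} = 1"

text \<open>For the Metropolis rule, w \<sigma> * exp (- \<beta> * max 0 (H \<eta> - H \<sigma>)) is
  the smaller of the two weights. In this form the conductance is visibly symmetric and monotone in
  \<open>w\<close>, which makes networks with comparable weights comparable.\<close>

definition conductance :: "nat \<Rightarrow> nat \<Rightarrow> (config \<Rightarrow> real) \<Rightarrow> config \<Rightarrow> config \<Rightarrow> real" where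
  "conductance q N w \<sigma> \<eta> =
     (if differ_once N \<sigma> \<eta> then 1 / (real N * real q) * min (w \<sigma>) (w \<eta>) else 0)"

lemma differ_once_sym: "differ_once N \<sigma> \<eta> \<longleftrightarrow> differ_once N \<eta> \<sigma>"
proof -
  have "{i \<in> {1..N}. \<sigma> i \<noteq> \<eta> i} = {i \<in> {1..N}. \<eta> i \<noteq> \<sigma> i}" by auto
  then show ?thesis by (simp only: differ_once_def)
qed

lemma network_conductance:
  assumes "\<And>\<sigma>. \<sigma> \<in> configs q N \<Longrightarrow> 0 < w \<sigma>"
  shows "network (configs q N) (conductance q N w)"
proof
  fix \<sigma> \<eta> assume *: "\<sigma> \<in> configs q N" "\<eta> \<in> configs q N"
  show "conductance q N w \<sigma> \<eta> = conductance q N w \<eta> \<sigma>"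
    by (simp add: conductance_def differ_once_sym[of N \<sigma>] min.commute)
  show "0 \<le> conductance q N w \<sigma> \<eta>"
    using assms[OF *(1)] assms[OF *(2)] by (simp add: conductance_def)
qed (rule finite_configs)

lemma configs_eqI:
  assumes "\<sigma> \<in> configs q N" "\<eta> \<in> configs q N" "\<And>i. i \<in> {1..N} \<Longrightarrow> \<sigma> i = \<eta> i"
  shows "\<sigma> = \<eta>"
  using assms unfolding configs_def by (rule PiE_ext)

text \<open>Induction on the number of sites at which \<sigma> and \<eta> disagree, correcting one
  site at a time; as all weights are positive, every correction is an edge.\<close>

lemma connected_conductance:
  assumes w: "\<And>\<sigma>. \<sigma> \<in> configs q N \<Longrightarrow> 0 < w \<sigma>" and Nq: "1 \<le> N" "1 \<le> q"
  shows "connected_network (configs q N) (conductance q N w)"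
  unfolding connected_network_def
proof (intro allI impI ballI)
  fix f :: "config \<Rightarrow> real" and \<sigma> \<eta>
  assume f: "\<forall>\<sigma>\<in>configs q N. \<forall>\<eta>\<in>configs q N. 0 < conductance q N w \<sigma> \<eta> \<longrightarrow> f \<sigma> = f \<eta>"
    and "\<sigma> \<in> configs q N" and \<eta>: "\<eta> \<in> configs q N"
  show "f \<sigma> = f \<eta>" using \<open>\<sigma> \<in> configs q N\<close>
  proof (induction "card {i \<in> {1..N}. \<sigma> i \<noteq> \<eta> i}" arbitrary: \<sigma>)
    case 0
    then have "\<sigma> = \<eta>" by (intro configs_eqI[OF _ \<eta>]) auto
    then show ?case by simp
  next
    case (Suc n)
    then have "{i \<in> {1..N}. \<sigma> i \<noteq> \<eta> i} \<noteq> {}" by (metis card.empty nat.distinct(1))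
    then obtain i where i: "i \<in> {1..N}" "\<sigma> i \<noteq> \<eta> i" by auto
    define \<sigma>' where "\<sigma>' = \<sigma>(i := \<eta> i)"
    have \<sigma>': "\<sigma>' \<in> configs q N"
      using Suc(3) \<eta> i by (auto simp: \<sigma>'_def configs_def PiE_iff extensional_def)
    have "{j \<in> {1..N}. \<sigma>' j \<noteq> \<eta> j} = {j \<in> {1..N}. \<sigma> j \<noteq> \<eta> j} - {i}"
      using i by (auto simp: \<sigma>'_def)
    then have "n = card {j \<in> {1..N}. \<sigma>' j \<noteq> \<eta> j}" using Suc(2) i by simp
    from Suc(1)[OF this \<sigma>'] have "f \<sigma>' = f \<eta>" .
    moreover have "{j \<in> {1..N}. \<sigma> j \<noteq> \<sigma>' j} = {i}" using i by (auto simp: \<sigma>'_def)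
    then have "0 < conductance q N w \<sigma> \<sigma>'"
      using w[OF Suc(3)] w[OF \<sigma>'] Nq by (simp add: conductance_def differ_once_def)
    then have "f \<sigma> = f \<sigma>'" using f Suc(3) \<sigma>' by blast
    ultimately show ?case by simp
  qed
qed

lemma reversible_chain_glauber:
  fixes H :: "config \<Rightarrow> real"
  assumes \<beta>: "0 < \<beta>" and Nq: "1 \<le> N" "1 \<le> q"
  defines "w \<equiv> \<lambda>\<sigma>. exp (- \<beta> * H \<sigma>)"
  shows "reversible_chain (configs q N) (conductance q N w) w (trans_prob q N \<beta> H)"
proof -
  have w: "0 < w \<sigma>" for \<sigma> by (simp add: w_def)
  have "conductance q N w \<sigma> \<eta> = w \<sigma> * trans_prob q N \<beta> H \<sigma> \<eta>" if "\<sigma> \<noteq> \<eta>" for \<sigma> \<eta>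
  proof -
    have "min (w \<sigma>) (w \<eta>) = w \<sigma> * exp (- \<beta> * max 0 (H \<eta> - H \<sigma>))"
    proof (cases "H \<sigma> \<le> H \<eta>")
      case True
      then have "w \<eta> \<le> w \<sigma>" using \<beta> by (simp add: w_def)
      then show ?thesis using True by (simp add: w_def exp_add[symmetric] algebra_simps)
    next
      case False
      then have "w \<sigma> \<le> w \<eta>" using \<beta> by (simp add: w_def)
      then show ?thesis using False by (simp add: w_def)
    qed
    then show ?thesis
      using that by (auto simp: conductance_def trans_prob_def flip_prob_def differ_once_def)
  qed
  then show ?thesis
    using network_conductance[of q N w] connected_conductance[of q N w] w Nq
      prob_vector_trans_prob[OF \<beta>]
    by (auto simp: reversible_chain_def reversible_chain_axioms_def)
qed

lemma glauber_mean_hitting_time: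
  fixes H :: "config \<Rightarrow> real"
  assumes \<beta>: "0 < \<beta>" and Nq: "1 \<le> N" "1 \<le> q"
    and AB: "A \<subseteq> configs q N" "B \<subseteq> configs q N" "A \<inter> B = {}" "A \<noteq> {}" "B \<noteq> {}"
  defines "w \<equiv> \<lambda>\<sigma>. exp (- \<beta> * H \<sigma>)"
  obtains h where "equilibrium (configs q N) (conductance q N w) A B h"
    "0 < energy (configs q N) (conductance q N w) h h"
    "mean_hitting_time q N \<beta> H (last_exit_distr q N \<beta> H A B) B =
      ennreal ((\<Sum>\<sigma>\<in>configs q N. w \<sigma> * h \<sigma>) / energy (configs q N) (conductance q N w) h h)"
proof -
  interpret reversible_chain "configs q N" "conductance q N w" w "trans_prob q N \<beta> H"
    unfolding w_def by (rule reversible_chain_glauber[OF \<beta> Nq])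
  have "(\<lambda>_\<in>{1..N}. 1) \<in> configs q N" using Nq by (auto simp: configs_def)
  then have z: "0 < (\<Sum>\<eta>\<in>configs q N. w \<eta>)"
    using finite_configs by (intro sum_pos) (auto simp: w_def)
  show thesis
  proof (rule mean_hitting_time_last_exit[OF AB])
    fix h
    assume h: "equilibrium (configs q N) (conductance q N w) A B h"
      "0 < energy (configs q N) (conductance q N w) h h"
    assume *: "\<And>g z. 0 < z \<Longrightarrow> (\<And>\<sigma>. \<sigma> \<in> A \<Longrightarrow> g \<sigma> = w \<sigma> / z) \<Longrightarrow>
      (\<integral>\<^sup>+X. ennreal_of_enat (hitting_time B X) \<partial>markov_law (configs q N)
        (\<lambda>\<sigma>. if \<sigma> \<in> A then g \<sigma> * (let P = markov_law (configs q N) (\<lambda>\<eta>. of_bool (\<eta> = \<sigma>)) (trans_prob q N \<beta> H) in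
      measure P {X \<in> space P. hitting_time B X < hitting_time A X}) / (\<Sum>\<sigma>'\<in>A. g \<sigma>' *
      (let P = markov_law (configs q N) (\<lambda>\<eta>. of_bool (\<eta> = \<sigma>')) (trans_prob q N \<beta> H) in
      measure P {X \<in> space P. hitting_time B X < hitting_time A X})) else 0) (trans_prob q N \<beta> H))
      = ennreal ((\<Sum>\<sigma>\<in>configs q N. w \<sigma> * h \<sigma>) / energy (configs q N) (conductance q N w) h h)"
    show thesis
    proof (rule that[OF h])
      show "mean_hitting_time q N \<beta> H (last_exit_distr q N \<beta> H A B) B =
        ennreal ((\<Sum>\<sigma>\<in>configs q N. w \<sigma> * h \<sigma>) / energy (configs q N) (conductance q N w) h h)"
        using *[OF z, of "gibbs q N \<beta> H"]
        unfolding mean_hitting_time_def glauber_law_def last_exit_distr_def hit_before_def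
        by (simp add: gibbs_def w_def)
    qed
  qed
qed

section \<open>Levels: configurations with prescribed occupation numbers\<close>

definition cnt :: "nat \<Rightarrow> config \<Rightarrow> nat \<Rightarrow> nat" where
  "cnt N \<sigma> k = card {i \<in> {1..N}. \<sigma> i = k}"

text \<open>The points of \<open>lattice_simplex\<close> multiplied by N, so that paths and counting
  stay in the natural numbers; \<open>lattice_simplex_eq\<close> translates.\<close>

definition comps :: "nat \<Rightarrow> nat \<Rightarrow> (nat \<Rightarrow> nat) set" where
  "comps q N = {n \<in> {1..q} \<rightarrow>\<^sub>E UNIV. (\<Sum>k\<in>{1..q}. n k) = N}"

definition lev :: "nat \<Rightarrow> nat \<Rightarrow> (nat \<Rightarrow> nat) \<Rightarrow> config set" where
  "lev q N n = {\<sigma> \<in> configs q N. \<forall>k\<in>{1..q}. cnt N \<sigma> k = n k}"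

definition move :: "nat \<Rightarrow> nat \<Rightarrow> (nat \<Rightarrow> nat) \<Rightarrow> (nat \<Rightarrow> nat)" where
  "move i j n = n(i := n i - 1, j := n j + 1)"

lemma comps_le: "n \<in> comps q N \<Longrightarrow> k \<in> {1..q} \<Longrightarrow> n k \<le> N"
  unfolding comps_def using member_le_sum[of k "{1..q}" n] by auto

lemma comps_subset: "comps q N \<subseteq> {1..q} \<rightarrow>\<^sub>E {..N}"
proof
  fix n assume "n \<in> comps q N"
  moreover from this have "n \<in> {1..q} \<rightarrow>\<^sub>E UNIV" by (simp add: comps_def)
  ultimately show "n \<in> {1..q} \<rightarrow>\<^sub>E {..N}" using comps_le[of n q N] unfolding PiE_iff by blast
qed

lemma finite_comps: "finite (comps q N)"
  by (rule finite_subset[OF comps_subset]) (simp add: finite_PiE)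

lemma card_comps_le: "card (comps q N) \<le> (N + 1) ^ q"
proof -
  have "card (comps q N) \<le> card ({1..q} \<rightarrow>\<^sub>E {..N})"
    by (intro card_mono comps_subset) (simp add: finite_PiE)
  then show ?thesis by (simp add: card_PiE)
qed

lemma sum_cnt: "\<sigma> \<in> configs q N \<Longrightarrow> (\<Sum>k\<in>{1..q}. cnt N \<sigma> k) = N"
proof -
  assume \<sigma>: "\<sigma> \<in> configs q N"
  have "(\<Sum>k\<in>{1..q}. cnt N \<sigma> k) = card (\<Union>k\<in>{1..q}. {i \<in> {1..N}. \<sigma> i = k})"
    unfolding cnt_def by (subst card_UN_disjoint) auto
  also have "(\<Union>k\<in>{1..q}. {i \<in> {1..N}. \<sigma> i = k}) = {1..N}"
    using \<sigma> by (auto simp: configs_def PiE_iff)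
  finally show ?thesis by simp
qed

lemma lev_subset: "lev q N n \<subseteq> configs q N"
  by (auto simp: lev_def)

lemma finite_lev: "finite (lev q N n)"
  by (rule finite_subset[OF lev_subset finite_configs])

lemma lev_disjoint:
  assumes "n \<in> comps q N" "n' \<in> comps q N" "n \<noteq> n'"
  shows "lev q N n \<inter> lev q N n' = {}"
proof (rule ccontr)
  assume "lev q N n \<inter> lev q N n' \<noteq> {}"
  then have "\<forall>k\<in>{1..q}. n k = n' k" by (auto simp: lev_def)
  then have "n = n'" using assms by (intro PiE_ext[of n "{1..q}" "\<lambda>_. UNIV" n']) (auto simp: comps_def)
  with assms show False by simp
qed

lemma configs_eq_UN_lev: "configs q N = (\<Union>n\<in>comps q N. lev q N n)"
proof (intro set_eqI iffI)
  fix \<sigma> assume \<sigma>: "\<sigma> \<in> configs q N"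
  have "restrict (cnt N \<sigma>) {1..q} \<in> comps q N" using sum_cnt[OF \<sigma>] by (auto simp: comps_def)
  moreover have "\<sigma> \<in> lev q N (restrict (cnt N \<sigma>) {1..q})" using \<sigma> by (auto simp: lev_def)
  ultimately show "\<sigma> \<in> (\<Union>n\<in>comps q N. lev q N n)" by blast
qed (auto simp: lev_def)

lemma move_in_comps:
  assumes "n \<in> comps q N" "i \<in> {1..q}" "j \<in> {1..q}" "i \<noteq> j" "0 < n i"
  shows "move i j n \<in> comps q N"
proof -
  have s: "sum g {1..q} = g i + g j + sum g ({1..q} - {i} - {j})" for g :: "nat \<Rightarrow> nat"
    using assms sum.remove[of "{1..q}" i g] sum.remove[of "{1..q} - {i}" j g] by simp
  have "sum (move i j n) ({1..q} - {i} - {j}) = sum n ({1..q} - {i} - {j})"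
    by (intro sum.cong) (auto simp: move_def)
  then have "sum (move i j n) {1..q} = sum n {1..q}"
    unfolding s using assms by (simp add: move_def)
  then show ?thesis using assms by (auto simp: comps_def move_def PiE_iff extensional_def)
qed

lemma cnt_flip:
  assumes "s \<in> {1..N}" "\<sigma> s = i" "i \<noteq> j"
  shows "cnt N (\<sigma>(s := j)) k = move i j (cnt N \<sigma>) k"
proof -
  consider "k = i" | "k = j" | "k \<noteq> i" "k \<noteq> j" by blast
  then show ?thesis
  proof cases
    case 1
    then have "{l \<in> {1..N}. (\<sigma>(s := j)) l = k} = {l \<in> {1..N}. \<sigma> l = k} - {s}" using assms by auto
    then show ?thesis using 1 assms by (simp add: cnt_def move_def)
  next
    case 2
    then have "{l \<in> {1..N}. (\<sigma>(s := j)) l = k} = insert s {l \<in> {1..N}. \<sigma> l = k}" using assms by auto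
    then show ?thesis using 2 assms by (simp add: cnt_def move_def)
  next
    case 3
    then have "{l \<in> {1..N}. (\<sigma>(s := j)) l = k} = {l \<in> {1..N}. \<sigma> l = k}" using assms by auto
    then show ?thesis using 3 by (simp add: cnt_def move_def)
  qed
qed

section \<open>A Poincare inequality across levels\<close>

definition lev_edges :: "nat \<Rightarrow> nat \<Rightarrow> (nat \<Rightarrow> nat) \<Rightarrow> nat \<Rightarrow> (config \<times> nat) set" where
  "lev_edges q N n i = {(\<sigma>, s). \<sigma> \<in> lev q N n \<and> s \<in> {1..N} \<and> \<sigma> s = i}"

lemma lev_edges_Sigma: "lev_edges q N n i = (SIGMA \<sigma>:lev q N n. {s \<in> {1..N}. \<sigma> s = i})"
  by (auto simp: lev_edges_def)

lemma sum_lev_edges: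
  assumes "i \<in> {1..q}"
  shows "(\<Sum>(\<sigma>, s)\<in>lev_edges q N n i. g \<sigma>) = real (n i) * (\<Sum>\<sigma>\<in>lev q N n. g \<sigma>)"
proof -
  have "(\<Sum>(\<sigma>, s)\<in>lev_edges q N n i. g \<sigma>) = (\<Sum>\<sigma>\<in>lev q N n. \<Sum>s\<in>{s \<in> {1..N}. \<sigma> s = i}. g \<sigma>)"
    unfolding lev_edges_Sigma by (subst sum.Sigma) (auto intro: finite_lev)
  also have "\<dots> = (\<Sum>\<sigma>\<in>lev q N n. real (cnt N \<sigma> i) * g \<sigma>)" by (simp add: cnt_def)
  also have "\<dots> = (\<Sum>\<sigma>\<in>lev q N n. real (n i) * g \<sigma>)"
    using assms by (intro sum.cong) (auto simp: lev_def)
  finally show ?thesis by (simp add: sum_distrib_left)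
qed

text \<open>A pair of a configuration and a site of colour i stands for the edge that recolours this
  site to j; recolouring back is the inverse. Positivity of \<open>n i\<close> keeps the truncated
  subtraction in \<open>move\<close> faithful.\<close>

lemma lev_edges_flip_bij:
  assumes ij: "i \<in> {1..q}" "j \<in> {1..q}" "i \<noteq> j" and pos: "0 < n i"
  shows "bij_betw (\<lambda>(\<sigma>, s). (\<sigma>(s := j), s)) (lev_edges q N n i) (lev_edges q N (move i j n) j)"
proof (rule bij_betwI[where g="\<lambda>(\<sigma>, s). (\<sigma>(s := i), s)"])
  have upd: "\<sigma>(s := k) \<in> configs q N" if "\<sigma> \<in> configs q N" "s \<in> {1..N}" "k \<in> {1..q}" for \<sigma> s k
    using that by (auto simp: configs_def PiE_iff extensional_def)
  show "(\<lambda>(\<sigma>, s). (\<sigma>(s := j), s)) \<in> lev_edges q N n i \<rightarrow> lev_edges q N (move i j n) j"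
  proof (safe, goal_cases)
    case (1 \<sigma> s)
    then have "\<sigma> \<in> configs q N" "\<forall>k\<in>{1..q}. cnt N \<sigma> k = n k" "s \<in> {1..N}" "\<sigma> s = i"
      by (auto simp: lev_edges_def lev_def)
    moreover from this have "cnt N (\<sigma>(s := j)) k = move i j n k" if "k \<in> {1..q}" for k
      using that ij by (subst cnt_flip[of s N \<sigma> i]) (auto simp: move_def)
    ultimately show ?case using upd ij by (auto simp: lev_edges_def lev_def)
  qed
  show "(\<lambda>(\<sigma>, s). (\<sigma>(s := i), s)) \<in> lev_edges q N (move i j n) j \<rightarrow> lev_edges q N n i"
  proof (safe, goal_cases)
    case (1 \<sigma> s)
    then have *: "\<sigma> \<in> configs q N" "\<forall>k\<in>{1..q}. cnt N \<sigma> k = move i j n k" "s \<in> {1..N}" "\<sigma> s = j"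
      by (auto simp: lev_edges_def lev_def)
    then have "cnt N (\<sigma>(s := i)) k = n k" if "k \<in> {1..q}" for k
      using that ij pos by (subst cnt_flip[of s N \<sigma> j]) (auto simp: move_def)
    with * show ?case using upd ij by (auto simp: lev_edges_def lev_def)
  qed
qed (auto simp: lev_edges_def)

text \<open>A quadratic mean rather than a mean of squares: being a norm, it obeys the triangle
  inequality, so that differences between neighbouring levels add up along a path.\<close>

definition lev_avg :: "nat \<Rightarrow> nat \<Rightarrow> (config \<Rightarrow> real) \<Rightarrow> (nat \<Rightarrow> nat) \<Rightarrow> real" where
  "lev_avg q N f n = sqrt ((\<Sum>\<sigma>\<in>lev q N n. (f \<sigma>)\<^sup>2) / real (card (lev q N n)))"

text \<open>
  The edges between two adjacent levels form a biregular bipartite graph, so a uniformly chosen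
  edge has uniformly distributed endpoints; this makes Minkowski's inequality applicable.
\<close>

lemma lev_avg_move_le:
  assumes ij: "i \<in> {1..q}" "j \<in> {1..q}" "i \<noteq> j" and n: "0 < n i" and N: "1 \<le> N"
    and w: "\<And>\<sigma>. \<sigma> \<in> configs q N \<Longrightarrow> 0 < w \<sigma>"
    and \<omega>: "\<And>\<sigma>. \<sigma> \<in> lev q N n \<Longrightarrow> w \<sigma> = \<omega>" "\<And>\<sigma>. \<sigma> \<in> lev q N (move i j n) \<Longrightarrow> w \<sigma> = \<omega>'"
    and \<theta>: "0 < \<theta>" "\<theta> \<le> sum w (lev q N n)" "\<theta> \<le> sum w (lev q N (move i j n))"
  shows "\<bar>lev_avg q N f n - lev_avg q N f (move i j n)\<bar>
    \<le> sqrt (2 * real N * real q * energy (configs q N) (conductance q N w) f f / \<theta>)"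
proof -
  let ?n' = "move i j n" and ?E = "lev_edges q N n i" and ?E' = "lev_edges q N (move i j n) j"
  let ?c = "conductance q N w"
  have q: "1 \<le> q" using ij by auto
  have n': "?n' j = n j + 1" using ij by (simp add: move_def)
  have flip: "(\<Sum>(\<sigma>, s)\<in>?E'. g \<sigma> s) = (\<Sum>(\<sigma>, s)\<in>?E. g (\<sigma>(s := j)) s)" for g :: "config \<Rightarrow> nat \<Rightarrow> real"
    using sum.reindex_bij_betw[OF lev_edges_flip_bij[where n=n and N=N, OF ij n], of "\<lambda>(\<sigma>, s). g \<sigma> s"]
    by (simp add: case_prod_unfold)
  have c1: "real (card ?E) = real (n i) * real (card (lev q N n))"
    using sum_lev_edges[OF ij(1), of "\<lambda>_. 1" N n] by (simp add: case_prod_unfold)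
  have c2: "real (card ?E) = real (n j + 1) * real (card (lev q N ?n'))"
    using sum_lev_edges[OF ij(2), of "\<lambda>_. 1" N ?n'] flip[of "\<lambda>_ _. 1"] by (simp add: case_prod_unfold n')
  have ne: "lev q N n \<noteq> {}" "lev q N ?n' \<noteq> {}" using \<theta> by auto
  then have cp: "0 < card (lev q N n)" "0 < card (lev q N ?n')" by (auto simp: card_gt_0_iff finite_lev)
  then have Epos: "0 < real (card ?E)" using c1 n by simp
  let ?F = "\<lambda>(\<sigma>, s). f \<sigma>" and ?G = "\<lambda>(\<sigma>, s). f (\<sigma>(s := j))"
  let ?D = "\<lambda>(\<sigma>, s). f \<sigma> - f (\<sigma>(s := j))"
  have a1: "lev_avg q N f n = L2_set ?F ?E / sqrt (card ?E)"
  proof -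
    have "L2_set ?F ?E = sqrt (real (n i) * (\<Sum>\<sigma>\<in>lev q N n. (f \<sigma>)\<^sup>2))"
      using sum_lev_edges[OF ij(1), of "\<lambda>\<sigma>. (f \<sigma>)\<^sup>2" N n] by (simp add: L2_set_def case_prod_unfold)
    then show ?thesis using n cp unfolding c1 lev_avg_def
      by (simp add: real_sqrt_mult real_sqrt_divide)
  qed
  have a2: "lev_avg q N f ?n' = L2_set ?G ?E / sqrt (card ?E)"
  proof -
    have "L2_set ?G ?E = sqrt (real (n j + 1) * (\<Sum>\<sigma>\<in>lev q N ?n'. (f \<sigma>)\<^sup>2))"
      using sum_lev_edges[OF ij(2), of "\<lambda>\<sigma>. (f \<sigma>)\<^sup>2" N ?n'] flip[of "\<lambda>\<sigma> s. (f \<sigma>)\<^sup>2"]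
      by (simp add: L2_set_def case_prod_unfold n')
    then show ?thesis using cp unfolding c2 lev_avg_def
      by (simp add: real_sqrt_mult real_sqrt_divide)
  qed
  have t1: "L2_set ?F ?E \<le> L2_set ?G ?E + L2_set ?D ?E"
  proof -
    have "?F = (\<lambda>x. ?G x + ?D x)" by auto
    then show ?thesis using L2_set_triangle_ineq[of ?G ?D ?E] by simp
  qed
  have t2: "L2_set ?G ?E \<le> L2_set ?F ?E + L2_set ?D ?E"
  proof -
    have "?G = (\<lambda>x. ?F x + (- ?D x))" by auto
    moreover have "L2_set (\<lambda>x. - ?D x) ?E = L2_set ?D ?E" by (simp add: L2_set_def)
    ultimately show ?thesis using L2_set_triangle_ineq[of ?F "\<lambda>x. - ?D x" ?E] by simp
  qed
  have "\<bar>lev_avg q N f n - lev_avg q N f ?n'\<bar> \<le> L2_set ?D ?E / sqrt (card ?E)"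
    using t1 t2 Epos unfolding a1 a2 by (simp add: diff_divide_distrib[symmetric] divide_right_mono abs_le_iff)
  also have "\<dots> = sqrt ((\<Sum>(\<sigma>, s)\<in>?E. (f \<sigma> - f (\<sigma>(s := j)))\<^sup>2) / card ?E)"
    by (simp add: L2_set_def real_sqrt_divide case_prod_unfold)
  also have "\<dots> \<le> sqrt (2 * real N * real q * energy (configs q N) ?c f f / \<theta>)"
  proof (rule real_sqrt_le_mono)
    define \<mu> where "\<mu> = min \<omega> \<omega>'"
    obtain \<sigma>1 \<sigma>2 where s12: "\<sigma>1 \<in> lev q N n" "\<sigma>2 \<in> lev q N ?n'" using ne by auto
    then have "0 < \<mu>" using w[of \<sigma>1] w[of \<sigma>2] \<omega>(1)[of \<sigma>1] \<omega>(2)[of \<sigma>2] lev_subset by (auto simp: \<mu>_def)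
    \<comment> \<open>Every configuration of either level is an endpoint of at least one of these
      edges, so their number dominates both level sizes.\<close>
    have "\<theta> \<le> card ?E * \<mu>"
    proof -
      have "sum w (lev q N n) = real (card (lev q N n)) * \<omega>" using \<omega> by simp
      moreover have "sum w (lev q N ?n') = real (card (lev q N ?n')) * \<omega>'" using \<omega> by simp
      moreover have "real (card (lev q N n)) \<le> card ?E"
        using n unfolding c1 by (simp add: mult_le_cancel_right1)
      moreover have "real (card (lev q N ?n')) \<le> card ?E"
        unfolding c2 by (simp add: mult_le_cancel_right1)
      moreover have "0 < \<omega>" "0 < \<omega>'" using s12 w \<omega> lev_subset by (metis subsetD)+
      ultimately have "\<theta> \<le> card ?E * \<omega>" "\<theta> \<le> card ?E * \<omega>'"
        using \<theta> by (smt (verit) mult_right_mono)+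
      then show ?thesis by (auto simp: \<mu>_def min_def)
    qed
    \<comment> \<open>The weight is constant on each level, so all edges between the two levels have
      the same conductance \<mu> / (N q).\<close>
    have "(\<Sum>(\<sigma>, s)\<in>?E. (f \<sigma> - f (\<sigma>(s := j)))\<^sup>2) * (\<mu> / (real N * real q))
      = (\<Sum>(\<sigma>, s)\<in>?E. ?c \<sigma> (\<sigma>(s := j)) * (f \<sigma> - f (\<sigma>(s := j)))\<^sup>2)"
      unfolding sum_distrib_right
    proof (intro sum.cong refl, safe, goal_cases)
      case (1 \<sigma> s)
      then have "(\<sigma>(s := j), s) \<in> ?E'" using bij_betwE[OF lev_edges_flip_bij[where n=n and N=N, OF ij n]] by fastforce
      then have "w (\<sigma>(s := j)) = \<omega>'" using \<omega> by (auto simp: lev_edges_def)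
      moreover have "w \<sigma> = \<omega>" using 1 \<omega> by (auto simp: lev_edges_def)
      moreover have "{l \<in> {1..N}. \<sigma> l \<noteq> (\<sigma>(s := j)) l} = {s}" using 1 ij by (auto simp: lev_edges_def)
      then have "differ_once N \<sigma> (\<sigma>(s := j))" by (simp add: differ_once_def)
      ultimately show ?case by (simp add: conductance_def \<mu>_def)
    qed
    also have "\<dots> = (\<Sum>(\<sigma>, \<eta>)\<in>(\<lambda>(\<sigma>, s). (\<sigma>, \<sigma>(s := j))) ` ?E. ?c \<sigma> \<eta> * (f \<sigma> - f \<eta>)\<^sup>2)"
    proof (subst sum.reindex)
      show "inj_on (\<lambda>(\<sigma>, s). (\<sigma>, \<sigma>(s := j))) ?E"
      proof (rule inj_onI)
        fix x y assume xy: "x \<in> ?E" "y \<in> ?E"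
          "(case x of (\<sigma>, s) \<Rightarrow> (\<sigma>, \<sigma>(s := j))) = (case y of (\<sigma>, s) \<Rightarrow> (\<sigma>, \<sigma>(s := j)))"
        obtain \<sigma> s \<sigma>' s' where x: "x = (\<sigma>, s)" and y: "y = (\<sigma>', s')" by (metis surj_pair)
        with xy have eq: "\<sigma>' = \<sigma>" "\<sigma>(s := j) = \<sigma>(s' := j)" by auto
        have "s = s'"
        proof (rule ccontr)
          assume "s \<noteq> s'"
          moreover have "\<sigma> s = i" using xy(1) x by (simp add: lev_edges_def)
          ultimately show False using fun_cong[OF eq(2), of s] ij by auto
        qed
        then show "x = y" using x y eq by simp
      qed
    qed (simp add: case_prod_unfold)
    also have "\<dots> \<le> (\<Sum>(\<sigma>, \<eta>)\<in>configs q N \<times> configs q N. ?c \<sigma> \<eta> * (f \<sigma> - f \<eta>)\<^sup>2)"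
    proof (rule sum_mono2)
      show "(\<lambda>(\<sigma>, s). (\<sigma>, \<sigma>(s := j))) ` ?E \<subseteq> configs q N \<times> configs q N"
        using bij_betwE[OF lev_edges_flip_bij[where n=n and N=N, OF ij n]] lev_subset
        by (auto simp: lev_edges_def) blast+
      have "0 \<le> ?c \<sigma> \<eta>" if "\<sigma> \<in> configs q N" "\<eta> \<in> configs q N" for \<sigma> \<eta>
        using w[OF that(1)] w[OF that(2)] by (simp add: conductance_def)
      then show "\<And>b. b \<in> configs q N \<times> configs q N - (\<lambda>(\<sigma>, s). (\<sigma>, \<sigma>(s := j))) ` ?E \<Longrightarrow>
         0 \<le> (case b of (\<sigma>, \<eta>) \<Rightarrow> ?c \<sigma> \<eta> * (f \<sigma> - f \<eta>)\<^sup>2)" by auto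
    qed (simp add: finite_configs)
    also have "\<dots> = 2 * energy (configs q N) ?c f f"
      by (simp add: energy_def sum.cartesian_product power2_eq_square mult.assoc)
    finally have le: "(\<Sum>(\<sigma>, s)\<in>?E. (f \<sigma> - f (\<sigma>(s := j)))\<^sup>2) * (\<mu> / (real N * real q))
        \<le> 2 * energy (configs q N) ?c f f" .
    let ?Q = "\<Sum>(\<sigma>, s)\<in>?E. (f \<sigma> - f (\<sigma>(s := j)))\<^sup>2"
    have "?Q * \<theta> \<le> ?Q * (card ?E * \<mu>)"
      using \<open>\<theta> \<le> card ?E * \<mu>\<close> by (intro mult_left_mono sum_nonneg) auto
    also have "\<dots> = card ?E * (?Q * (\<mu> / (real N * real q))) * (real N * real q)"
      using N q by simp
    also have "\<dots> \<le> card ?E * (2 * energy (configs q N) ?c f f) * (real N * real q)"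
      using le by (intro mult_right_mono mult_left_mono) auto
    finally show "?Q / card ?E \<le> 2 * real N * real q * energy (configs q N) ?c f f / \<theta>"
      using Epos \<theta>(1) by (simp add: field_simps)
  qed
  finally show ?thesis .
qed

text \<open>The threshold \<theta> bounds the bottleneck: every level met along a path of such steps
  has total weight at least \<theta>.\<close>

definition lev_step :: "nat \<Rightarrow> nat \<Rightarrow> (config \<Rightarrow> real) \<Rightarrow> real \<Rightarrow> ((nat \<Rightarrow> nat) \<times> (nat \<Rightarrow> nat)) set" where
  "lev_step q N w \<theta> = {(n, n'). n \<in> comps q N \<and> n' \<in> comps q N \<and>
     \<theta> \<le> sum w (lev q N n) \<and> \<theta> \<le> sum w (lev q N n') \<and>
     (\<exists>i\<in>{1..q}. \<exists>j\<in>{1..q}. i \<noteq> j \<and> 0 < n i \<and> n' = move i j n)}"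

text \<open>The quadratic mean of \<open>f\<close> changes by at most \<kappa> in each step and is 0
  at the end of the path. The number of steps is at most (N + 1)^(2 q), a bound on the number of
  pairs of levels; squaring it gives the exponent 4 q.\<close>

lemma sum_lev_square_le:
  assumes N: "1 \<le> N" and w: "\<And>\<sigma>. \<sigma> \<in> configs q N \<Longrightarrow> 0 < w \<sigma>"
    and lc: "\<And>n \<sigma> \<eta>. \<sigma> \<in> lev q N n \<Longrightarrow> \<eta> \<in> lev q N n \<Longrightarrow> w \<sigma> = w \<eta>"
    and \<theta>: "0 < \<theta>" and reach: "(n, n') \<in> (lev_step q N w \<theta>)\<^sup>*"
    and f: "\<And>\<sigma>. \<sigma> \<in> lev q N n' \<Longrightarrow> f \<sigma> = 0"
  shows "(\<Sum>\<sigma>\<in>lev q N n. w \<sigma> * (f \<sigma>)\<^sup>2) \<le>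
    sum w (lev q N n) / \<theta> * (2 * real N * real q * real (N + 1) ^ (4 * q))
    * energy (configs q N) (conductance q N w) f f"
proof -
  let ?R = "lev_step q N w \<theta>" and ?e = "energy (configs q N) (conductance q N w) f f"
  define \<kappa> where "\<kappa> = sqrt (2 * real N * real q * ?e / \<theta>)"
  interpret network "configs q N" "conductance q N w" using w by (rule network_conductance)
  have e0: "0 \<le> ?e" by (rule energy_nonneg)
  have sub: "?R \<subseteq> comps q N \<times> comps q N" by (auto simp: lev_step_def)
  have finR: "finite ?R" by (rule finite_subset[OF sub]) (simp add: finite_comps)
  have "card ?R \<le> card (comps q N \<times> comps q N)"
    by (intro card_mono sub) (simp add: finite_comps)
  also have "\<dots> \<le> (N + 1) ^ q * (N + 1) ^ q"
    unfolding card_cartesian_product by (intro mult_le_mono card_comps_le)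
  finally have cR: "card ?R \<le> (N + 1) ^ (2 * q)" by (simp add: power_add[symmetric] mult_2)
  have 1: "lev_avg q N f x \<le> lev_avg q N f y + \<kappa>" if "(x, y) \<in> ?R" for x y
  proof -
    from that obtain i j where ij: "i \<in> {1..q}" "j \<in> {1..q}" "i \<noteq> j" "0 < x i" "y = move i j x"
      and t: "\<theta> \<le> sum w (lev q N x)" "\<theta> \<le> sum w (lev q N y)" by (auto simp: lev_step_def)
    from t \<theta> have "lev q N x \<noteq> {}" "lev q N y \<noteq> {}" by auto
    then obtain \<sigma>1 \<sigma>2 where "\<sigma>1 \<in> lev q N x" "\<sigma>2 \<in> lev q N y" by auto
    then have "\<sigma> \<in> lev q N x \<Longrightarrow> w \<sigma> = w \<sigma>1" "\<sigma> \<in> lev q N (move i j x) \<Longrightarrow> w \<sigma> = w \<sigma>2" for \<sigma>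
      using lc ij(5) by blast+
    then have "\<bar>lev_avg q N f x - lev_avg q N f (move i j x)\<bar> \<le> \<kappa>"
      unfolding \<kappa>_def using N t ij(1-4) unfolding ij(5)
      by (rule_tac lev_avg_move_le[where \<omega>="w \<sigma>1" and \<omega>'="w \<sigma>2"]) (simp_all add: N w \<theta>)
    then show ?thesis using ij by auto
  qed
  have 2: "lev_avg q N f x \<le> lev_avg q N f y + real m * \<kappa>" if "(x, y) \<in> ?R ^^ m" for x y m
    using that
  proof (induction m arbitrary: y)
    case (Suc m)
    then obtain z where "(x, z) \<in> ?R ^^ m" "(z, y) \<in> ?R" by auto
    with Suc.IH[of z] 1[of z y] show ?case by (simp add: algebra_simps)
  qed auto
  \<comment> \<open>Reachability in a finite relation needs at most as many steps as the relation
    has pairs.\<close>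
  from reach obtain m where m: "m \<le> card ?R" "(n, n') \<in> ?R ^^ m"
    using rtrancl_finite_eq_relpow[OF finR] by auto
  have "lev_avg q N f n' = 0" using f by (simp add: lev_avg_def)
  with 2[OF m(2)] have "lev_avg q N f n \<le> real m * \<kappa>" by simp
  also have "\<dots> \<le> real (N + 1) ^ (2 * q) * \<kappa>"
  proof (rule mult_right_mono)
    have "real m \<le> real ((N + 1) ^ (2 * q))" using m(1) cR by (intro of_nat_mono) linarith
    then show "real m \<le> real (N + 1) ^ (2 * q)" by simp
    show "0 \<le> \<kappa>" using e0 \<theta> by (simp add: \<kappa>_def)
  qed
  finally have le: "lev_avg q N f n \<le> real (N + 1) ^ (2 * q) * \<kappa>" .
  have a0: "0 \<le> lev_avg q N f n" by (simp add: lev_avg_def sum_nonneg)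
  have W: "(\<Sum>\<sigma>\<in>lev q N n. w \<sigma> * (f \<sigma>)\<^sup>2) = sum w (lev q N n) * (lev_avg q N f n)\<^sup>2"
  proof (cases "lev q N n = {}")
    case False
    then obtain \<sigma>1 where "\<sigma>1 \<in> lev q N n" by auto
    then have *: "w \<sigma> = w \<sigma>1" if "\<sigma> \<in> lev q N n" for \<sigma> using lc that by blast
    have "card (lev q N n) \<noteq> 0" using False finite_lev by simp
    moreover have "(\<Sum>\<sigma>\<in>lev q N n. w \<sigma> * (f \<sigma>)\<^sup>2) = w \<sigma>1 * (\<Sum>\<sigma>\<in>lev q N n. (f \<sigma>)\<^sup>2)"
      unfolding sum_distrib_left by (intro sum.cong) (use * in auto)
    moreover have "sum w (lev q N n) = card (lev q N n) * w \<sigma>1" using * by simp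
    ultimately show ?thesis by (simp add: lev_avg_def sum_nonneg)
  qed (simp add: lev_avg_def)
  have "(lev_avg q N f n)\<^sup>2 \<le> (real (N + 1) ^ (2 * q) * \<kappa>)\<^sup>2" using le a0 by (intro power_mono)
  also have "\<dots> = real (N + 1) ^ (4 * q) * (2 * real N * real q * ?e / \<theta>)"
    using e0 \<theta> by (simp add: \<kappa>_def power_mult_distrib power_mult[symmetric] mult.commute)
  finally have "sum w (lev q N n) * (lev_avg q N f n)\<^sup>2
     \<le> sum w (lev q N n) * (real (N + 1) ^ (4 * q) * (2 * real N * real q * ?e / \<theta>))"
    using w lev_subset by (intro mult_left_mono sum_nonneg less_imp_le[OF w]) blast+
  then show ?thesis unfolding W by (simp add: mult_ac)
qed

section \<open>Critical points of the free energy\<close>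

text \<open>The share of one coordinate in the free energy, which is a sum over coordinates. Its
  second derivative 1 / (\<beta> u) - 1 changes sign at u = 1 / \<beta>, the threshold on which the
  classification of minimizers rests.\<close>

definition site_energy :: "real \<Rightarrow> real \<Rightarrow> real" where
  "site_energy \<beta> u = u * ln u / \<beta> - u\<^sup>2 / 2"

lemma free_energy_eq: "free_energy \<beta> q x = (\<Sum>k\<in>{1..q}. site_energy \<beta> (x k))"
  unfolding free_energy_def site_energy_def L2_set_def
  by (simp add: sum_nonneg sum_subtractf sum_divide_distrib)

lemma site_energy_continuous: "continuous_on {0..} (site_energy \<beta>)"
proof -
  \<comment> \<open>Continuity at 0: with y = 1 / u the function u * ln u is - ln y / y, which tends
    to 0.\<close>
  have "((\<lambda>u::real. - (ln (inverse u) / inverse u)) \<longlongrightarrow> - 0) (at_right 0)"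
    by (intro tendsto_minus filterlim_compose[OF ln_x_over_x_tendsto_0 filterlim_inverse_at_top_right])
  moreover have "eventually (\<lambda>u::real. - (ln (inverse u) / inverse u) = u * ln u) (at_right 0)"
    using eventually_at_right_less[of "0::real"] by eventually_elim (simp add: ln_inverse divide_inverse mult.commute)
  ultimately have "((\<lambda>u. u * ln u) \<longlongrightarrow> 0) (at_right (0::real))"
    by (auto elim: Lim_transform_eventually)
  then have 0: "continuous (at 0 within {0..}) (\<lambda>u::real. u * ln u)"
    unfolding continuous_within at_within_Ici_at_right by simp
  have "continuous (at u within {0..}) (\<lambda>u::real. u * ln u)" if "u \<in> {0..}" for u
  proof (cases "u = 0")
    case False
    with that have "isCont (\<lambda>u::real. u * ln u) u" by (intro continuous_intros) auto
    then show ?thesis by (rule continuous_at_imp_continuous_within)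
  qed (use 0 in simp)
  then have "continuous_on {0..} (\<lambda>u::real. u * ln u)"
    by (simp add: continuous_on_eq_continuous_within)
  from continuous_on_mult_right[OF this, of "inverse \<beta>"]
  have "continuous_on {0..} (\<lambda>u. u * ln u / \<beta>)" by (simp only: divide_inverse)
  moreover have "continuous_on {0..} (\<lambda>u::real. u\<^sup>2 / 2)" by (intro continuous_intros) auto
  ultimately show ?thesis unfolding site_energy_def[abs_def] by (rule continuous_on_diff)
qed

lemma site_energy_deriv:
  assumes "0 < u"
  shows "(site_energy \<beta> has_real_derivative ((ln u + 1) / \<beta> - u)) (at u)"
proof -
  have "((\<lambda>u. u * ln u) has_real_derivative (ln u + 1)) (at u)"
    using assms by (auto intro!: derivative_eq_intros)
  then have "((\<lambda>u. u * ln u / \<beta>) has_real_derivative (ln u + 1) / \<beta>) (at u)"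
    by (rule DERIV_cdivide)
  moreover have "((\<lambda>u. u\<^sup>2 / 2) has_real_derivative u) (at u)"
    by (auto intro!: derivative_eq_intros)
  ultimately show ?thesis unfolding site_energy_def[abs_def] by (rule DERIV_diff)
qed

section \<open>Continuity and compactness on the simplex\<close>

definition near :: "nat \<Rightarrow> real \<Rightarrow> (nat \<Rightarrow> real) \<Rightarrow> (nat \<Rightarrow> real) \<Rightarrow> bool" where
  "near q r x y \<longleftrightarrow> (\<forall>k\<in>{1..q}. \<bar>x k - y k\<bar> < r)"

lemma prob_simplexD:
  assumes "x \<in> prob_simplex q"
  shows "k \<in> {1..q} \<Longrightarrow> 0 \<le> x k" "k \<in> {1..q} \<Longrightarrow> x k \<le> 1" "(\<Sum>k\<in>{1..q}. x k) = 1" "x \<in> extensional {1..q}"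
  using assms by (auto simp: prob_simplex_def PiE_iff)

lemma prob_simplexI:
  assumes "x \<in> extensional {1..q}" "\<And>k. k \<in> {1..q} \<Longrightarrow> 0 \<le> x k" "(\<Sum>k\<in>{1..q}. x k) = 1"
  shows "x \<in> prob_simplex q"
proof -
  have "x k \<le> 1" if "k \<in> {1..q}" for k
    using member_le_sum[of k "{1..q}" x] that assms by auto
  then show ?thesis using assms by (auto simp: prob_simplex_def PiE_iff)
qed

lemma prob_simplex_eqI:
  assumes "x \<in> prob_simplex q" "y \<in> prob_simplex q" "\<And>k. k \<in> {1..q} \<Longrightarrow> x k = y k"
  shows "x = y"
  by (rule extensionalityI[OF prob_simplexD(4)[OF assms(1)] prob_simplexD(4)[OF assms(2)]])
     (rule assms(3))

text \<open>Equivalence of the Euclidean and the maximum norm. The latter splits over coordinates,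
  which suits both the rounding to lattice points and the transfer of mass between two
  coordinates.\<close>

lemma local_minimizer_near:
  "local_minimizer q F x \<longleftrightarrow> x \<in> prob_simplex q \<and>
    (\<exists>\<epsilon>>0. \<forall>y\<in>prob_simplex q. near q \<epsilon> x y \<longrightarrow> F x \<le> F y)"
proof
  assume "local_minimizer q F x"
  then obtain \<epsilon> where x: "x \<in> prob_simplex q" and e: "0 < \<epsilon>"
    "\<And>y. y \<in> prob_simplex q \<Longrightarrow> L2_set (\<lambda>k. y k - x k) {1..q} < \<epsilon> \<Longrightarrow> F x \<le> F y"
    unfolding local_minimizer_def by blast
  \<comment> \<open>The divisor q + 1 is positive also for q = 0 and makes the last estimate below
    strict.\<close>
  have "F x \<le> F y" if y: "y \<in> prob_simplex q" "near q (\<epsilon> / real (q + 1)) x y" for y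
  proof (rule e(2)[OF y(1)])
    have "L2_set (\<lambda>k. y k - x k) {1..q} \<le> (\<Sum>k\<in>{1..q}. \<bar>y k - x k\<bar>)" by (rule L2_set_le_sum_abs)
    also have "\<dots> \<le> (\<Sum>k\<in>{1..q}. \<epsilon> / real (q + 1))"
      using y(2) by (intro sum_mono) (force simp: near_def abs_minus_commute)
    also have "\<dots> < \<epsilon>" using e(1) by (simp add: field_simps)
    finally show "L2_set (\<lambda>k. y k - x k) {1..q} < \<epsilon>" .
  qed
  moreover have "0 < \<epsilon> / real (q + 1)" using e by simp
  ultimately show "x \<in> prob_simplex q \<and> (\<exists>\<epsilon>>0. \<forall>y\<in>prob_simplex q. near q \<epsilon> x y \<longrightarrow> F x \<le> F y)"
    using x by blast
next
  assume "x \<in> prob_simplex q \<and> (\<exists>\<epsilon>>0. \<forall>y\<in>prob_simplex q. near q \<epsilon> x y \<longrightarrow> F x \<le> F y)"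
  then obtain \<epsilon> :: real where x: "x \<in> prob_simplex q"
    and e: "0 < \<epsilon>" "\<forall>y\<in>prob_simplex q. near q \<epsilon> x y \<longrightarrow> F x \<le> F y" by blast
  have "F x \<le> F y" if "y \<in> prob_simplex q" "L2_set (\<lambda>k. y k - x k) {1..q} < \<epsilon>" for y
  proof -
    have "\<bar>x k - y k\<bar> < \<epsilon>" if "k \<in> {1..q}" for k
    proof -
      have "\<bar>y k - x k\<bar> \<le> L2_set (\<lambda>k. \<bar>y k - x k\<bar>) {1..q}" using that by (intro member_le_L2_set) auto
      also have "\<dots> = L2_set (\<lambda>k. y k - x k) {1..q}" by (simp add: L2_set_def)
      finally show ?thesis using \<open>L2_set (\<lambda>k. y k - x k) {1..q} < \<epsilon>\<close> by (simp add: abs_minus_commute)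
    qed
    then show ?thesis using e(2) that by (auto simp: near_def)
  qed
  then show "local_minimizer q F x" unfolding local_minimizer_def using x e by blast
qed

lemma free_energy_uniformly_continuous:
  assumes "0 < \<delta>"
  obtains r where "0 < r" "\<And>x y. x \<in> prob_simplex q \<Longrightarrow> y \<in> prob_simplex q \<Longrightarrow> near q r x y \<Longrightarrow>
    \<bar>free_energy \<beta> q x - free_energy \<beta> q y\<bar> < \<delta>"
proof -
  have "uniformly_continuous_on {0..1} (site_energy \<beta>)"
    by (intro compact_uniformly_continuous continuous_on_subset[OF site_energy_continuous]) auto
  moreover have "0 < \<delta> / real (q + 1)" using assms by simp
  ultimately obtain r where r: "0 < r"
    "\<And>u v. u \<in> {0..1} \<Longrightarrow> v \<in> {0..1} \<Longrightarrow> dist v u < r \<Longrightarrow> dist (site_energy \<beta> v) (site_energy \<beta> u) < \<delta> / real (q + 1)"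
    unfolding uniformly_continuous_on_def by metis
  show thesis
  proof (rule that[OF r(1)])
    fix x y assume x: "x \<in> prob_simplex q" and y: "y \<in> prob_simplex q" and n: "near q r x y"
    have "\<bar>free_energy \<beta> q x - free_energy \<beta> q y\<bar>
        \<le> (\<Sum>k\<in>{1..q}. \<bar>site_energy \<beta> (x k) - site_energy \<beta> (y k)\<bar>)"
      unfolding free_energy_eq sum_subtractf[symmetric] by (rule sum_abs)
    also have "\<dots> \<le> (\<Sum>k\<in>{1..q}. \<delta> / real (q + 1))"
    proof (rule sum_mono)
      fix k assume k: "k \<in> {1..q}"
      then have "dist (site_energy \<beta> (x k)) (site_energy \<beta> (y k)) < \<delta> / real (q + 1)"
        using prob_simplexD[OF x] prob_simplexD[OF y] n by (intro r(2)) (auto simp: near_def dist_real_def)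
      then show "\<bar>site_energy \<beta> (x k) - site_energy \<beta> (y k)\<bar> \<le> \<delta> / real (q + 1)" by (simp add: dist_real_def)
    qed
    also have "\<dots> < \<delta>" using assms by (simp add: field_simps)
    finally show "\<bar>free_energy \<beta> q x - free_energy \<beta> q y\<bar> < \<delta>" .
  qed
qed

text \<open>Vectors are plain functions here, so convergence is coordinatewise: a subsequence is
  refined once for every coordinate by induction over finite sets of coordinates.\<close>

lemma prob_simplex_seq_compact:
  assumes X: "\<And>n::nat. X n \<in> prob_simplex q"
  obtains x r where "x \<in> prob_simplex q" "strict_mono r" "\<And>k. k \<in> {1..q} \<Longrightarrow> (\<lambda>n. X (r n) k) \<longlonglongrightarrow> x k"
proof -
  have "\<exists>r::nat\<Rightarrow>nat. strict_mono r \<and> (\<forall>k\<in>K. \<exists>l. (\<lambda>n. X (r n) k) \<longlonglongrightarrow> l)"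
    if "finite K" "K \<subseteq> {1..q}" for K
    using that
  proof (induction K rule: finite_induct)
    case empty
    show ?case by (rule exI[of _ id]) (auto simp: strict_mono_def)
  next
    case (insert a K)
    then obtain r :: "nat \<Rightarrow> nat" where r: "strict_mono r" "\<forall>k\<in>K. \<exists>l. (\<lambda>n. X (r n) k) \<longlonglongrightarrow> l" by auto
    have "\<forall>n. X (r n) a \<in> {0..1}" using prob_simplexD(1,2)[OF X, of a] insert.prems by auto
    then obtain l r' where r': "strict_mono r'" "((\<lambda>n. X (r n) a) \<circ> r') \<longlonglongrightarrow> l"
      using seq_compactE[OF compact_imp_seq_compact[OF compact_Icc[of "0::real" 1]], of "\<lambda>n. X (r n) a"]
      by blast
    have "\<exists>l. (\<lambda>n. X ((r \<circ> r') n) k) \<longlonglongrightarrow> l" if "k \<in> K" for k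
    proof -
      from r(2) that obtain l where "(\<lambda>n. X (r n) k) \<longlonglongrightarrow> l" by auto
      from LIMSEQ_subseq_LIMSEQ[OF this r'(1)] show ?thesis by (auto simp: o_def)
    qed
    moreover have "\<exists>l. (\<lambda>n. X ((r \<circ> r') n) a) \<longlonglongrightarrow> l" using r'(2) by (auto simp: o_def)
    moreover have "strict_mono (r \<circ> r')" using r(1) r'(1) by (rule strict_mono_o)
    ultimately show ?case by blast
  qed
  from this[OF finite_atLeastAtMost subset_refl] obtain r where r1: "strict_mono r"
    and ex: "\<forall>k\<in>{1..q}. \<exists>l. (\<lambda>n. X (r n) k) \<longlonglongrightarrow> l" by blast
  from bchoice[OF ex] obtain l where "\<forall>k\<in>{1..q}. (\<lambda>n. X (r n) k) \<longlonglongrightarrow> l k" by blast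
  with r1 have r: "strict_mono r" "\<And>k. k \<in> {1..q} \<Longrightarrow> (\<lambda>n. X (r n) k) \<longlonglongrightarrow> l k" by blast+
  have "restrict l {1..q} \<in> prob_simplex q"
  proof (rule prob_simplexI)
    show "0 \<le> restrict l {1..q} k" if "k \<in> {1..q}" for k
      using LIMSEQ_le_const[OF r(2)[OF that], of 0] prob_simplexD(1)[OF X] that by auto
    have "(\<lambda>n. \<Sum>k\<in>{1..q}. X (r n) k) \<longlonglongrightarrow> (\<Sum>k\<in>{1..q}. l k)" by (intro tendsto_sum r(2))
    then have "(\<lambda>n. 1) \<longlonglongrightarrow> (\<Sum>k\<in>{1..q}. l k)" using prob_simplexD(3)[OF X] by simp
    then show "(\<Sum>k\<in>{1..q}. restrict l {1..q} k) = 1"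
      using LIMSEQ_unique[OF _ tendsto_const] by fastforce
  qed auto
  then show thesis using that[of "restrict l {1..q}" r] r by auto
qed

lemma free_energy_tendsto:
  assumes X: "\<And>n::nat. X n \<in> prob_simplex q" and x: "x \<in> prob_simplex q"
    and lim: "\<And>k. k \<in> {1..q} \<Longrightarrow> (\<lambda>n. X n k) \<longlonglongrightarrow> x k"
  shows "(\<lambda>n. free_energy \<beta> q (X n)) \<longlonglongrightarrow> free_energy \<beta> q x"
  unfolding free_energy_eq
proof (rule tendsto_sum)
  fix k assume k: "k \<in> {1..q}"
  show "(\<lambda>n. site_energy \<beta> (X n k)) \<longlonglongrightarrow> site_energy \<beta> (x k)"
    using site_energy_continuous lim[OF k]
    by (rule continuous_on_tendsto_compose) (use prob_simplexD(1)[OF X] prob_simplexD(1)[OF x] k in auto)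
qed

section \<open>First and second order conditions at local minimizers\<close>

definition transfer :: "nat \<Rightarrow> nat \<Rightarrow> real \<Rightarrow> (nat \<Rightarrow> real) \<Rightarrow> (nat \<Rightarrow> real)" where
  "transfer i j t x = x(i := x i - t, j := x j + t)"

lemma sum_transfer:
  fixes g :: "real \<Rightarrow> real"
  assumes "i \<in> {1..q}" "j \<in> {1..q}" "i \<noteq> j"
  shows "(\<Sum>k\<in>{1..q}. g (transfer i j t x k)) =
    (\<Sum>k\<in>{1..q}. g (x k)) + g (x i - t) + g (x j + t) - g (x i) - g (x j)"
proof -
  have s: "sum f {1..q} = f i + f j + sum f ({1..q} - {i} - {j})" for f :: "nat \<Rightarrow> real"
    using assms sum.remove[of "{1..q}" i f] sum.remove[of "{1..q} - {i}" j f] by simp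
  have "(\<Sum>k\<in>{1..q} - {i} - {j}. g (transfer i j t x k)) = (\<Sum>k\<in>{1..q} - {i} - {j}. g (x k))"
    by (intro sum.cong) (auto simp: transfer_def)
  then show ?thesis using assms(3)
    unfolding s[of "\<lambda>k. g (transfer i j t x k)"] s[of "\<lambda>k. g (x k)"] by (simp add: transfer_def)
qed

lemma transfer_in_simplex:
  assumes x: "x \<in> prob_simplex q" and ij: "i \<in> {1..q}" "j \<in> {1..q}" "i \<noteq> j"
    and t: "t \<le> x i" "- t \<le> x j"
  shows "transfer i j t x \<in> prob_simplex q"
proof (rule prob_simplexI)
  show "transfer i j t x \<in> extensional {1..q}"
    using prob_simplexD(4)[OF x] ij by (auto simp: transfer_def extensional_def)
  show "0 \<le> transfer i j t x k" if "k \<in> {1..q}" for k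
    using that prob_simplexD(1)[OF x that] t by (auto simp: transfer_def)
  show "(\<Sum>k\<in>{1..q}. transfer i j t x k) = 1"
    using sum_transfer[OF ij, of "\<lambda>x. x"] prob_simplexD(3)[OF x] by simp
qed

lemma local_minimizer_transfer:
  assumes x: "local_minimizer q (free_energy \<beta> q) x" and ij: "i \<in> {1..q}" "j \<in> {1..q}" "i \<noteq> j"
  obtains \<epsilon> where "0 < \<epsilon>" "\<And>t. \<bar>t\<bar> < \<epsilon> \<Longrightarrow> t \<le> x i \<Longrightarrow> - t \<le> x j \<Longrightarrow>
    site_energy \<beta> (x i) + site_energy \<beta> (x j) \<le> site_energy \<beta> (x i - t) + site_energy \<beta> (x j + t)"
proof -
  from x obtain \<epsilon> where xP: "x \<in> prob_simplex q" and e: "0 < \<epsilon>"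
    "\<And>y. y \<in> prob_simplex q \<Longrightarrow> near q \<epsilon> x y \<Longrightarrow> free_energy \<beta> q x \<le> free_energy \<beta> q y"
    unfolding local_minimizer_near by blast
  show thesis
  proof (rule that[OF e(1)])
    fix t assume t: "\<bar>t\<bar> < \<epsilon>" "t \<le> x i" "- t \<le> x j"
    have "free_energy \<beta> q x \<le> free_energy \<beta> q (transfer i j t x)"
      using t e(1) by (intro e(2) transfer_in_simplex[OF xP ij]) (auto simp: near_def transfer_def)
    then show "site_energy \<beta> (x i) + site_energy \<beta> (x j) \<le> site_energy \<beta> (x i - t) + site_energy \<beta> (x j + t)"
      unfolding free_energy_eq sum_transfer[OF ij] by simp
  qed
qed

text \<open>The entropy has slope minus infinity at 0: moving a small mass t from a positive
  coordinate to an empty one changes the energy by about t * ln t / \<beta>, which beats all other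
  terms.\<close>

lemma local_minimizer_positive:
  assumes \<beta>: "0 < \<beta>" and x: "local_minimizer q (free_energy \<beta> q) x" and j: "j \<in> {1..q}"
  shows "0 < x j"
proof (rule ccontr)
  assume "\<not> 0 < x j"
  moreover have xP: "x \<in> prob_simplex q" using x by (simp add: local_minimizer_near)
  ultimately have j0: "x j = 0" using prob_simplexD(1)[OF xP j] by simp
  have "\<exists>i\<in>{1..q}. 0 < x i"
  proof (rule ccontr)
    assume "\<not> ?thesis"
    then have "\<forall>i\<in>{1..q}. x i = 0" using prob_simplexD(1)[OF xP] by force
    then show False using prob_simplexD(3)[OF xP] by simp
  qed
  then obtain i where i: "i \<in> {1..q}" "0 < x i" by auto
  with j0 have ij: "i \<noteq> j" by auto
  define u where "u = x i"
  have u: "0 < u" using i by (simp add: u_def)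
  obtain \<epsilon> where e: "0 < \<epsilon>" "\<And>t. \<bar>t\<bar> < \<epsilon> \<Longrightarrow> t \<le> x i \<Longrightarrow> - t \<le> x j \<Longrightarrow>
    site_energy \<beta> (x i) + site_energy \<beta> (x j) \<le> site_energy \<beta> (x i - t) + site_energy \<beta> (x j + t)"
    using local_minimizer_transfer[OF x i(1) j ij] by blast
  \<comment> \<open>The bound t < u * exp (- \<beta> (u + 1)) means ln t < ln u - \<beta> (u + 1),
    and with it the change of energy is at most - t - t^2. The halves make the inequalities
    strict.\<close>
  define t where "t = min (\<epsilon> / 2) (u * exp (- \<beta> * (u + 1)) / 2)"
  have "exp (- \<beta> * (u + 1)) < 1" using \<beta> u by (simp add: add_pos_pos)
  then have "u * exp (- \<beta> * (u + 1)) < u" using u by simp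
  then have t: "0 < t" "t < \<epsilon>" "t < u" "t < u * exp (- \<beta> * (u + 1))"
  proof -
    have "0 < u * exp (- \<beta> * (u + 1))" using u by simp
    moreover have "t \<le> \<epsilon> / 2" "t \<le> u * exp (- \<beta> * (u + 1)) / 2" "t = \<epsilon> / 2 \<or> t = u * exp (- \<beta> * (u + 1)) / 2"
      unfolding t_def by (auto simp: min_def)
    ultimately show "0 < t" "t < \<epsilon>" "t < u" "t < u * exp (- \<beta> * (u + 1))"
      using e(1) u \<open>u * exp (- \<beta> * (u + 1)) < u\<close> by argo+
  qed
  have "ln t < ln (u * exp (- \<beta> * (u + 1)))" using t u by (subst ln_less_cancel_iff) auto
  also have "\<dots> = ln u - \<beta> * (u + 1)" using u by (simp add: ln_mult)
  finally have lt: "ln t < ln u - \<beta> * (u + 1)" .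
  have "0 \<le> site_energy \<beta> (u - t) + site_energy \<beta> t - site_energy \<beta> u"
    using e(2)[of t] t by (simp add: j0 u_def site_energy_def)
  also have "\<dots> = ((u - t) * ln (u - t) + t * ln t - u * ln u) / \<beta> + t * (u - t)"
    using \<beta> by (simp add: site_energy_def field_simps power2_eq_square)
  also have "\<dots> \<le> ((u - t) * ln u + t * (ln u - \<beta> * (u + 1)) - u * ln u) / \<beta> + t * (u - t)"
    using \<beta> t u lt
    by (intro add_right_mono divide_right_mono diff_right_mono add_mono mult_left_mono) auto
  also have "\<dots> = - t - t * t" using \<beta> by (simp add: field_simps)
  also have "\<dots> < 0" using t(1) mult_pos_pos[OF t(1) t(1)] by linarith
  finally show False by simp
qed

text \<open>The Lagrange condition, obtained by differentiating along a transfer between two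
  coordinates; both are positive, so the derivative at 0 is two-sided.\<close>

lemma local_minimizer_critical:
  assumes \<beta>: "0 < \<beta>" and x: "local_minimizer q (free_energy \<beta> q) x"
    and ij: "i \<in> {1..q}" "j \<in> {1..q}"
  shows "ln (x i) - \<beta> * x i = ln (x j) - \<beta> * x j"
proof (cases "i = j")
  case False
  have xi: "0 < x i" and xj: "0 < x j" using local_minimizer_positive[OF \<beta> x] ij by auto
  obtain \<epsilon> where e: "0 < \<epsilon>" "\<And>t. \<bar>t\<bar> < \<epsilon> \<Longrightarrow> t \<le> x i \<Longrightarrow> - t \<le> x j \<Longrightarrow>
    site_energy \<beta> (x i) + site_energy \<beta> (x j) \<le> site_energy \<beta> (x i - t) + site_energy \<beta> (x j + t)"
    using local_minimizer_transfer[OF x ij False] by blast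
  let ?G = "\<lambda>t. site_energy \<beta> (x i - t) + site_energy \<beta> (x j + t)"
  have "(?G has_real_derivative (((ln (x i) + 1) / \<beta> - x i) * (- 1) + ((ln (x j) + 1) / \<beta> - x j) * 1)) (at 0)"
  proof (rule DERIV_add)
    show "((\<lambda>t. site_energy \<beta> (x i - t)) has_real_derivative ((ln (x i) + 1) / \<beta> - x i) * (- 1)) (at 0)"
      by (rule DERIV_chain2[where f="site_energy \<beta>"])
         (use site_energy_deriv[of "x i" \<beta>] xi in \<open>auto intro!: derivative_eq_intros\<close>)
    show "((\<lambda>t. site_energy \<beta> (x j + t)) has_real_derivative ((ln (x j) + 1) / \<beta> - x j) * 1) (at 0)"
      by (rule DERIV_chain2[where f="site_energy \<beta>"])
         (use site_energy_deriv[of "x j" \<beta>] xj in \<open>auto intro!: derivative_eq_intros\<close>)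
  qed
  moreover have "0 < min \<epsilon> (min (x i) (x j))" using e xi xj by simp
  moreover have "\<forall>t. \<bar>0 - t\<bar> < min \<epsilon> (min (x i) (x j)) \<longrightarrow> ?G 0 \<le> ?G t"
    using e(2) by auto
  ultimately have "((ln (x i) + 1) / \<beta> - x i) * (- 1) + ((ln (x j) + 1) / \<beta> - x j) * 1 = 0"
    by (rule DERIV_local_min)
  then have "\<beta> * ((ln (x i) + 1) / \<beta> - x i) = \<beta> * ((ln (x j) + 1) / \<beta> - x j)" by simp
  then show ?thesis using \<beta> by (simp add: right_diff_distrib)
qed simp

lemma ln_less_minus_one:
  fixes u :: real
  assumes "0 < u" "u \<noteq> 1"
  shows "ln u < u - 1"
  using ln_le_minus_one[OF assms(1)] ln_eq_minus_one[OF assms(1)] assms(2) by fastforce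

text \<open>The map u \<mapsto> ln u - \<beta> u rises up to 1 / \<beta> and falls afterwards.
  Together with the Lagrange condition it leaves at most two different coordinate values, one on
  each side of 1 / \<beta>.\<close>

lemma ln_minus_linear_strict_mono:
  fixes \<beta> u v :: real
  assumes "0 < \<beta>" "0 < u" "u < v"
  shows "v \<le> 1 / \<beta> \<Longrightarrow> ln u - \<beta> * u < ln v - \<beta> * v"
    and "1 / \<beta> \<le> u \<Longrightarrow> ln v - \<beta> * v < ln u - \<beta> * u"
proof -
  assume v: "v \<le> 1 / \<beta>"
  have "ln (u / v) < u / v - 1" using assms by (intro ln_less_minus_one) auto
  then have "ln u - ln v < (u - v) / v" using assms by (simp add: ln_div diff_divide_distrib)
  also have "(u - v) / v \<le> (u - v) * \<beta>"
  proof -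
    have "\<beta> \<le> 1 / v" using v assms by (simp add: field_simps)
    then have "(u - v) * (1 / v) \<le> (u - v) * \<beta>" using assms by (intro mult_left_mono_neg) auto
    then show ?thesis by simp
  qed
  finally show "ln u - \<beta> * u < ln v - \<beta> * v" by (simp add: algebra_simps)
next
  assume u: "1 / \<beta> \<le> u"
  have "ln (v / u) < v / u - 1" using assms by (intro ln_less_minus_one) auto
  then have "ln v - ln u < (v - u) / u" using assms by (simp add: ln_div diff_divide_distrib)
  also have "(v - u) / u \<le> (v - u) * \<beta>"
  proof -
    have "1 / u \<le> \<beta>" using u assms by (simp add: field_simps)
    then have "(v - u) * (1 / u) \<le> (v - u) * \<beta>" using assms by (intro mult_left_mono) auto
    then show ?thesis by simp
  qed
  finally show "ln v - \<beta> * v < ln u - \<beta> * u" by (simp add: algebra_simps)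
qed

text \<open>Above 1 / \<beta> the site energy is strictly concave. Two coordinates there would be
  equal by criticality, and shifting mass from one to the other would lower the energy.\<close>

lemma local_minimizer_one_large:
  assumes \<beta>: "0 < \<beta>" and x: "local_minimizer q (free_energy \<beta> q) x"
    and ij: "i \<in> {1..q}" "j \<in> {1..q}" "i \<noteq> j" and large: "1 / \<beta> < x i" "1 / \<beta> < x j"
  shows False
proof -
  have pos: "0 < x i" "0 < x j" using local_minimizer_positive[OF \<beta> x] ij by auto
  have eq: "x i = x j"
    using local_minimizer_critical[OF \<beta> x ij(1,2)] ln_minus_linear_strict_mono(2)[OF \<beta>, of "x i" "x j"]
      ln_minus_linear_strict_mono(2)[OF \<beta>, of "x j" "x i"] pos large by (cases "x i" "x j" rule: linorder_cases) auto
  define u where "u = x i"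
  obtain \<epsilon> where e: "0 < \<epsilon>" "\<And>t. \<bar>t\<bar> < \<epsilon> \<Longrightarrow> t \<le> x i \<Longrightarrow> - t \<le> x j \<Longrightarrow>
    site_energy \<beta> (x i) + site_energy \<beta> (x j) \<le> site_energy \<beta> (x i - t) + site_energy \<beta> (x j + t)"
    using local_minimizer_transfer[OF x ij] by blast
  \<comment> \<open>Keeps both shifted coordinates at or above 1 / \<beta>, inside the region of
    concavity.\<close>
  define t where "t = min (\<epsilon> / 2) (u - 1 / \<beta>)"
  have t: "0 < t" "t < \<epsilon>" "1 / \<beta> \<le> u - t" using e large by (auto simp: t_def u_def)
  have upos: "0 < 1 / \<beta>" using \<beta> by simp
  have "\<exists>\<xi>. 0 < \<xi> \<and> \<xi> < t \<and> (site_energy \<beta> (u - t) + site_energy \<beta> (u + t)) - (site_energy \<beta> (u - 0) + site_energy \<beta> (u + 0))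
      = (t - 0) * (((ln (u - \<xi>) + 1) / \<beta> - (u - \<xi>)) * (- 1) + ((ln (u + \<xi>) + 1) / \<beta> - (u + \<xi>)) * 1)"
  proof (rule MVT2[OF t(1)])
    fix s assume s: "0 \<le> s" "s \<le> t"
    then have us: "0 < u - s" "0 < u + s" using t upos by linarith+
    show "((\<lambda>t. site_energy \<beta> (u - t) + site_energy \<beta> (u + t)) has_real_derivative
       (((ln (u - s) + 1) / \<beta> - (u - s)) * (- 1) + ((ln (u + s) + 1) / \<beta> - (u + s)) * 1)) (at s)"
      by (intro DERIV_add; rule DERIV_chain2[where f="site_energy \<beta>"])
         (use site_energy_deriv[OF us(1), of \<beta>] site_energy_deriv[OF us(2), of \<beta>]
           in \<open>auto intro!: derivative_eq_intros\<close>)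
  qed
  then obtain \<xi> where \<xi>: "0 < \<xi>" "\<xi> < t"
    and d: "site_energy \<beta> (u - t) + site_energy \<beta> (u + t) - (site_energy \<beta> u + site_energy \<beta> u)
      = t * (((ln (u + \<xi>) + 1) / \<beta> - (u + \<xi>)) - ((ln (u - \<xi>) + 1) / \<beta> - (u - \<xi>)))"
    by (simp only: diff_zero add_0_right mult_minus1_right mult_1_right uminus_add_conv_diff) blast
  have "ln (u + \<xi>) - \<beta> * (u + \<xi>) < ln (u - \<xi>) - \<beta> * (u - \<xi>)"
    by (rule ln_minus_linear_strict_mono(2)[OF \<beta>]; use \<xi> t upos in linarith)
  then have "(ln (u + \<xi>) - \<beta> * (u + \<xi>)) / \<beta> < (ln (u - \<xi>) - \<beta> * (u - \<xi>)) / \<beta>"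
    using \<beta> by (rule divide_strict_right_mono)
  then have "((ln (u + \<xi>) + 1) / \<beta> - (u + \<xi>)) - ((ln (u - \<xi>) + 1) / \<beta> - (u - \<xi>)) < 0"
    using \<beta> by (simp add: diff_divide_distrib add_divide_distrib)
  then have "t * (((ln (u + \<xi>) + 1) / \<beta> - (u + \<xi>)) - ((ln (u - \<xi>) + 1) / \<beta> - (u - \<xi>))) < 0"
    using t by (intro mult_pos_neg)
  moreover have "t \<le> u" "- t \<le> u" using t upos by linarith+
  then have "site_energy \<beta> u + site_energy \<beta> u \<le> site_energy \<beta> (u - t) + site_energy \<beta> (u + t)"
    using e(2)[of t] t(1,2) eq by (simp add: u_def)
  ultimately show False using d by linarith
qed

section \<open>The curve from the uniform vector to a vertex, and the mean-field equation\<close>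

definition spike :: "nat \<Rightarrow> nat \<Rightarrow> real \<Rightarrow> nat \<Rightarrow> real" where
  "spike q i s = (\<lambda>k\<in>{1..q}. if k = i then (1 + (real q - 1) * s) / real q else (1 - s) / real q)"

definition log_ratio :: "nat \<Rightarrow> real \<Rightarrow> real" where
  "log_ratio q s = ln (1 + (real q - 1) * s) - ln (1 - s)"

text \<open>The coordinates not exceeding 1 / \<beta> coincide, and at most one coordinate exceeds
  it. Without such a coordinate the vector is uniform; otherwise it is a spike, and criticality
  becomes the equation for s.\<close>

lemma local_minimizer_cases:
  assumes \<beta>: "0 < \<beta>" and q: "2 \<le> q" and x: "local_minimizer q (free_energy \<beta> q) x"
  shows "x = (\<lambda>k\<in>{1..q}. 1 / real q) \<or>
    (\<exists>i\<in>{1..q}. \<exists>s. 0 < s \<and> s < 1 \<and> log_ratio q s = \<beta> * s \<and> x = spike q i s)"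
proof -
  have xP: "x \<in> prob_simplex q" using x by (simp add: local_minimizer_near)
  have small: "x i = x j" if "i \<in> {1..q}" "j \<in> {1..q}" "x i \<le> 1 / \<beta>" "x j \<le> 1 / \<beta>" for i j
  proof (rule ccontr)
    assume "x i \<noteq> x j"
    then consider "x i < x j" | "x j < x i" by linarith
    then show False
    proof cases
      case 1
      from ln_minus_linear_strict_mono(1)[OF \<beta> local_minimizer_positive[OF \<beta> x that(1)] 1 that(4)]
      show False using local_minimizer_critical[OF \<beta> x that(1,2)] by simp
    next
      case 2
      from ln_minus_linear_strict_mono(1)[OF \<beta> local_minimizer_positive[OF \<beta> x that(2)] 2 that(3)]
      show False using local_minimizer_critical[OF \<beta> x that(1,2)] by simp
    qed
  qed
  show ?thesis
  proof (cases "\<exists>i\<in>{1..q}. 1 / \<beta> < x i")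
    case False
    have 1: "1 \<in> {1..q}" using q by auto
    have x1: "x k = x 1" if "k \<in> {1..q}" for k using False small[OF that 1] that 1 by (meson not_le)
    have "(\<Sum>k\<in>{1..q}. x k) = (\<Sum>k\<in>{1..q}. x 1)" by (intro sum.cong refl x1)
    then have "(\<Sum>k\<in>{1..q}. x k) = real q * x 1" by simp
    then have "x 1 = 1 / real q" using prob_simplexD(3)[OF xP] q by (simp add: field_simps)
    then have "x = (\<lambda>k\<in>{1..q}. 1 / real q)"
      using x1 prob_simplexD(4)[OF xP] by (intro extensionalityI[of _ "{1..q}"]) auto
    then show ?thesis ..
  next
    case True
    then obtain i where i: "i \<in> {1..q}" "1 / \<beta> < x i" by auto
    have le: "x k \<le> 1 / \<beta>" if "k \<in> {1..q}" "k \<noteq> i" for k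
      using local_minimizer_one_large[OF \<beta> x that(1) i(1) that(2)] i(2) by force
    define j where "j = (if i = 1 then 2 else 1::nat)"
    have j: "j \<in> {1..q}" "j \<noteq> i" using q by (auto simp: j_def)
    define a where "a = x j"
    have xa: "x k = a" if "k \<in> {1..q}" "k \<noteq> i" for k
      using small[OF that(1) j(1) le[OF that] le[OF j]] by (simp add: a_def)
    have "(\<Sum>k\<in>{1..q} - {i}. x k) = (\<Sum>k\<in>{1..q} - {i}. a)"
      by (intro sum.cong refl xa) auto
    then have "(\<Sum>k\<in>{1..q}. x k) = x i + real (q - 1) * a"
      using i(1) sum.remove[of "{1..q}" i x] by simp
    then have xi: "x i = 1 - (real q - 1) * a" using prob_simplexD(3)[OF xP] q by (simp add: of_nat_diff)
    \<comment> \<open>Chosen so that the common small coordinate is (1 - s) / q; s > 0 says that the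
      exceptional coordinate is the larger one.\<close>
    define s where "s = 1 - real q * a"
    have a0: "0 < a" using local_minimizer_positive[OF \<beta> x j(1)] by (simp add: a_def)
    have "a < x i" using le[OF j] i by (simp add: a_def)
    then have s0: "0 < s" using xi by (simp add: s_def algebra_simps)
    have s1: "s < 1" using a0 q by (simp add: s_def)
    have q0: "0 < real q" using q by simp
    have ae: "a = (1 - s) / real q" using q0 by (simp add: s_def)
    have "1 + (real q - 1) * s = real q * (1 - (real q - 1) * a)" by (simp add: s_def algebra_simps)
    then have be: "x i = (1 + (real q - 1) * s) / real q" using q0 xi by simp
    have "ln (x i) - ln a = \<beta> * (x i - a)"
      using local_minimizer_critical[OF \<beta> x i(1) j(1)] by (simp add: a_def algebra_simps)
    also have "x i - a = s" unfolding ae be using q0 by (simp add: field_simps)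
    also have "ln (x i) - ln a = log_ratio q s"
    proof -
      have "0 < 1 + (real q - 1) * s" using q s0 by (intro add_pos_nonneg mult_nonneg_nonneg) auto
      then show ?thesis unfolding ae be log_ratio_def using q0 s1 by (subst (1 2) ln_div) auto
    qed
    finally have "log_ratio q s = \<beta> * s" .
    moreover have "x = spike q i s"
      unfolding spike_def using xa ae be prob_simplexD(4)[OF xP]
      by (intro extensionalityI[of _ "{1..q}"]) auto
    ultimately show ?thesis using i s0 s1 by blast
  qed
qed

lemma spike_in_simplex:
  assumes "2 \<le> q" "i \<in> {1..q}" "0 \<le> s" "s \<le> 1"
  shows "spike q i s \<in> prob_simplex q"
proof (rule prob_simplexI)
  have "(\<Sum>k\<in>{1..q}. spike q i s k) = (1 + (real q - 1) * s) / real q + real (q - 1) * ((1 - s) / real q)"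
  proof -
    have "(\<Sum>k\<in>{1..q} - {i}. spike q i s k) = (\<Sum>k\<in>{1..q} - {i}. (1 - s) / real q)"
      by (intro sum.cong) (auto simp: spike_def)
    then show ?thesis using assms sum.remove[of "{1..q}" i "spike q i s"] by (simp add: spike_def)
  qed
  also have "\<dots> = 1" using assms by (simp add: of_nat_diff field_simps)
  finally show "(\<Sum>k\<in>{1..q}. spike q i s k) = 1" .
qed (use assms in \<open>auto simp: spike_def\<close>)

lemma free_energy_spike:
  assumes "2 \<le> q" "i \<in> {1..q}"
  shows "free_energy \<beta> q (spike q i s) = site_energy \<beta> ((1 + (real q - 1) * s) / real q)
    + (real q - 1) * site_energy \<beta> ((1 - s) / real q)"
proof -
  have "(\<Sum>k\<in>{1..q} - {i}. site_energy \<beta> (spike q i s k)) = (\<Sum>k\<in>{1..q} - {i}. site_energy \<beta> ((1 - s) / real q))"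
    by (intro sum.cong) (auto simp: spike_def)
  then show ?thesis unfolding free_energy_eq
    using assms sum.remove[of "{1..q}" i "\<lambda>k. site_energy \<beta> (spike q i s k)"]
    by (simp add: spike_def of_nat_diff)
qed

lemma spike_energy_deriv:
  assumes q: "2 \<le> q" and s: "0 \<le> s" "s < 1"
  shows "((\<lambda>s. site_energy \<beta> ((1 + (real q - 1) * s) / real q) + (real q - 1) * site_energy \<beta> ((1 - s) / real q))
    has_real_derivative (real q - 1) / real q * (log_ratio q s / \<beta> - s)) (at s)"
proof -
  let ?b = "(1 + (real q - 1) * s) / real q" and ?a = "(1 - s) / real q"
  have pos: "0 < 1 + (real q - 1) * s" "0 < 1 - s" "0 < real q"
    using q s by (auto intro!: add_pos_nonneg mult_nonneg_nonneg)
  have "((\<lambda>s. site_energy \<beta> ((1 + (real q - 1) * s) / real q)) has_real_derivative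
      ((ln ?b + 1) / \<beta> - ?b) * ((real q - 1) / real q)) (at s)"
    by (rule DERIV_chain2[where f="site_energy \<beta>"])
       (use pos in \<open>auto intro!: site_energy_deriv derivative_eq_intros\<close>)
  moreover have "((\<lambda>s. site_energy \<beta> ((1 - s) / real q)) has_real_derivative
      ((ln ?a + 1) / \<beta> - ?a) * (- 1 / real q)) (at s)"
    by (rule DERIV_chain2[where f="site_energy \<beta>"])
       (use pos in \<open>auto intro!: site_energy_deriv derivative_eq_intros\<close>)
  ultimately have "((\<lambda>s. site_energy \<beta> ((1 + (real q - 1) * s) / real q) + (real q - 1) * site_energy \<beta> ((1 - s) / real q))
    has_real_derivative ((ln ?b + 1) / \<beta> - ?b) * ((real q - 1) / real q)
      + (real q - 1) * (((ln ?a + 1) / \<beta> - ?a) * (- 1 / real q))) (at s)"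
    by (intro DERIV_add DERIV_cmult)
  also have "((ln ?b + 1) / \<beta> - ?b) * ((real q - 1) / real q)
      + (real q - 1) * (((ln ?a + 1) / \<beta> - ?a) * (- 1 / real q))
      = (real q - 1) / real q * ((ln ?b - ln ?a) / \<beta> - (?b - ?a))"
    by (simp add: algebra_simps add_divide_distrib diff_divide_distrib)
  also have "?b - ?a = s" using pos by (simp add: field_simps)
  also have "ln ?b - ln ?a = log_ratio q s"
    unfolding log_ratio_def using pos by (subst (1 2) ln_div) auto
  finally show ?thesis .
qed

lemma log_ratio_deriv:
  assumes q: "2 \<le> q" and s: "0 \<le> s" "s < 1"
  shows "(log_ratio q has_real_derivative real q / ((1 + (real q - 1) * s) * (1 - s))) (at s)"
proof -
  have pos: "0 < 1 + (real q - 1) * s" "0 < 1 - s"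
    using q s by (auto intro!: add_pos_nonneg mult_nonneg_nonneg)
  have "(log_ratio q has_real_derivative (real q - 1) / (1 + (real q - 1) * s) + 1 / (1 - s)) (at s)"
    unfolding log_ratio_def[abs_def] using pos by (auto intro!: derivative_eq_intros)
  also have "(real q - 1) / (1 + (real q - 1) * s) + 1 / (1 - s) = real q / ((1 + (real q - 1) * s) * (1 - s))"
    using pos by (subst add_frac_eq) (auto simp: algebra_simps)
  finally show ?thesis .
qed

text \<open>Up to the factor (q - 1) / (q \<beta>) this is the slope of the free energy along the
  spike curve, so its sign tells whether the energy rises or falls there.\<close>

definition log_gap :: "nat \<Rightarrow> real \<Rightarrow> real \<Rightarrow> real" where
  "log_gap q \<beta> s = log_ratio q s - \<beta> * s"

lemma log_gap_deriv:
  assumes "2 \<le> q" "0 \<le> s" "s < 1"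
  shows "(log_gap q \<beta> has_real_derivative real q / ((1 + (real q - 1) * s) * (1 - s)) - \<beta>) (at s)"
  unfolding log_gap_def[abs_def] using log_ratio_deriv[OF assms]
  by (auto intro!: derivative_eq_intros)

lemma log_gap_0 [simp]: "log_gap q \<beta> 0 = 0"
  by (simp add: log_gap_def log_ratio_def)

lemma log_gap_continuous:
  assumes "2 \<le> q" "0 \<le> a" "b < 1"
  shows "continuous_on {a..b} (log_gap q \<beta>)"
proof (rule DERIV_atLeastAtMost_imp_continuous_on)
  fix x assume "a \<le> x" "x \<le> b"
  then show "\<exists>y. (log_gap q \<beta> has_real_derivative y) (at x)"
    using log_gap_deriv[of q x \<beta>] assms by auto
qed

lemma log_gap_mvt:
  assumes q: "2 \<le> q" and ab: "0 \<le> a" "a < b" "b < 1"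
  obtains \<xi> where "a < \<xi>" "\<xi> < b"
    "log_gap q \<beta> b - log_gap q \<beta> a = (b - a) * (real q / ((1 + (real q - 1) * \<xi>) * (1 - \<xi>)) - \<beta>)"
proof -
  have "\<exists>\<xi>. a < \<xi> \<and> \<xi> < b \<and>
    log_gap q \<beta> b - log_gap q \<beta> a = (b - a) * (real q / ((1 + (real q - 1) * \<xi>) * (1 - \<xi>)) - \<beta>)"
    by (rule MVT2[OF ab(2)], rule log_gap_deriv[OF q]) (use ab in auto)
  then show thesis using that by blast
qed

text \<open>
  The derivative of the gap first decreases and then increases, being a constant over a concave
  quadratic; so the gap, once negative or back at zero, stays negative until its next zero.
\<close>

lemma log_gap_neg_between:
  assumes q: "2 \<le> q" and s: "0 < s" "s < s2" "s2 < 1"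
    and gap: "log_gap q \<beta> s \<le> 0" "log_gap q \<beta> s2 = 0" and u: "s < u" "u < s2"
  shows "log_gap q \<beta> u < 0"
proof (rule ccontr)
  assume "\<not> log_gap q \<beta> u < 0"
  then have nn: "0 \<le> log_gap q \<beta> u" by simp
  let ?d = "\<lambda>s. (1 + (real q - 1) * s) * (1 - s)"
  let ?g = "\<lambda>s. real q / ?d s - \<beta>"
  \<comment> \<open>A nonnegative value at u would give slopes that are nonpositive, nonnegative and
    nonpositive at x1 < x2 < x3. The quadratic \<open>?d\<close> would then be at x2 no larger than
    at x1 and at x3, which strict concavity forbids.\<close>
  obtain x1 where x1: "0 < x1" "x1 < s" "log_gap q \<beta> s - log_gap q \<beta> 0 = (s - 0) * ?g x1"
    using log_gap_mvt[OF q, of 0 s] s by auto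
  obtain x2 where x2: "s < x2" "x2 < u" "log_gap q \<beta> u - log_gap q \<beta> s = (u - s) * ?g x2"
    using log_gap_mvt[OF q, of s u] s u by auto
  obtain x3 where x3: "u < x3" "x3 < s2" "log_gap q \<beta> s2 - log_gap q \<beta> u = (s2 - u) * ?g x3"
    using log_gap_mvt[OF q, of u s2] s u by auto
  have g1: "?g x1 \<le> 0" using x1 gap s by (simp add: zero_less_mult_iff mult_le_0_iff)
  have g2: "0 \<le> ?g x2" using x2 nn gap u by (metis diff_ge_0_iff_ge diff_gt_0_iff_gt order_trans zero_le_mult_iff linorder_not_less)
  have g3: "?g x3 \<le> 0" using x3 nn gap u by (simp add: mult_le_0_iff zero_less_mult_iff) (smt (verit) mult_pos_pos)
  have dpos: "0 < ?d x" if "0 \<le> x" "x < 1" for x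
    using that q by (intro mult_pos_pos add_pos_nonneg mult_nonneg_nonneg) auto
  have p1: "0 < ?d x1" and p2: "0 < ?d x2" and p3: "0 < ?d x3"
    using x1 x2 x3 s u by (auto intro!: dpos)
  have q0: "0 < real q" using q by simp
  have "real q / ?d x1 \<le> real q / ?d x2" using g1 g2 by linarith
  then have d12: "?d x2 \<le> ?d x1" using p1 p2 q0
    by (metis divide_strict_left_mono linorder_not_less mult_pos_pos)
  have "real q / ?d x3 \<le> real q / ?d x2" using g2 g3 by linarith
  then have d23: "?d x2 \<le> ?d x3" using p2 p3 q0
    by (metis divide_strict_left_mono linorder_not_less mult_pos_pos)
  have e: "?d y - ?d x = (y - x) * ((real q - 2) - (real q - 1) * (x + y))" for x y
    by (simp add: algebra_simps)
  have "(x2 - x1) * ((real q - 2) - (real q - 1) * (x1 + x2)) \<le> 0" using d12 e[of x2 x1] by linarith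
  then have "(real q - 2) - (real q - 1) * (x1 + x2) \<le> 0" using x1 x2 by (simp add: mult_le_0_iff)
  moreover have "(real q - 1) * (x1 + x2) < (real q - 1) * (x2 + x3)"
    using x1 x2 x3 q by (intro mult_strict_left_mono) auto
  ultimately have "(x3 - x2) * ((real q - 2) - (real q - 1) * (x2 + x3)) < 0"
    using x2 x3 by (intro mult_pos_neg) auto
  then show False using d23 e[of x3 x2] by linarith
qed

text \<open>From s = 1 - exp (- \<beta>) on, - ln (1 - s) alone is at least \<beta> > \<beta>
  s.\<close>

lemma log_gap_pos_near_1:
  assumes q: "2 \<le> q" and \<beta>: "0 < \<beta>" and s: "1 - exp (- \<beta>) \<le> s" "s < 1"
  shows "0 < log_gap q \<beta> s"
proof -
  have s0: "0 < s" using s(1) \<beta> by (smt (verit) exp_less_one_iff)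
  have "ln (1 - s) \<le> - \<beta>" using s ln_le_cancel_iff[of "1 - s" "exp (- \<beta>)"] by simp
  moreover have "0 < ln (1 + (real q - 1) * s)" using s0 q by (intro ln_gt_zero) auto
  moreover have "\<beta> * s < \<beta>" using s \<beta> by simp
  ultimately show ?thesis by (simp add: log_gap_def log_ratio_def)
qed

text \<open>\<open>GREATEST\<close> is meaningful here: the zeros of the gap in [0, 1) lie below 1 -
  exp (- \<beta>), hence form a compact set, and 0 is always one of them.\<close>

lemma largest_s_props:
  assumes q: "2 \<le> q" and \<beta>: "0 < \<beta>"
  shows "0 \<le> largest_s q \<beta>" "largest_s q \<beta> < 1" "log_gap q \<beta> (largest_s q \<beta>) = 0"
    and "\<And>s. 0 \<le> s \<Longrightarrow> s < 1 \<Longrightarrow> log_gap q \<beta> s = 0 \<Longrightarrow> s \<le> largest_s q \<beta>"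
proof -
  let ?P = "\<lambda>s. 0 \<le> s \<and> s < 1 \<and> ln (1 + (real q - 1) * s) - ln (1 - s) = \<beta> * s"
  have P: "?P s \<longleftrightarrow> 0 \<le> s \<and> s < 1 \<and> log_gap q \<beta> s = 0" for s
    by (auto simp: log_gap_def log_ratio_def)
  define m where "m = 1 - exp (- \<beta>)"
  have m: "0 \<le> m" "m < 1" using \<beta> by (auto simp: m_def)
  let ?S = "{s \<in> {0..m}. log_gap q \<beta> s = 0}"
  have "closed ?S"
    by (intro continuous_closed_preimage_constant log_gap_continuous q) (use m in auto)
  then have "compact ?S"
    unfolding compact_eq_bounded_closed using bounded_subset[OF bounded_closed_interval[of 0 m], of ?S] by blast
  moreover have "?S \<noteq> {}" using m by (auto intro!: exI[of _ 0])
  ultimately obtain x where x: "x \<in> ?S" "\<And>s. s \<in> ?S \<Longrightarrow> s \<le> x"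
    using compact_attains_sup[of ?S] by blast
  have max: "s \<le> x" if "?P s" for s
  proof -
    have "s < m" using that log_gap_pos_near_1[OF q \<beta>, of s] unfolding P m_def by linarith
    then show ?thesis using that x(2)[of s] unfolding P by auto
  qed
  have px: "?P x" unfolding P using x(1) m by auto
  have lx: "largest_s q \<beta> = x"
    unfolding largest_s_def using px max by (rule Greatest_equality)
  show "0 \<le> largest_s q \<beta>" "largest_s q \<beta> < 1" "log_gap q \<beta> (largest_s q \<beta>) = 0"
    using px unfolding P lx by blast+
  show "\<And>s. 0 \<le> s \<Longrightarrow> s < 1 \<Longrightarrow> log_gap q \<beta> s = 0 \<Longrightarrow> s \<le> largest_s q \<beta>"
    using max unfolding P lx by blast
qed

lemma minimizer_eq_spike: "i \<noteq> 0 \<Longrightarrow> minimizer q \<beta> i = spike q i (largest_s q \<beta>)"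
  unfolding minimizer_def spike_def by (auto simp: fun_eq_iff)

text \<open>To the right of a positive zero that is not the largest the gap is negative, so the
  energy falls when one moves along the spike curve and the point is not a local minimum.\<close>

lemma local_minimizer_spike_largest:
  assumes \<beta>: "0 < \<beta>" and q: "2 \<le> q" and i: "i \<in> {1..q}" and s: "0 < s" "s < 1" "log_ratio q s = \<beta> * s"
    and lm: "local_minimizer q (free_energy \<beta> q) (spike q i s)"
  shows "s = largest_s q \<beta>"
proof (rule ccontr)
  let ?t = "largest_s q \<beta>"
  note L = largest_s_props[OF q \<beta>]
  assume "s \<noteq> ?t"
  moreover have gs: "log_gap q \<beta> s = 0" using s by (simp add: log_gap_def)
  ultimately have st: "s < ?t" using L(4)[of s] s by auto
  obtain \<epsilon> where e: "0 < \<epsilon>"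
    "\<And>y. y \<in> prob_simplex q \<Longrightarrow> near q \<epsilon> (spike q i s) y \<Longrightarrow> free_energy \<beta> q (spike q i s) \<le> free_energy \<beta> q y"
    using lm unfolding local_minimizer_near by blast
  define t where "t = min (s + \<epsilon> / 2) ((s + ?t) / 2)"
  have t: "s < t" "t < ?t" "t - s < \<epsilon>" using e st by (auto simp: t_def min_def)
  have le: "free_energy \<beta> q (spike q i s) \<le> free_energy \<beta> q (spike q i t)"
  proof (rule e(2))
    show "spike q i t \<in> prob_simplex q" using t s L by (intro spike_in_simplex[OF q i]) auto
    have q0: "1 \<le> real q" using q by simp
    have "\<bar>(1 + (real q - 1) * s) / real q - (1 + (real q - 1) * t) / real q\<bar> = (real q - 1) / real q * (t - s)"
      using q0 t by (simp add: diff_divide_distrib[symmetric] right_diff_distrib[symmetric] abs_mult)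
    also have "\<dots> \<le> 1 * (t - s)" using q0 t by (intro mult_right_mono) auto
    finally have 1: "\<bar>(1 + (real q - 1) * s) / real q - (1 + (real q - 1) * t) / real q\<bar> < \<epsilon>" using t by simp
    have "\<bar>(1 - s) / real q - (1 - t) / real q\<bar> = 1 / real q * (t - s)"
      using q0 t by (simp add: diff_divide_distrib[symmetric])
    also have "\<dots> \<le> 1 * (t - s)" using q0 t by (intro mult_right_mono) auto
    finally have 2: "\<bar>(1 - s) / real q - (1 - t) / real q\<bar> < \<epsilon>" using t by simp
    show "near q \<epsilon> (spike q i s) (spike q i t)" using 1 2 by (auto simp: near_def spike_def)
  qed
  let ?f = "\<lambda>s. site_energy \<beta> ((1 + (real q - 1) * s) / real q) + (real q - 1) * site_energy \<beta> ((1 - s) / real q)"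
  have "\<exists>z. s < z \<and> z < t \<and> ?f t - ?f s = (t - s) * ((real q - 1) / real q * (log_ratio q z / \<beta> - z))"
    by (rule MVT2[OF t(1)], rule spike_energy_deriv[OF q]) (use s t L in auto)
  then obtain z where z: "s < z" "z < t" "?f t - ?f s = (t - s) * ((real q - 1) / real q * (log_ratio q z / \<beta> - z))"
    by blast
  have "log_gap q \<beta> z < 0"
    using log_gap_neg_between[OF q s(1) st L(2) _ L(3), of z] gs z t by auto
  then have "log_ratio q z / \<beta> - z < 0" using \<beta> by (simp add: log_gap_def field_simps)
  then have "(t - s) * ((real q - 1) / real q * (log_ratio q z / \<beta> - z)) < 0"
    using t q by (intro mult_pos_neg) auto
  then show False using z(3) le unfolding free_energy_spike[OF q i] by linarith
qed

section \<open>Global minimizers and the two critical values of \<beta>\<close>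

lemma global_minimizer_exists:
  assumes "1 \<le> q"
  obtains x where "global_minimizer q (free_energy \<beta> q) x"
proof -
  let ?F = "free_energy \<beta> q"
  let ?V = "?F ` prob_simplex q"
  have ne: "prob_simplex q \<noteq> {}"
  proof -
    have "(\<lambda>k\<in>{1..q}. 1 / real q) \<in> prob_simplex q"
      using assms by (intro prob_simplexI) auto
    then show ?thesis by auto
  qed
  have bd: "bdd_below ?V"
  proof (rule ccontr)
    assume "\<not> bdd_below ?V"
    then have "\<exists>x\<in>prob_simplex q. ?F x < - real n" for n
      unfolding bdd_below_def by (force simp: not_le)
    then obtain X where X: "\<And>n. X n \<in> prob_simplex q" "\<And>n. ?F (X n) < - real n" by metis
    obtain x r where x: "x \<in> prob_simplex q" "strict_mono r" "\<And>k. k \<in> {1..q} \<Longrightarrow> (\<lambda>n. X (r n) k) \<longlonglongrightarrow> x k"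
      using prob_simplex_seq_compact[of X q] X(1) by blast
    have lim: "(\<lambda>n. ?F (X (r n))) \<longlonglongrightarrow> ?F x" by (intro free_energy_tendsto X x)
    obtain n :: nat where n: "- ?F x + 1 < real n" using reals_Archimedean2 by blast
    have "eventually (\<lambda>m. ?F x - 1 < ?F (X (r m))) sequentially"
      using lim by (rule order_tendstoD) simp
    then obtain m where "?F x - 1 < ?F (X (r m))" "n \<le> m"
      by (metis (mono_tags, lifting) eventually_sequentially linorder_linear)
    moreover have "?F (X (r m)) < - real m" using X(2)[of "r m"] seq_suble[OF x(2), of m] by linarith
    ultimately show False using n by linarith
  qed
  have "\<exists>x\<in>prob_simplex q. ?F x < Inf ?V + 1 / real (Suc n)" for n
    using cInf_lessD[of ?V "Inf ?V + 1 / real (Suc n)"] ne by auto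
  then obtain X where X: "\<And>n. X n \<in> prob_simplex q" "\<And>n. ?F (X n) < Inf ?V + 1 / real (Suc n)" by metis
  obtain x r where x: "x \<in> prob_simplex q" "strict_mono r" "\<And>k. k \<in> {1..q} \<Longrightarrow> (\<lambda>n. X (r n) k) \<longlonglongrightarrow> x k"
    using prob_simplex_seq_compact[of X q] X(1) by blast
  have lim: "(\<lambda>n. ?F (X (r n))) \<longlonglongrightarrow> ?F x" by (intro free_energy_tendsto X x)
  have "(\<lambda>n. Inf ?V + 1 / real (Suc (r n))) \<longlonglongrightarrow> Inf ?V + 0"
    using LIMSEQ_subseq_LIMSEQ[OF LIMSEQ_Suc[OF lim_1_over_n] x(2)]
    by (intro tendsto_intros) (simp add: o_def)
  then have "?F x \<le> Inf ?V"
    using LIMSEQ_le[OF lim, of "\<lambda>n. Inf ?V + 1 / real (Suc (r n))" "Inf ?V"] X(2) by (auto intro: less_imp_le)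
  then have "global_minimizer q ?F x"
    unfolding global_minimizer_def using x(1) cInf_lower[OF _ bd] by (force intro: order_trans)
  then show thesis by (rule that)
qed

lemma global_imp_local_minimizer: "global_minimizer q F x \<Longrightarrow> local_minimizer q F x"
  unfolding global_minimizer_def local_minimizer_near by (auto intro: exI[of _ 1])

lemma uniform_in_simplex: "1 \<le> q \<Longrightarrow> (\<lambda>k\<in>{1..q}. 1 / real q) \<in> prob_simplex q"
  by (intro prob_simplexI) auto

lemma free_energy_uniform:
  assumes "1 \<le> q"
  shows "free_energy \<beta> q (\<lambda>k\<in>{1..q}. 1 / real q) = - (ln (real q) / \<beta>) - 1 / (2 * real q)"
proof -
  have "free_energy \<beta> q (\<lambda>k\<in>{1..q}. 1 / real q) = real q * site_energy \<beta> (1 / real q)"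
    unfolding free_energy_eq by simp
  moreover have "real q * ((1 / real q) * ln (1 / real q) / \<beta>) = - (ln (real q) / \<beta>)"
    using assms by (simp add: ln_div)
  moreover have "real q * ((1 / real q)\<^sup>2 / 2) = 1 / (2 * real q)"
    using assms by (simp add: power2_eq_square)
  ultimately show ?thesis by (simp only: site_energy_def right_diff_distrib)
qed

text \<open>Comparison with a vertex of the simplex, whose energy is - 1/2. The bound makes the set
  defining \<open>\<beta>\<^sub>2\<close> bounded, and beyond it a global minimizer is not uniform,
  so the set defining \<open>\<beta>\<^sub>1\<close> is non-empty.\<close>

lemma global_minimizer_uniform_bound:
  assumes q: "2 \<le> q" and \<beta>: "0 < \<beta>"
    and g: "global_minimizer q (free_energy \<beta> q) (\<lambda>k\<in>{1..q}. 1 / real q)"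
  shows "\<beta> \<le> 4 * ln (real q)"
proof -
  have "free_energy \<beta> q (\<lambda>k\<in>{1..q}. 1 / real q) \<le> free_energy \<beta> q (spike q 1 1)"
    using g spike_in_simplex[OF q, of 1 1] q unfolding global_minimizer_def by auto
  also have "free_energy \<beta> q (spike q 1 1) = - 1 / 2"
    using q by (subst free_energy_spike) (auto simp: site_energy_def)
  finally have "1 / 2 - 1 / (2 * real q) \<le> ln (real q) / \<beta>"
    using free_energy_uniform[of q \<beta>] q by simp
  moreover have "1 / 4 \<le> 1 / 2 - 1 / (2 * real q)" using q by (simp add: field_simps)
  ultimately have "1 / 4 \<le> ln (real q) / \<beta>" by linarith
  then show ?thesis using \<beta> by (simp add: field_simps)
qed

text \<open>The infimum is approached from the set, so some \<beta>' below \<beta> has a local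
  minimizer that is not uniform; by the classification this is a spike and gives a nonzero solution
  of the mean-field equation.\<close>

lemma \<beta>\<^sub>1_less_obtains:
  assumes q: "2 \<le> q" and \<beta>: "\<beta>\<^sub>1 q < \<beta>"
  obtains \<beta>' s where "0 < \<beta>'" "\<beta>' < \<beta>" "0 < s" "s < 1" "log_ratio q s = \<beta>' * s"
proof -
  let ?X = "{\<beta>. 0 < \<beta> \<and> (\<exists>x. x \<noteq> (\<lambda>k\<in>{1..q}. 1 / real q) \<and> local_minimizer q (free_energy \<beta> q) x)}"
  have "?X \<noteq> {}"
  proof -
    define b where "b = 4 * ln (real q) + 1"
    have b: "0 < b" using q by (simp add: b_def add_nonneg_pos)
    have "1 \<le> q" using q by simp
    then obtain x where x: "global_minimizer q (free_energy b q) x" using global_minimizer_exists by blast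
    then have "x \<noteq> (\<lambda>k\<in>{1..q}. 1 / real q)"
      using global_minimizer_uniform_bound[OF q b] by (auto simp: b_def)
    then show ?thesis using b global_imp_local_minimizer[OF x] by blast
  qed
  moreover have "bdd_below ?X" by (auto intro!: bdd_belowI[of _ 0])
  ultimately obtain \<beta>' where b': "\<beta>' \<in> ?X" "\<beta>' < \<beta>"
    using \<beta> cInf_lessD[of ?X \<beta>] unfolding \<beta>\<^sub>1_def by blast
  then obtain x where x: "x \<noteq> (\<lambda>k\<in>{1..q}. 1 / real q)" "local_minimizer q (free_energy \<beta>' q) x" and "0 < \<beta>'" by blast
  with local_minimizer_cases[OF \<open>0 < \<beta>'\<close> q x(2)] b'(2) show thesis by (blast intro: that)
qed

text \<open>The gap decreases strictly in \<beta> at fixed s > 0, so a positive zero at a smaller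
  \<beta>' becomes a point of negative gap at \<beta>. Since the gap is positive near 1, the largest
  zero lies beyond that point.\<close>

lemma largest_s_pos:
  assumes q: "2 \<le> q" and \<beta>: "\<beta>\<^sub>1 q < \<beta>"
  shows "0 < \<beta>"
    and "\<exists>s'. 0 < s' \<and> s' < largest_s q \<beta> \<and> (\<forall>u. s' < u \<and> u < largest_s q \<beta> \<longrightarrow> log_gap q \<beta> u < 0)"
    and "\<And>u. largest_s q \<beta> < u \<Longrightarrow> u < 1 \<Longrightarrow> 0 < log_gap q \<beta> u"
proof -
  obtain \<beta>' s where s: "0 < \<beta>'" "\<beta>' < \<beta>" "0 < s" "s < 1" "log_ratio q s = \<beta>' * s"
    using \<beta>\<^sub>1_less_obtains[OF q \<beta>] by blast
  show b: "0 < \<beta>" using s by simp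
  note L = largest_s_props[OF q b]
  have sneg: "log_gap q \<beta> s < 0" using s by (simp add: log_gap_def)
  \<comment> \<open>The intermediate value theorem between \<open>a\<close> and a point near 1 where
    the gap is positive.\<close>
  have zero: "\<exists>z. a \<le> z \<and> z < 1 \<and> log_gap q \<beta> z = 0" if "0 \<le> a" "a < 1" "log_gap q \<beta> a \<le> 0" for a
  proof -
    define m where "m = max a (1 - exp (- \<beta>))"
    have m: "a \<le> m" "m < 1" using that by (auto simp: m_def)
    have "0 < log_gap q \<beta> m \<or> log_gap q \<beta> m = log_gap q \<beta> a"
      using log_gap_pos_near_1[OF q b, of m] m by (auto simp: m_def)
    then have "\<exists>z. a \<le> z \<and> z \<le> m \<and> log_gap q \<beta> z = 0"
    proof
      assume "0 < log_gap q \<beta> m"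
      then show ?thesis using that m
        by (intro IVT' log_gap_continuous q) auto
    next
      assume *: "log_gap q \<beta> m = log_gap q \<beta> a"
      have "0 < log_gap q \<beta> m" using log_gap_pos_near_1[OF q b, of m] m by (auto simp: m_def)
      with * that show ?thesis by simp
    qed
    then show ?thesis using m by force
  qed
  obtain z where z: "s \<le> z" "z < 1" "log_gap q \<beta> z = 0" using zero[of s] s sneg by auto
  have "s \<noteq> z" using z sneg by auto
  then have sl: "s < largest_s q \<beta>" using L(4)[of z] z s by auto
  have "log_gap q \<beta> u < 0" if "s < u" "u < largest_s q \<beta>" for u
    using log_gap_neg_between[OF q s(3) sl L(2) _ L(3) that] sneg by simp
  then show "\<exists>s'. 0 < s' \<and> s' < largest_s q \<beta> \<and> (\<forall>u. s' < u \<and> u < largest_s q \<beta> \<longrightarrow> log_gap q \<beta> u < 0)"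
    using s sl by blast
  show "0 < log_gap q \<beta> u" if u: "largest_s q \<beta> < u" "u < 1" for u
  proof (rule ccontr)
    assume "\<not> 0 < log_gap q \<beta> u"
    then have "log_gap q \<beta> u \<le> 0" "0 \<le> u" using u L(1) by auto
    then obtain z where "u \<le> z" "z < 1" "log_gap q \<beta> z = 0" using zero[of u] u by auto
    then show False using L(4)[of z] u L(1) by auto
  qed
qed

section \<open>Local minimality of the uniform vector and of the spikes\<close>

lemma site_energy_convex:
  assumes \<beta>: "0 < \<beta>"
  shows "convex_on {0<..1 / \<beta>} (site_energy \<beta>)"
proof (rule f''_ge0_imp_convex[where f'="\<lambda>u. (ln u + 1) / \<beta> - u" and f''="\<lambda>u. 1 / (\<beta> * u) - 1"])
  fix u assume u: "u \<in> {0<..1 / \<beta>}"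
  then show "(site_energy \<beta> has_real_derivative (ln u + 1) / \<beta> - u) (at u)" by (intro site_energy_deriv) auto
  have "((\<lambda>u. (ln u + 1) / \<beta> - u) has_real_derivative (1 / u) / \<beta> - 1) (at u)"
    using u by (auto intro!: derivative_eq_intros)
  then show "((\<lambda>u. (ln u + 1) / \<beta> - u) has_real_derivative 1 / (\<beta> * u) - 1) (at u)"
    by (simp add: mult.commute)
  show "0 \<le> 1 / (\<beta> * u) - 1" using u \<beta> by (simp add: field_simps)
qed (rule convex_real_interval)

lemma site_energy_jensen:
  assumes \<beta>: "0 < \<beta>" and K: "finite K" "K \<noteq> {}" and y: "\<And>k. k \<in> K \<Longrightarrow> 0 < y k \<and> y k \<le> 1 / \<beta>"
  shows "real (card K) * site_energy \<beta> ((\<Sum>k\<in>K. y k) / real (card K)) \<le> (\<Sum>k\<in>K. site_energy \<beta> (y k))"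
proof -
  have c: "0 < real (card K)" using K by (simp add: card_gt_0_iff)
  have "site_energy \<beta> (\<Sum>k\<in>K. (1 / real (card K)) *\<^sub>R y k) \<le> (\<Sum>k\<in>K. (1 / real (card K)) * site_energy \<beta> (y k))"
    using K c y by (intro convex_on_sum[OF K site_energy_convex[OF \<beta>]]) auto
  then have "site_energy \<beta> ((\<Sum>k\<in>K. y k) / real (card K)) \<le> (\<Sum>k\<in>K. site_energy \<beta> (y k)) / real (card K)"
    by (simp add: sum_divide_distrib[symmetric])
  then show ?thesis using c by (simp add: field_simps)
qed

text \<open>For \<beta> < q the common coordinate 1 / q lies below 1 / \<beta>, where the site
  energy is convex; Jensen's inequality then gives minimality among all vectors with coordinates in
  that region.\<close>

lemma local_minimizer_uniform:
  assumes q: "2 \<le> q" and \<beta>: "0 < \<beta>" "\<beta> < real q"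
  shows "local_minimizer q (free_energy \<beta> q) (minimizer q \<beta> 0)"
proof -
  define \<epsilon> where "\<epsilon> = min (1 / real q) (1 / \<beta> - 1 / real q)"
  have "1 / real q < 1 / \<beta>" using \<beta> q by (intro divide_strict_left_mono) auto
  then have e: "0 < \<epsilon>" using q by (simp add: \<epsilon>_def)
  have "free_energy \<beta> q (minimizer q \<beta> 0) \<le> free_energy \<beta> q y"
    if y: "y \<in> prob_simplex q" "near q \<epsilon> (minimizer q \<beta> 0) y" for y
  proof -
    have "0 < y k \<and> y k \<le> 1 / \<beta>" if "k \<in> {1..q}" for k
    proof -
      have "\<bar>1 / real q - y k\<bar> < \<epsilon>" using y(2) that by (simp add: near_def minimizer_def)
      then show ?thesis unfolding \<epsilon>_def by linarith
    qed
    from site_energy_jensen[where K="{1..q}" and y=y, OF \<beta>(1) _ _ this] q prob_simplexD(3)[OF y(1)]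
    have "real q * site_energy \<beta> (1 / real q) \<le> (\<Sum>k\<in>{1..q}. site_energy \<beta> (y k))" by simp
    then show ?thesis unfolding free_energy_eq by (simp add: minimizer_def)
  qed
  then show ?thesis unfolding local_minimizer_near
    using e uniform_in_simplex[of q] q by (auto simp: minimizer_def)
qed

text \<open>Jensen's inequality in the small coordinates shows that a nearby vector has no less
  energy than the spike with the same i-th coordinate. Along spikes the energy falls before
  \<open>largest_s\<close> and rises after it.\<close>

lemma local_minimizer_spike:
  assumes q: "2 \<le> q" and \<beta>: "\<beta>\<^sub>1 q < \<beta>" and i: "i \<in> {1..q}"
  shows "local_minimizer q (free_energy \<beta> q) (minimizer q \<beta> i)"
proof -
  note P = largest_s_pos[OF q \<beta>]
  note L = largest_s_props[OF q P(1)]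
  define s where "s = largest_s q \<beta>"
  from P(2) obtain s' where s': "0 < s'" "s' < s" "\<And>u. s' < u \<Longrightarrow> u < s \<Longrightarrow> log_gap q \<beta> u < 0"
    unfolding s_def by blast
  have s: "0 < s" "s < 1" using s' L by (auto simp: s_def)
  have q0: "1 \<le> real q" "0 < real q" "0 < real q - 1" using q by auto
  let ?a = "(1 - s) / real q" and ?b = "(1 + (real q - 1) * s) / real q"
  have mi: "minimizer q \<beta> i = spike q i s" using i by (simp add: minimizer_eq_spike s_def)
  have a0: "0 < ?a" using s q0 by simp
  have ab: "?a < ?b" using s q0 by (intro divide_strict_right_mono) (auto simp: algebra_simps)
  \<comment> \<open>Otherwise both values of the spike would lie where ln u - \<beta> u is strictly
    decreasing, and criticality could not hold.\<close>
  have aless: "?a < 1 / \<beta>"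
  proof (rule ccontr)
    assume "\<not> ?a < 1 / \<beta>"
    then have "ln ?b - \<beta> * ?b < ln ?a - \<beta> * ?a"
      using ln_minus_linear_strict_mono(2)[OF P(1) a0 ab] by simp
    moreover have "ln ?b - ln ?a = log_ratio q s"
    proof -
      have "0 < 1 + (real q - 1) * s" using q0 s by (intro add_pos_nonneg mult_nonneg_nonneg) auto
      then show ?thesis unfolding log_ratio_def using q0 s by (subst (1 2) ln_div) auto
    qed
    moreover have "\<beta> * ?b - \<beta> * ?a = \<beta> * s" using q0 by (simp add: field_simps)
    moreover have "log_ratio q s = \<beta> * s" using L(3) by (simp add: log_gap_def s_def)
    ultimately show False by linarith
  qed
  let ?f = "\<lambda>s. site_energy \<beta> ((1 + (real q - 1) * s) / real q) + (real q - 1) * site_energy \<beta> ((1 - s) / real q)"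
  have f_min: "?f s \<le> ?f u" if u: "s' < u" "u < 1" for u
  proof (cases u s rule: linorder_cases)
    case less
    have "\<exists>z. u < z \<and> z < s \<and> ?f s - ?f u = (s - u) * ((real q - 1) / real q * (log_ratio q z / \<beta> - z))"
      by (rule MVT2[OF less], rule spike_energy_deriv[OF q]) (use s s' u in auto)
    then obtain z where z: "u < z" "z < s" "?f s - ?f u = (s - u) * ((real q - 1) / real q * (log_ratio q z / \<beta> - z))"
      by blast
    have "log_ratio q z / \<beta> - z < 0" using s'(3)[of z] u z P(1) by (simp add: log_gap_def field_simps)
    then have "(s - u) * ((real q - 1) / real q * (log_ratio q z / \<beta> - z)) < 0"
      using less q0 by (intro mult_pos_neg) auto
    then show ?thesis using z by linarith
  next
    case greater
    have "\<exists>z. s < z \<and> z < u \<and> ?f u - ?f s = (u - s) * ((real q - 1) / real q * (log_ratio q z / \<beta> - z))"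
      by (rule MVT2[OF greater], rule spike_energy_deriv[OF q]) (use s s' u in auto)
    then obtain z where z: "s < z" "z < u" "?f u - ?f s = (u - s) * ((real q - 1) / real q * (log_ratio q z / \<beta> - z))"
      by blast
    have "0 < log_ratio q z / \<beta> - z" using P(3)[of z] u z P(1) by (simp add: s_def log_gap_def field_simps)
    then have "0 < (u - s) * ((real q - 1) / real q * (log_ratio q z / \<beta> - z))"
      using greater q0 by (intro mult_pos_pos) auto
    then show ?thesis using z by linarith
  qed simp
  \<comment> \<open>The first two terms keep the small coordinates in the convex region. A change of
    the i-th coordinate by \<epsilon> moves the spike parameter by at most q \<epsilon> / (q - 1)
    \<le> 2 \<epsilon>, so the third keeps it above s'.\<close>
  define \<epsilon> where "\<epsilon> = min (min ?a (1 / \<beta> - ?a)) (s - s') / 2"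
  have e: "0 < \<epsilon>" using a0 aless s' by (simp add: \<epsilon>_def)
  have e3: "\<epsilon> < ?a" "\<epsilon> < 1 / \<beta> - ?a" "2 * \<epsilon> \<le> s - s'"
  proof -
    define M where "M = min (min ?a (1 / \<beta> - ?a)) (s - s')"
    have "M \<le> ?a" "M \<le> 1 / \<beta> - ?a" "M \<le> s - s'" "\<epsilon> = M / 2" by (auto simp: M_def \<epsilon>_def)
    then show "\<epsilon> < ?a" "\<epsilon> < 1 / \<beta> - ?a" "2 * \<epsilon> \<le> s - s'" using e by linarith+
  qed
  have "free_energy \<beta> q (spike q i s) \<le> free_energy \<beta> q y"
    if y: "y \<in> prob_simplex q" "near q \<epsilon> (spike q i s) y" for y
  proof -
    have nr: "\<bar>spike q i s k - y k\<bar> < \<epsilon>" if "k \<in> {1..q}" for k using y(2) that by (simp add: near_def)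
    have yk: "0 < y k \<and> y k \<le> 1 / \<beta>" if "k \<in> {1..q} - {i}" for k
    proof -
      have "\<bar>?a - y k\<bar> < \<epsilon>" using nr[of k] that by (simp add: spike_def)
      then show ?thesis using e3 by linarith
    qed
    \<comment> \<open>Parameter of the spike whose i-th coordinate is \<open>y i\<close>.\<close>
    define u where "u = (real q * y i - 1) / (real q - 1)"
    have yi: "y i = (1 + (real q - 1) * u) / real q" using q0 by (simp add: u_def)
    have rest: "(\<Sum>k\<in>{1..q} - {i}. y k) = 1 - y i"
      using prob_simplexD(3)[OF y(1)] i sum.remove[of "{1..q}" i y] by simp
    have av: "(1 - y i) / (real q - 1) = (1 - u) / real q" using q0 by (simp add: u_def field_simps)
    have card: "real (card ({1..q} - {i})) = real q - 1" using i q by (simp add: of_nat_diff)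
    have ne: "{1..q} - {i} \<noteq> {}" using card q0 by (metis card.empty less_irrefl of_nat_0)
    have "(real q - 1) * site_energy \<beta> ((1 - u) / real q) \<le> (\<Sum>k\<in>{1..q} - {i}. site_energy \<beta> (y k))"
      using site_energy_jensen[where y=y, OF P(1) _ ne yk] unfolding card rest av by simp
    then have 1: "?f u \<le> free_energy \<beta> q y"
      unfolding free_energy_eq using i sum.remove[of "{1..q}" i "\<lambda>k. site_energy \<beta> (y k)"] yi by simp
    have "0 < (\<Sum>k\<in>{1..q} - {i}. y k)" using ne yk by (intro sum_pos) auto
    then have "u < 1" using rest q0 by (simp add: u_def field_simps)
    moreover have "s' < u"
    proof -
      have "\<bar>?b - y i\<bar> < \<epsilon>" using nr[OF i] i by (simp add: spike_def)
      then have "?b - \<epsilon> < y i" by linarith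
      then have "real q * (?b - \<epsilon>) < real q * y i" using q0 by simp
      then have "(1 + (real q - 1) * s) - real q * \<epsilon> < 1 + (real q - 1) * u"
        using q0 unfolding yi by (simp add: right_diff_distrib)
      then have "(real q - 1) * s - real q * \<epsilon> < (real q - 1) * u" by simp
      moreover have "real q * \<epsilon> \<le> (real q - 1) * (s - s')"
      proof -
        have "real q * \<epsilon> \<le> (2 * (real q - 1)) * \<epsilon>" using q e by (intro mult_right_mono) auto
        also have "\<dots> = (real q - 1) * (2 * \<epsilon>)" by simp
        also have "\<dots> \<le> (real q - 1) * (s - s')" using e3 q0 by (intro mult_left_mono) auto
        finally show ?thesis .
      qed
      ultimately have "(real q - 1) * s' < (real q - 1) * u" by (simp add: right_diff_distrib)
      then show ?thesis using q0 by simp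
    qed
    ultimately have "?f s \<le> ?f u" by (intro f_min)
    with 1 show ?thesis unfolding free_energy_spike[OF q i] by linarith
  qed
  then show ?thesis unfolding local_minimizer_near mi
    using e spike_in_simplex[OF q i, of s] s by auto
qed

lemma local_minimizer_is_minimizer:
  assumes q: "2 \<le> q" and \<beta>: "0 < \<beta>" and x: "local_minimizer q (free_energy \<beta> q) x"
  shows "\<exists>i\<le>q. x = minimizer q \<beta> i"
  using local_minimizer_cases[OF \<beta> q x]
proof
  assume "x = (\<lambda>k\<in>{1..q}. 1 / real q)"
  then show ?thesis by (auto simp: minimizer_def intro!: exI[of _ 0])
next
  assume "\<exists>i\<in>{1..q}. \<exists>s. 0 < s \<and> s < 1 \<and> log_ratio q s = \<beta> * s \<and> x = spike q i s"
  then obtain i s where i: "i \<in> {1..q}" and s: "0 < s" "s < 1" "log_ratio q s = \<beta> * s" and xs: "x = spike q i s" by blast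
  have "s = largest_s q \<beta>" using local_minimizer_spike_largest[OF \<beta> q i s] x xs by simp
  then have "x = minimizer q \<beta> i" using i xs by (simp add: minimizer_eq_spike)
  then show ?thesis using i by auto
qed

lemma minimizer_inj:
  assumes q: "2 \<le> q" and \<beta>: "\<beta>\<^sub>1 q < \<beta>" and ij: "i \<le> q" "j \<le> q" "minimizer q \<beta> i = minimizer q \<beta> j"
  shows "i = j"
proof (rule ccontr)
  have s: "0 < largest_s q \<beta>" using largest_s_pos(2)[OF q \<beta>] by force
  have ne: "(1 + (real q - 1) * largest_s q \<beta>) / real q \<noteq> (1 - largest_s q \<beta>) / real q"
    "(1 + (real q - 1) * largest_s q \<beta>) / real q \<noteq> 1 / real q"
    using q s by (auto simp: field_simps)
  have *: False if "i \<noteq> j" "i \<noteq> 0" "i \<le> q" "minimizer q \<beta> i = minimizer q \<beta> j" for i j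
  proof -
    have "minimizer q \<beta> i i = minimizer q \<beta> j i" using that by simp
    then show False using that ne by (auto simp: minimizer_def split: if_splits)
  qed
  assume "i \<noteq> j"
  then show False using *[of i j] *[of j i] ij by fastforce
qed

lemma free_energy_minimizer_eq:
  assumes "2 \<le> q" "i \<in> {1..q}" "j \<in> {1..q}"
  shows "free_energy \<beta> q (minimizer q \<beta> i) = free_energy \<beta> q (minimizer q \<beta> j)"
  using assms by (simp add: minimizer_eq_spike free_energy_spike)

text \<open>Above \<open>\<beta>\<^sub>2\<close> the uniform vector is not a global minimizer. A
  global minimizer exists and is local, hence some m_i with i > 0, and all of these have the same
  energy.\<close>

lemma free_energy_minimizer_less:
  assumes q: "2 \<le> q" and \<beta>: "0 < \<beta>" "\<beta>\<^sub>2 q < \<beta>"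
  shows "free_energy \<beta> q (minimizer q \<beta> 1) < free_energy \<beta> q (minimizer q \<beta> 0)"
proof -
  let ?u = "\<lambda>k\<in>{1..q}. 1 / real q"
  have m0: "minimizer q \<beta> 0 = ?u" by (simp add: minimizer_def)
  have "\<not> global_minimizer q (free_energy \<beta> q) ?u"
  proof
    assume "global_minimizer q (free_energy \<beta> q) ?u"
    then have "\<beta> \<le> \<beta>\<^sub>2 q" unfolding \<beta>\<^sub>2_def using \<beta> global_minimizer_uniform_bound[OF q]
      by (intro cSup_upper bdd_aboveI[of _ "4 * ln (real q)"]) auto
    with \<beta> show False by simp
  qed
  then obtain y where y: "y \<in> prob_simplex q" "free_energy \<beta> q y < free_energy \<beta> q ?u"
    using uniform_in_simplex[of q] q unfolding global_minimizer_def by force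
  have "1 \<le> q" using q by simp
  then obtain z where z: "global_minimizer q (free_energy \<beta> q) z" using global_minimizer_exists by blast
  then have zy: "free_energy \<beta> q z < free_energy \<beta> q ?u"
    using y unfolding global_minimizer_def by force
  obtain i where i: "i \<le> q" "z = minimizer q \<beta> i"
    using local_minimizer_is_minimizer[OF q \<beta>(1) global_imp_local_minimizer[OF z]] by auto
  then have "i \<noteq> 0" using zy m0 by (intro notI) simp
  then have "free_energy \<beta> q z = free_energy \<beta> q (minimizer q \<beta> 1)"
    using free_energy_minimizer_eq[OF q, of i 1] i q by auto
  with zy m0 show ?thesis by simp
qed

section \<open>Lattice profiles\<close>

definition profile :: "nat \<Rightarrow> nat \<Rightarrow> (nat \<Rightarrow> nat) \<Rightarrow> nat \<Rightarrow> real" where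
  "profile q N n = (\<lambda>k\<in>{1..q}. real (n k) / real N)"

lemma profile_in_simplex:
  assumes "1 \<le> N" "n \<in> comps q N"
  shows "profile q N n \<in> prob_simplex q"
proof (rule prob_simplexI)
  have "(\<Sum>k\<in>{1..q}. profile q N n k) = real (\<Sum>k\<in>{1..q}. n k) / real N"
    by (simp add: profile_def sum_divide_distrib)
  moreover have "(\<Sum>k\<in>{1..q}. n k) = N" using assms by (simp add: comps_def)
  ultimately show "(\<Sum>k\<in>{1..q}. profile q N n k) = 1" using assms(1) by (simp only:) simp
qed (auto simp: profile_def)

definition box_between :: "nat \<Rightarrow> (nat \<Rightarrow> nat) \<Rightarrow> (nat \<Rightarrow> nat) \<Rightarrow> (nat \<Rightarrow> nat) set" where
  "box_between q n n' = {z. \<forall>k\<in>{1..q}. min (n k) (n' k) \<le> z k \<and> z k \<le> max (n k) (n' k)}"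

definition moves :: "nat \<Rightarrow> nat \<Rightarrow> (nat \<Rightarrow> nat) set \<Rightarrow> ((nat \<Rightarrow> nat) \<times> (nat \<Rightarrow> nat)) set" where
  "moves q N Z = {(n, n'). n \<in> comps q N \<inter> Z \<and> n' \<in> comps q N \<inter> Z \<and>
     (\<exists>i\<in>{1..q}. \<exists>j\<in>{1..q}. i \<noteq> j \<and> 0 < n i \<and> n' = move i j n)}"

lemma moves_mono: "Z \<subseteq> Z' \<Longrightarrow> moves q N Z \<subseteq> moves q N Z'"
  by (auto simp: moves_def)

text \<open>Induction on the total excess over the target: while the two differ, some coordinate is
  above its target and another below, and moving one unit between them stays in the box.\<close>

lemma moves_box_between:
  assumes "n \<in> comps q N" "n' \<in> comps q N"
  shows "(n, n') \<in> (moves q N (box_between q n n'))\<^sup>*"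
  using assms(1)
proof (induction "\<Sum>k\<in>{1..q}. n k - n' k" arbitrary: n rule: less_induct)
  case less
  show ?case
  proof (cases "n = n'")
    case False
    have s: "(\<Sum>k\<in>{1..q}. n k) = (\<Sum>k\<in>{1..q}. n' k)" using less.prems assms(2) by (simp add: comps_def)
    obtain k where k: "k \<in> {1..q}" "n k \<noteq> n' k"
      using False less.prems assms(2) PiE_ext[of n "{1..q}" "\<lambda>_. UNIV" n'] by (auto simp: comps_def)
    have "\<exists>i\<in>{1..q}. n' i < n i"
    proof (rule ccontr)
      assume *: "\<not> ?thesis"
      then have "n k < n' k" using k by force
      with * have "(\<Sum>k\<in>{1..q}. n k) < (\<Sum>k\<in>{1..q}. n' k)"
        using k by (intro sum_strict_mono_ex1) (auto simp: not_less)
      with s show False by simp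
    qed
    then obtain i where i: "i \<in> {1..q}" "n' i < n i" by blast
    have "\<exists>j\<in>{1..q}. n j < n' j"
    proof (rule ccontr)
      assume *: "\<not> ?thesis"
      then have "n' k < n k" using k by force
      with * have "(\<Sum>k\<in>{1..q}. n' k) < (\<Sum>k\<in>{1..q}. n k)"
        using k by (intro sum_strict_mono_ex1) (auto simp: not_less)
      with s show False by simp
    qed
    then obtain j where j: "j \<in> {1..q}" "n j < n' j" by blast
    have ij: "i \<noteq> j" using i j by auto
    let ?m = "move i j n"
    have m: "?m \<in> comps q N" using i j ij by (intro move_in_comps less.prems) auto
    have "(\<Sum>k\<in>{1..q}. ?m k - n' k) < (\<Sum>k\<in>{1..q}. n k - n' k)"
      using i j ij by (intro sum_strict_mono_ex1) (auto simp: move_def intro!: bexI[of _ i])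
    from less.hyps[OF this m] have "(?m, n') \<in> (moves q N (box_between q ?m n'))\<^sup>*" .
    moreover have sub: "box_between q ?m n' \<subseteq> box_between q n n'"
    proof
      fix z assume z: "z \<in> box_between q ?m n'"
      have "min (n k) (n' k) \<le> z k \<and> z k \<le> max (n k) (n' k)" if "k \<in> {1..q}" for k
        using z that i j ij unfolding box_between_def move_def by (cases "k = i"; cases "k = j") fastforce+
      then show "z \<in> box_between q n n'" by (simp add: box_between_def)
    qed
    ultimately have "(?m, n') \<in> (moves q N (box_between q n n'))\<^sup>*"
      using rtrancl_mono[OF moves_mono[OF sub]] by blast
    moreover have "(n, ?m) \<in> moves q N (box_between q n n')"
    proof -
      have "?m \<in> box_between q n n'" using i j ij by (auto simp: box_between_def move_def)
      moreover have "n \<in> box_between q n n'" by (auto simp: box_between_def)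
      ultimately show ?thesis using less.prems m i j ij unfolding moves_def
        by (intro CollectI case_prodI conjI IntI bexI[of _ i] bexI[of _ j]) auto
    qed
    ultimately show ?thesis by (rule converse_rtrancl_into_rtrancl[rotated])
  qed simp
qed

section \<open>Sizes and weights of levels\<close>

lemma card_lev_move:
  assumes ij: "i \<in> {1..q}" "j \<in> {1..q}" "i \<noteq> j" and n: "0 < n i"
  shows "real (card (lev q N n)) * real (n i) = real (card (lev q N (move i j n))) * real (n j + 1)"
proof -
  have "card (lev_edges q N n i) = card (lev_edges q N (move i j n) j)"
    using bij_betw_same_card[OF lev_edges_flip_bij[where n=n and N=N, OF ij n]] .
  moreover have "real (card (lev_edges q N n i)) = real (n i) * real (card (lev q N n))"
    using sum_lev_edges[OF ij(1), of "\<lambda>_. 1" N n] by (simp add: case_prod_unfold)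
  moreover have "real (card (lev_edges q N (move i j n) j)) = real (n j + 1) * real (card (lev q N (move i j n)))"
    using sum_lev_edges[OF ij(2), of "\<lambda>_. 1" N "move i j n"] ij by (simp add: case_prod_unfold move_def)
  ultimately show ?thesis by (simp add: mult.commute)
qed

lemma prod_fact_move:
  assumes ij: "i \<in> {1..q}" "j \<in> {1..q}" "i \<noteq> j" and n: "0 < n i"
  shows "(\<Prod>k\<in>{1..q}. fact (move i j n k)) * real (n i) = (\<Prod>k\<in>{1..q}. fact (n k)) * real (n j + 1)"
proof -
  have s: "prod f {1..q} = f i * (f j * prod f ({1..q} - {i} - {j}))" for f :: "nat \<Rightarrow> real"
    using assms prod.remove[of "{1..q}" i f] prod.remove[of "{1..q} - {i}" j f] by simp
  have "(\<Prod>k\<in>{1..q} - {i} - {j}. fact (move i j n k)) = (\<Prod>k\<in>{1..q} - {i} - {j}. fact (n k) :: real)"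
    by (intro prod.cong) (auto simp: move_def)
  moreover have "fact (move i j n i) * real (n i) = fact (n i)"
    using n ij by (cases "n i") (auto simp: move_def mult.commute)
  moreover have "fact (move i j n j) = fact (n j) * real (n j + 1)"
    using ij by (simp add: move_def mult.commute)
  moreover have "a' * (b' * R') * d = a * (b * R) * e"
    if "R' = R" "a' * d = a" "b' = b * e" for a a' b b' R R' d e :: real
    unfolding that(1,3) that(2)[symmetric] by (simp only: mult_ac)
  ultimately show ?thesis
    unfolding s[of "\<lambda>k. fact (move i j n k)"] s[of "\<lambda>k. fact (n k)"] by blast
qed

text \<open>The multinomial coefficient without combinatorics: the product on the left is unchanged
  by a move, since both factors change by the same ratio, and moves connect every level to the
  one-colour level, which has a single configuration.\<close>

lemma card_lev:
  assumes q: "1 \<le> q" and n: "n \<in> comps q N"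
  shows "real (card (lev q N n)) * (\<Prod>k\<in>{1..q}. fact (n k)) = fact N"
proof -
  let ?G = "\<lambda>n. real (card (lev q N n)) * (\<Prod>k\<in>{1..q}. fact (n k))"
  let ?t = "\<lambda>k\<in>{1..q}. if k = 1 then N else 0"
  have t: "?t \<in> comps q N"
  proof -
    have "(\<Sum>k\<in>{1..q}. ?t k) = (\<Sum>k\<in>{1..q}. if k = 1 then N else 0)" by (intro sum.cong) auto
    then show ?thesis using q by (auto simp: comps_def)
  qed
  have step: "?G x = ?G y" if "(x, y) \<in> moves q N (box_between q n ?t)" for x y
  proof -
    from that obtain i j where ij: "i \<in> {1..q}" "j \<in> {1..q}" "i \<noteq> j" "0 < x i" "y = move i j x"
      by (auto simp: moves_def)
    have "?G y * (real (x i) * real (x j + 1))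
        = (real (card (lev q N y)) * real (x j + 1)) * ((\<Prod>k\<in>{1..q}. fact (y k)) * real (x i))"
      by (simp only: mult_ac)
    also have "\<dots> = (real (card (lev q N x)) * real (x i)) * ((\<Prod>k\<in>{1..q}. fact (x k)) * real (x j + 1))"
      using card_lev_move[OF ij(1-3), of x N] prod_fact_move[OF ij(1-3), of x] ij(4,5) by simp
    also have "\<dots> = ?G x * (real (x i) * real (x j + 1))" by (simp only: mult_ac)
    finally show ?thesis using ij(4) by simp
  qed
  have "?G n = ?G ?t" using moves_box_between[OF n t]
  proof (induction rule: rtrancl_induct)
    case (step y z)
    then show ?case using \<open>\<And>x y. (x, y) \<in> moves q N (box_between q n ?t) \<Longrightarrow> ?G x = ?G y\<close>[of y z] by simp
  qed simp
  also have "card (lev q N ?t) = 1"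
  proof -
    have c1: "(\<lambda>_\<in>{1..N}. 1) \<in> configs q N" using q by (auto simp: configs_def)
    have "lev q N ?t = {\<lambda>_\<in>{1..N}. 1}"
    proof (intro equalityI subsetI)
      fix \<sigma> assume \<sigma>: "\<sigma> \<in> lev q N ?t"
      then have "cnt N \<sigma> 1 = N" using q by (auto simp: lev_def)
      then have "{i \<in> {1..N}. \<sigma> i = 1} = {1..N}"
        unfolding cnt_def by (intro card_subset_eq) auto
      then have "\<sigma> = (\<lambda>_\<in>{1..N}. 1)"
        using \<sigma> c1 by (intro configs_eqI[of \<sigma> q N]) (auto simp: lev_def)
      then show "\<sigma> \<in> {\<lambda>_\<in>{1..N}. 1}" by simp
    next
      fix \<sigma> assume "\<sigma> \<in> {\<lambda>_\<in>{1..N}. 1::nat}"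
      then have \<sigma>: "\<sigma> = (\<lambda>_\<in>{1..N}. 1)" by simp
      have "{i \<in> {1..N}. \<sigma> i = k} = (if k = 1 then {1..N} else {})" for k unfolding \<sigma> by auto
      then have "cnt N \<sigma> k = (if k = 1 then N else 0)" for k by (simp add: cnt_def)
      then show "\<sigma> \<in> lev q N ?t" using c1 \<sigma> by (auto simp: lev_def)
    qed
    then show ?thesis by simp
  qed
  also have "(\<Prod>k\<in>{1..q}. fact (?t k)) = (\<Prod>k\<in>{1..q}. if k = 1 then fact N else (1::real))"
    by (intro prod.cong) auto
  finally show ?thesis using q by simp
qed

text \<open>Stirling's formula with a logarithmic error, by induction from ln x \<le> x - 1. The
  correction 2 ln (n + 1) is coarse enough for its increment to cover 1 / (n + 1) in the induction
  step.\<close>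

lemma ln_fact_bounds:
  shows "real n * ln (real n) - real n \<le> ln (fact n)"
    and "ln (fact n) \<le> real n * ln (real n) - real n + 2 * ln (real n + 1) + 1"
proof -
  have s: "ln (fact (Suc n)) = ln (real n + 1) + ln (fact n :: real)" for n
    by (simp add: ln_mult add.commute)
  show "real n * ln (real n) - real n \<le> ln (fact n)"
  proof (induction n)
    case (Suc n)
    have "real n * (ln (real n + 1) - ln (real n)) \<le> 1"
    proof (cases "n = 0")
      case False
      then have "ln ((real n + 1) / real n) \<le> (real n + 1) / real n - 1" by (intro ln_le_minus_one) auto
      then have "ln (real n + 1) - ln (real n) \<le> 1 / real n" using False by (simp add: ln_div field_simps)
      then have "real n * (ln (real n + 1) - ln (real n)) \<le> real n * (1 / real n)" by (intro mult_left_mono) auto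
      then show ?thesis using False by simp
    qed simp
    with Suc show ?case unfolding s by (simp add: algebra_simps)
  qed simp
  show "ln (fact n) \<le> real n * ln (real n) - real n + 2 * ln (real n + 1) + 1"
  proof (induction n)
    case (Suc n)
    have "1 \<le> real n * (ln (real n + 1) - ln (real n)) + 2 * (ln (real n + 2) - ln (real n + 1))"
    proof -
      have "ln ((real n + 1) / (real n + 2)) \<le> (real n + 1) / (real n + 2) - 1" by (intro ln_le_minus_one) auto
      also have "\<dots> = - 1 / (real n + 2)" by (simp add: field_simps)
      finally have 1: "1 / (real n + 2) \<le> ln (real n + 2) - ln (real n + 1)" by (simp add: ln_div)
      have 2: "real n * (1 / (real n + 1)) \<le> real n * (ln (real n + 1) - ln (real n))"
      proof (cases "n = 0")
        case False
        then have "ln (real n / (real n + 1)) \<le> real n / (real n + 1) - 1" by (intro ln_le_minus_one) auto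
        also have "\<dots> = - 1 / (real n + 1)" by (simp add: field_simps)
        finally have "1 / (real n + 1) \<le> ln (real n + 1) - ln (real n)" using False by (simp add: ln_div)
        then show ?thesis by (intro mult_left_mono) auto
      qed simp
      have "1 / (real n + 1) \<le> 2 * (1 / (real n + 2))" by (simp add: field_simps)
      moreover have "real n * (1 / (real n + 1)) = 1 - 1 / (real n + 1)" by (simp add: field_simps)
      ultimately have "1 \<le> real n * (1 / (real n + 1)) + 2 * (1 / (real n + 2))" by linarith
      also have "\<dots> \<le> real n * (ln (real n + 1) - ln (real n)) + 2 * (ln (real n + 2) - ln (real n + 1))"
        using 1 2 by (intro add_mono) auto
      finally show ?thesis .
    qed
    with Suc show ?case unfolding s by (simp add: algebra_simps)
  qed simp
qed

text \<open>The sum of squares counts ordered pairs of sites of equal colour: each unordered pair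
  twice, and the N diagonal pairs once.\<close>

lemma sum_pairs_eq:
  fixes \<sigma> :: config
  assumes "\<sigma> \<in> lev q N n"
  shows "2 * (\<Sum>(i, j) \<in> {(i, j). 1 \<le> i \<and> i < j \<and> j \<le> N}. of_bool (\<sigma> i = \<sigma> j)) + real N
    = (\<Sum>k\<in>{1..q}. (real (n k))\<^sup>2)"
proof -
  let ?P = "{(i, j). 1 \<le> i \<and> i < j \<and> j \<le> N}"
  let ?Q = "{(i, j). 1 \<le> j \<and> j < i \<and> i \<le> N}"
  let ?D = "(\<lambda>i. (i, i)) ` {1..N}"
  let ?g = "\<lambda>(i, j). of_bool (\<sigma> i = \<sigma> j) :: real"
  have fin: "finite ?P" "finite ?Q" "finite ?D"
    by (auto intro: finite_subset[of _ "{1..N} \<times> {1..N}"])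
  have "{1..N} \<times> {1..N} = (?P \<union> ?Q) \<union> ?D" by auto
  then have "(\<Sum>x\<in>{1..N} \<times> {1..N}. ?g x) = (\<Sum>x\<in>?P \<union> ?Q. ?g x) + (\<Sum>x\<in>?D. ?g x)"
    using fin by (simp only:) (intro sum.union_disjoint, auto)
  also have "(\<Sum>x\<in>?P \<union> ?Q. ?g x) = (\<Sum>x\<in>?P. ?g x) + (\<Sum>x\<in>?Q. ?g x)"
    using fin by (intro sum.union_disjoint) auto
  also have "(\<Sum>x\<in>?Q. ?g x) = (\<Sum>x\<in>?P. ?g x)"
    by (rule sum.reindex_bij_witness[of _ prod.swap prod.swap]) (auto simp: eq_commute)
  also have "(\<Sum>x\<in>?D. ?g x) = real N" by (subst sum.reindex) (auto intro: inj_onI)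
  finally have 1: "(\<Sum>x\<in>{1..N} \<times> {1..N}. ?g x) = 2 * (\<Sum>x\<in>?P. ?g x) + real N" by simp
  have \<sigma>: "\<sigma> \<in> configs q N" "\<And>k. k \<in> {1..q} \<Longrightarrow> cnt N \<sigma> k = n k" using assms by (auto simp: lev_def)
  have "(\<Sum>k\<in>{1..q}. (real (n k))\<^sup>2) = (\<Sum>k\<in>{1..q}. \<Sum>i\<in>{1..N}. \<Sum>j\<in>{1..N}. of_bool (\<sigma> i = k) * of_bool (\<sigma> j = k))"
  proof (rule sum.cong[OF refl])
    fix k assume k: "k \<in> {1..q}"
    have "real (n k) = (\<Sum>i\<in>{1..N}. of_bool (\<sigma> i = k))"
      using \<sigma>(2)[OF k] by (simp add: cnt_def Int_def)
    then have "(real (n k))\<^sup>2 = (\<Sum>i\<in>{1..N}. of_bool (\<sigma> i = k)) * (\<Sum>j\<in>{1..N}. of_bool (\<sigma> j = k))"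
      by (simp only: power2_eq_square)
    then show "(real (n k))\<^sup>2 = (\<Sum>i\<in>{1..N}. \<Sum>j\<in>{1..N}. of_bool (\<sigma> i = k) * of_bool (\<sigma> j = k))"
      by (simp only: sum_product)
  qed
  also have "\<dots> = (\<Sum>i\<in>{1..N}. \<Sum>j\<in>{1..N}. \<Sum>k\<in>{1..q}. of_bool (\<sigma> i = k) * of_bool (\<sigma> j = k))"
    by (subst sum.swap, rule sum.cong[OF refl], rule sum.swap)
  also have "\<dots> = (\<Sum>i\<in>{1..N}. \<Sum>j\<in>{1..N}. of_bool (\<sigma> i = \<sigma> j))"
  proof (intro sum.cong refl)
    fix i j assume "i \<in> {1..N}" "j \<in> {1..N}"
    then have "\<sigma> i \<in> {1..q}" using \<sigma>(1) unfolding configs_def by blast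
    have "(\<Sum>k\<in>{1..q}. of_bool (\<sigma> i = k) * of_bool (\<sigma> j = k)) = (\<Sum>k\<in>{1..q}. if k = \<sigma> i then of_bool (\<sigma> j = \<sigma> i) else (0::real))"
      by (intro sum.cong) auto
    also have "\<dots> = of_bool (\<sigma> j = \<sigma> i)" using \<open>\<sigma> i \<in> {1..q}\<close> by simp
    also have "\<dots> = of_bool (\<sigma> i = \<sigma> j)" by (rule arg_cong[where f=of_bool], rule eq_commute)
    finally show "(\<Sum>k\<in>{1..q}. of_bool (\<sigma> i = k) * of_bool (\<sigma> j = k)) = (of_bool (\<sigma> i = \<sigma> j) :: real)" .
  qed
  also have "\<dots> = (\<Sum>x\<in>{1..N} \<times> {1..N}. ?g x)" by (simp only: sum.cartesian_product)
  finally show ?thesis using 1 by simp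
qed

definition cw_weight :: "nat \<Rightarrow> real \<Rightarrow> config \<Rightarrow> real" where
  "cw_weight N \<beta> \<sigma> = exp (- \<beta> * hamiltonian N (\<lambda>_ _. 1) \<sigma>)"

lemma cw_weight_lev:
  assumes N: "1 \<le> N" and \<sigma>: "\<sigma> \<in> lev q N n"
  shows "cw_weight N \<beta> \<sigma> = exp (\<beta> * real N * (\<Sum>k\<in>{1..q}. (profile q N n k)\<^sup>2) / 2 - \<beta> / 2)"
proof -
  define E where "E = (\<Sum>(i, j) \<in> {(i, j). 1 \<le> i \<and> i < j \<and> j \<le> N}. of_bool (\<sigma> i = \<sigma> j) :: real)"
  define Q where "Q = (\<Sum>k\<in>{1..q}. (profile q N n k)\<^sup>2)"
  have EQ: "2 * E + real N = (\<Sum>k\<in>{1..q}. (real (n k))\<^sup>2)"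
    unfolding E_def by (rule sum_pairs_eq[OF \<sigma>])
  have "Q = (\<Sum>k\<in>{1..q}. (real (n k))\<^sup>2) / (real N)\<^sup>2"
    unfolding sum_divide_distrib Q_def by (intro sum.cong) (auto simp: profile_def power_divide)
  then have "real N * Q / 2 = (2 * E + real N) / (2 * real N)"
    using N unfolding EQ by (simp add: power2_eq_square)
  then have "real N * Q / 2 - 1 / 2 = 1 / real N * E"
    using N by (simp add: add_divide_distrib)
  moreover have "hamiltonian N (\<lambda>_ _. 1) \<sigma> = - (1 / real N) * E"
    unfolding hamiltonian_def E_def by simp
  ultimately have "- \<beta> * hamiltonian N (\<lambda>_ _. 1) \<sigma> = \<beta> * (real N * Q / 2 - 1 / 2)"
    by (simp only:)
  then show ?thesis unfolding cw_weight_def Q_def[symmetric] by (simp add: algebra_simps)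
qed

lemma ln_card_lev_bounds:
  assumes q: "1 \<le> q" and N: "1 \<le> N" and n: "n \<in> comps q N"
  shows "lev q N n \<noteq> {}"
    and "\<bar>ln (real (card (lev q N n))) + real N * (\<Sum>k\<in>{1..q}. profile q N n k * ln (profile q N n k))\<bar>
      \<le> real q * (2 * ln (real N + 1) + 1)"
proof -
  have c: "real (card (lev q N n)) * (\<Prod>k\<in>{1..q}. fact (n k)) = fact N" by (rule card_lev[OF q n])
  have pp: "0 < (\<Prod>k\<in>{1..q}. fact (n k) :: real)" by (intro prod_pos) auto
  show ne: "lev q N n \<noteq> {}" using c by auto
  then have cp: "0 < real (card (lev q N n))" using finite_lev by (simp add: card_gt_0_iff)
  have "ln (real (card (lev q N n))) + ln (\<Prod>k\<in>{1..q}. fact (n k) :: real) = ln (fact N)"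
    using cp pp unfolding c[symmetric] by (rule ln_mult_pos[symmetric])
  moreover have "ln (\<Prod>k\<in>{1..q}. fact (n k) :: real) = (\<Sum>k\<in>{1..q}. ln (fact (n k)))"
    by (intro ln_prod) auto
  ultimately have L: "ln (real (card (lev q N n))) = ln (fact N) - (\<Sum>k\<in>{1..q}. ln (fact (n k)))" by simp
  have "(\<Sum>k\<in>{1..q}. n k) = N" using n by (simp add: comps_def)
  from arg_cong[OF this, of real] have s: "(\<Sum>k\<in>{1..q}. real (n k)) = real N" by simp
  have e: "real N * (\<Sum>k\<in>{1..q}. profile q N n k * ln (profile q N n k))
      = (\<Sum>k\<in>{1..q}. real (n k) * ln (real (n k))) - real N * ln (real N)"
  proof -
    have "real N * (\<Sum>k\<in>{1..q}. profile q N n k * ln (profile q N n k))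
        = (\<Sum>k\<in>{1..q}. real (n k) * ln (real (n k)) - real (n k) * ln (real N))"
      unfolding sum_distrib_left
    proof (intro sum.cong refl)
      fix k assume "k \<in> {1..q}"
      then show "real N * (profile q N n k * ln (profile q N n k)) = real (n k) * ln (real (n k)) - real (n k) * ln (real N)"
        using N by (cases "n k = 0") (auto simp: profile_def ln_div right_diff_distrib)
    qed
    then show ?thesis by (simp only: sum_subtractf sum_distrib_right[symmetric] s)
  qed
  have lo: "(\<Sum>k\<in>{1..q}. real (n k) * ln (real (n k)) - real (n k)) \<le> (\<Sum>k\<in>{1..q}. ln (fact (n k)))"
    by (intro sum_mono ln_fact_bounds(1))
  have up: "(\<Sum>k\<in>{1..q}. ln (fact (n k)))
      \<le> (\<Sum>k\<in>{1..q}. real (n k) * ln (real (n k)) - real (n k) + (2 * ln (real N + 1) + 1))"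
  proof (rule sum_mono)
    fix k assume "k \<in> {1..q}"
    then have "ln (real (n k) + 1) \<le> ln (real N + 1)" using comps_le[OF n] by (subst ln_le_cancel_iff) auto
    then show "ln (fact (n k)) \<le> real (n k) * ln (real (n k)) - real (n k) + (2 * ln (real N + 1) + 1)"
      using ln_fact_bounds(2)[of "n k"] by linarith
  qed
  have lo': "(\<Sum>k\<in>{1..q}. real (n k) * ln (real (n k))) - real N \<le> (\<Sum>k\<in>{1..q}. ln (fact (n k)))"
    using lo unfolding sum_subtractf s .
  have up': "(\<Sum>k\<in>{1..q}. ln (fact (n k))) \<le> (\<Sum>k\<in>{1..q}. real (n k) * ln (real (n k))) - real N
      + real q * (2 * ln (real N + 1) + 1)"
    using up unfolding sum.distrib sum_subtractf s by (simp add: distrib_left)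
  have "0 \<le> 2 * ln (real N + 1) + 1" by (simp add: add_nonneg_nonneg)
  then have "1 * (2 * ln (real N + 1) + 1) \<le> real q * (2 * ln (real N + 1) + 1)"
    using q by (intro mult_right_mono) auto
  moreover have "\<bar>a - b + (c - d)\<bar> \<le> E"
    if "1 * e \<le> E" "d - M \<le> a" "a \<le> d - M + e" "c - M \<le> b" "b \<le> c - M + E" for a b c d e E M :: real
    using that by linarith
  ultimately show "\<bar>ln (real (card (lev q N n))) + real N * (\<Sum>k\<in>{1..q}. profile q N n k * ln (profile q N n k))\<bar>
      \<le> real q * (2 * ln (real N + 1) + 1)"
    using ln_fact_bounds[of N] lo' up' unfolding L e add.assoc by blast
qed

text \<open>Logarithmic in N, hence a polynomial factor after exponentiation. The first summand is
  the Stirling error, the second the diagonal term of the Hamiltonian.\<close>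

definition entropy_error :: "nat \<Rightarrow> real \<Rightarrow> nat \<Rightarrow> real" where
  "entropy_error q \<beta> N = real q * (2 * ln (real N + 1) + 1) + \<beta> / 2"

lemma lev_weight_bounds:
  assumes q: "1 \<le> q" and N: "1 \<le> N" and n: "n \<in> comps q N" and \<beta>: "0 < \<beta>"
  shows "exp (- \<beta> * real N * free_energy \<beta> q (profile q N n) - entropy_error q \<beta> N) \<le> sum (cw_weight N \<beta>) (lev q N n)"
    and "sum (cw_weight N \<beta>) (lev q N n) \<le> exp (- \<beta> * real N * free_energy \<beta> q (profile q N n) + entropy_error q \<beta> N)"
proof -
  let ?S = "\<Sum>k\<in>{1..q}. (profile q N n k)\<^sup>2" and ?L = "\<Sum>k\<in>{1..q}. profile q N n k * ln (profile q N n k)"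
  let ?c = "real (card (lev q N n))"
  note B = ln_card_lev_bounds[OF q N n]
  have cp: "0 < ?c" using B(1) finite_lev by (simp add: card_gt_0_iff)
  have "sum (cw_weight N \<beta>) (lev q N n) = ?c * exp (\<beta> * real N * ?S / 2 - \<beta> / 2)"
    using cw_weight_lev[OF N] by simp
  also have "\<dots> = exp (ln ?c + (\<beta> * real N * ?S / 2 - \<beta> / 2))" using cp by (simp only: exp_add exp_ln)
  finally have W: "sum (cw_weight N \<beta>) (lev q N n) = exp (ln ?c + (\<beta> * real N * ?S / 2 - \<beta> / 2))" .
  have F: "- \<beta> * real N * free_energy \<beta> q (profile q N n) = \<beta> * real N * ?S / 2 - real N * ?L"
  proof -
    have "\<beta> * free_energy \<beta> q (profile q N n) = - \<beta> * ?S / 2 + ?L"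
      using \<beta> unfolding free_energy_def L2_set_def
      by (simp add: sum_nonneg distrib_left right_diff_distrib)
    then have "- real N * (\<beta> * free_energy \<beta> q (profile q N n)) = - real N * (- \<beta> * ?S / 2 + ?L)" by simp
    then show ?thesis by (simp add: algebra_simps)
  qed
  show "exp (- \<beta> * real N * free_energy \<beta> q (profile q N n) - entropy_error q \<beta> N) \<le> sum (cw_weight N \<beta>) (lev q N n)"
    "sum (cw_weight N \<beta>) (lev q N n) \<le> exp (- \<beta> * real N * free_energy \<beta> q (profile q N n) + entropy_error q \<beta> N)"
    unfolding W F exp_le_cancel_iff entropy_error_def using B(2) \<beta> by (auto simp: abs_le_iff)
qed

section \<open>Passing between the simplex and the lattice\<close>

lemma lattice_approx:
  assumes q: "1 \<le> q" and N: "1 \<le> N" and x: "x \<in> prob_simplex q"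
  obtains n where "n \<in> comps q N" "\<And>k. k \<in> {1..q} \<Longrightarrow> \<bar>profile q N n k - x k\<bar> \<le> real q / real N"
proof -
  define f where "f k = nat \<lfloor>real N * x k\<rfloor>" for k
  have xk: "0 \<le> real N * x k" if "k \<in> {1..q}" for k using prob_simplexD(1)[OF x that] by simp
  have f1: "real (f k) \<le> real N * x k" if "k \<in> {1..q}" for k
    using xk[OF that] unfolding f_def by linarith
  have f2: "real N * x k < real (f k) + 1" if "k \<in> {1..q}" for k
    using xk[OF that] unfolding f_def by linarith
  \<comment> \<open>The units lost by rounding all coordinates down, at most q of them; they are put
    into coordinate 1.\<close>
  define g where "g = N - (\<Sum>k\<in>{1..q}. f k)"
  have "(\<Sum>k\<in>{1..q}. real (f k)) \<le> (\<Sum>k\<in>{1..q}. real N * x k)" by (intro sum_mono f1)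
  also have "\<dots> = real N" using prob_simplexD(3)[OF x] by (simp flip: sum_distrib_left)
  finally have "real (\<Sum>k\<in>{1..q}. f k) \<le> real N" by simp
  then have le: "(\<Sum>k\<in>{1..q}. f k) \<le> N" by (simp only: of_nat_le_iff)
  have "real N = (\<Sum>k\<in>{1..q}. real N * x k)" using prob_simplexD(3)[OF x] by (simp flip: sum_distrib_left)
  also have "\<dots> \<le> (\<Sum>k\<in>{1..q}. real (f k) + 1)" using f2 by (intro sum_mono less_imp_le)
  also have "\<dots> = real (\<Sum>k\<in>{1..q}. f k) + real q" by (simp add: sum.distrib)
  finally have g: "real g \<le> real q" using le by (simp add: g_def of_nat_diff)
  let ?n = "\<lambda>k\<in>{1..q}. if k = 1 then f 1 + g else f k"
  have "(\<Sum>k\<in>{1..q}. ?n k) = (\<Sum>k\<in>{1..q}. f k + (if k = 1 then g else 0))"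
    by (intro sum.cong) auto
  also have "\<dots> = (\<Sum>k\<in>{1..q}. f k) + g" using q by (simp add: sum.distrib)
  also have "\<dots> = N" using le by (simp add: g_def)
  finally have n: "?n \<in> comps q N" by (auto simp: comps_def)
  show thesis
  proof (rule that[OF n])
    fix k assume k: "k \<in> {1..q}"
    have "\<bar>real (?n k) - real N * x k\<bar> \<le> real q"
      using f1[OF k] f2[OF k] g q k by auto
    then have "\<bar>real (?n k) - real N * x k\<bar> / real N \<le> real q / real N" by (intro divide_right_mono) auto
    moreover have "profile q N ?n k - x k = (real (?n k) - real N * x k) / real N"
      using N k unfolding profile_def by (simp add: diff_divide_distrib)
    then have "\<bar>real (?n k) - real N * x k\<bar> / real N = \<bar>profile q N ?n k - x k\<bar>"
      by (simp only: abs_divide)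
    ultimately show "\<bar>profile q N ?n k - x k\<bar> \<le> real q / real N" by simp
  qed
qed

lemma lattice_simplex_eq:
  assumes N: "1 \<le> N"
  shows "lattice_simplex q N = profile q N ` comps q N"
proof (intro equalityI subsetI)
  fix x assume "x \<in> lattice_simplex q N"
  then have x: "x \<in> prob_simplex q" and "\<forall>k\<in>{1..q}. \<exists>n::nat. x k = real n / real N"
    by (auto simp: lattice_simplex_def)
  then obtain n where n: "\<forall>k\<in>{1..q}. x k = real (n k) / real N" using bchoice by metis
  have "(\<Sum>k\<in>{1..q}. real (n k) / real N) = 1" using prob_simplexD(3)[OF x] n by simp
  then have "real (\<Sum>k\<in>{1..q}. n k) = real N" using N by (simp flip: sum_divide_distrib)
  then have "(\<Sum>k\<in>{1..q}. n k) = N" by (simp only: of_nat_eq_iff)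
  then have "restrict n {1..q} \<in> comps q N" by (simp add: comps_def)
  moreover have "x = profile q N (restrict n {1..q})"
    using n prob_simplexD(4)[OF x] by (intro extensionalityI[of _ "{1..q}"]) (auto simp: profile_def)
  ultimately show "x \<in> profile q N ` comps q N" by blast
qed (auto simp: lattice_simplex_def profile_in_simplex[OF N], auto simp: profile_def)

lemma level_set_profile:
  assumes N: "1 \<le> N"
  shows "level_set q N (profile q N n) = lev q N n"
proof -
  have "empirical q N \<sigma> = profile q N n \<longleftrightarrow> (\<forall>k\<in>{1..q}. cnt N \<sigma> k = n k)" for \<sigma>
  proof -
    have "empirical q N \<sigma> = profile q N (cnt N \<sigma>)"
      unfolding empirical_def profile_def cnt_def by (rule restrict_ext) (simp add: Int_def)
    moreover have "profile q N (cnt N \<sigma>) = profile q N n \<longleftrightarrow> (\<forall>k\<in>{1..q}. cnt N \<sigma> k = n k)"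
    proof
      assume e: "profile q N (cnt N \<sigma>) = profile q N n"
      show "\<forall>k\<in>{1..q}. cnt N \<sigma> k = n k"
      proof
        fix k assume "k \<in> {1..q}"
        then show "cnt N \<sigma> k = n k" using fun_cong[OF e, of k] N by (simp add: profile_def)
      qed
    qed (auto simp: profile_def intro!: restrict_ext)
    ultimately show ?thesis by simp
  qed
  then show ?thesis by (auto simp: level_set_def lev_def)
qed

text \<open>A closest point is at least as close as the rounded point of
  \<open>lattice_approx\<close>; bounding the Euclidean distance by the sum of the coordinate errors
  yields q^2 / N.\<close>

lemma closest_lattice_point_obtains:
  assumes q: "1 \<le> q" and N: "1 \<le> N" and x: "x \<in> prob_simplex q" and m: "closest_lattice_point q N x y"
  obtains n where "n \<in> comps q N" "y = profile q N n" "\<And>k. k \<in> {1..q} \<Longrightarrow> \<bar>profile q N n k - x k\<bar> \<le> (real q)\<^sup>2 / real N"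
proof -
  have y: "y \<in> lattice_simplex q N"
    and min: "\<And>z. z \<in> lattice_simplex q N \<Longrightarrow> L2_set (\<lambda>k. y k - x k) {1..q} \<le> L2_set (\<lambda>k. z k - x k) {1..q}"
    using m unfolding closest_lattice_point_def is_arg_min_def by (auto simp: not_less)
  then obtain n where n: "n \<in> comps q N" "y = profile q N n" unfolding lattice_simplex_eq[OF N] by auto
  obtain n' where n': "n' \<in> comps q N" "\<And>k. k \<in> {1..q} \<Longrightarrow> \<bar>profile q N n' k - x k\<bar> \<le> real q / real N"
    using lattice_approx[OF q N x] by blast
  show thesis
  proof (rule that[OF n])
    fix k assume k: "k \<in> {1..q}"
    have "\<bar>y k - x k\<bar> \<le> L2_set (\<lambda>k. \<bar>y k - x k\<bar>) {1..q}" using k by (intro member_le_L2_set) auto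
    also have "\<dots> = L2_set (\<lambda>k. y k - x k) {1..q}" by (simp add: L2_set_def)
    also have "\<dots> \<le> L2_set (\<lambda>k. profile q N n' k - x k) {1..q}"
      using n'(1) by (intro min) (simp add: lattice_simplex_eq[OF N])
    also have "\<dots> \<le> (\<Sum>k\<in>{1..q}. \<bar>profile q N n' k - x k\<bar>)" by (rule L2_set_le_sum_abs)
    also have "\<dots> \<le> (\<Sum>k\<in>{1..q}. real q / real N)" by (intro sum_mono n'(2))
    also have "\<dots> = (real q)\<^sup>2 / real N" by (simp add: power2_eq_square)
    finally show "\<bar>profile q N n k - x k\<bar> \<le> (real q)\<^sup>2 / real N" using n(2) by simp
  qed
qed

lemma moves_path_near:
  assumes N: "1 \<le> N" and n: "n \<in> comps q N" "n' \<in> comps q N" and nr: "near q r (profile q N n) (profile q N n')"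
    and Z: "\<And>z. z \<in> comps q N \<Longrightarrow> near q r (profile q N n) (profile q N z) \<Longrightarrow> z \<in> Z"
  shows "(n, n') \<in> (moves q N Z)\<^sup>*"
proof -
  have "z \<in> Z" if z: "z \<in> comps q N" "z \<in> box_between q n n'" for z
  proof (rule Z[OF z(1)])
    show "near q r (profile q N n) (profile q N z)"
      unfolding near_def
    proof
      fix k assume k: "k \<in> {1..q}"
      have "min (n k) (n' k) \<le> z k" "z k \<le> max (n k) (n' k)"
        using z(2) k by (simp_all add: box_between_def)
      then have "\<bar>real (n k) - real (z k)\<bar> \<le> \<bar>real (n k) - real (n' k)\<bar>"
        by (auto simp: min_def max_def split: if_splits)
      then have "\<bar>(real (n k) - real (z k)) / real N\<bar> \<le> \<bar>(real (n k) - real (n' k)) / real N\<bar>"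
        by (simp add: abs_divide divide_right_mono)
      moreover have "\<bar>profile q N n k - profile q N n' k\<bar> < r" using nr k by (simp add: near_def)
      ultimately show "\<bar>profile q N n k - profile q N z k\<bar> < r"
        using k by (simp add: profile_def diff_divide_distrib)
    qed
  qed
  then have "moves q N (box_between q n n') \<subseteq> moves q N Z" unfolding moves_def by blast
  then show ?thesis using moves_box_between[OF n] rtrancl_mono by blast
qed

section \<open>Compactness arguments for the landscape\<close>

lemma finite_uniform_positive:
  fixes P :: "'i \<Rightarrow> real \<Rightarrow> bool"
  assumes "finite I" and "\<And>i. i \<in> I \<Longrightarrow> \<exists>d>0. P i d"
    and mono: "\<And>i d d'. P i d \<Longrightarrow> 0 < d' \<Longrightarrow> d' \<le> d \<Longrightarrow> P i d'"
  shows "\<exists>d>0. \<forall>i\<in>I. P i d"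
  using assms(1,2)
proof (induction I rule: finite_induct)
  case (insert i I)
  then obtain d d' where "0 < d" "\<forall>i\<in>I. P i d" "0 < d'" "P i d'" by (meson insertCI)
  then show ?case using mono by (intro exI[of _ "min d d'"]) (auto intro: mono)
qed (auto intro: exI[of _ 1])

lemma near_mono: "near q r x y \<Longrightarrow> r \<le> r' \<Longrightarrow> near q r' x y"
  by (auto simp: near_def)

lemma near_triangle: "near q r x y \<Longrightarrow> near q s y z \<Longrightarrow> near q (r + s) x z"
  unfolding near_def by (smt (verit))

lemma near_commute: "near q r x y \<longleftrightarrow> near q r y x"
  by (simp add: near_def abs_minus_commute)

lemma eventually_near:
  assumes "\<And>k. k \<in> {1..q} \<Longrightarrow> (\<lambda>n. X n k) \<longlonglongrightarrow> x k" "0 < r"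
  shows "eventually (\<lambda>n. near q r (X n) x) sequentially"
  unfolding near_def
proof (rule eventually_ball_finite)
  show "\<forall>k\<in>{1..q}. eventually (\<lambda>n. \<bar>X n k - x k\<bar> < r) sequentially"
    using tendstoD[OF assms(1) assms(2)] by (auto simp: dist_real_def)
qed simp

text \<open>Otherwise there are counterexamples for arbitrarily large N. A limit point of them is a
  local minimizer of the continuous energy because the radius r does not shrink with N, so it is one
  of the m_i, contrary to the distance \<rho>.\<close>

lemma lattice_local_minimum_near:
  assumes q: "2 \<le> q" and \<beta>: "0 < \<beta>" and \<rho>: "0 < \<rho>" and r: "0 < r"
  shows "\<exists>N0. \<forall>N\<ge>N0. \<forall>y\<in>comps q N.
    (\<forall>z\<in>comps q N. near q r (profile q N y) (profile q N z) \<longrightarrow>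
      free_energy \<beta> q (profile q N y) \<le> free_energy \<beta> q (profile q N z)) \<longrightarrow>
    (\<exists>i\<le>q. near q \<rho> (minimizer q \<beta> i) (profile q N y))"
proof (rule ccontr)
  let ?F = "free_energy \<beta> q"
  let ?Q = "\<lambda>N y. y \<in> comps q N \<and> (\<forall>z\<in>comps q N. near q r (profile q N y) (profile q N z) \<longrightarrow>
      ?F (profile q N y) \<le> ?F (profile q N z)) \<and> \<not> (\<exists>i\<le>q. near q \<rho> (minimizer q \<beta> i) (profile q N y))"
  assume "\<not> ?thesis"
  then have "\<forall>n. \<exists>N y. Suc n \<le> N \<and> ?Q N y" by blast
  then obtain f Y where f: "\<And>n. Suc n \<le> f n" and Y: "\<And>n. ?Q (f n) (Y n)" by metis
  have f1: "1 \<le> f n" for n using f[of n] by linarith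
  define X where "X n = profile q (f n) (Y n)" for n
  have X: "X n \<in> prob_simplex q" for n unfolding X_def using Y f1 profile_in_simplex by blast
  obtain x s where x: "x \<in> prob_simplex q" and s: "strict_mono s"
    and lim: "\<And>k. k \<in> {1..q} \<Longrightarrow> (\<lambda>n. X (s n) k) \<longlonglongrightarrow> x k"
    using prob_simplex_seq_compact[of X q, OF X] by blast
  have inv0: "(\<lambda>n. real q / real (f (s n))) \<longlonglongrightarrow> 0"
  proof (rule tendsto_sandwich[OF _ _ tendsto_const[of 0]])
    show "eventually (\<lambda>n. 0 \<le> real q / real (f (s n))) sequentially" by simp
    have "real q / real (f (s n)) \<le> real q / real (Suc n)" for n
      using f[of "s n"] seq_suble[OF s, of n] by (intro divide_left_mono) auto
    then show "eventually (\<lambda>n. real q / real (f (s n)) \<le> real q / real (Suc n)) sequentially" by simp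
    show "(\<lambda>n. real q / real (Suc n)) \<longlonglongrightarrow> 0"
      using LIMSEQ_Suc[OF lim_const_over_n[of "real q"]] by simp
  qed
  \<comment> \<open>The limit inherits minimality in radius r / 2: two approximation errors r / 4
    and the distance r / 2 add up to r.\<close>
  have "local_minimizer q ?F x"
    unfolding local_minimizer_near
  proof (intro conjI x exI[of _ "r / 2"] ballI impI)
    show "0 < r / 2" using r by simp
    fix z assume z: "z \<in> prob_simplex q" "near q (r / 2) x z"
    have "\<exists>m. m \<in> comps q (f (s n)) \<and> (\<forall>k\<in>{1..q}. \<bar>profile q (f (s n)) m k - z k\<bar> \<le> real q / real (f (s n)))" for n
      using lattice_approx[OF _ f1 z(1), of "s n"] q by (metis one_le_numeral order_trans)
    then obtain Z where Z: "\<And>n. Z n \<in> comps q (f (s n))"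
      "\<And>n k. k \<in> {1..q} \<Longrightarrow> \<bar>profile q (f (s n)) (Z n) k - z k\<bar> \<le> real q / real (f (s n))" by metis
    have Zlim: "(\<lambda>n. profile q (f (s n)) (Z n) k) \<longlonglongrightarrow> z k" if k: "k \<in> {1..q}" for k
    proof -
      have "(\<lambda>n. profile q (f (s n)) (Z n) k - z k) \<longlonglongrightarrow> 0"
        by (rule Lim_null_comparison[OF _ inv0]) (use Z(2)[OF k] in auto)
      then show ?thesis by (simp add: LIM_zero_iff)
    qed
    have ev: "eventually (\<lambda>n. ?F (X (s n)) \<le> ?F (profile q (f (s n)) (Z n))) sequentially"
    proof -
      have "0 < r / 4" using r by simp
      then have "eventually (\<lambda>n. near q (r / 4) (X (s n)) x) sequentially"
        "eventually (\<lambda>n. near q (r / 4) (profile q (f (s n)) (Z n)) z) sequentially"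
        by (auto intro!: eventually_near lim Zlim)
      then show ?thesis
      proof eventually_elim
        case (elim n)
        have "near q (r / 4 + r / 2 + r / 4) (X (s n)) (profile q (f (s n)) (Z n))"
          using elim z(2) by (intro near_triangle[OF near_triangle]) (auto simp: near_commute)
        then show ?case using Y[of "s n"] Z(1)[of n] by (simp add: X_def)
      qed
    qed
    show "?F x \<le> ?F z"
    proof (rule tendsto_le[OF _ _ _ ev])
      show "(\<lambda>n. ?F (profile q (f (s n)) (Z n))) \<longlonglongrightarrow> ?F z"
        by (intro free_energy_tendsto profile_in_simplex f1 Z z Zlim)
      show "(\<lambda>n. ?F (X (s n))) \<longlonglongrightarrow> ?F x" by (intro free_energy_tendsto X x lim)
    qed simp
  qed
  then obtain i where i: "i \<le> q" "x = minimizer q \<beta> i"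
    using local_minimizer_is_minimizer[OF q \<beta>] by blast
  have "eventually (\<lambda>n. near q \<rho> (X (s n)) x) sequentially" by (intro eventually_near lim \<rho>)
  then obtain n where "near q \<rho> (X (s n)) x" by (auto simp: eventually_sequentially)
  then show False using Y[of "s n"] i by (auto simp: X_def near_commute)
qed

text \<open>Common form of the three regimes, with starting wells \<open>IA\<close> of equal depth
  \<open>FA\<close> and target wells \<open>IB\<close>. The last assumption says that a well on
  neither side is strictly shallower than the starting wells; it speaks about m_0 in regime (iii)
  and is vacuous in the other two.\<close>

locale wells =
  fixes q :: nat and \<beta> :: real and IA IB :: "nat set" and FA :: real
  assumes q: "2 \<le> q" and \<beta>1: "\<beta>\<^sub>1 q < \<beta>"
    and I: "IA \<subseteq> {..q}" "IB \<subseteq> {..q}" "IA \<inter> IB = {}" "IA \<noteq> {}" "IB \<noteq> {}"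
    and IA_min: "\<And>i. i \<in> IA \<Longrightarrow> local_minimizer q (free_energy \<beta> q) (minimizer q \<beta> i)"
    and IA_eq: "\<And>i. i \<in> IA \<Longrightarrow> free_energy \<beta> q (minimizer q \<beta> i) = FA"
    and other: "\<And>i. i \<le> q \<Longrightarrow> i \<notin> IA \<union> IB \<Longrightarrow> FA < free_energy \<beta> q (minimizer q \<beta> i)"
begin

abbreviation "F \<equiv> free_energy \<beta> q"
abbreviation "\<mu> \<equiv> minimizer q \<beta>"

lemma \<beta>_pos: "0 < \<beta>" using largest_s_pos(1)[OF q \<beta>1] .

lemma minimizer_in_simplex: "\<mu> i \<in> prob_simplex q" if "i \<le> q"
proof (cases "i = 0")
  case True
  then show ?thesis using uniform_in_simplex[of q] q by (auto simp: minimizer_def)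
next
  case False
  then show ?thesis using largest_s_props[OF q \<beta>_pos] that
    by (auto simp: minimizer_eq_spike intro!: spike_in_simplex[OF q])
qed

text \<open>Among the lattice points reachable from n without exceeding the height of n by more than
  \<delta>, take a lowest one. Everything within a fixed distance is reachable as well, so it is a
  lattice minimum at that scale and lies near some m_i; its height excludes wells outside the two
  families. The margin \<eta> does not depend on \<delta>.\<close>

lemma descent_path:
  "\<exists>\<eta>>0. \<forall>\<delta>>0. \<exists>N0. \<forall>N\<ge>N0. \<forall>n\<in>comps q N. F (profile q N n) \<le> FA + \<eta> \<longrightarrow>
    (\<exists>i\<in>IA \<union> IB. \<forall>b\<in>comps q N. (\<forall>k\<in>{1..q}. \<bar>profile q N b k - \<mu> i k\<bar> \<le> (real q)\<^sup>2 / real N) \<longrightarrow>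
      (n, b) \<in> (moves q N {z. F (profile q N z) \<le> F (profile q N n) + \<delta>})\<^sup>*)"
proof -
  have "\<exists>\<eta>>0. \<forall>i\<in>{..q} - (IA \<union> IB). FA + 2 * \<eta> \<le> F (\<mu> i)"
  proof (rule finite_uniform_positive)
    fix i assume "i \<in> {..q} - (IA \<union> IB)"
    then have "FA < F (\<mu> i)" by (intro other) auto
    then show "\<exists>\<eta>>0. FA + 2 * \<eta> \<le> F (\<mu> i)" by (intro exI[of _ "(F (\<mu> i) - FA) / 2"]) (auto simp: field_simps)
  qed auto
  then obtain \<eta> where \<eta>: "0 < \<eta>" "\<And>i. i \<le> q \<Longrightarrow> i \<notin> IA \<union> IB \<Longrightarrow> FA + 2 * \<eta> \<le> F (\<mu> i)" by auto
  show ?thesis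
  proof (intro exI[of _ \<eta>] conjI allI impI \<eta>(1))
    fix \<delta> :: real assume \<delta>: "0 < \<delta>"
    \<comment> \<open>At most \<delta>, so the final stretch to the well stays below the permitted
      height; at most \<eta>, so the well reached has energy below FA + 2 \<eta>.\<close>
    define \<delta>' where "\<delta>' = min \<delta> \<eta>"
    have \<delta>': "0 < \<delta>'" "\<delta>' \<le> \<delta>" "\<delta>' \<le> \<eta>" using \<delta> \<eta> by (auto simp: \<delta>'_def)
    obtain r where r: "0 < r" "\<And>x y. x \<in> prob_simplex q \<Longrightarrow> y \<in> prob_simplex q \<Longrightarrow> near q r x y \<Longrightarrow> \<bar>F x - F y\<bar> < \<delta>'"
      using free_energy_uniformly_continuous[OF \<delta>'(1)] by blast
    have r2: "0 < r / 2" using r by simp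
    obtain N1 where N1: "\<And>N y. N \<ge> N1 \<Longrightarrow> y \<in> comps q N \<Longrightarrow>
      (\<forall>z\<in>comps q N. near q r (profile q N y) (profile q N z) \<longrightarrow> F (profile q N y) \<le> F (profile q N z)) \<Longrightarrow>
      (\<exists>i\<le>q. near q (r / 2) (\<mu> i) (profile q N y))"
      using lattice_local_minimum_near[OF q \<beta>_pos r2 r(1)] by blast
    obtain N2 :: nat where N2: "(real q)\<^sup>2 / (r / 2) < real N2" using reals_Archimedean2 by blast
    show "\<exists>N0. \<forall>N\<ge>N0. \<forall>n\<in>comps q N. F (profile q N n) \<le> FA + \<eta> \<longrightarrow>
      (\<exists>i\<in>IA \<union> IB. \<forall>b\<in>comps q N. (\<forall>k\<in>{1..q}. \<bar>profile q N b k - \<mu> i k\<bar> \<le> (real q)\<^sup>2 / real N) \<longrightarrow>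
      (n, b) \<in> (moves q N {z. F (profile q N z) \<le> F (profile q N n) + \<delta>})\<^sup>*)"
    proof (intro exI[of _ "max 1 (max N1 N2)"] allI impI ballI)
      fix N n assume N: "max 1 (max N1 N2) \<le> N" and n: "n \<in> comps q N" and Fn: "F (profile q N n) \<le> FA + \<eta>"
      have N': "1 \<le> N" "N1 \<le> N" "real N2 \<le> real N" using N by auto
      note pS = profile_in_simplex[OF N'(1)]
      have qN: "(real q)\<^sup>2 / real N < r / 2"
      proof -
        have "(real q)\<^sup>2 / (r / 2) < real N" using N2 N'(3) by linarith
        then show ?thesis using r N' by (simp add: field_simps)
      qed
      define R where "R = moves q N {z. F (profile q N z) \<le> F (profile q N n) + \<delta>}"
      define C where "C = {z \<in> comps q N. (n, z) \<in> R\<^sup>*}"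
      have "finite C" unfolding C_def using finite_comps by simp
      moreover have "n \<in> C" using n by (simp add: C_def)
      ultimately obtain y where y: "y \<in> C" "\<And>z. z \<in> C \<Longrightarrow> F (profile q N y) \<le> F (profile q N z)"
        using arg_min_if_finite[of C "\<lambda>z. F (profile q N z)"] by (metis empty_iff linorder_not_less)
      have yc: "y \<in> comps q N" "(n, y) \<in> R\<^sup>*" using y by (auto simp: C_def)
      have yn: "F (profile q N y) \<le> F (profile q N n)" using y(2) \<open>n \<in> C\<close> .
      have reach: "(n, z) \<in> R\<^sup>*" if z: "z \<in> comps q N" "near q r (profile q N y) (profile q N z)" for z
      proof -
        have "(y, z) \<in> R\<^sup>*" unfolding R_def
        proof (rule moves_path_near[OF N'(1) yc(1) z])
          fix u assume "u \<in> comps q N" "near q r (profile q N y) (profile q N u)"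
          then have "\<bar>F (profile q N y) - F (profile q N u)\<bar> < \<delta>'" using r(2) pS yc by blast
          then show "u \<in> {z. F (profile q N z) \<le> F (profile q N n) + \<delta>}" using yn \<delta>' by auto
        qed
        with yc(2) show ?thesis by (rule rtrancl_trans)
      qed
      then have "\<forall>z\<in>comps q N. near q r (profile q N y) (profile q N z) \<longrightarrow> F (profile q N y) \<le> F (profile q N z)"
        using y(2) by (simp add: C_def)
      then obtain i where i: "i \<le> q" "near q (r / 2) (\<mu> i) (profile q N y)" using N1[OF N'(2) yc(1)] by blast
      have "i \<in> IA \<union> IB"
      proof (rule ccontr)
        assume "i \<notin> IA \<union> IB"
        from \<eta>(2)[OF i(1) this] have "FA + 2 * \<eta> \<le> F (\<mu> i)" .
        moreover have "\<bar>F (\<mu> i) - F (profile q N y)\<bar> < \<delta>'"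
          using i r(1) by (intro r(2) minimizer_in_simplex pS yc near_mono[OF i(2)]) auto
        ultimately show False using yn Fn \<delta>' by linarith
      qed
      moreover have "(n, b) \<in> R\<^sup>*" if b: "b \<in> comps q N" "\<forall>k\<in>{1..q}. \<bar>profile q N b k - \<mu> i k\<bar> \<le> (real q)\<^sup>2 / real N" for b
      proof (rule reach[OF b(1)])
        have "near q (r / 2) (\<mu> i) (profile q N b)"
          using b(2) qN unfolding near_def by (metis abs_minus_commute le_less_trans)
        then have "near q (r / 2 + r / 2) (profile q N y) (profile q N b)"
          using i(2) near_triangle near_commute by blast
        then show "near q r (profile q N y) (profile q N b)" by simp
      qed
      ultimately show "\<exists>i\<in>IA \<union> IB. \<forall>b\<in>comps q N. (\<forall>k\<in>{1..q}. \<bar>profile q N b k - \<mu> i k\<bar> \<le> (real q)\<^sup>2 / real N) \<longrightarrow>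
        (n, b) \<in> (moves q N {z. F (profile q N z) \<le> F (profile q N n) + \<delta>})\<^sup>*"
        unfolding R_def by blast
    qed
  qed
qed

lemma minimizers_separated: "\<exists>d>0. \<forall>i\<le>q. \<forall>j\<le>q. i \<noteq> j \<longrightarrow> \<not> near q d (\<mu> i) (\<mu> j)"
proof -
  have "\<exists>d>0. \<forall>x\<in>{(i, j). i \<le> q \<and> j \<le> q \<and> i \<noteq> j}. \<not> near q d (\<mu> (fst x)) (\<mu> (snd x))"
  proof (rule finite_uniform_positive)
    show "finite {(i, j). i \<le> q \<and> j \<le> q \<and> i \<noteq> j}"
      by (rule finite_subset[of _ "{..q} \<times> {..q}"]) auto
    fix x assume "x \<in> {(i, j). i \<le> q \<and> j \<le> q \<and> i \<noteq> j}"
    then obtain i j where x: "x = (i, j)" "i \<le> q" "j \<le> q" "i \<noteq> j" by auto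
    then have "\<mu> i \<noteq> \<mu> j" using minimizer_inj[OF q \<beta>1] by blast
    then obtain k where k: "k \<in> {1..q}" "\<mu> i k \<noteq> \<mu> j k"
      using prob_simplex_eqI[OF minimizer_in_simplex[OF x(2)] minimizer_in_simplex[OF x(3)]] by blast
    then show "\<exists>d>0. \<not> near q d (\<mu> (fst x)) (\<mu> (snd x))"
      using x by (intro exI[of _ "\<bar>\<mu> i k - \<mu> j k\<bar>"]) (auto simp: near_def)
  qed (auto dest: near_mono)
  then show ?thesis by auto
qed

text \<open>A point near m_i of energy not above \<open>FA\<close> would itself be a local
  minimizer, whereas local minimizers are finitely many and separated. So the minimum is strict, and
  compactness of the shell turns strictness into a gap \<Delta>.\<close>

lemma barrier:
  obtains r \<Delta> where "0 < r" "0 < \<Delta>"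
    "\<And>i y. i \<in> IA \<Longrightarrow> y \<in> prob_simplex q \<Longrightarrow> near q r (\<mu> i) y \<Longrightarrow> \<not> near q (r / 2) (\<mu> i) y \<Longrightarrow> FA + \<Delta> \<le> F y"
    "\<And>i j. i \<in> IA \<Longrightarrow> j \<le> q \<Longrightarrow> i \<noteq> j \<Longrightarrow> \<not> near q (2 * r) (\<mu> i) (\<mu> j)"
proof -
  have finA: "finite IA" using I(1) finite_subset by auto
  obtain d where d: "0 < d" "\<And>i j. i \<le> q \<Longrightarrow> j \<le> q \<Longrightarrow> i \<noteq> j \<Longrightarrow> \<not> near q d (\<mu> i) (\<mu> j)"
    using minimizers_separated by blast
  have "\<exists>e>0. \<forall>i\<in>IA. \<forall>y\<in>prob_simplex q. near q e (\<mu> i) y \<longrightarrow> FA \<le> F y"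
  proof (rule finite_uniform_positive[OF finA])
    fix i assume "i \<in> IA"
    then show "\<exists>e>0. \<forall>y\<in>prob_simplex q. near q e (\<mu> i) y \<longrightarrow> FA \<le> F y"
      using IA_min[of i] IA_eq[of i] unfolding local_minimizer_near by auto
  qed (meson near_mono)
  then obtain e where e: "0 < e" "\<And>i y. i \<in> IA \<Longrightarrow> y \<in> prob_simplex q \<Longrightarrow> near q e (\<mu> i) y \<Longrightarrow> FA \<le> F y" by blast
  \<comment> \<open>A ball of radius 2 r around a point within 2 r of m_i stays inside both the
    region of minimality and the region of separation.\<close>
  define r where "r = min (e / 4) (d / 4)"
  have r: "0 < r" "4 * r \<le> e" "4 * r \<le> d" using d(1) e(1) by (auto simp: r_def)
  have strict: "FA < F y" if y: "i \<in> IA" "y \<in> prob_simplex q" "near q (2 * r) (\<mu> i) y" "y \<noteq> \<mu> i" for i y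
  proof (rule ccontr)
    assume "\<not> FA < F y"
    have "F y \<le> F z" if z: "z \<in> prob_simplex q" "near q (2 * r) y z" for z
    proof -
      have "near q (2 * r + 2 * r) (\<mu> i) z" using y(3) z(2) by (rule near_triangle)
      then have "near q e (\<mu> i) z" by (rule near_mono) (use r in simp)
      then show ?thesis using e(2)[OF y(1) z(1)] \<open>\<not> FA < F y\<close> by simp
    qed
    then have "local_minimizer q F y" unfolding local_minimizer_near using y(2) r(1)
      by (intro conjI exI[of _ "2 * r"]) auto
    then obtain j where j: "j \<le> q" "y = \<mu> j" using local_minimizer_is_minimizer[OF q \<beta>_pos] by blast
    moreover have "near q d (\<mu> i) y" by (rule near_mono[OF y(3)]) (use r in simp)
    ultimately show False using d(2)[of i j] y I(1) by auto
  qed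
  have "\<exists>\<Delta>>0. \<forall>i\<in>IA. \<forall>y\<in>prob_simplex q. near q r (\<mu> i) y \<and> \<not> near q (r / 2) (\<mu> i) y \<longrightarrow> FA + \<Delta> \<le> F y"
  proof (rule finite_uniform_positive[OF finA])
    fix i assume i: "i \<in> IA"
    show "\<exists>\<Delta>>0. \<forall>y\<in>prob_simplex q. near q r (\<mu> i) y \<and> \<not> near q (r / 2) (\<mu> i) y \<longrightarrow> FA + \<Delta> \<le> F y"
    proof (rule ccontr)
      assume "\<not> ?thesis"
      then have *: "\<exists>y\<in>prob_simplex q. near q r (\<mu> i) y \<and> \<not> near q (r / 2) (\<mu> i) y \<and> F y < FA + \<Delta>" if "0 < \<Delta>" for \<Delta>
        using that by (auto simp: not_le)
      have "\<exists>y. y \<in> prob_simplex q \<and> near q r (\<mu> i) y \<and> \<not> near q (r / 2) (\<mu> i) y \<and> F y < FA + 1 / real (Suc n)" for n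
        using *[of "1 / real (Suc n)"] by auto
      then obtain Y where Y: "\<And>n. Y n \<in> prob_simplex q" "\<And>n. near q r (\<mu> i) (Y n)"
        "\<And>n. \<not> near q (r / 2) (\<mu> i) (Y n)" "\<And>n. F (Y n) < FA + 1 / real (Suc n)" by metis
      obtain y s where y: "y \<in> prob_simplex q" and s: "strict_mono s"
        and lim: "\<And>k. k \<in> {1..q} \<Longrightarrow> (\<lambda>n. Y (s n) k) \<longlonglongrightarrow> y k"
        using prob_simplex_seq_compact[of Y q, OF Y(1)] by blast
      have ev: "eventually (\<lambda>n. near q t (Y (s n)) y) sequentially" if "0 < t" for t
        by (intro eventually_near lim that)
      obtain n where "near q r (Y (s n)) y" using ev[OF r(1)] by (auto simp: eventually_sequentially)
      then have "near q (2 * r) (\<mu> i) y" using near_triangle[OF Y(2)[of "s n"]] by fastforce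
      moreover have "y \<noteq> \<mu> i"
      proof
        assume "y = \<mu> i"
        then obtain n where "near q (r / 2) (Y (s n)) (\<mu> i)"
          using ev[of "r / 2"] r(1) by (auto simp: eventually_sequentially)
        then show False using Y(3) near_commute by blast
      qed
      ultimately have "FA < F y" using strict i y by blast
      moreover have "F y \<le> FA"
      proof (rule LIMSEQ_le)
        show "(\<lambda>n. F (Y (s n))) \<longlonglongrightarrow> F y" by (intro free_energy_tendsto Y y lim)
        have "(\<lambda>n. FA + 1 / real (Suc (s n))) \<longlonglongrightarrow> FA + 0"
          using LIMSEQ_subseq_LIMSEQ[OF LIMSEQ_Suc[OF lim_1_over_n] s]
          by (intro tendsto_intros) (simp add: o_def)
        then show "(\<lambda>n. FA + 1 / real (Suc (s n))) \<longlonglongrightarrow> FA" by simp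
      qed (use Y(4) in \<open>auto intro: less_imp_le\<close>)
      ultimately show False by simp
    qed
  qed (meson order_trans add_left_mono)
  then obtain \<Delta> where \<Delta>: "0 < \<Delta>" "\<And>i y. i \<in> IA \<Longrightarrow> y \<in> prob_simplex q \<Longrightarrow> near q r (\<mu> i) y \<Longrightarrow>
      \<not> near q (r / 2) (\<mu> i) y \<Longrightarrow> FA + \<Delta> \<le> F y" by blast
  show thesis
  proof (rule that[OF r(1) \<Delta>])
    fix i j assume ij: "i \<in> IA" "j \<le> q" "i \<noteq> j"
    show "\<not> near q (2 * r) (\<mu> i) (\<mu> j)"
    proof
      assume "near q (2 * r) (\<mu> i) (\<mu> j)"
      then have "near q d (\<mu> i) (\<mu> j)" by (rule near_mono) (use r in simp)
      then show False using d(2)[of i j] ij I(1) by auto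
    qed
  qed
qed

end

section \<open>Concentration of the equilibrium potential\<close>

lemma energy_conductance_le:
  assumes w: "\<And>\<sigma>. \<sigma> \<in> configs q N \<Longrightarrow> w \<sigma> \<le> K * w' \<sigma>" and K: "0 \<le> K"
  shows "energy (configs q N) (conductance q N w) f f \<le> K * energy (configs q N) (conductance q N w') f f"
proof -
  have "conductance q N w \<sigma> \<eta> * (f \<sigma> - f \<eta>) * (f \<sigma> - f \<eta>)
      \<le> K * (conductance q N w' \<sigma> \<eta> * (f \<sigma> - f \<eta>) * (f \<sigma> - f \<eta>))"
    if "\<sigma> \<in> configs q N" "\<eta> \<in> configs q N" for \<sigma> \<eta>
  proof -
    have "min (w \<sigma>) (w \<eta>) \<le> K * min (w' \<sigma>) (w' \<eta>)"
      using w[OF that(1)] w[OF that(2)] by (auto simp: min_def)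
    then have "1 / (real N * real q) * min (w \<sigma>) (w \<eta>) \<le> 1 / (real N * real q) * (K * min (w' \<sigma>) (w' \<eta>))"
      by (intro mult_left_mono) auto
    then have "conductance q N w \<sigma> \<eta> \<le> K * conductance q N w' \<sigma> \<eta>"
      by (simp add: conductance_def mult_ac)
    then have "conductance q N w \<sigma> \<eta> * (f \<sigma> - f \<eta>)\<^sup>2 \<le> K * conductance q N w' \<sigma> \<eta> * (f \<sigma> - f \<eta>)\<^sup>2"
      by (intro mult_right_mono) auto
    then show ?thesis by (simp add: power2_eq_square mult.assoc)
  qed
  then have "(\<Sum>\<sigma>\<in>configs q N. \<Sum>\<eta>\<in>configs q N. conductance q N w \<sigma> \<eta> * (f \<sigma> - f \<eta>) * (f \<sigma> - f \<eta>))
    \<le> (\<Sum>\<sigma>\<in>configs q N. \<Sum>\<eta>\<in>configs q N. K * (conductance q N w' \<sigma> \<eta> * (f \<sigma> - f \<eta>) * (f \<sigma> - f \<eta>)))"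
    by (intro sum_mono) auto
  then show ?thesis unfolding energy_def by (simp flip: sum_distrib_left)
qed

text \<open>Each passage between the two weights costs \<open>exp D\<close>: one for the weighted
  sum and one for the energy in the Poincare inequality, and one more for the capacity bounded by
  the test function \<open>g\<close>. This is the origin of the factor 3.\<close>

lemma perturbed_sum_equilibrium_le:
  assumes w': "\<And>\<sigma>. \<sigma> \<in> configs q N \<Longrightarrow> 0 < w' \<sigma>" and D: "0 \<le> D"
    and w: "\<And>\<sigma>. \<sigma> \<in> configs q N \<Longrightarrow> exp (- D) * w' \<sigma> \<le> w \<sigma> \<and> w \<sigma> \<le> exp D * w' \<sigma>"
    and AB: "A \<subseteq> configs q N" "B \<subseteq> configs q N" "A \<inter> B = {}"
    and h: "equilibrium (configs q N) (conductance q N w) A B h"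
    and X: "X \<subseteq> configs q N" and K: "0 \<le> K"
    and poincare: "\<And>f. (\<And>\<sigma>. \<sigma> \<in> B \<Longrightarrow> f \<sigma> = 0) \<Longrightarrow>
      (\<Sum>\<sigma>\<in>X. w' \<sigma> * (f \<sigma>)\<^sup>2) \<le> K * energy (configs q N) (conductance q N w') f f"
    and g: "\<And>\<sigma>. \<sigma> \<in> A \<Longrightarrow> g \<sigma> = 1" "\<And>\<sigma>. \<sigma> \<in> B \<Longrightarrow> g \<sigma> = 0"
      "energy (configs q N) (conductance q N w') g g \<le> c0"
    and d: "0 < d"
  shows "(\<Sum>\<sigma>\<in>X. w \<sigma> * h \<sigma>) \<le> exp (3 * D) * (K * c0 * ln ((1 + d) / d) + d * (\<Sum>\<sigma>\<in>configs q N. w' \<sigma>))"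
proof -
  let ?S = "configs q N" and ?E = "energy (configs q N) (conductance q N w)"
    and ?E' = "energy (configs q N) (conductance q N w')"
  have wpos: "0 < w \<sigma>" if "\<sigma> \<in> ?S" for \<sigma>
    using w[OF that] w'[OF that] by (smt (verit) exp_gt_zero mult_pos_pos)
  interpret network ?S "conductance q N w" using wpos by (rule network_conductance)
  have EE': "?E f f \<le> exp D * ?E' f f" for f using w by (intro energy_conductance_le) auto
  have E'E: "?E' f f \<le> exp D * ?E f f" for f
  proof (rule energy_conductance_le)
    fix \<sigma> assume "\<sigma> \<in> ?S"
    then have "exp D * (exp (- D) * w' \<sigma>) \<le> exp D * w \<sigma>" using w by (intro mult_left_mono) auto
    then show "w' \<sigma> \<le> exp D * w \<sigma>" by (simp add: mult.assoc[symmetric] exp_add[symmetric])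
  qed simp
  have l0: "0 \<le> ln ((1 + d) / d)" using d by (intro ln_ge_zero) (simp add: field_simps)
  have c00: "0 \<le> c0" using g(3) E'E[of g] energy_nonneg[of g]
    by (smt (verit) EE' exp_gt_zero mult_nonneg_nonpos zero_le_mult_iff)
  have cap: "?E h h \<le> exp D * c0"
  proof -
    have "?E h h \<le> ?E g g" using g(1,2) by (rule dirichlet_principle[OF AB h])
    also have "\<dots> \<le> exp D * ?E' g g" by (rule EE')
    also have "\<dots> \<le> exp D * c0" using g(3) by (intro mult_left_mono) auto
    finally show ?thesis .
  qed
  have "(\<Sum>\<sigma>\<in>X. w \<sigma> * h \<sigma>) \<le> (exp (2 * D) * K) * ?E h h * ln ((1 + d) / d) + d * (\<Sum>\<sigma>\<in>X. w \<sigma>)"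
  proof (rule sum_equilibrium_le[OF AB h X _ _ _ d])
    fix f :: "config \<Rightarrow> real" assume f: "\<And>\<sigma>. \<sigma> \<in> B \<Longrightarrow> f \<sigma> = 0"
    have "(\<Sum>\<sigma>\<in>X. w \<sigma> * (f \<sigma>)\<^sup>2) \<le> (\<Sum>\<sigma>\<in>X. exp D * (w' \<sigma> * (f \<sigma>)\<^sup>2))"
    proof (rule sum_mono)
      fix \<sigma> assume "\<sigma> \<in> X"
      then have "w \<sigma> * (f \<sigma>)\<^sup>2 \<le> (exp D * w' \<sigma>) * (f \<sigma>)\<^sup>2" using w X by (intro mult_right_mono) auto
      then show "w \<sigma> * (f \<sigma>)\<^sup>2 \<le> exp D * (w' \<sigma> * (f \<sigma>)\<^sup>2)" by (simp add: mult.assoc)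
    qed
    also have "\<dots> = exp D * (\<Sum>\<sigma>\<in>X. w' \<sigma> * (f \<sigma>)\<^sup>2)" by (simp add: sum_distrib_left)
    also have "\<dots> \<le> exp D * (K * ?E' f f)" using poincare[of f] f by (intro mult_left_mono) auto
    also have "\<dots> \<le> exp D * (K * (exp D * ?E f f))" using K by (intro mult_left_mono E'E) auto
    also have "\<dots> = exp (2 * D) * K * ?E f f"
    proof -
      have "exp (2 * D) = exp D * exp D" by (simp add: exp_add[symmetric])
      then show ?thesis by (simp only: mult_ac)
    qed
    finally show "(\<Sum>\<sigma>\<in>X. w \<sigma> * (f \<sigma>)\<^sup>2) \<le> exp (2 * D) * K * ?E f f" .
  next
    fix \<sigma> assume "\<sigma> \<in> X"
    then show "0 \<le> w \<sigma>" using wpos X by (meson less_imp_le subsetD)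
  qed (use K in simp)
  also have "(exp (2 * D) * K) * ?E h h * ln ((1 + d) / d) \<le> (exp (2 * D) * K) * (exp D * c0) * ln ((1 + d) / d)"
    using cap K l0 by (intro mult_right_mono mult_left_mono) auto
  also have "\<dots> = exp (3 * D) * (K * c0 * ln ((1 + d) / d))"
  proof -
    have "exp (3 * D) = exp (2 * D) * exp D" by (simp add: exp_add[symmetric])
    then show ?thesis by (simp add: mult_ac)
  qed
  also have "d * (\<Sum>\<sigma>\<in>X. w \<sigma>) \<le> d * (exp (3 * D) * (\<Sum>\<sigma>\<in>?S. w' \<sigma>))"
  proof (rule mult_left_mono)
    have "(\<Sum>\<sigma>\<in>X. w \<sigma>) \<le> (\<Sum>\<sigma>\<in>?S. w \<sigma>)" using X wpos finite_configs by (intro sum_mono2) (auto intro: less_imp_le)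
    also have "\<dots> \<le> (\<Sum>\<sigma>\<in>?S. exp (3 * D) * w' \<sigma>)"
    proof (rule sum_mono)
      fix \<sigma> assume s: "\<sigma> \<in> ?S"
      have "exp D * w' \<sigma> \<le> exp (3 * D) * w' \<sigma>" using w'[OF s] D by (intro mult_right_mono) auto
      then show "w \<sigma> \<le> exp (3 * D) * w' \<sigma>" using w[OF s] by linarith
    qed
    finally show "(\<Sum>\<sigma>\<in>X. w \<sigma>) \<le> exp (3 * D) * (\<Sum>\<sigma>\<in>?S. w' \<sigma>)" by (simp add: sum_distrib_left)
  qed (use d in simp)
  finally show ?thesis by (simp add: algebra_simps)
qed

section \<open>Capacity bound, Poincare constant and total weights of the pure model\<close>

lemma sum_conductance_le:
  assumes w: "\<And>\<sigma>. \<sigma> \<in> configs q N \<Longrightarrow> 0 < w \<sigma>" and \<sigma>: "\<sigma> \<in> configs q N"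
  shows "(\<Sum>\<eta>\<in>configs q N. conductance q N w \<sigma> \<eta>) \<le> w \<sigma>"
proof -
  \<comment> \<open>With zero Hamiltonian the flip probabilities are 1 / (N q) on each neighbour, so
    their sum counts neighbours.\<close>
  let ?f = "flip_prob q N 1 (\<lambda>_. 0) \<sigma>"
  have "0 \<le> trans_prob q N 1 (\<lambda>_. 0) \<sigma> \<sigma>"
    using prob_vector_trans_prob[OF zero_less_one \<sigma>, of "\<lambda>_. 0"] \<sigma> by (auto simp: prob_vector_def)
  then have le: "(\<Sum>\<eta>\<in>configs q N - {\<sigma>}. ?f \<eta>) \<le> 1" by (simp add: trans_prob_def)
  have "\<not> differ_once N \<sigma> \<sigma>" by (simp add: differ_once_def)
  then have "(\<Sum>\<eta>\<in>configs q N. conductance q N w \<sigma> \<eta>) = (\<Sum>\<eta>\<in>configs q N - {\<sigma>}. conductance q N w \<sigma> \<eta>)"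
    using \<sigma> finite_configs by (simp add: sum.remove[of _ \<sigma>] conductance_def)
  also have "\<dots> \<le> (\<Sum>\<eta>\<in>configs q N - {\<sigma>}. w \<sigma> * ?f \<eta>)"
  proof (rule sum_mono)
    fix \<eta>
    have "1 / (real N * real q) * min (w \<sigma>) (w \<eta>) \<le> 1 / (real N * real q) * w \<sigma>"
      by (intro mult_left_mono) auto
    then show "conductance q N w \<sigma> \<eta> \<le> w \<sigma> * ?f \<eta>"
      by (simp add: conductance_def flip_prob_def differ_once_def mult.commute)
  qed
  also have "\<dots> = w \<sigma> * (\<Sum>\<eta>\<in>configs q N - {\<sigma>}. ?f \<eta>)" by (simp add: sum_distrib_left)
  also have "\<dots> \<le> w \<sigma>" using le w[OF \<sigma>] by (simp add: mult_left_le)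
  finally show ?thesis .
qed

text \<open>Only edges leaving \<open>U\<close> contribute; each is charged to its endpoint in
  \<open>bd\<close>, and the total conductance at a configuration is at most its weight.\<close>

lemma energy_indicator_le:
  assumes w: "\<And>\<sigma>. \<sigma> \<in> configs q N \<Longrightarrow> 0 < w \<sigma>" and U: "U \<subseteq> configs q N"
    and bd: "\<And>\<sigma> \<eta>. \<sigma> \<in> U \<Longrightarrow> \<eta> \<in> configs q N - U \<Longrightarrow> differ_once N \<sigma> \<eta> \<Longrightarrow> \<sigma> \<in> bd"
    and bdS: "bd \<subseteq> configs q N"
  shows "energy (configs q N) (conductance q N w) (\<lambda>\<sigma>. of_bool (\<sigma> \<in> U)) (\<lambda>\<sigma>. of_bool (\<sigma> \<in> U)) \<le> sum w bd"
proof -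
  let ?S = "configs q N" and ?c = "conductance q N w" and ?g = "\<lambda>\<sigma>. of_bool (\<sigma> \<in> U) :: real"
  interpret network ?S ?c using w by (rule network_conductance)
  have "?c \<sigma> \<eta> * (?g \<sigma> - ?g \<eta>) * (?g \<sigma> - ?g \<eta>) \<le> of_bool (\<sigma> \<in> bd) * ?c \<sigma> \<eta> + of_bool (\<eta> \<in> bd) * ?c \<eta> \<sigma>"
    if s: "\<sigma> \<in> ?S" "\<eta> \<in> ?S" for \<sigma> \<eta>
  proof (cases "differ_once N \<sigma> \<eta> \<and> (\<sigma> \<in> U \<longleftrightarrow> \<eta> \<notin> U)")
    case True
    then have "\<sigma> \<in> bd \<or> \<eta> \<in> bd" using bd[of \<sigma> \<eta>] bd[of \<eta> \<sigma>] s by (auto simp: differ_once_sym)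
    moreover have "(?g \<sigma> - ?g \<eta>) * (?g \<sigma> - ?g \<eta>) = 1" using True by auto
    then have "?c \<sigma> \<eta> * (?g \<sigma> - ?g \<eta>) * (?g \<sigma> - ?g \<eta>) = ?c \<sigma> \<eta>"
      by (simp only: mult.assoc mult_1_right)
    ultimately show ?thesis using nonneg[OF s] sym[OF s] by auto
  next
    case False
    then have "?c \<sigma> \<eta> = 0 \<or> ?g \<sigma> - ?g \<eta> = 0" by (auto simp: conductance_def)
    then have "?c \<sigma> \<eta> * (?g \<sigma> - ?g \<eta>) * (?g \<sigma> - ?g \<eta>) = 0" by auto
    moreover have "0 \<le> of_bool (\<sigma> \<in> bd) * ?c \<sigma> \<eta> + of_bool (\<eta> \<in> bd) * ?c \<eta> \<sigma>"
      using nonneg[OF s] nonneg[OF s(2,1)] by (intro add_nonneg_nonneg mult_nonneg_nonneg) auto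
    ultimately show ?thesis by (simp only:)
  qed
  then have "(\<Sum>\<sigma>\<in>?S. \<Sum>\<eta>\<in>?S. ?c \<sigma> \<eta> * (?g \<sigma> - ?g \<eta>) * (?g \<sigma> - ?g \<eta>))
      \<le> (\<Sum>\<sigma>\<in>?S. \<Sum>\<eta>\<in>?S. of_bool (\<sigma> \<in> bd) * ?c \<sigma> \<eta> + of_bool (\<eta> \<in> bd) * ?c \<eta> \<sigma>)"
    by (intro sum_mono) auto
  also have "\<dots> = 2 * (\<Sum>\<sigma>\<in>?S. of_bool (\<sigma> \<in> bd) * (\<Sum>\<eta>\<in>?S. ?c \<sigma> \<eta>))"
  proof -
    have "(\<Sum>\<sigma>\<in>?S. \<Sum>\<eta>\<in>?S. of_bool (\<eta> \<in> bd) * ?c \<eta> \<sigma>) = (\<Sum>\<sigma>\<in>?S. \<Sum>\<eta>\<in>?S. of_bool (\<sigma> \<in> bd) * ?c \<sigma> \<eta>)"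
      by (rule sum.swap)
    then show ?thesis by (simp only: sum.distrib sum_distrib_left[symmetric])
  qed
  also have "\<dots> \<le> 2 * (\<Sum>\<sigma>\<in>?S. of_bool (\<sigma> \<in> bd) * w \<sigma>)"
    using sum_conductance_le[where w=w, OF w] by (intro mult_left_mono sum_mono) auto
  also have "(\<Sum>\<sigma>\<in>?S. of_bool (\<sigma> \<in> bd) * w \<sigma>) = sum w bd"
    using bdS by (intro sum.mono_neutral_cong_right finite_configs) auto
  finally show ?thesis by (simp add: energy_def)
qed

lemma differ_once_cnt:
  assumes "differ_once N \<sigma> \<eta>"
  shows "\<bar>real (cnt N \<sigma> k) - real (cnt N \<eta> k)\<bar> \<le> 1"
proof -
  have *: "cnt N \<sigma> k \<le> cnt N \<eta> k + 1" if d: "differ_once N \<sigma> \<eta>" for \<sigma> \<eta> :: config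
  proof -
    have "cnt N \<sigma> k \<le> card ({i \<in> {1..N}. \<eta> i = k} \<union> {i \<in> {1..N}. \<sigma> i \<noteq> \<eta> i})"
      unfolding cnt_def by (intro card_mono) auto
    also have "\<dots> \<le> card {i \<in> {1..N}. \<eta> i = k} + card {i \<in> {1..N}. \<sigma> i \<noteq> \<eta> i}" by (rule card_Un_le)
    finally show ?thesis using d by (simp add: cnt_def differ_once_def)
  qed
  from *[OF assms] *[of \<eta> \<sigma>] assms show ?thesis by (simp add: differ_once_sym[of N \<eta>] abs_le_iff)
qed

lemma sum_UN_lev:
  assumes "Y \<subseteq> comps q N"
  shows "sum g (\<Union>n\<in>Y. lev q N n) = (\<Sum>n\<in>Y. sum g (lev q N n))"
proof (rule sum.UNION_disjoint)
  show "finite Y" using finite_subset[OF assms finite_comps] .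
  show "\<forall>i\<in>Y. \<forall>j\<in>Y. i \<noteq> j \<longrightarrow> lev q N i \<inter> lev q N j = {}"
    using lev_disjoint[of _ q N] assms by blast
qed (simp add: finite_lev)

lemma cw_weight_pos: "0 < cw_weight N \<beta> \<sigma>"
  by (simp add: cw_weight_def)

text \<open>The number of levels, times the weight of a level relative to the least weight on its
  descending path, times the path factor of \<open>sum_lev_square_le\<close>.\<close>

definition poincare_bound :: "nat \<Rightarrow> real \<Rightarrow> real \<Rightarrow> nat \<Rightarrow> real" where
  "poincare_bound q \<beta> \<delta> N = real (N + 1) ^ q *
     (exp (\<beta> * real N * \<delta> + 2 * entropy_error q \<beta> N) * (2 * real N * real q * real (N + 1) ^ (4 * q)))"

lemma cw_poincare:
  assumes q: "1 \<le> q" and N: "1 \<le> N" and \<beta>: "0 < \<beta>" and Y: "Y \<subseteq> comps q N"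
    and reach: "\<And>n. n \<in> Y \<Longrightarrow> \<exists>b\<in>comps q N. lev q N b \<subseteq> B \<and>
      (n, b) \<in> (moves q N {z. free_energy \<beta> q (profile q N z) \<le> free_energy \<beta> q (profile q N n) + \<delta>})\<^sup>*"
    and f: "\<And>\<sigma>. \<sigma> \<in> B \<Longrightarrow> f \<sigma> = 0"
  shows "(\<Sum>\<sigma>\<in>(\<Union>n\<in>Y. lev q N n). cw_weight N \<beta> \<sigma> * (f \<sigma>)\<^sup>2)
    \<le> poincare_bound q \<beta> \<delta> N * energy (configs q N) (conductance q N (cw_weight N \<beta>)) f f"
proof -
  let ?w = "cw_weight N \<beta>" and ?F = "\<lambda>n. free_energy \<beta> q (profile q N n)" and ?e = "entropy_error q \<beta> N"
  let ?E = "energy (configs q N) (conductance q N ?w) f f"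
  let ?P = "2 * real N * real q * real (N + 1) ^ (4 * q)"
  interpret network "configs q N" "conductance q N ?w" by (rule network_conductance) (rule cw_weight_pos)
  have E0: "0 \<le> ?E" by (rule energy_nonneg)
  have one: "(\<Sum>\<sigma>\<in>lev q N n. ?w \<sigma> * (f \<sigma>)\<^sup>2) \<le> exp (\<beta> * real N * \<delta> + 2 * ?e) * ?P * ?E" if n: "n \<in> Y" for n
  proof -
    \<comment> \<open>The weight guaranteed to every level of height at most
      \<open>?F n + \<delta>\<close>, so the descending path consists of steps admissible for this
      threshold.\<close>
    define \<theta> where "\<theta> = exp (- \<beta> * real N * (?F n + \<delta>) - ?e)"
    obtain b where b: "lev q N b \<subseteq> B" "(n, b) \<in> (moves q N {z. ?F z \<le> ?F n + \<delta>})\<^sup>*" using reach[OF n] by blast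
    have "moves q N {z. ?F z \<le> ?F n + \<delta>} \<subseteq> lev_step q N ?w \<theta>"
    proof -
      have "\<theta> \<le> sum ?w (lev q N z)" if "z \<in> comps q N" "?F z \<le> ?F n + \<delta>" for z
      proof -
        have "\<beta> * real N * ?F z \<le> \<beta> * real N * (?F n + \<delta>)" using that \<beta> by (intro mult_left_mono) auto
        then have "\<theta> \<le> exp (- \<beta> * real N * ?F z - ?e)" by (simp add: \<theta>_def)
        also have "\<dots> \<le> sum ?w (lev q N z)" by (rule lev_weight_bounds(1)[OF q N that(1) \<beta>])
        finally show ?thesis .
      qed
      then show ?thesis unfolding moves_def lev_step_def by blast
    qed
    then have "(n, b) \<in> (lev_step q N ?w \<theta>)\<^sup>*" using b(2) rtrancl_mono by blast
    then have "(\<Sum>\<sigma>\<in>lev q N n. ?w \<sigma> * (f \<sigma>)\<^sup>2) \<le> sum ?w (lev q N n) / \<theta> * ?P * ?E"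
    proof (rule sum_lev_square_le[OF N cw_weight_pos, rotated 2])
      show "\<And>n \<sigma> \<eta>. \<sigma> \<in> lev q N n \<Longrightarrow> \<eta> \<in> lev q N n \<Longrightarrow> ?w \<sigma> = ?w \<eta>" by (simp add: cw_weight_lev[OF N])
    qed (use f b in \<open>auto simp: \<theta>_def\<close>)
    also have "\<dots> \<le> exp (\<beta> * real N * \<delta> + 2 * ?e) * ?P * ?E"
    proof (intro mult_right_mono E0)
      have "sum ?w (lev q N n) \<le> exp (- \<beta> * real N * ?F n + ?e)"
        using lev_weight_bounds(2)[OF q N _ \<beta>] n Y by blast
      also have "\<dots> = exp (\<beta> * real N * \<delta> + 2 * ?e) * \<theta>"
        unfolding \<theta>_def by (simp add: exp_add[symmetric] algebra_simps)
      finally show "sum ?w (lev q N n) / \<theta> \<le> exp (\<beta> * real N * \<delta> + 2 * ?e)"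
        by (simp add: \<theta>_def field_simps)
    qed simp
    finally show ?thesis .
  qed
  have "(\<Sum>\<sigma>\<in>(\<Union>n\<in>Y. lev q N n). ?w \<sigma> * (f \<sigma>)\<^sup>2) = (\<Sum>n\<in>Y. \<Sum>\<sigma>\<in>lev q N n. ?w \<sigma> * (f \<sigma>)\<^sup>2)"
    by (rule sum_UN_lev[OF Y])
  also have "\<dots> \<le> (\<Sum>n\<in>Y. exp (\<beta> * real N * \<delta> + 2 * ?e) * ?P * ?E)" by (intro sum_mono one)
  also have "\<dots> = real (card Y) * (exp (\<beta> * real N * \<delta> + 2 * ?e) * ?P * ?E)" by simp
  also have "\<dots> \<le> real (N + 1) ^ q * (exp (\<beta> * real N * \<delta> + 2 * ?e) * ?P * ?E)"
  proof (rule mult_right_mono)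
    have "card Y \<le> (N + 1) ^ q" using card_mono[OF finite_comps Y] card_comps_le[of q N] by linarith
    then have "real (card Y) \<le> real ((N + 1) ^ q)" by (rule of_nat_mono)
    then show "real (card Y) \<le> real (N + 1) ^ q" by simp
  qed (use E0 in simp)
  finally show ?thesis by (simp add: poincare_bound_def mult.assoc)
qed

lemma sum_cw_weight_le:
  assumes q: "1 \<le> q" and N: "1 \<le> N" and \<beta>: "0 < \<beta>" and Y: "Y \<subseteq> comps q N"
    and F: "\<And>n. n \<in> Y \<Longrightarrow> c \<le> free_energy \<beta> q (profile q N n)"
  shows "sum (cw_weight N \<beta>) (\<Union>n\<in>Y. lev q N n) \<le> real (N + 1) ^ q * exp (- \<beta> * real N * c + entropy_error q \<beta> N)"
proof -
  have "sum (cw_weight N \<beta>) (\<Union>n\<in>Y. lev q N n) = (\<Sum>n\<in>Y. sum (cw_weight N \<beta>) (lev q N n))"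
    by (rule sum_UN_lev[OF Y])
  also have "\<dots> \<le> (\<Sum>n\<in>Y. exp (- \<beta> * real N * c + entropy_error q \<beta> N))"
  proof (rule sum_mono)
    fix n assume n: "n \<in> Y"
    have "sum (cw_weight N \<beta>) (lev q N n) \<le> exp (- \<beta> * real N * free_energy \<beta> q (profile q N n) + entropy_error q \<beta> N)"
      using lev_weight_bounds(2)[OF q N _ \<beta>] n Y by blast
    also have "\<dots> \<le> exp (- \<beta> * real N * c + entropy_error q \<beta> N)"
      using mult_left_mono[OF F[OF n], of "\<beta> * real N"] \<beta> by simp
    finally show "sum (cw_weight N \<beta>) (lev q N n) \<le> exp (- \<beta> * real N * c + entropy_error q \<beta> N)" .
  qed
  also have "\<dots> = real (card Y) * exp (- \<beta> * real N * c + entropy_error q \<beta> N)" by simp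
  also have "\<dots> \<le> real (N + 1) ^ q * exp (- \<beta> * real N * c + entropy_error q \<beta> N)"
  proof (rule mult_right_mono)
    have "card Y \<le> (N + 1) ^ q" using card_mono[OF finite_comps Y] card_comps_le[of q N] by linarith
    then have "real (card Y) \<le> real ((N + 1) ^ q)" by (rule of_nat_mono)
    then show "real (card Y) \<le> real (N + 1) ^ q" by simp
  qed simp
  finally show ?thesis .
qed

section \<open>Polynomial errors against an exponential gain\<close>

lemma eventually_power_le_exp:
  assumes a: "0 < (a::real)"
  shows "eventually (\<lambda>N. C * real (N + 1) ^ m \<le> exp (a * real N)) sequentially"
proof -
  have "((\<lambda>x::real. x ^ m / exp x) \<longlongrightarrow> 0) at_top" by (rule tendsto_power_div_exp_0)
  moreover have "filterlim (\<lambda>N. a * real (N + 1)) at_top sequentially"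
    by (rule filterlim_tendsto_pos_mult_at_top[OF tendsto_const a])
       (rule filterlim_compose[OF filterlim_real_sequentially filterlim_add_const_nat_at_top])
  ultimately have "(\<lambda>N. (a * real (N + 1)) ^ m / exp (a * real (N + 1))) \<longlonglongrightarrow> 0" by (rule filterlim_compose)
  moreover have e: "0 < exp (- a) * a ^ m / (\<bar>C\<bar> + 1)" using a by (simp add: add_nonneg_pos)
  ultimately have "eventually (\<lambda>N. (a * real (N + 1)) ^ m / exp (a * real (N + 1)) < exp (- a) * a ^ m / (\<bar>C\<bar> + 1)) sequentially"
    by (rule order_tendstoD(2))
  then show ?thesis
  proof eventually_elim
    case (elim N)
    have "a ^ m * real (N + 1) ^ m < exp (- a) * a ^ m / (\<bar>C\<bar> + 1) * exp (a * real (N + 1))"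
      using elim by (simp add: pos_divide_less_eq power_mult_distrib)
    also have "\<dots> = a ^ m * (exp (a * real N) / (\<bar>C\<bar> + 1))"
      by (simp add: exp_add[symmetric] algebra_simps)
    finally have "real (N + 1) ^ m < exp (a * real N) / (\<bar>C\<bar> + 1)"
      using a by (subst (asm) mult_less_cancel_left_pos) auto
    then have "(\<bar>C\<bar> + 1) * real (N + 1) ^ m < exp (a * real N)" by (simp add: field_simps add_nonneg_pos)
    moreover have "C * real (N + 1) ^ m \<le> (\<bar>C\<bar> + 1) * real (N + 1) ^ m" by (intro mult_right_mono) auto
    ultimately show ?case by linarith
  qed
qed

lemma polynomial_error_eventually:
  assumes a: "0 < (a::real)"
  shows "eventually (\<lambda>N. 5 * (real (N + 1) ^ q * real (N + 1) ^ q * (2 * real N * real q * real (N + 1) ^ (4 * q)) *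
    (M * real N + 1) * exp (5 * entropy_error q \<beta> N)) \<le> exp (a * real N)) sequentially"
proof -
  define C where "C = 5 * (2 * real q) * (\<bar>M\<bar> + 1) * exp (5 * (real q + \<beta> / 2))"
  from eventually_power_le_exp[OF a, of C "q + q + (1 + 4 * q) + 1 + 10 * q"] show ?thesis
  proof eventually_elim
    case (elim N)
    let ?n = "real (N + 1)"
    have n1: "1 \<le> ?n" by simp
    have e: "exp (5 * entropy_error q \<beta> N) = ?n ^ (10 * q) * exp (5 * (real q + \<beta> / 2))"
    proof -
      have "?n ^ (10 * q) = exp (real (10 * q) * ln ?n)"
        by (simp add: exp_of_nat_mult del: of_nat_Suc of_nat_mult of_nat_add)
      then have "?n ^ (10 * q) * exp (5 * (real q + \<beta> / 2)) = exp (real (10 * q) * ln ?n + 5 * (real q + \<beta> / 2))"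
        by (simp only: exp_add)
      also have "real (10 * q) * ln ?n + 5 * (real q + \<beta> / 2) = 5 * entropy_error q \<beta> N"
        by (simp add: entropy_error_def algebra_simps)
      finally show ?thesis ..
    qed
    have "M * real N + 1 \<le> (\<bar>M\<bar> + 1) * ?n"
    proof -
      have "M * real N \<le> \<bar>M\<bar> * real N" by (intro mult_right_mono) auto
      then show ?thesis by (simp add: algebra_simps)
    qed
    then have "5 * (?n ^ q * ?n ^ q * (2 * real N * real q * ?n ^ (4 * q)) * (M * real N + 1) * exp (5 * entropy_error q \<beta> N))
      \<le> 5 * (?n ^ q * ?n ^ q * (2 * ?n * real q * ?n ^ (4 * q)) * ((\<bar>M\<bar> + 1) * ?n) * exp (5 * entropy_error q \<beta> N))"
    proof -
      have "(?n ^ q * ?n ^ q * (2 * real N * real q * ?n ^ (4 * q))) * (M * real N + 1)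
        \<le> (?n ^ q * ?n ^ q * (2 * real N * real q * ?n ^ (4 * q))) * ((\<bar>M\<bar> + 1) * ?n)"
        using \<open>M * real N + 1 \<le> (\<bar>M\<bar> + 1) * ?n\<close> by (intro mult_left_mono) auto
      also have "\<dots> \<le> (?n ^ q * ?n ^ q * (2 * ?n * real q * ?n ^ (4 * q))) * ((\<bar>M\<bar> + 1) * ?n)"
        by (intro mult_right_mono mult_left_mono) auto
      finally show ?thesis by (intro mult_left_mono mult_right_mono) auto
    qed
    also have "\<dots> = C * ?n ^ (q + q + (1 + 4 * q) + 1 + 10 * q)"
      unfolding e C_def power_add by (simp only: power_one_right mult_ac)
    also have "\<dots> \<le> exp (a * real N)" by (rule elim)
    finally show ?case .
  qed
qed

text \<open>Bookkeeping in units of \<kappa>. There are five error terms, each at most a polynomial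
  factor times exp (- b (FA + 7 \<kappa>)), whereas \<open>W\<close> is at least exp (- b (FA +
  \<kappa>) - e). Of the 6 units in between, five absorb the polynomial factors and one remains as
  decay.\<close>

lemma error_arith:
  fixes b :: real
  assumes K: "K = R * (exp (b * \<kappa> + 2 * e) * S)" and c0: "c0 = R * exp (- b * (FA + \<Delta>) + e)"
    and l: "l \<le> MN + 1" and dW: "dW \<le> R * exp (- b * (FA + \<Delta>) + e)"
    and rest: "rest = R * exp (- b * (FA + \<eta>) + e)"
    and k: "0 \<le> b" "8 * \<kappa> \<le> \<Delta>" "8 * \<kappa> \<le> \<eta>" "0 \<le> \<kappa>"
    and pos: "1 \<le> R" "1 \<le> S" "0 \<le> MN" "0 \<le> e"
    and big: "5 * (R * R * S * (MN + 1) * exp (5 * e)) \<le> exp (5 * (b * \<kappa>))"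
    and W: "exp (- b * (FA + \<kappa>) - e) \<le> W"
  shows "(K * c0 * l + dW) + (K * c0 * l + dW) + rest \<le> exp (- (b * \<kappa>)) * W"
proof -
  define P where "P = R * R * S * (MN + 1) * exp (4 * e)"
  define G where "G = exp (- b * (FA + 7 * \<kappa>))"
  have RR: "R \<le> R * R * S * (MN + 1)"
  proof -
    have "1 * 1 \<le> R * S" using pos by (intro mult_mono) auto
    then have "1 * 1 \<le> (R * S) * (MN + 1)" using pos by (intro mult_mono) auto
    then have "R * 1 \<le> R * ((R * S) * (MN + 1))" using pos by (intro mult_left_mono) auto
    then show ?thesis by (simp add: mult_ac)
  qed
  have g: "exp (- b * (FA + t)) \<le> G" if "7 * \<kappa> \<le> t" for t
    unfolding G_def using that k(1) by (simp add: mult_left_mono)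
  have RG: "R * exp (- b * (FA + t) + e) \<le> P * G" if "7 * \<kappa> \<le> t" for t
  proof -
    have "R * exp (- b * (FA + t) + e) = R * (exp e * exp (- b * (FA + t)))" by (simp add: exp_add[symmetric] add.commute)
    also have "\<dots> \<le> (R * R * S * (MN + 1)) * (exp (4 * e) * G)"
      using g[OF that] RR pos by (intro mult_mono) auto
    finally show ?thesis by (simp add: P_def mult.assoc)
  qed
  have Kc: "K * c0 * l \<le> P * G"
  proof -
    have "exp (b * \<kappa> + 2 * e) * exp (- b * (FA + \<Delta>) + e) = exp (3 * e) * exp (- b * (FA + (\<Delta> - \<kappa>)))"
      by (simp add: exp_add[symmetric] algebra_simps)
    also have "\<dots> \<le> exp (4 * e) * G" using k pos by (intro mult_mono g) auto
    finally have "exp (b * \<kappa> + 2 * e) * exp (- b * (FA + \<Delta>) + e) \<le> exp (4 * e) * G" .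
    then have "(R * R * S * (MN + 1)) * (exp (b * \<kappa> + 2 * e) * exp (- b * (FA + \<Delta>) + e)) \<le> (R * R * S * (MN + 1)) * (exp (4 * e) * G)"
      using pos by (intro mult_left_mono) auto
    moreover have "K * c0 * l \<le> K * c0 * (MN + 1)" using l pos unfolding K c0 by (intro mult_left_mono) auto
    ultimately show ?thesis unfolding K c0 P_def by (simp add: mult_ac)
  qed
  have 1: "dW \<le> P * G" using RG[of \<Delta>] dW k by linarith
  have 2: "rest \<le> P * G" unfolding rest using RG[of \<eta>] k by linarith
  have "5 * (P * G) \<le> exp (- (b * \<kappa>)) * exp (- b * (FA + \<kappa>) - e)"
  proof -
    have "5 * (P * G) = 5 * (R * R * S * (MN + 1) * exp (5 * e)) * (exp (- e) * G)"
      unfolding P_def by (simp add: mult_ac exp_add[symmetric])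
    also have "\<dots> \<le> exp (5 * (b * \<kappa>)) * (exp (- e) * G)"
      using big by (intro mult_right_mono) (auto simp: G_def)
    also have "\<dots> = exp (- (b * \<kappa>)) * exp (- b * (FA + \<kappa>) - e)"
      unfolding G_def by (simp add: exp_add[symmetric] algebra_simps)
    finally show ?thesis .
  qed
  also have "\<dots> \<le> exp (- (b * \<kappa>)) * W" using W by (intro mult_left_mono) auto
  finally show ?thesis using Kc 1 2 by linarith
qed

section \<open>Valleys and the concentration estimate\<close>

context wells
begin

definition well_union :: "(nat \<Rightarrow> nat \<Rightarrow> nat \<Rightarrow> real) \<Rightarrow> nat set \<Rightarrow> nat \<Rightarrow> config set" where
  "well_union m J N = (\<Union>i\<in>J. level_set q N (m i N))"

definition perturbed :: "nat \<Rightarrow> real \<Rightarrow> (config \<Rightarrow> real) \<Rightarrow> bool" where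
  "perturbed N D w \<longleftrightarrow> (\<forall>\<sigma>\<in>configs q N. exp (- D) * cw_weight N \<beta> \<sigma> \<le> w \<sigma> \<and> w \<sigma> \<le> exp D * cw_weight N \<beta> \<sigma>)"

lemma free_energy_lower:
  obtains C where "0 \<le> C" "\<And>x. x \<in> prob_simplex q \<Longrightarrow> - C \<le> F x"
proof -
  obtain x where x: "global_minimizer q F x" using global_minimizer_exists[of q \<beta>] q by auto
  show thesis by (rule that[of "\<bar>F x\<bar>"]) (use x in \<open>force simp: global_minimizer_def\<close>)+
qed

text \<open>The low levels are split by the pure landscape: \<open>VA\<close> descends to the
  starting wells and the other low levels \<open>VB\<close> must descend to the targets. The
  Poincare inequality towards \<open>A\<close> handles 1 - h on the first part, the one towards
  \<open>B\<close> handles h on the second, and high levels have little weight. The set V depends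
  neither on the perturbed weight nor on D.\<close>

lemma potential_concentrates:
  assumes m: "\<And>i N. i \<le> q \<Longrightarrow> 1 \<le> N \<Longrightarrow> closest_lattice_point q N (\<mu> i) (m i N)"
  shows "\<exists>\<epsilon>>0. eventually (\<lambda>N. 1 \<le> N \<and>
    well_union m IA N \<subseteq> configs q N \<and> well_union m IB N \<subseteq> configs q N \<and>
    well_union m IA N \<inter> well_union m IB N = {} \<and> well_union m IA N \<noteq> {} \<and> well_union m IB N \<noteq> {} \<and>
    (\<exists>V\<subseteq>configs q N. V \<noteq> {} \<and> (\<forall>w D h. 0 \<le> D \<longrightarrow> perturbed N D w \<longrightarrow>
      equilibrium (configs q N) (conductance q N w) (well_union m IA N) (well_union m IB N) h \<longrightarrow>
      (\<Sum>\<sigma>\<in>V. w \<sigma> * (1 - h \<sigma>)) + (\<Sum>\<sigma>\<in>configs q N - V. w \<sigma> * h \<sigma>)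
        \<le> exp (3 * D - \<epsilon> * real N) * sum (cw_weight N \<beta>) V))) sequentially"
proof -
  note bp = \<beta>_pos
  have q1: "1 \<le> q" using q by simp
  have "\<forall>i N. \<exists>n. i \<le> q \<and> 1 \<le> N \<longrightarrow> n \<in> comps q N \<and> m i N = profile q N n \<and>
      (\<forall>k\<in>{1..q}. \<bar>profile q N n k - \<mu> i k\<bar> \<le> (real q)\<^sup>2 / real N)"
    using closest_lattice_point_obtains[OF q1 _ minimizer_in_simplex m] by metis
  then obtain b where b: "\<And>i N. i \<le> q \<Longrightarrow> 1 \<le> N \<Longrightarrow> b i N \<in> comps q N"
    "\<And>i N. i \<le> q \<Longrightarrow> 1 \<le> N \<Longrightarrow> m i N = profile q N (b i N)"
    "\<And>i N k. i \<le> q \<Longrightarrow> 1 \<le> N \<Longrightarrow> k \<in> {1..q} \<Longrightarrow> \<bar>profile q N (b i N) k - \<mu> i k\<bar> \<le> (real q)\<^sup>2 / real N"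
    by metis
  have lev_b: "level_set q N (m i N) = lev q N (b i N)" if "i \<le> q" "1 \<le> N" for i N
    using b(2)[OF that] level_set_profile[OF that(2)] by simp
  obtain r \<Delta> where r: "0 < r" and \<Delta>: "0 < \<Delta>"
    and shell: "\<And>i y. i \<in> IA \<Longrightarrow> y \<in> prob_simplex q \<Longrightarrow> near q r (\<mu> i) y \<Longrightarrow> \<not> near q (r / 2) (\<mu> i) y \<Longrightarrow> FA + \<Delta> \<le> F y"
    and sep: "\<And>i j. i \<in> IA \<Longrightarrow> j \<le> q \<Longrightarrow> i \<noteq> j \<Longrightarrow> \<not> near q (2 * r) (\<mu> i) (\<mu> j)"
    using barrier by blast
  obtain \<eta> where \<eta>: "0 < \<eta>" and desc: "\<And>\<delta>. 0 < \<delta> \<Longrightarrow> \<exists>N0. \<forall>N\<ge>N0. \<forall>n\<in>comps q N. F (profile q N n) \<le> FA + \<eta> \<longrightarrow>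
    (\<exists>i\<in>IA \<union> IB. \<forall>b\<in>comps q N. (\<forall>k\<in>{1..q}. \<bar>profile q N b k - \<mu> i k\<bar> \<le> (real q)\<^sup>2 / real N) \<longrightarrow>
      (n, b) \<in> (moves q N {z. F (profile q N z) \<le> F (profile q N n) + \<delta>})\<^sup>*)"
    using descent_path by blast
  obtain C where C: "0 \<le> C" "\<And>x. x \<in> prob_simplex q \<Longrightarrow> - C \<le> F x" using free_energy_lower by blast
  \<comment> \<open>The unit of \<open>error_arith\<close>: both the barrier and the descent margin
    are worth at least 8 of it.\<close>
  define \<kappa> where "\<kappa> = min \<Delta> \<eta> / 8"
  have \<kappa>: "0 < \<kappa>" "8 * \<kappa> \<le> \<Delta>" "8 * \<kappa> \<le> \<eta>" using \<Delta> \<eta> by (auto simp: \<kappa>_def)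
  \<comment> \<open>Rate of the shift \<open>d\<close>: exp (- M N) times the total weight is of the
    order exp (- \<beta> N (FA + \<Delta>)), like the capacity bound, up to the same polynomial
    factor.\<close>
  define M where "M = \<beta> * (C + FA + \<Delta>)"
  obtain iA where iA: "iA \<in> IA" using I by auto
  have "- C \<le> FA" using C(2)[OF minimizer_in_simplex[of iA]] IA_eq[OF iA] iA I(1) by auto
  then have M0: "0 \<le> M" using bp \<Delta> by (simp add: M_def)
  obtain s where s: "0 < s" "\<And>x y. x \<in> prob_simplex q \<Longrightarrow> y \<in> prob_simplex q \<Longrightarrow> near q s x y \<Longrightarrow> \<bar>F x - F y\<bar> < \<kappa>"
    using free_energy_uniformly_continuous[OF \<kappa>(1)] by blast
  obtain N1 where N1: "\<And>N n. N1 \<le> N \<Longrightarrow> n \<in> comps q N \<Longrightarrow> F (profile q N n) \<le> FA + \<eta> \<Longrightarrow>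
    \<exists>i\<in>IA \<union> IB. \<forall>b\<in>comps q N. (\<forall>k\<in>{1..q}. \<bar>profile q N b k - \<mu> i k\<bar> \<le> (real q)\<^sup>2 / real N) \<longrightarrow>
      (n, b) \<in> (moves q N {z. F (profile q N z) \<le> F (profile q N n) + \<kappa>})\<^sup>*"
    using desc[OF \<kappa>(1)] by blast
  have evq: "eventually (\<lambda>N. (real q)\<^sup>2 / real N < t) sequentially" if "0 < t" for t
    using order_tendstoD(2)[OF lim_const_over_n[of "(real q)\<^sup>2"] that] .
  have "eventually (\<lambda>N. 5 * (real (N + 1) ^ q * real (N + 1) ^ q * (2 * real N * real q * real (N + 1) ^ (4 * q)) *
    (M * real N + 1) * exp (5 * entropy_error q \<beta> N)) \<le> exp (5 * \<beta> * \<kappa> * real N)) sequentially"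
    using bp \<kappa> by (intro polynomial_error_eventually) simp
  then show ?thesis
  proof (intro exI[of _ "\<beta> * \<kappa>"] conjI)
    show "0 < \<beta> * \<kappa>" using bp \<kappa> by simp
    assume big: "eventually (\<lambda>N. 5 * (real (N + 1) ^ q * real (N + 1) ^ q * (2 * real N * real q * real (N + 1) ^ (4 * q)) *
      (M * real N + 1) * exp (5 * entropy_error q \<beta> N)) \<le> exp (5 * \<beta> * \<kappa> * real N)) sequentially"
    have r4: "0 < r / 4" using r by simp
    show "eventually (\<lambda>N. 1 \<le> N \<and>
      well_union m IA N \<subseteq> configs q N \<and> well_union m IB N \<subseteq> configs q N \<and>
      well_union m IA N \<inter> well_union m IB N = {} \<and> well_union m IA N \<noteq> {} \<and> well_union m IB N \<noteq> {} \<and>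
      (\<exists>V\<subseteq>configs q N. V \<noteq> {} \<and> (\<forall>w D h. 0 \<le> D \<longrightarrow> perturbed N D w \<longrightarrow>
      equilibrium (configs q N) (conductance q N w) (well_union m IA N) (well_union m IB N) h \<longrightarrow>
      (\<Sum>\<sigma>\<in>V. w \<sigma> * (1 - h \<sigma>)) + (\<Sum>\<sigma>\<in>configs q N - V. w \<sigma> * h \<sigma>)
        \<le> exp (3 * D - \<beta> * \<kappa> * real N) * sum (cw_weight N \<beta>) V))) sequentially"
      using big eventually_ge_at_top[of "max 1 N1"] evq[OF r4] evq[OF s(1)]
    proof eventually_elim
      case (elim N)
      have N: "1 \<le> N" "N1 \<le> N" using elim(2) by auto
      note qr = elim(3) and qs = elim(4)
      let ?S = "configs q N" and ?w = "cw_weight N \<beta>" and ?P = "profile q N" and ?A = "well_union m IA N" and ?B = "well_union m IB N"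
      note pS = profile_in_simplex[OF N(1)]
      have Iq: "i \<le> q" if "i \<in> IA \<union> IB" for i using that I by auto
      have AU: "?A = (\<Union>i\<in>IA. lev q N (b i N))" and BU: "?B = (\<Union>i\<in>IB. lev q N (b i N))"
        using lev_b[OF Iq N(1)] by (auto simp: well_union_def)
      have sub: "?A \<subseteq> ?S" "?B \<subseteq> ?S" using lev_subset unfolding AU BU by blast+
      have ne: "?A \<noteq> {}" "?B \<noteq> {}"
      proof -
        have "lev q N (b i N) \<noteq> {}" if "i \<in> IA \<union> IB" for i
          by (rule ln_card_lev_bounds(1)[OF q1 N(1) b(1)[OF Iq[OF that] N(1)]])
        then show "?A \<noteq> {}" "?B \<noteq> {}" using I(4,5) unfolding AU BU by blast+
      qed
      have bn: "near q t (\<mu> i) (?P (b i N))" if "i \<le> q" "(real q)\<^sup>2 / real N < t" for i t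
        unfolding near_def
      proof
        fix k assume "k \<in> {1..q}"
        from b(3)[OF that(1) N(1) this] that(2) show "\<bar>\<mu> i k - ?P (b i N) k\<bar> < t" by linarith
      qed
      \<comment> \<open>The radius lies between r / 2 and r: one spin flip moves the profile by less
        than r / 4, so configurations at the inner boundary of the region are in the shell where the
        energy is at least FA + \<Delta>.\<close>
      define inU where "inU n \<longleftrightarrow> (\<exists>i\<in>IA. near q (3 * r / 4) (\<mu> i) (?P n))" for n
      have UB: "\<not> inU (b j N)" if "j \<in> IB" for j
      proof
        assume "inU (b j N)"
        then obtain i where i: "i \<in> IA" "near q (3 * r / 4) (\<mu> i) (?P (b j N))" by (auto simp: inU_def)
        have "near q (3 * r / 4 + r / 4) (\<mu> i) (\<mu> j)"
        proof (rule near_triangle[OF i(2)])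
          have "near q (r / 4) (\<mu> j) (?P (b j N))" by (rule bn[OF Iq qr]) (use that in simp)
          then show "near q (r / 4) (?P (b j N)) (\<mu> j)" by (simp only: near_commute)
        qed
        then have "near q (2 * r) (\<mu> i) (\<mu> j)" by (rule near_mono) (use r in simp)
        then show False using sep[of i j] i that I Iq by blast
      qed
      have UA: "inU (b i N)" if "i \<in> IA" for i
      proof -
        have "near q (r / 4) (\<mu> i) (?P (b i N))" by (rule bn[OF Iq qr]) (use that in simp)
        then have "near q (3 * r / 4) (\<mu> i) (?P (b i N))" by (rule near_mono) (use r in simp)
        then show ?thesis unfolding inU_def using that by blast
      qed
      define U where "U = {\<sigma> \<in> ?S. inU (cnt N \<sigma>)}"
      have P_cnt: "?P (cnt N \<sigma>) = ?P n" if "\<sigma> \<in> lev q N n" for \<sigma> n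
        using that by (auto simp: lev_def profile_def intro!: restrict_ext)
      have U_lev: "\<sigma> \<in> U \<longleftrightarrow> inU n" if "\<sigma> \<in> lev q N n" for \<sigma> n
        using that lev_subset P_cnt[OF that] by (auto simp: U_def inU_def)
      define g where "g \<sigma> = (of_bool (\<sigma> \<in> U) :: real)" for \<sigma>
      have gA: "g \<sigma> = 1" if "\<sigma> \<in> ?A" for \<sigma> using that UA U_lev unfolding AU g_def by auto
      have gB: "g \<sigma> = 0" if "\<sigma> \<in> ?B" for \<sigma> using that UB U_lev unfolding BU g_def by auto
      have AB0: "?A \<inter> ?B = {}" using gA gB by force
      define e where "e = entropy_error q \<beta> N"
      define c0 where "c0 = real (N + 1) ^ q * exp (- (\<beta> * real N) * (FA + \<Delta>) + e)"
      have gE: "energy ?S (conductance q N ?w) g g \<le> c0"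
      proof -
        let ?Y = "{n \<in> comps q N. FA + \<Delta> \<le> F (?P n)}"
        have "energy ?S (conductance q N ?w) g g \<le> sum ?w (\<Union>n\<in>?Y. lev q N n)"
          unfolding g_def
        proof (rule energy_indicator_le)
          show "U \<subseteq> ?S" by (auto simp: U_def)
          show "(\<Union>n\<in>?Y. lev q N n) \<subseteq> ?S" using lev_subset by blast
          fix \<sigma> \<eta> assume \<sigma>: "\<sigma> \<in> U" and \<eta>: "\<eta> \<in> ?S - U" and d: "differ_once N \<sigma> \<eta>"
          obtain n where n: "n \<in> comps q N" "\<sigma> \<in> lev q N n" using \<sigma> configs_eq_UN_lev[of q N] by (auto simp: U_def)
          obtain i where i: "i \<in> IA" "near q (3 * r / 4) (\<mu> i) (?P n)" using \<sigma> U_lev[OF n(2)] by (auto simp: inU_def)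
          have "\<not> near q (r / 2) (\<mu> i) (?P n)"
          proof
            assume a: "near q (r / 2) (\<mu> i) (?P n)"
            have "near q (r / 4) (?P (cnt N \<sigma>)) (?P (cnt N \<eta>))"
              unfolding near_def
            proof
              fix k assume k: "k \<in> {1..q}"
              have "\<bar>?P (cnt N \<sigma>) k - ?P (cnt N \<eta>) k\<bar> = \<bar>real (cnt N \<sigma> k) - real (cnt N \<eta> k)\<bar> / real N"
                using k by (simp add: profile_def diff_divide_distrib[symmetric])
              also have "\<dots> \<le> 1 / real N" using differ_once_cnt[OF d] by (intro divide_right_mono) auto
              also have "\<dots> \<le> (real q)\<^sup>2 / real N" using q by (intro divide_right_mono one_le_power) auto
              finally show "\<bar>?P (cnt N \<sigma>) k - ?P (cnt N \<eta>) k\<bar> < r / 4" using qr by linarith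
            qed
            then have "near q (r / 2 + r / 4) (\<mu> i) (?P (cnt N \<eta>))"
              using near_triangle[OF a, of "r / 4"] P_cnt[OF n(2)] by simp
            then have "inU (cnt N \<eta>)" unfolding inU_def using i by (intro bexI[of _ i]) (auto elim: near_mono)
            then show False using \<eta> by (simp add: U_def)
          qed
          moreover have "near q r (\<mu> i) (?P n)" using i(2) r by (auto elim: near_mono)
          ultimately have "FA + \<Delta> \<le> F (?P n)" using shell i pS n by blast
          then show "\<sigma> \<in> (\<Union>n\<in>?Y. lev q N n)" using n by blast
        qed (rule cw_weight_pos)
        also have "\<dots> \<le> real (N + 1) ^ q * exp (- \<beta> * real N * (FA + \<Delta>) + entropy_error q \<beta> N)"
          by (rule sum_cw_weight_le[OF q1 N(1) bp]) auto
        finally show ?thesis by (simp add: c0_def e_def)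
      qed
      define low where "low = {n \<in> comps q N. F (?P n) \<le> FA + \<eta>}"
      \<comment> \<open>The path may climb by \<kappa> at most; the loss exp (\<beta> N \<kappa>) in
        the Poincare constant is one unit.\<close>
      define toA where "toA n \<longleftrightarrow> (\<exists>i\<in>IA. (n, b i N) \<in> (moves q N {z. F (?P z) \<le> F (?P n) + \<kappa>})\<^sup>*)" for n
      define VA where "VA = {n \<in> low. toA n}"
      define VB where "VB = {n \<in> low. \<not> toA n}"
      define HI where "HI = {n \<in> comps q N. FA + \<eta> \<le> F (?P n)}"
      have subs: "VA \<subseteq> comps q N" "VB \<subseteq> comps q N" "HI \<subseteq> comps q N" by (auto simp: VA_def VB_def low_def HI_def)
      let ?V = "\<Union>n\<in>VA. lev q N n" and ?VB = "\<Union>n\<in>VB. lev q N n" and ?HI = "\<Union>n\<in>HI. lev q N n"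
      have reachA: "\<exists>c\<in>comps q N. lev q N c \<subseteq> ?A \<and> (n, c) \<in> (moves q N {z. F (?P z) \<le> F (?P n) + \<kappa>})\<^sup>*" if "n \<in> VA" for n
        using that b(1)[OF Iq N(1)] unfolding VA_def toA_def AU by blast
      have reachB: "\<exists>c\<in>comps q N. lev q N c \<subseteq> ?B \<and> (n, c) \<in> (moves q N {z. F (?P z) \<le> F (?P n) + \<kappa>})\<^sup>*" if n: "n \<in> VB" for n
      proof -
        from n have "n \<in> comps q N" "F (?P n) \<le> FA + \<eta>" "\<not> toA n" by (auto simp: VB_def low_def)
        from N1[OF N(2) this(1,2)] obtain i where i: "i \<in> IA \<union> IB" and
          *: "\<And>c. c \<in> comps q N \<Longrightarrow> (\<forall>k\<in>{1..q}. \<bar>?P c k - \<mu> i k\<bar> \<le> (real q)\<^sup>2 / real N) \<Longrightarrow>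
            (n, c) \<in> (moves q N {z. F (?P z) \<le> F (?P n) + \<kappa>})\<^sup>*" by blast
        have p: "(n, b i N) \<in> (moves q N {z. F (?P z) \<le> F (?P n) + \<kappa>})\<^sup>*"
          using b(3)[OF Iq[OF i] N(1)] by (intro * b(1) Iq i N) auto
        then have "i \<in> IB" using \<open>\<not> toA n\<close> i by (auto simp: toA_def)
        then show ?thesis using p b(1)[OF Iq[OF i] N(1)] unfolding BU by blast
      qed
      have bA: "b iA N \<in> VA"
      proof -
        have "\<bar>F (\<mu> iA) - F (?P (b iA N))\<bar> < \<kappa>"
          by (intro s(2) minimizer_in_simplex pS b N bn qs Iq) (use iA in auto)
        then have "F (?P (b iA N)) \<le> FA + \<eta>" using IA_eq[OF iA] \<kappa> by linarith
        then show ?thesis using iA b(1)[OF Iq N(1)] by (auto simp: VA_def low_def toA_def)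
      qed
      have Vne: "?V \<noteq> {}"
      proof -
        have "lev q N (b iA N) \<noteq> {}" by (rule ln_card_lev_bounds(1)[OF q1 N(1)]) (use bA subs in blast)
        then show ?thesis using bA by blast
      qed
      have VW: "exp (- (\<beta> * real N) * (FA + \<kappa>) - e) \<le> sum ?w ?V"
      proof -
        have bc: "b iA N \<in> comps q N" using bA subs by auto
        have "\<bar>F (\<mu> iA) - F (?P (b iA N))\<bar> < \<kappa>"
          by (intro s(2) minimizer_in_simplex pS b N bn qs Iq) (use iA in auto)
        then have "F (?P (b iA N)) \<le> FA + \<kappa>" using IA_eq[OF iA] by linarith
        then have "\<beta> * real N * F (?P (b iA N)) \<le> \<beta> * real N * (FA + \<kappa>)" using bp by (intro mult_left_mono) auto
        then have "exp (- (\<beta> * real N) * (FA + \<kappa>) - e) \<le> exp (- \<beta> * real N * F (?P (b iA N)) - entropy_error q \<beta> N)"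
          by (simp add: e_def)
        also have "\<dots> \<le> sum ?w (lev q N (b iA N))" by (rule lev_weight_bounds(1)[OF q1 N(1) bc bp])
        also have "\<dots> \<le> sum ?w ?V"
        proof (rule sum_mono2)
          show "finite ?V" using finite_subset[OF subs(1) finite_comps] finite_lev by blast
        qed (use bA cw_weight_pos in \<open>auto intro: less_imp_le\<close>)
        finally show ?thesis .
      qed
      have e0: "0 \<le> e" unfolding e_def entropy_error_def using bp by (intro add_nonneg_nonneg mult_nonneg_nonneg) auto
      define d where "d = exp (- (M * real N))"
      have d: "0 < d" by (simp add: d_def)
      have l: "ln ((1 + d) / d) \<le> M * real N + 1"
      proof -
        have "0 \<le> M * real N" using M0 by simp
        then have "1 \<le> exp (M * real N)" by simp
        then have "(1 + d) / d \<le> 2 * exp (M * real N)" by (simp add: d_def exp_minus field_simps)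
        also have "\<dots> \<le> exp 1 * exp (M * real N)" using exp_ge_add_one_self[of 1] by (intro mult_right_mono) auto
        also have "\<dots> = exp (M * real N + 1)" by (simp add: exp_add[symmetric])
        finally have "ln ((1 + d) / d) \<le> ln (exp (M * real N + 1))" using d by (subst ln_le_cancel_iff) auto
        then show ?thesis by simp
      qed
      have dW: "d * sum ?w ?S \<le> real (N + 1) ^ q * exp (- (\<beta> * real N) * (FA + \<Delta>) + e)"
      proof -
        have "sum ?w ?S \<le> real (N + 1) ^ q * exp (- \<beta> * real N * (- C) + entropy_error q \<beta> N)"
          unfolding configs_eq_UN_lev by (rule sum_cw_weight_le[OF q1 N(1) bp]) (auto intro: C pS)
        then have "d * sum ?w ?S \<le> d * (real (N + 1) ^ q * exp (- \<beta> * real N * (- C) + entropy_error q \<beta> N))"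
          using d by (intro mult_left_mono) auto
        also have "\<dots> = real (N + 1) ^ q * exp (- (\<beta> * real N) * (FA + \<Delta>) + e)"
          unfolding d_def M_def e_def
          by (simp add: mult.left_commute[of "exp _"] exp_add[symmetric] algebra_simps)
        finally show ?thesis .
      qed
      define K where "K = poincare_bound q \<beta> \<kappa> N"
      have K0: "0 \<le> K" by (simp add: K_def poincare_bound_def)
      define rest where "rest = real (N + 1) ^ q * exp (- (\<beta> * real N) * (FA + \<eta>) + e)"
      have arith: "(K * c0 * ln ((1 + d) / d) + d * sum ?w ?S) + (K * c0 * ln ((1 + d) / d) + d * sum ?w ?S) + rest
        \<le> exp (- (\<beta> * real N * \<kappa>)) * sum ?w ?V"
      proof (rule error_arith[OF _ c0_def l dW rest_def _ \<kappa>(2,3) _ _ _ _ e0 _ VW])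
        show "K = real (N + 1) ^ q * (exp (\<beta> * real N * \<kappa> + 2 * e) * (2 * real N * real q * real (N + 1) ^ (4 * q)))"
          by (simp add: K_def poincare_bound_def e_def)
        show "1 \<le> real (N + 1) ^ q" by (rule one_le_power) simp
        have "1 * 1 * 1 * 1 \<le> 2 * real N * real q * real (N + 1) ^ (4 * q)"
          using N q1 by (intro mult_mono one_le_power) auto
        then show "1 \<le> 2 * real N * real q * real (N + 1) ^ (4 * q)" by simp
        show "5 * (real (N + 1) ^ q * real (N + 1) ^ q * (2 * real N * real q * real (N + 1) ^ (4 * q)) *
            (M * real N + 1) * exp (5 * e)) \<le> exp (5 * (\<beta> * real N * \<kappa>))"
          using elim(1) by (simp add: e_def mult_ac)
      qed (use bp \<kappa> M0 in auto)
      show ?case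
      proof (intro conjI N sub ne AB0 exI[of _ ?V] Vne allI impI)
        show "?V \<subseteq> ?S" using lev_subset by blast
        fix w D h assume D: "0 \<le> D" and pw: "perturbed N D w" and h: "equilibrium ?S (conductance q N w) ?A ?B h"
        have w: "exp (- D) * ?w \<sigma> \<le> w \<sigma> \<and> w \<sigma> \<le> exp D * ?w \<sigma>" if "\<sigma> \<in> ?S" for \<sigma>
          using pw that by (simp add: perturbed_def)
        have wpos: "0 < w \<sigma>" if "\<sigma> \<in> ?S" for \<sigma>
          using w[OF that] cw_weight_pos[of N \<beta> \<sigma>] by (smt (verit) exp_gt_zero mult_pos_pos)
        interpret network ?S "conductance q N w" using wpos by (rule network_conductance)
        interpret cw: network ?S "conductance q N ?w" by (rule network_conductance) (rule cw_weight_pos)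
        have h01: "0 \<le> h \<sigma>" "h \<sigma> \<le> 1" if "\<sigma> \<in> ?S" for \<sigma> using h that by (auto simp: equilibrium_def)
        let ?b = "exp (3 * D) * (K * c0 * ln ((1 + d) / d) + d * sum ?w ?S)"
        \<comment> \<open>With the roles exchanged, \<open>1 - h\<close> is the equilibrium
          potential that vanishes on \<open>?A\<close>, the end of all descending paths from
          V.\<close>
        have 1: "(\<Sum>\<sigma>\<in>?V. w \<sigma> * (1 - h \<sigma>)) \<le> ?b"
        proof (rule perturbed_sum_equilibrium_le[where g="\<lambda>\<sigma>. 1 - g \<sigma>" and w'="?w" and A="?B" and B="?A"])
          show "equilibrium ?S (conductance q N w) ?B ?A (\<lambda>\<sigma>. 1 - h \<sigma>)" using h by (rule equilibrium_swap)
          show "energy ?S (conductance q N ?w) (\<lambda>\<sigma>. 1 - g \<sigma>) (\<lambda>\<sigma>. 1 - g \<sigma>) \<le> c0"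
            using gE by (simp only: cw.energy_one_minus)
          show "(\<Sum>\<sigma>\<in>?V. ?w \<sigma> * (f \<sigma>)\<^sup>2) \<le> K * energy ?S (conductance q N ?w) f f" if "\<And>\<sigma>. \<sigma> \<in> ?A \<Longrightarrow> f \<sigma> = 0" for f
            unfolding K_def using that by (intro cw_poincare[OF q1 N(1) bp subs(1) reachA]) auto
          show "?V \<subseteq> ?S" using lev_subset by blast
        qed (use D w sub AB0 K0 gA gB d cw_weight_pos in auto)
        have 2: "(\<Sum>\<sigma>\<in>?VB. w \<sigma> * h \<sigma>) \<le> ?b"
        proof (rule perturbed_sum_equilibrium_le[where g=g and w'="?w" and A="?A" and B="?B", OF _ _ _ _ _ _ h])
          show "(\<Sum>\<sigma>\<in>?VB. ?w \<sigma> * (f \<sigma>)\<^sup>2) \<le> K * energy ?S (conductance q N ?w) f f" if "\<And>\<sigma>. \<sigma> \<in> ?B \<Longrightarrow> f \<sigma> = 0" for f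
            unfolding K_def using that by (intro cw_poincare[OF q1 N(1) bp subs(2) reachB]) auto
          show "?VB \<subseteq> ?S" using lev_subset by blast
        qed (use D w sub AB0 K0 gA gB gE d cw_weight_pos in auto)
        have 3: "(\<Sum>\<sigma>\<in>?HI. w \<sigma> * h \<sigma>) \<le> exp (3 * D) * rest"
        proof -
          have "(\<Sum>\<sigma>\<in>?HI. w \<sigma> * h \<sigma>) \<le> (\<Sum>\<sigma>\<in>?HI. exp (3 * D) * ?w \<sigma>)"
          proof (rule sum_mono)
            fix \<sigma> assume "\<sigma> \<in> ?HI"
            then have \<sigma>: "\<sigma> \<in> ?S" using lev_subset by blast
            have "w \<sigma> * h \<sigma> \<le> w \<sigma> * 1" using h01[OF \<sigma>] wpos[OF \<sigma>] by (intro mult_left_mono) auto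
            also have "\<dots> \<le> exp D * ?w \<sigma>" using w[OF \<sigma>] by simp
            also have "\<dots> \<le> exp (3 * D) * ?w \<sigma>" using D cw_weight_pos[of N \<beta> \<sigma>] by (intro mult_right_mono) auto
            finally show "w \<sigma> * h \<sigma> \<le> exp (3 * D) * ?w \<sigma>" .
          qed
          also have "\<dots> = exp (3 * D) * sum ?w ?HI" by (simp add: sum_distrib_left)
          also have "sum ?w ?HI \<le> real (N + 1) ^ q * exp (- \<beta> * real N * (FA + \<eta>) + entropy_error q \<beta> N)"
            by (rule sum_cw_weight_le[OF q1 N(1) bp subs(3)]) (auto simp: HI_def)
          finally show ?thesis by (simp add: rest_def e_def)
        qed
        have "(\<Sum>\<sigma>\<in>?S - ?V. w \<sigma> * h \<sigma>) \<le> (\<Sum>\<sigma>\<in>?VB \<union> ?HI. w \<sigma> * h \<sigma>)"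
        proof (rule sum_mono2)
          show "finite (?VB \<union> ?HI)" using finite_subset[OF subs(2) finite_comps] finite_subset[OF subs(3) finite_comps] finite_lev by blast
          show "?S - ?V \<subseteq> ?VB \<union> ?HI"
          proof
            fix \<sigma> assume \<sigma>: "\<sigma> \<in> ?S - ?V"
            then obtain n where n: "n \<in> comps q N" "\<sigma> \<in> lev q N n" using configs_eq_UN_lev[of q N] by auto
            then have "n \<notin> VA" using \<sigma> by auto
            then have "n \<in> VB \<or> n \<in> HI" using n by (auto simp: VA_def VB_def HI_def low_def)
            then show "\<sigma> \<in> ?VB \<union> ?HI" using n by auto
          qed
        next
          fix \<sigma> assume "\<sigma> \<in> (?VB \<union> ?HI) - (?S - ?V)"
          then have \<sigma>: "\<sigma> \<in> ?S" using lev_subset by blast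
          show "0 \<le> w \<sigma> * h \<sigma>" using wpos[OF \<sigma>] h01[OF \<sigma>] by simp
        qed
        also have "\<dots> \<le> (\<Sum>\<sigma>\<in>?VB. w \<sigma> * h \<sigma>) + (\<Sum>\<sigma>\<in>?HI. w \<sigma> * h \<sigma>)"
        proof -
          have fin: "finite ?VB" "finite ?HI" using finite_subset[OF subs(2) finite_comps] finite_subset[OF subs(3) finite_comps] finite_lev by blast+
          have "0 \<le> (\<Sum>\<sigma>\<in>?VB \<inter> ?HI. w \<sigma> * h \<sigma>)"
          proof (rule sum_nonneg)
            fix \<sigma> assume "\<sigma> \<in> ?VB \<inter> ?HI"
            then have \<sigma>: "\<sigma> \<in> ?S" using lev_subset by blast
            show "0 \<le> w \<sigma> * h \<sigma>" using wpos[OF \<sigma>] h01[OF \<sigma>] by simp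
          qed
          then show ?thesis using sum.union_inter[OF fin, of "\<lambda>\<sigma>. w \<sigma> * h \<sigma>"] by linarith
        qed
        finally have "(\<Sum>\<sigma>\<in>?V. w \<sigma> * (1 - h \<sigma>)) + (\<Sum>\<sigma>\<in>?S - ?V. w \<sigma> * h \<sigma>) \<le> ?b + ?b + exp (3 * D) * rest"
          using 1 2 3 by linarith
        also have "\<dots> = exp (3 * D) * ((K * c0 * ln ((1 + d) / d) + d * sum ?w ?S) + (K * c0 * ln ((1 + d) / d) + d * sum ?w ?S) + rest)"
          by (simp only: distrib_left)
        also have "\<dots> \<le> exp (3 * D) * (exp (- (\<beta> * real N * \<kappa>)) * sum ?w ?V)" using arith by (intro mult_left_mono) auto
        also have "\<dots> = exp (3 * D - \<beta> * \<kappa> * real N) * sum ?w ?V"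
        proof -
          have "exp (3 * D - \<beta> * \<kappa> * real N) = exp (3 * D) * exp (- (\<beta> * real N * \<kappa>))"
            unfolding exp_add[symmetric] by (simp add: mult_ac)
          then show ?thesis by (simp only: mult.assoc)
        qed
        finally show "(\<Sum>\<sigma>\<in>?V. w \<sigma> * (1 - h \<sigma>)) + (\<Sum>\<sigma>\<in>?S - ?V. w \<sigma> * h \<sigma>)
          \<le> exp (3 * D - \<beta> * \<kappa> * real N) * sum ?w ?V" .
      qed
    qed
  qed
qed

end

section \<open>Exponential moments of the disorder\<close>

lemma exp_le_quadratic_cubic:
  fixes y :: real
  shows "exp y \<le> 1 + y + y\<^sup>2 / 2 + \<bar>y\<bar> ^ 3 * exp \<bar>y\<bar>"
proof -
  obtain t where t: "\<bar>t\<bar> \<le> \<bar>y\<bar>" "exp y = (\<Sum>m<3. y ^ m / fact m) + exp t / fact 3 * y ^ 3"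
    using Maclaurin_exp_le[of y 3] by blast
  have "exp t / fact 3 * y ^ 3 \<le> \<bar>exp t / fact 3 * y ^ 3\<bar>" by (rule abs_ge_self)
  also have "\<dots> = exp t / fact 3 * \<bar>y\<bar> ^ 3" by (simp add: abs_mult power_abs)
  also have "\<dots> \<le> exp \<bar>y\<bar> * \<bar>y\<bar> ^ 3"
  proof (rule mult_right_mono)
    have "exp t / fact 3 \<le> exp t" by (simp add: fact_numeral field_simps)
    also have "\<dots> \<le> exp \<bar>y\<bar>" using t(1) by simp
    finally show "exp t / fact 3 \<le> exp \<bar>y\<bar>" .
  qed simp
  finally show ?thesis unfolding t(2) by (simp add: numeral_3_eq_3 power2_eq_square mult.commute)
qed

text \<open>Trades the cubic Taylor remainder for an exponential, whose mean is finite by assumption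
  on the disorder.\<close>

lemma cube_le_exp:
  fixes u :: real
  assumes "0 \<le> u"
  shows "u ^ 3 / 6 \<le> exp u"
proof -
  obtain t where t: "exp u = (\<Sum>m<4. u ^ m / fact m) + exp t / fact 4 * u ^ 4"
    using Maclaurin_exp_le[of u 4] by blast
  have "(\<Sum>m<4. u ^ m / fact m) = 1 + u + u ^ 2 / 2 + u ^ 3 / 6"
    by (simp add: eval_nat_numeral fact_numeral)
  moreover have "0 \<le> exp t / fact 4 * u ^ 4" using assms by simp
  moreover have "0 \<le> u ^ 2" by simp
  ultimately show ?thesis using t assms by linarith
qed

lemma ennreal_integral_le_nn_integral:
  fixes f :: "'a \<Rightarrow> real"
  assumes "integrable M f"
  shows "ennreal (\<integral>x. f x \<partial>M) \<le> (\<integral>\<^sup>+x. ennreal (f x) \<partial>M)"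
proof -
  have i: "integrable M (\<lambda>x. max 0 (f x))" using assms by simp
  have "ennreal (\<integral>x. f x \<partial>M) \<le> ennreal (\<integral>x. max 0 (f x) \<partial>M)"
    using assms i by (intro ennreal_leI integral_mono) auto
  also have "\<dots> = (\<integral>\<^sup>+x. ennreal (max 0 (f x)) \<partial>M)"
    using i by (intro nn_integral_eq_integral[symmetric]) auto
  also have "\<dots> = (\<integral>\<^sup>+x. ennreal (f x) \<partial>M)"
    by (intro nn_integral_cong) (auto simp: max_def ennreal_neg)
  finally show ?thesis .
qed

definition pairs :: "nat \<Rightarrow> (nat \<times> nat) set" where
  "pairs N = {(i, j). 1 \<le> i \<and> i < j \<and> j \<le> N}"

lemma finite_pairs: "finite (pairs N)"
  by (rule finite_subset[of _ "{1..N} \<times> {1..N}"]) (auto simp: pairs_def)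

lemma card_pairs_le: "real (card (pairs N)) \<le> (real N)\<^sup>2 / 2"
proof -
  have "card (pairs N) + card (prod.swap ` pairs N) = card (pairs N \<union> prod.swap ` pairs N)"
    by (intro card_Un_disjoint[symmetric] finite_imageI finite_pairs) (auto simp: pairs_def)
  also have "\<dots> \<le> card ({1..N} \<times> {1..N})" by (intro card_mono) (auto simp: pairs_def)
  also have "card (prod.swap ` pairs N) = card (pairs N)" by (intro card_image) (auto intro: inj_onI)
  finally have "2 * card (pairs N) \<le> N * N" by simp
  then have "real (2 * card (pairs N)) \<le> real (N * N)" by (rule of_nat_mono)
  then show ?thesis by (simp add: power2_eq_square)
qed

section \<open>Exponential moments of linear statistics of the couplings\<close>

locale disorder = prob_space M for M :: "'a measure" +
  fixes J :: "nat \<Rightarrow> nat \<Rightarrow> 'a \<Rightarrow> real" and v :: real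
  assumes v: "0 < v"
    and indep: "indep_vars (\<lambda>_. borel) (\<lambda>(i, j). J i j) {(i, j). 1 \<le> i \<and> i < j}"
    and ident: "\<And>i j. 1 \<le> i \<Longrightarrow> i < j \<Longrightarrow> distr M borel (J i j) = distr M borel (J 1 2)"
    and int1: "integrable M (J 1 2)" and mean: "expectation (J 1 2) = 1"
    and int2: "integrable M (\<lambda>\<omega>. (J 1 2 \<omega>)\<^sup>2)" and var: "variance (J 1 2) = v"
    and exp_moment: "0 \<in> interior {l::real. integrable M (\<lambda>\<omega>. exp (l * J 1 2 \<omega>))}"
begin

lemma J_measurable [measurable]:
  assumes "1 \<le> i" "i < j"
  shows "J i j \<in> borel_measurable M"
  using indep assms unfolding indep_vars_def by auto

lemma nn_integral_J:
  assumes "1 \<le> i" "i < j" and [measurable]: "g \<in> borel_measurable borel"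
  shows "(\<integral>\<^sup>+\<omega>. g (J i j \<omega>) \<partial>M) = (\<integral>\<^sup>+\<omega>. g (J 1 2 \<omega>) \<partial>M)"
proof -
  have "(\<integral>\<^sup>+\<omega>. g (J i j \<omega>) \<partial>M) = (\<integral>\<^sup>+x. g x \<partial>distr M borel (J i j))"
    using assms by (subst nn_integral_distr) auto
  also have "\<dots> = (\<integral>\<^sup>+x. g x \<partial>distr M borel (J 1 2))" using ident[OF assms(1,2)] by simp
  also have "\<dots> = (\<integral>\<^sup>+\<omega>. g (J 1 2 \<omega>) \<partial>M)" by (subst nn_integral_distr) auto
  finally show ?thesis .
qed

lemma integrable_J:
  assumes ij: "1 \<le> i" "i < j"
  shows "integrable M (J i j)" "expectation (J i j) = 1"
proof -
  have [measurable]: "J i j \<in> borel_measurable M" using ij by simp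
  have [measurable]: "J 1 2 \<in> borel_measurable M" by simp
  have "integrable (distr M borel (J 1 2)) (\<lambda>x. x)" using int1 by (subst integrable_distr_eq) auto
  then have "integrable (distr M borel (J i j)) (\<lambda>x. x)" by (simp only: ident[OF ij])
  then show "integrable M (J i j)" by (subst (asm) integrable_distr_eq) auto
  have "expectation (J i j) = (\<integral>x. x \<partial>distr M borel (J i j))" by (subst integral_distr) auto
  also have "\<dots> = (\<integral>x. x \<partial>distr M borel (J 1 2))" by (simp only: ident[OF ij])
  also have "\<dots> = expectation (J 1 2)" by (subst integral_distr) auto
  finally show "expectation (J i j) = 1" using mean by simp
qed

text \<open>Second-order expansion at 0: the centred coupling has mean 0 and variance v, and for
  small a the remainder of order |a|^3 is absorbed by \<epsilon> a^2.\<close>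

lemma exp_moment_J:
  assumes \<epsilon>: "0 < \<epsilon>"
  obtains a0 where "0 < a0"
    "\<And>a. \<bar>a\<bar> \<le> a0 \<Longrightarrow> (\<integral>\<^sup>+\<omega>. ennreal (exp (a * (J 1 2 \<omega> - 1))) \<partial>M) \<le> ennreal (exp ((v / 2 + \<epsilon>) * a\<^sup>2))"
proof -
  let ?X = "\<lambda>\<omega>. J 1 2 \<omega> - 1"
  have [measurable]: "J 1 2 \<in> borel_measurable M" by simp
  obtain l0 where l0: "0 < l0" "\<And>l. \<bar>l\<bar> < l0 \<Longrightarrow> integrable M (\<lambda>\<omega>. exp (l * J 1 2 \<omega>))"
    using exp_moment unfolding mem_interior by (auto simp: subset_iff dist_real_def)
  define l where "l = l0 / 2"
  have l: "0 < l" "l < l0" using l0 by (auto simp: l_def)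
  have iX: "integrable M (\<lambda>\<omega>. exp (a * ?X \<omega>))" if "\<bar>a\<bar> \<le> l" for a
  proof -
    have "integrable M (\<lambda>\<omega>. exp (- a) * exp (a * J 1 2 \<omega>))"
      using that l by (intro integrable_mult_right l0) auto
    then show ?thesis by (simp add: exp_add[symmetric] algebra_simps)
  qed
  let ?Z = "\<lambda>\<omega>. exp (l * ?X \<omega>) + exp (- l * ?X \<omega>)"
  have iZ: "integrable M ?Z" using iX[of l] iX[of "- l"] l by auto
  \<comment> \<open>From (l |x| / 2)^3 / 6 \<le> exp (l |x| / 2); the other half of l pays for exp
    (|a| |x|).\<close>
  define C0 where "C0 = 6 * (2 / l) ^ 3"
  have C0: "0 \<le> C0" using l by (simp add: C0_def)
  have cube: "\<bar>x\<bar> ^ 3 * exp (\<bar>a\<bar> * \<bar>x\<bar>) \<le> C0 * (exp (l * x) + exp (- l * x))" if a: "\<bar>a\<bar> \<le> l / 2" for a x :: real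
  proof -
    have "(l / 2 * \<bar>x\<bar>) ^ 3 / 6 \<le> exp (l / 2 * \<bar>x\<bar>)" using l by (intro cube_le_exp) simp
    then have "\<bar>x\<bar> ^ 3 \<le> C0 * exp (l / 2 * \<bar>x\<bar>)"
      using l by (simp add: C0_def power_mult_distrib power_divide field_simps)
    then have "\<bar>x\<bar> ^ 3 * exp (\<bar>a\<bar> * \<bar>x\<bar>) \<le> (C0 * exp (l / 2 * \<bar>x\<bar>)) * exp (l / 2 * \<bar>x\<bar>)"
      using mult_right_mono[OF a abs_ge_zero[of x]] C0 by (intro mult_mono) auto
    also have "\<dots> = C0 * exp (l * \<bar>x\<bar>)" by (simp add: exp_add[symmetric] mult.assoc)
    also have "\<dots> \<le> C0 * (exp (l * x) + exp (- l * x))"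
      using C0 by (intro mult_left_mono) (auto simp: abs_if)
    finally show ?thesis .
  qed
  define C where "C = C0 * (\<integral>\<omega>. ?Z \<omega> \<partial>M)"
  have C: "0 \<le> C" unfolding C_def using C0 by (intro mult_nonneg_nonneg integral_nonneg_AE) auto
  \<comment> \<open>The second bound gives |a|^3 * C \<le> \<epsilon> a^2.\<close>
  define a0 where "a0 = min (l / 2) (\<epsilon> / (C + 1))"
  have a0: "0 < a0" using l \<epsilon> C by (simp add: a0_def)
  have iX1: "integrable M ?X" using int1 by simp
  have iX2: "integrable M (\<lambda>\<omega>. (?X \<omega>)\<^sup>2)" using int1 int2 by (simp add: power2_diff)
  show thesis
  proof (rule that[OF a0])
    fix a :: real assume a: "\<bar>a\<bar> \<le> a0"
    then have al: "\<bar>a\<bar> \<le> l / 2" "\<bar>a\<bar> \<le> l" using l by (auto simp: a0_def)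
    have i: "integrable M (\<lambda>\<omega>. a * ?X \<omega>)" "integrable M (\<lambda>\<omega>. a\<^sup>2 * (?X \<omega>)\<^sup>2 / 2)"
      "integrable M (\<lambda>\<omega>. \<bar>a\<bar> ^ 3 * C0 * ?Z \<omega>)"
      by (rule integrable_mult_right[OF iX1], rule integrable_divide[OF integrable_mult_right[OF iX2]],
          rule integrable_mult_right[OF iZ])
    have "(\<integral>\<omega>. exp (a * ?X \<omega>) \<partial>M) \<le> (\<integral>\<omega>. 1 + a * ?X \<omega> + a\<^sup>2 * (?X \<omega>)\<^sup>2 / 2 + \<bar>a\<bar> ^ 3 * C0 * ?Z \<omega> \<partial>M)"
    proof (intro integral_mono iX al(2))
      show "integrable M (\<lambda>\<omega>. 1 + a * ?X \<omega> + a\<^sup>2 * (?X \<omega>)\<^sup>2 / 2 + \<bar>a\<bar> ^ 3 * C0 * ?Z \<omega>)"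
        by (intro Bochner_Integration.integrable_add i integrable_const)
      fix \<omega>
      have "exp (a * ?X \<omega>) \<le> 1 + a * ?X \<omega> + (a * ?X \<omega>)\<^sup>2 / 2 + \<bar>a * ?X \<omega>\<bar> ^ 3 * exp \<bar>a * ?X \<omega>\<bar>"
        by (rule exp_le_quadratic_cubic)
      also have "\<bar>a * ?X \<omega>\<bar> ^ 3 * exp \<bar>a * ?X \<omega>\<bar> = \<bar>a\<bar> ^ 3 * (\<bar>?X \<omega>\<bar> ^ 3 * exp (\<bar>a\<bar> * \<bar>?X \<omega>\<bar>))"
        by (simp add: abs_mult power_mult_distrib)
      also have "\<dots> \<le> \<bar>a\<bar> ^ 3 * (C0 * ?Z \<omega>)" using cube[OF al(1)] by (intro mult_left_mono) auto
      finally show "exp (a * ?X \<omega>) \<le> 1 + a * ?X \<omega> + a\<^sup>2 * (?X \<omega>)\<^sup>2 / 2 + \<bar>a\<bar> ^ 3 * C0 * ?Z \<omega>"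
        by (simp add: power_mult_distrib mult.assoc)
    qed
    also have "\<dots> = 1 + a * (\<integral>\<omega>. ?X \<omega> \<partial>M) + a\<^sup>2 * (\<integral>\<omega>. (?X \<omega>)\<^sup>2 \<partial>M) / 2 + \<bar>a\<bar> ^ 3 * C0 * (\<integral>\<omega>. ?Z \<omega> \<partial>M)"
    proof -
      have "(\<integral>\<omega>. 1 + a * ?X \<omega> + a\<^sup>2 * (?X \<omega>)\<^sup>2 / 2 + \<bar>a\<bar> ^ 3 * C0 * ?Z \<omega> \<partial>M)
        = (\<integral>\<omega>. 1 \<partial>M) + (\<integral>\<omega>. a * ?X \<omega> \<partial>M) + (\<integral>\<omega>. a\<^sup>2 * (?X \<omega>)\<^sup>2 / 2 \<partial>M) + (\<integral>\<omega>. \<bar>a\<bar> ^ 3 * C0 * ?Z \<omega> \<partial>M)"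
        using i by (subst Bochner_Integration.integral_add, auto)+
      then show ?thesis by (simp only: integral_mult_right_zero integral_divide_zero) (simp add: prob_space)
    qed
    also have "(\<integral>\<omega>. ?X \<omega> \<partial>M) = 0" using int1 mean by (simp add: prob_space)
    also have "(\<integral>\<omega>. (?X \<omega>)\<^sup>2 \<partial>M) = v" using var mean by simp
    also have "1 + a * 0 + a\<^sup>2 * v / 2 + \<bar>a\<bar> ^ 3 * C0 * (\<integral>\<omega>. ?Z \<omega> \<partial>M) \<le> 1 + (v / 2 + \<epsilon>) * a\<^sup>2"
    proof -
      have "\<bar>a\<bar> * C \<le> \<epsilon> / (C + 1) * C" using a C by (intro mult_right_mono) (auto simp: a0_def)
      also have "\<dots> \<le> \<epsilon>" using C \<epsilon> by (simp add: field_simps)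
      finally have "(\<bar>a\<bar> * C) * a\<^sup>2 \<le> \<epsilon> * a\<^sup>2" by (intro mult_right_mono) auto
      moreover have "\<bar>a\<bar> ^ 3 = \<bar>a\<bar> * a\<^sup>2" by (simp add: power3_eq_cube power2_eq_square)
      ultimately show ?thesis by (simp add: C_def algebra_simps)
    qed
    also have "\<dots> \<le> exp ((v / 2 + \<epsilon>) * a\<^sup>2)" by (rule exp_ge_add_one_self)
    finally have "(\<integral>\<omega>. exp (a * ?X \<omega>) \<partial>M) \<le> exp ((v / 2 + \<epsilon>) * a\<^sup>2)" .
    moreover have "(\<integral>\<^sup>+\<omega>. ennreal (exp (a * ?X \<omega>)) \<partial>M) = ennreal (\<integral>\<omega>. exp (a * ?X \<omega>) \<partial>M)"
      using iX[OF al(2)] by (intro nn_integral_eq_integral) auto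
    ultimately show "(\<integral>\<^sup>+\<omega>. ennreal (exp (a * ?X \<omega>)) \<partial>M) \<le> ennreal (exp ((v / 2 + \<epsilon>) * a\<^sup>2))"
      by (simp add: ennreal_leI)
  qed
qed

text \<open>Arbitrary coefficients are allowed because the mixtures arising from the maximum of two
  fluctuations are also of this form.\<close>

definition lin :: "nat \<Rightarrow> (nat \<times> nat \<Rightarrow> real) \<Rightarrow> 'a \<Rightarrow> real" where
  "lin N u \<omega> = (\<Sum>p\<in>pairs N. u p * (J (fst p) (snd p) \<omega> - 1))"

lemma lin_measurable [measurable]: "lin N u \<in> borel_measurable M"
  unfolding lin_def by (intro borel_measurable_sum) (auto simp: pairs_def)

lemma lin_combination: "lin N (\<lambda>p. a * f p + b * g p) \<omega> = a * lin N f \<omega> + b * lin N g \<omega>"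
  unfolding lin_def sum_distrib_left sum.distrib[symmetric] by (intro sum.cong) (auto simp: algebra_simps)

lemma exp_moment_lin:
  assumes \<epsilon>: "0 < \<epsilon>"
  obtains a0 where "0 < a0" "\<And>N u. (\<And>p. p \<in> pairs N \<Longrightarrow> \<bar>u p\<bar> \<le> a0) \<Longrightarrow>
    (\<integral>\<^sup>+\<omega>. ennreal (exp (lin N u \<omega>)) \<partial>M) \<le> ennreal (exp ((v / 2 + \<epsilon>) * (\<Sum>p\<in>pairs N. (u p)\<^sup>2)))"
proof -
  obtain a0 where a0: "0 < a0"
    "\<And>a. \<bar>a\<bar> \<le> a0 \<Longrightarrow> (\<integral>\<^sup>+\<omega>. ennreal (exp (a * (J 1 2 \<omega> - 1))) \<partial>M) \<le> ennreal (exp ((v / 2 + \<epsilon>) * a\<^sup>2))"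
    using exp_moment_J[OF \<epsilon>] by blast
  show thesis
  proof (rule that[OF a0(1)])
    fix N and u :: "nat \<times> nat \<Rightarrow> real" assume u: "\<And>p. p \<in> pairs N \<Longrightarrow> \<bar>u p\<bar> \<le> a0"
    have iv: "indep_vars (\<lambda>_. borel) (\<lambda>p \<omega>. ennreal (exp (u p * ((case p of (i, j) \<Rightarrow> J i j) \<omega> - 1)))) (pairs N)"
    proof (rule indep_vars_compose2[where Y="\<lambda>p x. ennreal (exp (u p * (x - 1)))"])
      show "indep_vars (\<lambda>_. borel) (\<lambda>p. case p of (i, j) \<Rightarrow> J i j) (pairs N)"
        using indep by (rule indep_vars_subset) (auto simp: pairs_def)
    qed auto
    have "(\<integral>\<^sup>+\<omega>. ennreal (exp (lin N u \<omega>)) \<partial>M)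
        = (\<integral>\<^sup>+\<omega>. (\<Prod>p\<in>pairs N. ennreal (exp (u p * ((case p of (i, j) \<Rightarrow> J i j) \<omega> - 1)))) \<partial>M)"
      by (intro nn_integral_cong) (simp add: lin_def exp_sum finite_pairs prod_ennreal case_prod_unfold)
    also have "\<dots> = (\<Prod>p\<in>pairs N. \<integral>\<^sup>+\<omega>. ennreal (exp (u p * ((case p of (i, j) \<Rightarrow> J i j) \<omega> - 1))) \<partial>M)"
      by (rule indep_vars_nn_integral[OF finite_pairs iv]) simp
    also have "\<dots> \<le> (\<Prod>p\<in>pairs N. ennreal (exp ((v / 2 + \<epsilon>) * (u p)\<^sup>2)))"
    proof (rule prod_mono_ennreal)
      fix p assume p: "p \<in> pairs N"
      obtain i j where ij: "p = (i, j)" "1 \<le> i" "i < j" using p by (auto simp: pairs_def)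
      have "(\<integral>\<^sup>+\<omega>. ennreal (exp (u p * (J i j \<omega> - 1))) \<partial>M) = (\<integral>\<^sup>+\<omega>. ennreal (exp (u p * (J 1 2 \<omega> - 1))) \<partial>M)"
        by (rule nn_integral_J[OF ij(2,3), of "\<lambda>x. ennreal (exp (u p * (x - 1)))"]) simp
      also have "\<dots> \<le> ennreal (exp ((v / 2 + \<epsilon>) * (u p)\<^sup>2))" by (rule a0(2)[OF u[OF p]])
      finally show "(\<integral>\<^sup>+\<omega>. ennreal (exp (u p * ((case p of (i, j) \<Rightarrow> J i j) \<omega> - 1))) \<partial>M)
        \<le> ennreal (exp ((v / 2 + \<epsilon>) * (u p)\<^sup>2))" by (simp add: ij(1))
    qed
    also have "\<dots> = ennreal (exp ((v / 2 + \<epsilon>) * (\<Sum>p\<in>pairs N. (u p)\<^sup>2)))"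
      by (simp add: prod_ennreal exp_sum finite_pairs sum_distrib_left)
    finally show "(\<integral>\<^sup>+\<omega>. ennreal (exp (lin N u \<omega>)) \<partial>M) \<le> ennreal (exp ((v / 2 + \<epsilon>) * (\<Sum>p\<in>pairs N. (u p)\<^sup>2)))" .
  qed
qed

text \<open>Jensen's inequality for a centred variable, in the form of integrating 1 + x \<le> exp
  x.\<close>

lemma exp_moment_lin_ge_1: "1 \<le> (\<integral>\<^sup>+\<omega>. ennreal (exp (lin N u \<omega>)) \<partial>M)"
proof -
  have J: "integrable M (J (fst p) (snd p))" "expectation (J (fst p) (snd p)) = 1" if "p \<in> pairs N" for p
    using that integrable_J[of "fst p" "snd p"] by (auto simp: pairs_def)
  have i: "integrable M (lin N u)"
    unfolding lin_def using J
    by (intro Bochner_Integration.integrable_sum integrable_mult_right Bochner_Integration.integrable_diff) auto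
  have "expectation (lin N u) = (\<Sum>p\<in>pairs N. expectation (\<lambda>\<omega>. u p * (J (fst p) (snd p) \<omega> - 1)))"
    unfolding lin_def using J
    by (intro Bochner_Integration.integral_sum integrable_mult_right Bochner_Integration.integrable_diff) auto
  also have "\<dots> = 0"
    using J by (intro sum.neutral ballI) (simp add: prob_space)
  finally have "(\<integral>\<omega>. 1 + lin N u \<omega> \<partial>M) = 1" using i by (simp add: prob_space)
  then have "1 = ennreal (\<integral>\<omega>. 1 + lin N u \<omega> \<partial>M)" by simp
  also have "\<dots> \<le> (\<integral>\<^sup>+\<omega>. ennreal (1 + lin N u \<omega>) \<partial>M)"
    using i by (intro ennreal_integral_le_nn_integral) auto
  also have "\<dots> \<le> (\<integral>\<^sup>+\<omega>. ennreal (exp (lin N u \<omega>)) \<partial>M)"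
    by (intro nn_integral_mono ennreal_leI exp_ge_add_one_self)
  finally show ?thesis .
qed

text \<open>The coefficients c u / N become small uniformly, so the Gaussian bound applies, with sum
  of squares at most c^2 / 2 + O(1 / N); times v / 2 this is v c^2 / 4. The slack K' N admits order
  N bonds with coefficients larger than 1.\<close>

lemma exp_moment_eventually:
  assumes \<epsilon>: "0 < \<epsilon>"
  shows "eventually (\<lambda>N. \<forall>u. (\<forall>p\<in>pairs N. \<bar>u p\<bar> \<le> K) \<longrightarrow> (\<Sum>p\<in>pairs N. (u p)\<^sup>2) \<le> (real N)\<^sup>2 / 2 + K' * real N \<longrightarrow>
    (\<integral>\<^sup>+\<omega>. ennreal (exp (c / real N * lin N u \<omega>)) \<partial>M) \<le> ennreal (exp (v * c\<^sup>2 / 4 + \<epsilon>))) sequentially"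
proof -
  define \<epsilon>1 where "\<epsilon>1 = \<epsilon> / (c\<^sup>2 + 1)"
  have c1: "0 < c\<^sup>2 + 1" by (simp add: add_nonneg_pos)
  have e1: "0 < \<epsilon>1" using \<epsilon> c1 by (simp add: \<epsilon>1_def)
  obtain a0 where a0: "0 < a0" "\<And>N u. (\<And>p. p \<in> pairs N \<Longrightarrow> \<bar>u p\<bar> \<le> a0) \<Longrightarrow>
    (\<integral>\<^sup>+\<omega>. ennreal (exp (lin N u \<omega>)) \<partial>M) \<le> ennreal (exp ((v / 2 + \<epsilon>1) * (\<Sum>p\<in>pairs N. (u p)\<^sup>2)))"
    using exp_moment_lin[OF e1] by blast
  have "eventually (\<lambda>N. \<bar>c\<bar> * K / real N < a0) sequentially"
    using order_tendstoD(2)[OF lim_const_over_n a0(1)] .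
  moreover have "eventually (\<lambda>N. (v / 2 + \<epsilon>1) * (c\<^sup>2 * K') / real N < \<epsilon> / 2) sequentially"
    using order_tendstoD(2)[OF lim_const_over_n, of "\<epsilon> / 2"] \<epsilon> by simp
  ultimately show ?thesis using eventually_gt_at_top[of 0]
  proof eventually_elim
    case (elim N)
    show ?case
    proof (intro allI impI)
      fix u assume u: "\<forall>p\<in>pairs N. \<bar>u p\<bar> \<le> K" "(\<Sum>p\<in>pairs N. (u p)\<^sup>2) \<le> (real N)\<^sup>2 / 2 + K' * real N"
      have N: "0 < real N" using elim by simp
      have l: "c / real N * lin N u \<omega> = lin N (\<lambda>p. c / real N * u p) \<omega>" for \<omega>
        by (simp add: lin_def sum_distrib_left mult.assoc)
      have "(\<integral>\<^sup>+\<omega>. ennreal (exp (lin N (\<lambda>p. c / real N * u p) \<omega>)) \<partial>M)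
          \<le> ennreal (exp ((v / 2 + \<epsilon>1) * (\<Sum>p\<in>pairs N. (c / real N * u p)\<^sup>2)))"
      proof (rule a0(2))
        fix p assume "p \<in> pairs N"
        then have "\<bar>c\<bar> / real N * \<bar>u p\<bar> \<le> \<bar>c\<bar> / real N * K" using u by (intro mult_left_mono) auto
        then show "\<bar>c / real N * u p\<bar> \<le> a0" using elim by (simp add: abs_mult)
      qed
      also have "\<dots> \<le> ennreal (exp (v * c\<^sup>2 / 4 + \<epsilon>))"
      proof (intro ennreal_leI, unfold exp_le_cancel_iff)
        have "(\<Sum>p\<in>pairs N. (c / real N * u p)\<^sup>2) = c\<^sup>2 / (real N)\<^sup>2 * (\<Sum>p\<in>pairs N. (u p)\<^sup>2)"
          by (simp add: sum_distrib_left power_mult_distrib power_divide)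
        also have "\<dots> \<le> c\<^sup>2 / (real N)\<^sup>2 * ((real N)\<^sup>2 / 2 + K' * real N)" using u by (intro mult_left_mono) auto
        also have "\<dots> = c\<^sup>2 / 2 + c\<^sup>2 * K' / real N" using N by (simp add: field_simps power2_eq_square)
        finally have "(v / 2 + \<epsilon>1) * (\<Sum>p\<in>pairs N. (c / real N * u p)\<^sup>2) \<le> (v / 2 + \<epsilon>1) * (c\<^sup>2 / 2 + c\<^sup>2 * K' / real N)"
          using v e1 by (intro mult_left_mono) auto
        also have "\<dots> = v * c\<^sup>2 / 4 + \<epsilon>1 * c\<^sup>2 / 2 + (v / 2 + \<epsilon>1) * (c\<^sup>2 * K') / real N" by (simp add: algebra_simps)
        also have "\<epsilon>1 * c\<^sup>2 / 2 \<le> \<epsilon> / 2" using c1 \<epsilon> by (simp add: \<epsilon>1_def field_simps)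
        finally show "(v / 2 + \<epsilon>1) * (\<Sum>p\<in>pairs N. (c / real N * u p)\<^sup>2) \<le> v * c\<^sup>2 / 4 + \<epsilon>"
          using elim by linarith
      qed
      finally show "(\<integral>\<^sup>+\<omega>. ennreal (exp (c / real N * lin N u \<omega>)) \<partial>M) \<le> ennreal (exp (v * c\<^sup>2 / 4 + \<epsilon>))"
        unfolding l .
    qed
  qed
qed

text \<open>Minus the change of the Hamiltonian caused by the disorder, so the Gibbs weight is
  multiplied by exp (\<beta> * fluct).\<close>

definition fluct :: "nat \<Rightarrow> config \<Rightarrow> 'a \<Rightarrow> real" where
  "fluct N \<sigma> \<omega> = 1 / real N * lin N (\<lambda>(i, j). of_bool (\<sigma> i = \<sigma> j)) \<omega>"

lemma fluct_measurable [measurable]: "fluct N \<sigma> \<in> borel_measurable M"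
  unfolding fluct_def by simp

lemma hamiltonian_fluct:
  "hamiltonian N (\<lambda>i j. J i j \<omega>) \<sigma> = hamiltonian N (\<lambda>_ _. 1) \<sigma> - fluct N \<sigma> \<omega>"
  unfolding hamiltonian_def fluct_def lin_def pairs_def[symmetric]
  by (simp add: case_prod_unfold right_diff_distrib sum_subtractf left_diff_distrib mult.commute)

lemma exp_moment_fluct:
  assumes \<epsilon>: "0 < \<epsilon>"
  shows "eventually (\<lambda>N. \<forall>\<sigma>. (\<integral>\<^sup>+\<omega>. ennreal (exp (c * fluct N \<sigma> \<omega>)) \<partial>M) \<le> ennreal (exp (v * c\<^sup>2 / 4 + \<epsilon>))) sequentially"
  using exp_moment_eventually[OF \<epsilon>, of 1 0 c]
proof eventually_elim
  case (elim N)
  show ?case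
  proof
    fix \<sigma> :: config
    let ?u = "\<lambda>(i, j). of_bool (\<sigma> i = \<sigma> j) :: real"
    have "(\<Sum>p\<in>pairs N. (?u p)\<^sup>2) \<le> (\<Sum>p\<in>pairs N. 1)" by (intro sum_mono) auto
    then have "(\<Sum>p\<in>pairs N. (?u p)\<^sup>2) \<le> (real N)\<^sup>2 / 2 + 0 * real N" using card_pairs_le[of N] by simp
    moreover have "\<forall>p\<in>pairs N. \<bar>?u p\<bar> \<le> 1" by auto
    ultimately show "(\<integral>\<^sup>+\<omega>. ennreal (exp (c * fluct N \<sigma> \<omega>)) \<partial>M) \<le> ennreal (exp (v * c\<^sup>2 / 4 + \<epsilon>))"
      using elim by (simp add: fluct_def)
  qed
qed

text \<open>
  The maximum of two exponentials is dominated by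
  \<open>2 powr (1/n)\<close> times the mean of two exponentials of linear combinations, so it costs no more
  than one exponential when the two exponents differ only in the bonds at a single site.
\<close>

lemma max_exp_le:
  fixes x y :: real
  assumes n: "1 \<le> (n::nat)"
  shows "max (exp x) (exp y) \<le> exp (ln 2 / real n) *
    ((exp ((x + y) / 2 + real n * ((x - y) / 2)) + exp ((x + y) / 2 + real n * (- ((x - y) / 2)))) / 2)"
proof -
  define d where "d = \<bar>x - y\<bar> / 2"
  have d0: "0 \<le> d" by (simp add: d_def)
  have "max x y = (x + y) / 2 + d" by (simp add: d_def max_def abs_if field_simps)
  moreover have "max (exp x) (exp y) = exp (max x y)" by (simp add: max_def)
  ultimately have m: "max (exp x) (exp y) = exp ((x + y) / 2) * exp d" by (simp add: exp_add)
  have "(x - y) / 2 = d \<or> (x - y) / 2 = - d" by (auto simp: d_def abs_if)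
  then have cosh: "exp (real n * ((x - y) / 2)) + exp (real n * (- ((x - y) / 2))) = exp (real n * d) + exp (- (real n * d))"
    by (elim disjE) simp_all
  let ?c = "(exp (real n * d) + exp (- (real n * d))) / 2"
  have c1: "1 \<le> ?c"
  proof -
    have "0 \<le> (exp (real n * d / 2) - exp (- (real n * d / 2)))\<^sup>2" by simp
    also have "\<dots> = exp (real n * d) + exp (- (real n * d)) - 2"
      unfolding power2_diff by (simp add: power2_eq_square mult.assoc exp_add[symmetric] mult.commute)
    finally show ?thesis by simp
  qed
  \<comment> \<open>The chain is exp d \<le> (2 cosh (n d))^(1/n) \<le> 2^(1/n) * cosh (n d); the
    second step drops the root because cosh is at least 1.\<close>
  have "exp d = exp (real n * d) powr (1 / real n)" using n by (simp add: powr_def)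
  also have "\<dots> \<le> (2 * ?c) powr (1 / real n)" by (intro powr_mono2) auto
  also have "\<dots> = 2 powr (1 / real n) * ?c powr (1 / real n)" using c1 by (subst powr_mult) auto
  also have "\<dots> \<le> 2 powr (1 / real n) * ?c powr 1" using c1 n by (intro mult_left_mono powr_mono) auto
  also have "\<dots> = exp (ln 2 / real n) * ?c" using c1 by (simp add: powr_def)
  finally have "exp ((x + y) / 2) * exp d \<le> exp ((x + y) / 2) * (exp (ln 2 / real n) * ?c)" by (intro mult_left_mono) auto
  then show ?thesis unfolding m cosh[symmetric] exp_add by (simp add: algebra_simps)
qed

lemma exp_moment_max_fluct:
  assumes \<epsilon>: "0 < \<epsilon>"
  shows "eventually (\<lambda>N. \<forall>\<sigma> \<eta>. card {i \<in> {1..N}. \<sigma> i \<noteq> \<eta> i} = 1 \<longrightarrow>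
    (\<integral>\<^sup>+\<omega>. ennreal (max (exp (c * fluct N \<sigma> \<omega>)) (exp (c * fluct N \<eta> \<omega>))) \<partial>M) \<le> ennreal (exp (v * c\<^sup>2 / 4 + \<epsilon>))) sequentially"
proof -
  \<comment> \<open>So large that the factor 2^(1/n) costs at most \<epsilon> / 2 in the
    exponent.\<close>
  obtain n0 :: nat where n0: "2 * ln 2 / \<epsilon> < real n0" using reals_Archimedean2 by blast
  define n where "n = max 1 n0"
  have n: "1 \<le> n" "ln 2 / real n \<le> \<epsilon> / 2"
  proof -
    have "2 * ln 2 / \<epsilon> < real n" "0 < real n" using n0 by (auto simp: n_def)
    then show "ln 2 / real n \<le> \<epsilon> / 2" using \<epsilon> by (simp add: field_simps)
  qed (simp add: n_def)
  have "0 < \<epsilon> / 2" using \<epsilon> by simp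
  from exp_moment_eventually[OF this, of "real n + 1" "(real n + 1)\<^sup>2" c] show ?thesis
  proof eventually_elim
    case (elim N)
    show ?case
    proof (intro allI impI)
      fix \<sigma> \<eta> :: config assume once: "card {i \<in> {1..N}. \<sigma> i \<noteq> \<eta> i} = 1"
      let ?a = "\<lambda>\<sigma> (i, j). of_bool (\<sigma> i = (\<sigma> j :: nat)) :: real"
      \<comment> \<open>Coefficients of the mixed fluctuation; s = n and s = - n give the two
        exponents of \<open>max_exp_le\<close>.\<close>
      define w where "w s p = (?a \<sigma> p + ?a \<eta> p) / 2 + s * ((?a \<sigma> p - ?a \<eta> p) / 2)" for s p
      obtain k where k: "{i \<in> {1..N}. \<sigma> i \<noteq> \<eta> i} = {k}" using once by (rule card_1_singletonE)
      have kN: "k \<in> {1..N}" using k by blast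
      have same: "\<sigma> i = \<eta> i" if "i \<in> {1..N}" "i \<noteq> k" for i using k that by blast
      have b: "(\<integral>\<^sup>+\<omega>. ennreal (exp (c / real N * lin N (w s) \<omega>)) \<partial>M) \<le> ennreal (exp (v * c\<^sup>2 / 4 + \<epsilon> / 2))"
        if s: "\<bar>s\<bar> \<le> real n" for s
      proof -
        have bound: "\<bar>w s p\<bar> \<le> real n + 1" for p
        proof -
          obtain i j where p: "p = (i, j)" by (cases p)
          have "\<bar>(?a \<sigma> p - ?a \<eta> p) / 2\<bar> \<le> 1" unfolding p by auto
          then have "\<bar>s\<bar> * \<bar>(?a \<sigma> p - ?a \<eta> p) / 2\<bar> \<le> \<bar>s\<bar> * 1" by (intro mult_left_mono) auto
          moreover have "\<bar>(?a \<sigma> p + ?a \<eta> p) / 2\<bar> \<le> 1" unfolding p by auto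
          ultimately show ?thesis using s abs_triangle_ineq[of "(?a \<sigma> p + ?a \<eta> p) / 2" "s * ((?a \<sigma> p - ?a \<eta> p) / 2)"]
            unfolding w_def abs_mult by linarith
        qed
        \<comment> \<open>The bonds at the flipped site k. Elsewhere the two indicators agree and
          the mixed coefficient is again 0 or 1.\<close>
        let ?K = "{p \<in> pairs N. fst p = k \<or> snd p = k}"
        have "(\<Sum>p\<in>pairs N. (w s p)\<^sup>2) \<le> (\<Sum>p\<in>pairs N. 1 + of_bool (p \<in> ?K) * (real n + 1)\<^sup>2)"
        proof (rule sum_mono)
          fix p assume p: "p \<in> pairs N"
          show "(w s p)\<^sup>2 \<le> 1 + of_bool (p \<in> ?K) * (real n + 1)\<^sup>2"
          proof (cases "p \<in> ?K")
            case True
            have "\<bar>w s p\<bar>\<^sup>2 \<le> (real n + 1)\<^sup>2" using bound by (intro power_mono) auto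
            then show ?thesis using True by simp
          next
            case False
            then have "?a \<sigma> p = ?a \<eta> p" using p same by (auto simp: pairs_def)
            then have "w s p = ?a \<sigma> p" by (simp add: w_def)
            then show ?thesis by (auto split: prod.splits)
          qed
        qed
        also have "\<dots> = real (card (pairs N)) + real (card ?K) * (real n + 1)\<^sup>2"
        proof -
          have "(\<Sum>p\<in>pairs N. of_bool (p \<in> ?K) * (real n + 1)\<^sup>2) = (\<Sum>p\<in>?K. (real n + 1)\<^sup>2)"
            by (rule sum.mono_neutral_cong_right) (auto simp: finite_pairs)
          then show ?thesis by (simp only: sum.distrib) simp
        qed
        also have "real (card ?K) \<le> real N"
        proof -
          have "card ?K \<le> card {1..N}"
          proof (rule card_inj_on_le[where f="\<lambda>p. if fst p = k then snd p else fst p"])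
            show "inj_on (\<lambda>p. if fst p = k then snd p else fst p) ?K"
              by (rule inj_onI) (auto simp: pairs_def prod_eq_iff split: if_splits)
          qed (auto simp: pairs_def)
          then show ?thesis by simp
        qed
        finally have "(\<Sum>p\<in>pairs N. (w s p)\<^sup>2) \<le> (real N)\<^sup>2 / 2 + (real n + 1)\<^sup>2 * real N"
          using card_pairs_le[of N] by (simp add: mult.commute mult_right_mono)
        then show ?thesis using elim bound by blast
      qed
      have lin_w: "c / real N * lin N (w s) \<omega> = (c * fluct N \<sigma> \<omega> + c * fluct N \<eta> \<omega>) / 2
          + s * ((c * fluct N \<sigma> \<omega> - c * fluct N \<eta> \<omega>) / 2)" for s \<omega>
      proof -
        have "w s = (\<lambda>p. (1 + s) / 2 * ?a \<sigma> p + (1 - s) / 2 * ?a \<eta> p)"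
        proof
          have "(x + y) / 2 + s * ((x - y) / 2) = (1 + s) / 2 * x + (1 - s) / 2 * y" for x y :: real
            by (simp add: field_simps)
          then show "w s p = (1 + s) / 2 * ?a \<sigma> p + (1 - s) / 2 * ?a \<eta> p" for p unfolding w_def .
        qed
        then have "lin N (w s) \<omega> = (1 + s) / 2 * lin N (?a \<sigma>) \<omega> + (1 - s) / 2 * lin N (?a \<eta>) \<omega>"
          by (simp only: lin_combination)
        then have "c / real N * lin N (w s) \<omega> = (1 + s) / 2 * (c * fluct N \<sigma> \<omega>) + (1 - s) / 2 * (c * fluct N \<eta> \<omega>)"
        proof -
          have "c / real N * (a * x + b * y) = a * (c * (1 / real N * x)) + b * (c * (1 / real N * y))" for a b x y
            by (simp add: algebra_simps)
          then show "lin N (w s) \<omega> = (1 + s) / 2 * lin N (?a \<sigma>) \<omega> + (1 - s) / 2 * lin N (?a \<eta>) \<omega> \<Longrightarrow> ?thesis"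
            unfolding fluct_def by (simp only:)
        qed
        then show ?thesis by (simp add: field_simps)
      qed
      have "(\<integral>\<^sup>+\<omega>. ennreal (max (exp (c * fluct N \<sigma> \<omega>)) (exp (c * fluct N \<eta> \<omega>))) \<partial>M)
        \<le> (\<integral>\<^sup>+\<omega>. ennreal (exp (ln 2 / real n) / 2) * (ennreal (exp (c / real N * lin N (w (real n)) \<omega>))
            + ennreal (exp (c / real N * lin N (w (- real n)) \<omega>))) \<partial>M)"
      proof (rule nn_integral_mono)
        fix \<omega>
        let ?m = "max (exp (c * fluct N \<sigma> \<omega>)) (exp (c * fluct N \<eta> \<omega>))"
        have "?m \<le> exp (ln 2 / real n) / 2 * (exp (c / real N * lin N (w (real n)) \<omega>) + exp (c / real N * lin N (w (- real n)) \<omega>))"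
          using max_exp_le[OF n(1), of "c * fluct N \<sigma> \<omega>" "c * fluct N \<eta> \<omega>"] unfolding lin_w by simp
        then show "ennreal ?m \<le> ennreal (exp (ln 2 / real n) / 2) * (ennreal (exp (c / real N * lin N (w (real n)) \<omega>))
            + ennreal (exp (c / real N * lin N (w (- real n)) \<omega>)))"
          by (simp add: ennreal_leI flip: ennreal_plus ennreal_mult)
      qed
      also have "\<dots> = ennreal (exp (ln 2 / real n) / 2) * ((\<integral>\<^sup>+\<omega>. ennreal (exp (c / real N * lin N (w (real n)) \<omega>)) \<partial>M)
            + (\<integral>\<^sup>+\<omega>. ennreal (exp (c / real N * lin N (w (- real n)) \<omega>)) \<partial>M))"
        by (subst nn_integral_cmult, simp, subst nn_integral_add) auto
      also have "\<dots> \<le> ennreal (exp (ln 2 / real n) / 2) * (ennreal (exp (v * c\<^sup>2 / 4 + \<epsilon> / 2)) + ennreal (exp (v * c\<^sup>2 / 4 + \<epsilon> / 2)))"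
        by (intro mult_left_mono add_mono b) auto
      also have "\<dots> = ennreal (exp (ln 2 / real n) * exp (v * c\<^sup>2 / 4 + \<epsilon> / 2))"
        by (simp flip: ennreal_plus ennreal_mult)
      also have "\<dots> \<le> ennreal (exp (v * c\<^sup>2 / 4 + \<epsilon>))"
        using n(2) by (intro ennreal_leI, unfold exp_add[symmetric] exp_le_cancel_iff) linarith
      finally show "(\<integral>\<^sup>+\<omega>. ennreal (max (exp (c * fluct N \<sigma> \<omega>)) (exp (c * fluct N \<eta> \<omega>))) \<partial>M)
        \<le> ennreal (exp (v * c\<^sup>2 / 4 + \<epsilon>))" .
    qed
  qed
qed

section \<open>The maximal fluctuation\<close>

definition max_fluct :: "nat \<Rightarrow> nat \<Rightarrow> 'a \<Rightarrow> real" where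
  "max_fluct q N \<omega> = Max ((\<lambda>\<sigma>. \<bar>fluct N \<sigma> \<omega>\<bar>) ` configs q N)"

lemma max_fluct_measurable [measurable]: "max_fluct q N \<in> borel_measurable M"
  unfolding max_fluct_def[abs_def] by (intro borel_measurable_Max finite_configs) simp

lemma abs_fluct_le: "\<sigma> \<in> configs q N \<Longrightarrow> \<bar>fluct N \<sigma> \<omega>\<bar> \<le> max_fluct q N \<omega>"
  unfolding max_fluct_def by (intro Max_ge finite_imageI finite_configs) auto

lemma card_configs: "card (configs q N) = q ^ N"
  by (simp add: configs_def card_PiE)

text \<open>Below the level s = \<epsilon> N / 2 the bound exp s is used. Above it exp (t D) is at
  most exp (s - m s) * exp (m t D), and the last factor is at most a sum over all configurations of
  terms with bounded mean.\<close>

lemma exp_moment_max: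
  assumes \<epsilon>: "0 < \<epsilon>" and q: "1 \<le> q" and t: "0 \<le> t"
  shows "eventually (\<lambda>N. (\<integral>\<^sup>+\<omega>. ennreal (exp (t * max_fluct q N \<omega>)) \<partial>M) \<le> ennreal (exp (\<epsilon> * real N))) sequentially"
proof -
  obtain m0 :: nat where m0: "2 * ln (real q) / \<epsilon> < real m0" using reals_Archimedean2 by blast
  \<comment> \<open>Large enough that the number q^N of configurations is at most exp (m s).\<close>
  define m where "m = real (max 1 m0)"
  have m: "1 \<le> m" "ln (real q) \<le> m * (\<epsilon> / 2)"
  proof -
    have "2 * ln (real q) / \<epsilon> < m" using m0 by (auto simp: m_def)
    then show "ln (real q) \<le> m * (\<epsilon> / 2)" using \<epsilon> by (simp add: field_simps)
  qed (simp add: m_def)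
  define B where "B = exp (v * (m * t)\<^sup>2 / 4 + 1)"
  have "eventually (\<lambda>N. 1 + 2 * B \<le> exp (\<epsilon> / 2 * real N)) sequentially"
  proof -
    have "filterlim (\<lambda>N. exp (\<epsilon> / 2 * real N)) at_top sequentially"
      using \<epsilon> by (intro filterlim_compose[OF exp_at_top] filterlim_tendsto_pos_mult_at_top[OF tendsto_const]
          filterlim_real_sequentially) auto
    then show ?thesis by (simp add: filterlim_at_top)
  qed
  then show ?thesis
    using exp_moment_fluct[OF zero_less_one, of "m * t"] exp_moment_fluct[OF zero_less_one, of "- (m * t)"]
  proof eventually_elim
    case (elim N)
    define s where "s = \<epsilon> / 2 * real N"
    have s0: "0 \<le> s" using \<epsilon> by (simp add: s_def)
    let ?D = "max_fluct q N"
    have ne: "configs q N \<noteq> {}" using q by (auto simp: configs_def PiE_eq_empty_iff)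
    have pt: "exp (t * ?D \<omega>) \<le> exp s + exp (s - m * s) * (\<Sum>\<sigma>\<in>configs q N. exp (m * t * fluct N \<sigma> \<omega>) + exp (- (m * t) * fluct N \<sigma> \<omega>))" for \<omega>
    proof -
      obtain \<sigma>0 where \<sigma>0: "\<sigma>0 \<in> configs q N" "?D \<omega> = \<bar>fluct N \<sigma>0 \<omega>\<bar>"
        unfolding max_fluct_def using Max_in[of "(\<lambda>\<sigma>. \<bar>fluct N \<sigma> \<omega>\<bar>) ` configs q N"] ne finite_configs by fastforce
      have "exp (m * (t * ?D \<omega>)) \<le> exp (m * t * fluct N \<sigma>0 \<omega>) + exp (- (m * t) * fluct N \<sigma>0 \<omega>)"
        unfolding \<sigma>0(2) by (simp add: abs_if mult.assoc)
      also have "\<dots> \<le> (\<Sum>\<sigma>\<in>configs q N. exp (m * t * fluct N \<sigma> \<omega>) + exp (- (m * t) * fluct N \<sigma> \<omega>))"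
        using \<sigma>0(1) by (intro member_le_sum finite_configs) (auto intro: add_nonneg_nonneg)
      finally have le: "exp (m * (t * ?D \<omega>)) \<le> (\<Sum>\<sigma>\<in>configs q N. exp (m * t * fluct N \<sigma> \<omega>) + exp (- (m * t) * fluct N \<sigma> \<omega>))" .
      have "exp (t * ?D \<omega>) \<le> exp s + exp (s - m * s) * exp (m * (t * ?D \<omega>))"
      proof (cases "t * ?D \<omega> \<le> s")
        case True
        then have "exp (t * ?D \<omega>) \<le> exp s" by simp
        then show ?thesis by (simp add: add_increasing2)
      next
        case False
        then have "1 * (t * ?D \<omega> - s) \<le> m * (t * ?D \<omega> - s)" using m by (intro mult_right_mono) auto
        then have "exp (t * ?D \<omega>) \<le> exp (s - m * s) * exp (m * (t * ?D \<omega>))" by (simp add: exp_add[symmetric] algebra_simps)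
        then show ?thesis by (simp add: add_increasing)
      qed
      also have "\<dots> \<le> exp s + exp (s - m * s) * (\<Sum>\<sigma>\<in>configs q N. exp (m * t * fluct N \<sigma> \<omega>) + exp (- (m * t) * fluct N \<sigma> \<omega>))"
        using le by (intro add_left_mono mult_left_mono) auto
      finally show ?thesis .
    qed
    have "(\<integral>\<^sup>+\<omega>. ennreal (exp (t * ?D \<omega>)) \<partial>M) \<le> (\<integral>\<^sup>+\<omega>. ennreal (exp s) + ennreal (exp (s - m * s)) *
      (\<Sum>\<sigma>\<in>configs q N. ennreal (exp (m * t * fluct N \<sigma> \<omega>)) + ennreal (exp (- (m * t) * fluct N \<sigma> \<omega>))) \<partial>M)"
    proof (rule nn_integral_mono)
      fix \<omega>
      have "(\<Sum>\<sigma>\<in>configs q N. ennreal (exp (m * t * fluct N \<sigma> \<omega>)) + ennreal (exp (- (m * t) * fluct N \<sigma> \<omega>)))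
        = ennreal (\<Sum>\<sigma>\<in>configs q N. exp (m * t * fluct N \<sigma> \<omega>) + exp (- (m * t) * fluct N \<sigma> \<omega>))"
        by (subst sum_ennreal[symmetric]) (auto intro: add_nonneg_nonneg)
      then show "ennreal (exp (t * ?D \<omega>)) \<le> ennreal (exp s) + ennreal (exp (s - m * s)) *
        (\<Sum>\<sigma>\<in>configs q N. ennreal (exp (m * t * fluct N \<sigma> \<omega>)) + ennreal (exp (- (m * t) * fluct N \<sigma> \<omega>)))"
        using pt[of \<omega>] by (simp add: sum_nonneg add_nonneg_nonneg ennreal_leI flip: ennreal_mult ennreal_plus)
    qed
    also have "\<dots> = ennreal (exp s) + ennreal (exp (s - m * s)) *
      (\<Sum>\<sigma>\<in>configs q N. (\<integral>\<^sup>+\<omega>. ennreal (exp (m * t * fluct N \<sigma> \<omega>)) \<partial>M) + (\<integral>\<^sup>+\<omega>. ennreal (exp (- (m * t) * fluct N \<sigma> \<omega>)) \<partial>M))"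
      by (simp add: nn_integral_add nn_integral_cmult nn_integral_sum emeasure_space_1)
    also have "\<dots> \<le> ennreal (exp s) + ennreal (exp (s - m * s)) * (\<Sum>\<sigma>\<in>configs q N. ennreal B + ennreal B)"
      using elim(2,3) by (intro add_left_mono mult_left_mono sum_mono add_mono) (auto simp: B_def)
    also have "\<dots> = ennreal (exp s + exp (s - m * s) * (real (q ^ N) * (2 * B)))"
      by (simp add: B_def card_configs ennreal_of_nat_eq_real_of_nat flip: ennreal_mult ennreal_plus)
    also have "\<dots> \<le> ennreal (exp (\<epsilon> * real N))"
    proof (rule ennreal_leI)
      have "real (q ^ N) = exp (real N * ln (real q))" using q by (simp add: exp_of_nat_mult)
      also have "\<dots> \<le> exp (m * s)"
        using mult_left_mono[OF m(2), of "real N"] by (simp add: s_def mult_ac)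
      finally have "exp (s - m * s) * (real (q ^ N) * (2 * B)) \<le> exp (s - m * s) * (exp (m * s) * (2 * B))"
        by (intro mult_left_mono mult_right_mono) (auto simp: B_def)
      also have "\<dots> = exp s * (2 * B)" by (simp add: mult.assoc[symmetric] exp_add[symmetric])
      finally have "exp s + exp (s - m * s) * (real (q ^ N) * (2 * B)) \<le> exp s * (1 + 2 * B)" by (simp add: algebra_simps)
      also have "\<dots> \<le> exp s * exp s" using elim(1) by (intro mult_left_mono) (auto simp: s_def)
      also have "\<dots> = exp (\<epsilon> * real N)" by (simp add: exp_add[symmetric] s_def)
      finally show "exp s + exp (s - m * s) * (real (q ^ N) * (2 * B)) \<le> exp (\<epsilon> * real N)" .
    qed
    finally show ?case .
  qed
qed

end

section \<open>Comparison of mean hitting times\<close>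

lemma powr_sum_convex:
  fixes y :: "'i \<Rightarrow> real"
  assumes p: "1 \<le> p" and "finite I" and a: "(\<Sum>i\<in>I. a i) = 1" "\<And>i. i \<in> I \<Longrightarrow> 0 \<le> a i"
    and y: "\<And>i. i \<in> I \<Longrightarrow> 0 < y i"
  shows "(\<Sum>i\<in>I. a i * y i) powr p \<le> (\<Sum>i\<in>I. a i * y i powr p)"
proof -
  have "I \<noteq> {}" using a(1) by auto
  then show ?thesis
    using convex_on_sum[of I "{0<..}" "\<lambda>x. x powr p" a y] powr_convex[OF p] assms by simp
qed

lemma sum_sqrt_le_sqrt_sum:
  assumes a: "(\<Sum>i\<in>I. a i) = (1::real)" "\<And>i. i \<in> I \<Longrightarrow> 0 \<le> a i" and y: "\<And>i. i \<in> I \<Longrightarrow> 0 \<le> y i"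
  shows "(\<Sum>i\<in>I. a i * sqrt (y i)) \<le> sqrt (\<Sum>i\<in>I. a i * y i)"
proof -
  have "(\<Sum>i\<in>I. sqrt (a i) * sqrt (a i * y i))\<^sup>2 \<le> (\<Sum>i\<in>I. (sqrt (a i))\<^sup>2) * (\<Sum>i\<in>I. (sqrt (a i * y i))\<^sup>2)"
    by (rule Cauchy_Schwarz_ineq_sum)
  also have "(\<Sum>i\<in>I. (sqrt (a i))\<^sup>2) = 1" using a by simp
  also have "(\<Sum>i\<in>I. (sqrt (a i * y i))\<^sup>2) = (\<Sum>i\<in>I. a i * y i)" using a y by simp
  also have "(\<Sum>i\<in>I. sqrt (a i) * sqrt (a i * y i)) = (\<Sum>i\<in>I. a i * sqrt (y i))"
    using a by (intro sum.cong refl) (simp add: real_sqrt_mult mult.assoc[symmetric])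
  finally show ?thesis by (intro real_le_rsqrt) simp
qed

lemma powr_ge_tangent:
  fixes a z k :: real
  assumes a: "0 < a" and z: "0 \<le> z" and k: "1 \<le> k"
  shows "k * a powr (k - 1) * z - (k - 1) * a powr k \<le> z powr k"
proof (cases "z = 0")
  case True
  then show ?thesis using k by simp
next
  case False
  have "z powr k - a powr k \<ge> k * a powr (k - 1) * (z - a)"
    using a z False
    by (intro convex_on_imp_above_tangent[OF powr_convex[OF k]])
       (auto intro!: derivative_eq_intros simp: interior_open)
  moreover have "a powr (k - 1) * a = a powr k" using a by (simp add: powr_diff)
  moreover have "k * a powr (k - 1) * (z - a) = k * a powr (k - 1) * z - k * (a powr (k - 1) * a)"
    by (simp add: algebra_simps)
  ultimately show ?thesis by (simp add: left_diff_distrib)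
qed

lemma ennreal_powr_ennreal:
  assumes "0 \<le> x"
  shows "ennreal_powr (ennreal x) p = ennreal (x powr p)"
  using assms by (simp add: ennreal_powr_def)

lemma ennreal_powr_le:
  assumes "I \<le> ennreal c" "0 \<le> c" "0 < p"
  shows "ennreal_powr I p \<le> ennreal (c powr p)"
proof -
  obtain x where x: "I = ennreal x" "0 \<le> x" using assms(1)
    by (metis ennreal_cases neq_top_trans ennreal_neq_top)
  then have "x \<le> c" using assms by simp
  then show ?thesis unfolding x(1) ennreal_powr_ennreal[OF x(2)] using x assms by (intro ennreal_leI powr_mono2) auto
qed

lemma ennreal_powr_ge:
  assumes "ennreal c \<le> I" "0 \<le> c" "0 < p"
  shows "ennreal (c powr p) \<le> ennreal_powr I p"
proof (cases "I = \<top>")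
  case True
  then show ?thesis by (simp add: ennreal_powr_def)
next
  case False
  then obtain x where x: "I = ennreal x" "0 \<le> x" by (metis ennreal_cases)
  then have "c \<le> x" using assms by simp
  then show ?thesis unfolding x(1) ennreal_powr_ennreal[OF x(2)] using assms by (intro ennreal_leI powr_mono2) auto
qed

section \<open>Ratios of mean hitting times squeezed between averages\<close>

locale metastable_disorder = wells q \<beta> IA IB FA + disorder M J v
  for q \<beta> IA IB FA and M :: "'a measure" and J v +
  fixes m :: "nat \<Rightarrow> nat \<Rightarrow> nat \<Rightarrow> real"
  assumes m: "\<And>i N. i \<le> q \<Longrightarrow> 1 \<le> N \<Longrightarrow> closest_lattice_point q N (minimizer q \<beta> i) (m i N)"
begin

abbreviation "A \<equiv> well_union m IA"
abbreviation "B \<equiv> well_union m IB"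

definition hit_mean :: "nat \<Rightarrow> (config \<Rightarrow> real) \<Rightarrow> ennreal" where
  "hit_mean N H = mean_hitting_time q N \<beta> H (last_exit_distr q N \<beta> H (A N) (B N)) (B N)"

definition weight :: "nat \<Rightarrow> 'a \<Rightarrow> config \<Rightarrow> real" where
  "weight N \<omega> \<sigma> = exp (- \<beta> * hamiltonian N (\<lambda>i j. J i j \<omega>) \<sigma>)"

lemma weight_eq: "weight N \<omega> \<sigma> = cw_weight N \<beta> \<sigma> * exp (\<beta> * fluct N \<sigma> \<omega>)"
  unfolding weight_def cw_weight_def hamiltonian_fluct by (simp add: exp_add[symmetric] algebra_simps)

lemma weight_pos: "0 < weight N \<omega> \<sigma>"
  by (simp add: weight_def)

lemma perturbed_weight: "perturbed N (\<beta> * max_fluct q N \<omega>) (weight N \<omega>)"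
  unfolding perturbed_def
proof
  fix \<sigma> assume "\<sigma> \<in> configs q N"
  from abs_fluct_le[OF this, of \<omega>]
  have 1: "fluct N \<sigma> \<omega> \<le> max_fluct q N \<omega>" and 2: "- max_fluct q N \<omega> \<le> fluct N \<sigma> \<omega>" by (auto simp: abs_le_iff)
  have "\<beta> * fluct N \<sigma> \<omega> \<le> \<beta> * max_fluct q N \<omega>" using 1 \<beta>_pos by simp
  moreover have "- (\<beta> * max_fluct q N \<omega>) \<le> \<beta> * fluct N \<sigma> \<omega>"
    using mult_left_mono[OF 2, of \<beta>] \<beta>_pos by simp
  ultimately show "exp (- (\<beta> * max_fluct q N \<omega>)) * cw_weight N \<beta> \<sigma> \<le> weight N \<omega> \<sigma> \<and>
      weight N \<omega> \<sigma> \<le> exp (\<beta> * max_fluct q N \<omega>) * cw_weight N \<beta> \<sigma>"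
    unfolding weight_eq using cw_weight_pos[of N \<beta> \<sigma>] by (simp add: mult.commute mult_left_mono)
qed

text \<open>\<open>t \<omega>\<close> is the ratio of the disordered to the pure mean hitting time.
  In the construction \<rho> is the pure Gibbs measure conditioned on the valley set, \<kappa> is
  the share of each ordered edge in the pure capacity, and s selects the endpoint of smaller pure
  weight. The lower bound is linear in numerator and capacity for each l, so that their means can be
  taken separately.\<close>

definition sandwich ::
  "real \<Rightarrow> nat \<Rightarrow> real \<Rightarrow> config set \<Rightarrow> (config \<Rightarrow> real) \<Rightarrow> (config \<times> config) set \<Rightarrow> (config \<times> config \<Rightarrow> real) \<Rightarrow>
    (config \<times> config \<Rightarrow> config) \<Rightarrow> ('a \<Rightarrow> real) \<Rightarrow> bool" where
  "sandwich \<epsilon> N t0 V \<rho> E \<kappa> s t \<longleftrightarrow>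
     0 < t0 \<and> hit_mean N (hamiltonian N (\<lambda>_ _. 1)) = ennreal t0 \<and>
     finite V \<and> (\<Sum>\<sigma>\<in>V. \<rho> \<sigma>) = 1 \<and> (\<forall>\<sigma>\<in>V. 0 \<le> \<rho> \<sigma>) \<and>
     finite E \<and> (\<Sum>e\<in>E. \<kappa> e) = 1 \<and> (\<forall>e\<in>E. 0 \<le> \<kappa> e \<and> differ_once N (fst e) (snd e)) \<and>
     (\<forall>\<omega>. 0 \<le> t \<omega> \<and> hit_mean N (hamiltonian N (\<lambda>i j. J i j \<omega>)) = ennreal (t0 * t \<omega>) \<and>
       t \<omega> \<le> ((\<Sum>\<sigma>\<in>V. \<rho> \<sigma> * exp (\<beta> * fluct N \<sigma> \<omega>)) + exp (3 * (\<beta> * max_fluct q N \<omega>) - \<epsilon> * real N)) /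
           (1 - exp (- \<epsilon> * real N)) *
         (\<Sum>e\<in>E. \<kappa> e * max (exp (- \<beta> * fluct N (fst e) \<omega>)) (exp (- \<beta> * fluct N (snd e) \<omega>))) \<and>
       (\<forall>l>0. 2 * l * ((\<Sum>\<sigma>\<in>V. \<rho> \<sigma> * exp (\<beta> / 2 * fluct N \<sigma> \<omega>)) - exp ((3 * (\<beta> * max_fluct q N \<omega>) - \<epsilon> * real N) / 2)) /
           sqrt (1 + exp (- \<epsilon> * real N)) - l\<^sup>2 * (\<Sum>e\<in>E. \<kappa> e * exp (\<beta> * fluct N (s e) \<omega>)) \<le> t \<omega>))"

lemma max_fluct_nonneg: "0 \<le> max_fluct q N \<omega>"
proof -
  have "(\<lambda>_\<in>{1..N}. 1) \<in> configs q N" using q by (auto simp: configs_def)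
  from abs_fluct_le[OF this, of \<omega>] show ?thesis by (meson abs_ge_zero order_trans)
qed

lemma sandwich_exists:
  "\<exists>\<epsilon>>0. eventually (\<lambda>N. \<exists>t0 V \<rho> E \<kappa> s t. sandwich \<epsilon> N t0 V \<rho> E \<kappa> s t) sequentially"
proof -
  obtain \<epsilon> where \<epsilon>: "0 < \<epsilon>" and ev: "eventually (\<lambda>N. 1 \<le> N \<and>
    A N \<subseteq> configs q N \<and> B N \<subseteq> configs q N \<and> A N \<inter> B N = {} \<and> A N \<noteq> {} \<and> B N \<noteq> {} \<and>
    (\<exists>V\<subseteq>configs q N. V \<noteq> {} \<and> (\<forall>w D h. 0 \<le> D \<longrightarrow> perturbed N D w \<longrightarrow>
      equilibrium (configs q N) (conductance q N w) (A N) (B N) h \<longrightarrow>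
      (\<Sum>\<sigma>\<in>V. w \<sigma> * (1 - h \<sigma>)) + (\<Sum>\<sigma>\<in>configs q N - V. w \<sigma> * h \<sigma>)
        \<le> exp (3 * D - \<epsilon> * real N) * sum (cw_weight N \<beta>) V))) sequentially"
    using potential_concentrates[OF m] by blast
  from ev have "eventually (\<lambda>N. \<exists>t0 V \<rho> E \<kappa> s t. sandwich \<epsilon> N t0 V \<rho> E \<kappa> s t) sequentially"
  proof eventually_elim
    case (elim N)
    let ?S = "configs q N" and ?w' = "cw_weight N \<beta>"
    let ?c' = "conductance q N ?w'" and ?c = "\<lambda>\<omega>. conductance q N (weight N \<omega>)"
    have N: "1 \<le> N" and AB: "A N \<subseteq> ?S" "B N \<subseteq> ?S" "A N \<inter> B N = {}" "A N \<noteq> {}" "B N \<noteq> {}"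
      using elim by auto
    have q1: "1 \<le> q" using q by simp
    obtain V where V: "V \<subseteq> ?S" "V \<noteq> {}" and conc: "\<And>w D h. 0 \<le> D \<Longrightarrow> perturbed N D w \<Longrightarrow>
      equilibrium ?S (conductance q N w) (A N) (B N) h \<Longrightarrow>
      (\<Sum>\<sigma>\<in>V. w \<sigma> * (1 - h \<sigma>)) + (\<Sum>\<sigma>\<in>?S - V. w \<sigma> * h \<sigma>) \<le> exp (3 * D - \<epsilon> * real N) * sum ?w' V"
      using elim by blast
    have finV: "finite V" using finite_subset[OF V(1) finite_configs] .
    define W where "W = sum ?w' V"
    have W: "0 < W" unfolding W_def using finV V(2) cw_weight_pos by (intro sum_pos) auto
    define \<delta> where "\<delta> = exp (- \<epsilon> * real N)"
    have \<delta>: "0 < \<delta>" "\<delta> < 1" using \<epsilon> N by (auto simp: \<delta>_def)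
    obtain h' where h': "equilibrium ?S ?c' (A N) (B N) h'" "0 < energy ?S ?c' h' h'"
      and T': "hit_mean N (hamiltonian N (\<lambda>_ _. 1)) = ennreal ((\<Sum>\<sigma>\<in>?S. ?w' \<sigma> * h' \<sigma>) / energy ?S ?c' h' h')"
      using glauber_mean_hitting_time[OF \<beta>_pos N q1 AB, of "hamiltonian N (\<lambda>_ _. 1)"]
      unfolding hit_mean_def cw_weight_def[symmetric, abs_def] by blast
    have ex: "\<exists>h. equilibrium ?S (?c \<omega>) (A N) (B N) h \<and> 0 < energy ?S (?c \<omega>) h h \<and>
      hit_mean N (hamiltonian N (\<lambda>i j. J i j \<omega>)) = ennreal ((\<Sum>\<sigma>\<in>?S. weight N \<omega> \<sigma> * h \<sigma>) / energy ?S (?c \<omega>) h h)" for \<omega>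
      using glauber_mean_hitting_time[OF \<beta>_pos N q1 AB, of "hamiltonian N (\<lambda>i j. J i j \<omega>)"]
      unfolding hit_mean_def weight_def[symmetric, abs_def] by blast
    \<comment> \<open>The potential is chosen separately for each \<omega>; this is why
      \<open>t\<close> will later be enclosed by measurable functions before integrating.\<close>
    obtain h where hT: "\<forall>\<omega>. equilibrium ?S (?c \<omega>) (A N) (B N) (h \<omega>) \<and> 0 < energy ?S (?c \<omega>) (h \<omega>) (h \<omega>) \<and>
      hit_mean N (hamiltonian N (\<lambda>i j. J i j \<omega>)) =
        ennreal ((\<Sum>\<sigma>\<in>?S. weight N \<omega> \<sigma> * h \<omega> \<sigma>) / energy ?S (?c \<omega>) (h \<omega>) (h \<omega>))"
    proof -
      have "\<forall>\<omega>. \<exists>h. equilibrium ?S (?c \<omega>) (A N) (B N) h \<and> 0 < energy ?S (?c \<omega>) h h \<and>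
        hit_mean N (hamiltonian N (\<lambda>i j. J i j \<omega>)) = ennreal ((\<Sum>\<sigma>\<in>?S. weight N \<omega> \<sigma> * h \<sigma>) / energy ?S (?c \<omega>) h h)"
        using ex by blast
      from choice[OF this] show thesis using that by blast
    qed
    then have h: "\<And>\<omega>. equilibrium ?S (?c \<omega>) (A N) (B N) (h \<omega>)"
      "\<And>\<omega>. 0 < energy ?S (?c \<omega>) (h \<omega>) (h \<omega>)"
      and T: "\<And>\<omega>. hit_mean N (hamiltonian N (\<lambda>i j. J i j \<omega>)) =
        ennreal ((\<Sum>\<sigma>\<in>?S. weight N \<omega> \<sigma> * h \<omega> \<sigma>) / energy ?S (?c \<omega>) (h \<omega>) (h \<omega>))" by blast+
    interpret c': network ?S ?c' by (rule network_conductance) (rule cw_weight_pos)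
    define num' where "num' = (\<Sum>\<sigma>\<in>?S. ?w' \<sigma> * h' \<sigma>)"
    define cap' where "cap' = energy ?S ?c' h' h'"
    define num where "num \<omega> = (\<Sum>\<sigma>\<in>?S. weight N \<omega> \<sigma> * h \<omega> \<sigma>)" for \<omega>
    define cap where "cap \<omega> = energy ?S (?c \<omega>) (h \<omega>) (h \<omega>)" for \<omega>
    define \<rho> where "\<rho> \<sigma> = ?w' \<sigma> / W" for \<sigma>
    define E where "E = {e \<in> ?S \<times> ?S. differ_once N (fst e) (snd e)}"
    define \<kappa> where "\<kappa> e = ?c' (fst e) (snd e) * (h' (fst e) - h' (snd e))\<^sup>2 / 2 / cap'" for e
    define s where "s e = (if ?w' (fst e) \<le> ?w' (snd e) then fst e else snd e)" for e :: "config \<times> config"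
    have cap'0: "0 < cap'" and cap0: "0 < cap \<omega>" for \<omega> using h' h by (auto simp: cap'_def cap_def)
    have split: "sum f ?S = sum f V + sum f (?S - V)" for f :: "config \<Rightarrow> real"
      using sum.subset_diff[OF V(1) finite_configs, of f] by simp
    have h01: "0 \<le> h \<omega> \<sigma>" "h \<omega> \<sigma> \<le> 1" "0 \<le> h' \<sigma>" "h' \<sigma> \<le> 1" if "\<sigma> \<in> ?S" for \<omega> \<sigma>
      using h(1)[of \<omega>] h'(1) that by (auto simp: equilibrium_def)
    \<comment> \<open>The numerator is the weight of V up to two errors, which are the terms
      controlled by the concentration estimate.\<close>
    have num_eq: "(\<Sum>\<sigma>\<in>?S. w \<sigma> * f \<sigma>) = sum w V - (\<Sum>\<sigma>\<in>V. w \<sigma> * (1 - f \<sigma>)) + (\<Sum>\<sigma>\<in>?S - V. w \<sigma> * f \<sigma>)"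
      for w f :: "config \<Rightarrow> real"
      unfolding split[of "\<lambda>\<sigma>. w \<sigma> * f \<sigma>"] by (simp add: right_diff_distrib sum_subtractf)
    have p0: "perturbed N 0 ?w'" by (simp add: perturbed_def)
    have c0: "(\<Sum>\<sigma>\<in>V. ?w' \<sigma> * (1 - h' \<sigma>)) + (\<Sum>\<sigma>\<in>?S - V. ?w' \<sigma> * h' \<sigma>) \<le> \<delta> * W"
      using conc[OF _ p0 h'(1)] by (simp add: \<delta>_def W_def)
    have n0: "0 \<le> (\<Sum>\<sigma>\<in>V. ?w' \<sigma> * (1 - h' \<sigma>))" "0 \<le> (\<Sum>\<sigma>\<in>?S - V. ?w' \<sigma> * h' \<sigma>)"
      using V h01 cw_weight_pos[of N \<beta>, THEN less_imp_le] by (auto intro!: sum_nonneg mult_nonneg_nonneg)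
    have num'_lo: "W * (1 - \<delta>) \<le> num'" and num'_up: "num' \<le> W * (1 + \<delta>)"
      using c0 n0 num_eq[of ?w' h'] unfolding num'_def W_def[symmetric] by (auto simp: algebra_simps)
    have num'0: "0 < num'" using num'_lo W \<delta> by (smt (verit) mult_pos_pos)
    define D where "D \<omega> = \<beta> * max_fluct q N \<omega>" for \<omega>
    have D0: "0 \<le> D \<omega>" for \<omega> using \<beta>_pos max_fluct_nonneg by (simp add: D_def)
    define X where "X \<omega> = (\<Sum>\<sigma>\<in>V. \<rho> \<sigma> * exp (\<beta> * fluct N \<sigma> \<omega>))" for \<omega>
    have WX: "sum (weight N \<omega>) V = W * X \<omega>" for \<omega>
      unfolding X_def sum_distrib_left by (intro sum.cong) (use W in \<open>auto simp: \<rho>_def weight_eq\<close>)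
    have c1: "(\<Sum>\<sigma>\<in>V. weight N \<omega> \<sigma> * (1 - h \<omega> \<sigma>)) + (\<Sum>\<sigma>\<in>?S - V. weight N \<omega> \<sigma> * h \<omega> \<sigma>)
        \<le> exp (3 * D \<omega> - \<epsilon> * real N) * W" for \<omega>
      using conc[OF D0 _ h(1), of \<omega> \<omega>] perturbed_weight[of N \<omega>] by (simp add: D_def W_def)
    have n1: "0 \<le> (\<Sum>\<sigma>\<in>V. weight N \<omega> \<sigma> * (1 - h \<omega> \<sigma>))" "0 \<le> (\<Sum>\<sigma>\<in>?S - V. weight N \<omega> \<sigma> * h \<omega> \<sigma>)" for \<omega>
      using V h01 weight_pos[of N \<omega>, THEN less_imp_le] by (auto intro!: sum_nonneg mult_nonneg_nonneg)
    have num_up: "num \<omega> \<le> W * (X \<omega> + exp (3 * D \<omega> - \<epsilon> * real N))"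
      and num_lo: "W * (X \<omega> - exp (3 * D \<omega> - \<epsilon> * real N)) \<le> num \<omega>" for \<omega>
      using c1[of \<omega>] n1[of \<omega>] num_eq[of "weight N \<omega>" "h \<omega>"] unfolding num_def WX by (auto simp: algebra_simps)
    have num_nn: "0 \<le> num \<omega>" for \<omega>
      unfolding num_def using h01 weight_pos[of N \<omega>, THEN less_imp_le] by (auto intro!: sum_nonneg mult_nonneg_nonneg)
    have finE: "finite E" unfolding E_def using finite_configs by simp
    have E_sum: "energy ?S c f f = (\<Sum>e\<in>E. c (fst e) (snd e) * (f (fst e) - f (snd e))\<^sup>2 / 2)"
      if "\<And>\<sigma> \<eta>. \<not> differ_once N \<sigma> \<eta> \<Longrightarrow> c \<sigma> \<eta> = 0" for c and f :: "config \<Rightarrow> real"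
    proof -
      have "energy ?S c f f = (\<Sum>e\<in>?S \<times> ?S. c (fst e) (snd e) * (f (fst e) - f (snd e))\<^sup>2 / 2)"
        unfolding energy_def
        by (simp add: sum.cartesian_product case_prod_unfold sum_divide_distrib power2_eq_square mult.assoc)
      also have "\<dots> = (\<Sum>e\<in>E. c (fst e) (snd e) * (f (fst e) - f (snd e))\<^sup>2 / 2)"
        unfolding E_def using that finite_configs by (intro sum.mono_neutral_right) auto
      finally show ?thesis .
    qed
    have \<kappa>_cap: "?c' (fst e) (snd e) * (h' (fst e) - h' (snd e))\<^sup>2 / 2 = cap' * \<kappa> e" for e
      using cap'0 by (simp add: \<kappa>_def)
    have \<kappa>1: "(\<Sum>e\<in>E. \<kappa> e) = 1"
    proof -
      have "cap' = (\<Sum>e\<in>E. ?c' (fst e) (snd e) * (h' (fst e) - h' (snd e))\<^sup>2 / 2)"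
        unfolding cap'_def by (rule E_sum) (simp add: conductance_def)
      then have "cap' = (\<Sum>e\<in>E. cap' * \<kappa> e)" by (simp only: \<kappa>_cap)
      then show ?thesis using cap'0 by (simp flip: sum_distrib_left)
    qed
    have \<kappa>0: "0 \<le> \<kappa> e" if "e \<in> E" for e
      unfolding \<kappa>_def using that c'.nonneg cap'0 by (auto simp: E_def)
    have E_d: "differ_once N (fst e) (snd e)" "fst e \<in> ?S" "snd e \<in> ?S" if "e \<in> E" for e
      using that by (auto simp: E_def)
    have Nq: "0 < 1 / (real N * real q)" using N q by simp
    \<comment> \<open>The disordered minimum is at most the disordered weight at the endpoint where
      the pure minimum is attained.\<close>
    have ratio_up: "?c \<omega> (fst e) (snd e) \<le> ?c' (fst e) (snd e) * exp (\<beta> * fluct N (s e) \<omega>)" if e: "e \<in> E" for \<omega> e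
    proof -
      have "min (weight N \<omega> (fst e)) (weight N \<omega> (snd e)) \<le> min (?w' (fst e)) (?w' (snd e)) * exp (\<beta> * fluct N (s e) \<omega>)"
        unfolding s_def weight_eq by (auto simp: min_def)
      then have "1 / (real N * real q) * min (weight N \<omega> (fst e)) (weight N \<omega> (snd e))
        \<le> 1 / (real N * real q) * (min (?w' (fst e)) (?w' (snd e)) * exp (\<beta> * fluct N (s e) \<omega>))"
        using Nq by (intro mult_left_mono) auto
      then show ?thesis using E_d[OF e] by (simp add: conductance_def)
    qed
    \<comment> \<open>Here the disordered minimum may sit at either endpoint, so the larger of the
      two correction factors is needed.\<close>
    have ratio_lo: "?c' (fst e) (snd e) \<le> ?c \<omega> (fst e) (snd e) *
        max (exp (- \<beta> * fluct N (fst e) \<omega>)) (exp (- \<beta> * fluct N (snd e) \<omega>))" if e: "e \<in> E" for \<omega> e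
    proof -
      let ?m = "max (exp (- \<beta> * fluct N (fst e) \<omega>)) (exp (- \<beta> * fluct N (snd e) \<omega>))"
      have *: "?w' \<sigma> = weight N \<omega> \<sigma> * exp (- \<beta> * fluct N \<sigma> \<omega>)" for \<sigma>
        unfolding weight_eq by (simp add: mult.assoc exp_add[symmetric])
      have "?w' (fst e) \<le> weight N \<omega> (fst e) * ?m" "?w' (snd e) \<le> weight N \<omega> (snd e) * ?m"
        unfolding * using weight_pos[of N \<omega>, THEN less_imp_le] by (auto intro!: mult_left_mono)
      then have "min (?w' (fst e)) (?w' (snd e)) \<le> min (weight N \<omega> (fst e)) (weight N \<omega> (snd e)) * ?m"
        by (auto simp: min_def)
      then have "1 / (real N * real q) * min (?w' (fst e)) (?w' (snd e))
        \<le> 1 / (real N * real q) * (min (weight N \<omega> (fst e)) (weight N \<omega> (snd e)) * ?m)"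
        using Nq by (intro mult_left_mono) auto
      then show ?thesis using E_d[OF e] by (simp add: conductance_def)
    qed
    have cap_up: "cap \<omega> \<le> cap' * (\<Sum>e\<in>E. \<kappa> e * exp (\<beta> * fluct N (s e) \<omega>))" for \<omega>
    proof -
      interpret c: network ?S "?c \<omega>" by (rule network_conductance) (rule weight_pos)
      have "cap \<omega> \<le> energy ?S (?c \<omega>) h' h'"
        unfolding cap_def using h'(1) by (intro c.dirichlet_principle[OF AB(1-3) h(1)]) (auto simp: equilibrium_def)
      also have "\<dots> = (\<Sum>e\<in>E. ?c \<omega> (fst e) (snd e) * (h' (fst e) - h' (snd e))\<^sup>2 / 2)"
        by (rule E_sum) (simp add: conductance_def)
      also have "\<dots> \<le> (\<Sum>e\<in>E. (?c' (fst e) (snd e) * exp (\<beta> * fluct N (s e) \<omega>)) * (h' (fst e) - h' (snd e))\<^sup>2 / 2)"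
        using ratio_up by (intro sum_mono divide_right_mono mult_right_mono) auto
      also have "\<dots> = (\<Sum>e\<in>E. cap' * (\<kappa> e * exp (\<beta> * fluct N (s e) \<omega>)))"
      proof (rule sum.cong[OF refl])
        fix e
        have "(?c' (fst e) (snd e) * exp (\<beta> * fluct N (s e) \<omega>)) * (h' (fst e) - h' (snd e))\<^sup>2 / 2
          = (?c' (fst e) (snd e) * (h' (fst e) - h' (snd e))\<^sup>2 / 2) * exp (\<beta> * fluct N (s e) \<omega>)"
          by (simp only: times_divide_eq_left times_divide_eq_right mult_ac)
        then show "(?c' (fst e) (snd e) * exp (\<beta> * fluct N (s e) \<omega>)) * (h' (fst e) - h' (snd e))\<^sup>2 / 2
          = cap' * (\<kappa> e * exp (\<beta> * fluct N (s e) \<omega>))" unfolding \<kappa>_cap by (simp only: mult.assoc)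
      qed
      finally show ?thesis by (simp add: sum_distrib_left)
    qed
    \<comment> \<open>The pure equilibrium flow is tested in the disordered network; the squared
      flow over the disordered conductance is at most the pure energy of the edge times the
      correction factor.\<close>
    have cap_lo: "cap' \<le> cap \<omega> * (\<Sum>e\<in>E. \<kappa> e * max (exp (- \<beta> * fluct N (fst e) \<omega>)) (exp (- \<beta> * fluct N (snd e) \<omega>)))" for \<omega>
    proof -
      let ?m = "\<lambda>e. max (exp (- \<beta> * fluct N (fst e) \<omega>)) (exp (- \<beta> * fluct N (snd e) \<omega>))"
      interpret c: network ?S "?c \<omega>" by (rule network_conductance) (rule weight_pos)
      have pos: "0 < ?c \<omega> \<sigma> \<eta>" if "0 < ?c' \<sigma> \<eta>" for \<sigma> \<eta>
        using that weight_pos[of N \<omega>] Nq unfolding conductance_def by (auto split: if_splits)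
      have "cap'\<^sup>2 \<le> energy ?S (\<lambda>\<sigma> \<eta>. (?c' \<sigma> \<eta>)\<^sup>2 / ?c \<omega> \<sigma> \<eta>) h' h' * cap \<omega>"
        unfolding cap'_def cap_def using h(1)[of \<omega>] c.nonneg pos
        by (intro c'.thomson_principle[OF AB(1-3) h'(1)]) (auto simp: equilibrium_def)
      also have "energy ?S (\<lambda>\<sigma> \<eta>. (?c' \<sigma> \<eta>)\<^sup>2 / ?c \<omega> \<sigma> \<eta>) h' h'
          = (\<Sum>e\<in>E. (?c' (fst e) (snd e))\<^sup>2 / ?c \<omega> (fst e) (snd e) * (h' (fst e) - h' (snd e))\<^sup>2 / 2)"
        by (rule E_sum) (simp add: conductance_def)
      also have "\<dots> \<le> (\<Sum>e\<in>E. cap' * (\<kappa> e * ?m e))"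
      proof (rule sum_mono)
        fix e assume e: "e \<in> E"
        have cp: "0 < ?c \<omega> (fst e) (snd e)" using E_d[OF e] weight_pos Nq by (simp add: conductance_def)
        have "?c' (fst e) (snd e) * ?c' (fst e) (snd e) \<le> ?c' (fst e) (snd e) * (?c \<omega> (fst e) (snd e) * ?m e)"
          using ratio_lo[OF e] c'.nonneg[OF E_d(2,3)[OF e]] by (intro mult_left_mono) auto
        then have "(?c' (fst e) (snd e))\<^sup>2 / ?c \<omega> (fst e) (snd e) \<le> ?c' (fst e) (snd e) * ?m e"
          using cp by (simp add: power2_eq_square field_simps)
        then have "(?c' (fst e) (snd e))\<^sup>2 / ?c \<omega> (fst e) (snd e) * (h' (fst e) - h' (snd e))\<^sup>2 / 2
          \<le> ?c' (fst e) (snd e) * ?m e * (h' (fst e) - h' (snd e))\<^sup>2 / 2"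
          by (intro divide_right_mono mult_right_mono) auto
        also have "\<dots> = (?c' (fst e) (snd e) * (h' (fst e) - h' (snd e))\<^sup>2 / 2) * ?m e" by (simp only: times_divide_eq_left times_divide_eq_right mult_ac)
        finally show "(?c' (fst e) (snd e))\<^sup>2 / ?c \<omega> (fst e) (snd e) * (h' (fst e) - h' (snd e))\<^sup>2 / 2 \<le> cap' * (\<kappa> e * ?m e)"
          unfolding \<kappa>_cap by (simp only: mult.assoc)
      qed
      also have "\<dots> = cap' * (\<Sum>e\<in>E. \<kappa> e * ?m e)" by (simp add: sum_distrib_left)
      finally have "cap' * cap' \<le> cap' * ((\<Sum>e\<in>E. \<kappa> e * ?m e) * cap \<omega>)"
        using cap0[of \<omega>] by (simp add: power2_eq_square mult.assoc mult_right_mono)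
      then show ?thesis using cap'0 by (simp add: mult.commute)
    qed
    define t0 where "t0 = num' / cap'"
    define t where "t \<omega> = (num \<omega> / num') * (cap' / cap \<omega>)" for \<omega>
    have "sandwich \<epsilon> N t0 V \<rho> E \<kappa> s t"
      unfolding sandwich_def
    proof (intro conjI allI impI ballI)
      show "0 < t0" using num'0 cap'0 by (simp add: t0_def)
      show "hit_mean N (hamiltonian N (\<lambda>_ _. 1)) = ennreal t0" using T' by (simp add: t0_def num'_def cap'_def)
      show "(\<Sum>\<sigma>\<in>V. \<rho> \<sigma>) = 1" using W by (simp add: \<rho>_def W_def flip: sum_divide_distrib)
      show "0 \<le> \<rho> \<sigma>" for \<sigma> using W cw_weight_pos[of N \<beta> \<sigma>] by (simp add: \<rho>_def)
      show "0 \<le> \<kappa> e" "differ_once N (fst e) (snd e)" if "e \<in> E" for e using \<kappa>0 E_d that by auto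
      fix \<omega>
      show "0 \<le> t \<omega>" using num_nn[of \<omega>] num'0 cap'0 cap0[of \<omega>] by (simp add: t_def)
      show "hit_mean N (hamiltonian N (\<lambda>i j. J i j \<omega>)) = ennreal (t0 * t \<omega>)"
        unfolding T num_def[symmetric] cap_def[symmetric] t_def t0_def using num'0 cap'0 by simp
      show "t \<omega> \<le> ((\<Sum>\<sigma>\<in>V. \<rho> \<sigma> * exp (\<beta> * fluct N \<sigma> \<omega>)) + exp (3 * (\<beta> * max_fluct q N \<omega>) - \<epsilon> * real N)) /
           (1 - exp (- \<epsilon> * real N)) *
         (\<Sum>e\<in>E. \<kappa> e * max (exp (- \<beta> * fluct N (fst e) \<omega>)) (exp (- \<beta> * fluct N (snd e) \<omega>)))"
        unfolding X_def[symmetric] D_def[symmetric] \<delta>_def[symmetric] t_def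
      proof (rule mult_mono)
        have "num \<omega> / num' \<le> (W * (X \<omega> + exp (3 * D \<omega> - \<epsilon> * real N))) / (W * (1 - \<delta>))"
          using num_up[of \<omega>] num'_lo num_nn[of \<omega>] W \<delta> num'0 by (intro frac_le) auto
        then show "num \<omega> / num' \<le> (X \<omega> + exp (3 * D \<omega> - \<epsilon> * real N)) / (1 - \<delta>)" using W by simp
        show "cap' / cap \<omega> \<le> (\<Sum>e\<in>E. \<kappa> e * max (exp (- \<beta> * fluct N (fst e) \<omega>)) (exp (- \<beta> * fluct N (snd e) \<omega>)))"
          using cap_lo[of \<omega>] cap0[of \<omega>] by (simp add: field_simps)
        have "0 \<le> X \<omega>" unfolding X_def using W cw_weight_pos[of N \<beta>, THEN less_imp_le]
          by (intro sum_nonneg mult_nonneg_nonneg) (auto simp: \<rho>_def)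
        then show "0 \<le> (X \<omega> + exp (3 * D \<omega> - \<epsilon> * real N)) / (1 - \<delta>)" using \<delta> by simp
        show "0 \<le> cap' / cap \<omega>" using cap'0 cap0[of \<omega>] by simp
      qed
      fix l :: real assume l: "0 < l"
      define x where "x = num \<omega> / num'"
      define y where "y = cap \<omega> / cap'"
      have xy: "0 \<le> x" "0 < y" using num_nn[of \<omega>] num'0 cap'0 cap0[of \<omega>] by (auto simp: x_def y_def)
      let ?b = "exp (3 * D \<omega> - \<epsilon> * real N)"
      have X0: "0 \<le> X \<omega>" unfolding X_def using W cw_weight_pos[of N \<beta>, THEN less_imp_le]
          by (intro sum_nonneg mult_nonneg_nonneg) (auto simp: \<rho>_def)
      have x_lo: "X \<omega> - ?b \<le> x * (1 + \<delta>)"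
      proof -
        have "num \<omega> = x * num'" using num'0 by (simp add: x_def)
        also have "\<dots> \<le> x * (W * (1 + \<delta>))" using num'_up xy by (intro mult_left_mono) auto
        finally have "W * (X \<omega> - ?b) \<le> W * (x * (1 + \<delta>))" using num_lo[of \<omega>] by (simp add: mult_ac)
        then show ?thesis using W by simp
      qed
      \<comment> \<open>Subadditivity of the square root splits off the concentration error; its
        concavity then moves it inside the average over \<rho>, which halves \<beta>.\<close>
      have "sqrt (X \<omega>) \<le> sqrt (x * (1 + \<delta>) + ?b)" using x_lo by simp
      also have "\<dots> \<le> sqrt (x * (1 + \<delta>)) + sqrt ?b" using xy \<delta> by (intro sqrt_add_le_add_sqrt) auto
      also have "sqrt ?b = exp ((3 * D \<omega> - \<epsilon> * real N) / 2)"
        by (rule real_sqrt_unique) (auto simp: power2_eq_square exp_add[symmetric])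
      finally have sq: "sqrt (X \<omega>) - exp ((3 * D \<omega> - \<epsilon> * real N) / 2) \<le> sqrt x * sqrt (1 + \<delta>)" by (simp add: real_sqrt_mult)
      have "(\<Sum>\<sigma>\<in>V. \<rho> \<sigma> * sqrt (exp (\<beta> * fluct N \<sigma> \<omega>))) \<le> sqrt (X \<omega>)"
        unfolding X_def using W cw_weight_pos[of N \<beta>, THEN less_imp_le]
        by (intro sum_sqrt_le_sqrt_sum) (auto simp: \<rho>_def W_def simp flip: sum_divide_distrib)
      moreover have "sqrt (exp (\<beta> * fluct N \<sigma> \<omega>)) = exp (\<beta> / 2 * fluct N \<sigma> \<omega>)" for \<sigma>
        by (rule real_sqrt_unique) (auto simp: power2_eq_square exp_add[symmetric])
      ultimately have Q: "(\<Sum>\<sigma>\<in>V. \<rho> \<sigma> * exp (\<beta> / 2 * fluct N \<sigma> \<omega>)) - exp ((3 * D \<omega> - \<epsilon> * real N) / 2) \<le> sqrt x * sqrt (1 + \<delta>)"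
        using sq by simp
      have "((\<Sum>\<sigma>\<in>V. \<rho> \<sigma> * exp (\<beta> / 2 * fluct N \<sigma> \<omega>)) - exp ((3 * D \<omega> - \<epsilon> * real N) / 2)) / sqrt (1 + \<delta>) \<le> sqrt x"
        using Q \<delta> by (simp add: divide_le_eq add_pos_pos)
      then have "2 * l * (((\<Sum>\<sigma>\<in>V. \<rho> \<sigma> * exp (\<beta> / 2 * fluct N \<sigma> \<omega>)) - exp ((3 * D \<omega> - \<epsilon> * real N) / 2)) / sqrt (1 + \<delta>))
        \<le> 2 * l * sqrt x" using l by (intro mult_left_mono) auto
      moreover have "l\<^sup>2 * y \<le> l\<^sup>2 * (\<Sum>e\<in>E. \<kappa> e * exp (\<beta> * fluct N (s e) \<omega>))"
        using cap_up[of \<omega>] cap'0 by (intro mult_left_mono) (auto simp: y_def field_simps)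
      moreover have "2 * l * sqrt x - l\<^sup>2 * y \<le> x / y"
      proof -
        have "0 \<le> (sqrt x - l * y)\<^sup>2 / y" using xy by simp
        also have "\<dots> = x / y - 2 * l * sqrt x + l\<^sup>2 * y"
          using xy by (simp add: power2_diff power_mult_distrib field_simps power2_eq_square)
        finally show ?thesis by simp
      qed
      moreover have "x / y = t \<omega>" using cap'0 by (simp add: x_def y_def t_def)
      ultimately show "2 * l * ((\<Sum>\<sigma>\<in>V. \<rho> \<sigma> * exp (\<beta> / 2 * fluct N \<sigma> \<omega>)) - exp ((3 * (\<beta> * max_fluct q N \<omega>) - \<epsilon> * real N) / 2)) /
           sqrt (1 + exp (- \<epsilon> * real N)) - l\<^sup>2 * (\<Sum>e\<in>E. \<kappa> e * exp (\<beta> * fluct N (s e) \<omega>)) \<le> t \<omega>"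
        unfolding D_def[symmetric] \<delta>_def[symmetric] times_divide_eq_right by linarith
    qed (use finV finE \<kappa>1 in auto)
    then show ?case by blast
  qed
  then show ?thesis using \<epsilon> by blast
qed

end

section \<open>A calculus of bounds on means\<close>

context disorder
begin

text \<open>Bundles measurability and nonnegativity with the bound, so that bounds on sums and
  averages follow without repeating these side conditions.\<close>

definition mean_le :: "('a \<Rightarrow> real) \<Rightarrow> real \<Rightarrow> bool" where
  "mean_le f c \<longleftrightarrow> f \<in> borel_measurable M \<and> (\<forall>\<omega>. 0 \<le> f \<omega>) \<and> 0 \<le> c \<and> (\<integral>\<^sup>+\<omega>. ennreal (f \<omega>) \<partial>M) \<le> ennreal c"

lemma mean_le_const: "0 \<le> c \<Longrightarrow> mean_le (\<lambda>_. c) c"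
  by (simp add: mean_le_def emeasure_space_1)

lemma mean_le_add:
  assumes "mean_le f c" "mean_le g d"
  shows "mean_le (\<lambda>\<omega>. f \<omega> + g \<omega>) (c + d)"
proof -
  have [measurable]: "f \<in> borel_measurable M" "g \<in> borel_measurable M" using assms by (auto simp: mean_le_def)
  have "(\<integral>\<^sup>+\<omega>. ennreal (f \<omega> + g \<omega>) \<partial>M) = (\<integral>\<^sup>+\<omega>. ennreal (f \<omega>) \<partial>M) + (\<integral>\<^sup>+\<omega>. ennreal (g \<omega>) \<partial>M)"
    using assms by (simp add: mean_le_def nn_integral_add)
  also have "\<dots> \<le> ennreal (c + d)" using assms by (simp add: mean_le_def add_mono)
  finally show ?thesis using assms by (simp add: mean_le_def)
qed

lemma mean_le_cmult:
  assumes "0 \<le> a" "mean_le f c"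
  shows "mean_le (\<lambda>\<omega>. a * f \<omega>) (a * c)"
proof -
  have [measurable]: "f \<in> borel_measurable M" using assms by (auto simp: mean_le_def)
  have "(\<integral>\<^sup>+\<omega>. ennreal (a * f \<omega>) \<partial>M) = ennreal a * (\<integral>\<^sup>+\<omega>. ennreal (f \<omega>) \<partial>M)"
    using assms by (simp add: mean_le_def ennreal_mult nn_integral_cmult)
  also have "\<dots> \<le> ennreal a * ennreal c" using assms by (intro mult_left_mono) (auto simp: mean_le_def)
  finally show ?thesis using assms by (simp add: mean_le_def ennreal_mult)
qed

lemma mean_le_sum:
  assumes "finite I" "(\<Sum>i\<in>I. a i) = 1" "\<And>i. i \<in> I \<Longrightarrow> 0 \<le> a i" "\<And>i. i \<in> I \<Longrightarrow> mean_le (f i) c"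
  shows "mean_le (\<lambda>\<omega>. \<Sum>i\<in>I. a i * f i \<omega>) c"
proof -
  have "mean_le (\<lambda>\<omega>. \<Sum>i\<in>K. a i * f i \<omega>) (\<Sum>i\<in>K. a i * c)" if "K \<subseteq> I" for K
    using finite_subset[OF that assms(1)] that
  proof (induction K rule: finite_induct)
    case empty
    then show ?case using mean_le_const[of 0] by simp
  next
    case (insert i K)
    then show ?case using assms by (simp add: mean_le_add mean_le_cmult)
  qed
  from this[of I] show ?thesis using assms(2) by (simp flip: sum_distrib_right)
qed

lemma mean_le_mono: "mean_le f c \<Longrightarrow> c \<le> d \<Longrightarrow> mean_le f d"
  unfolding mean_le_def by (meson ennreal_leI order_trans)

lemma exp_moment_fluct_ge_1: "1 \<le> (\<integral>\<^sup>+\<omega>. ennreal (exp (c * fluct N \<sigma> \<omega>)) \<partial>M)"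
proof -
  have "c * fluct N \<sigma> \<omega> = lin N (\<lambda>p. c / real N * (case p of (i, j) \<Rightarrow> of_bool (\<sigma> i = \<sigma> j))) \<omega>" for \<omega>
    unfolding fluct_def lin_def by (simp add: sum_distrib_left mult.assoc)
  then show ?thesis using exp_moment_lin_ge_1 by simp
qed

end

lemma tendsto_exp_minus_linear:
  assumes "0 < (a::real)"
  shows "(\<lambda>N. exp (- a * real N)) \<longlonglongrightarrow> 0"
proof -
  have "filterlim (\<lambda>N. a * real N) at_top sequentially"
    using assms by (intro filterlim_tendsto_pos_mult_at_top[OF tendsto_const] filterlim_real_sequentially)
  then have "filterlim (\<lambda>N. - (a * real N)) at_bot sequentially" by (simp add: filterlim_uminus_at_bot)
  then have "(\<lambda>N. exp (- (a * real N))) \<longlonglongrightarrow> 0" by (rule filterlim_compose[OF exp_at_bot])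
  then show ?thesis by simp
qed

section \<open>Moments of the ratio of mean hitting times\<close>

context metastable_disorder
begin

text \<open>The product of numerator X and inverse capacity Y is separated by (X Y)^k \<le> (X^p +
  Y^p) / 2 with p = 2 k. Convexity moves the p-th power inside the averages, and each single moment
  is about exp (v (p \<beta>)^2 / 4).\<close>

lemma expectation_upper:
  assumes \<epsilon>: "0 < \<epsilon>" and k: "1 \<le> k" and \<zeta>: "0 < \<zeta>"
  shows "eventually (\<lambda>N. \<forall>t0 V \<rho> E \<kappa> s t. sandwich \<epsilon> N t0 V \<rho> E \<kappa> s t \<longrightarrow>
    (\<exists>U. mean_le U (exp (\<beta>\<^sup>2 * v * k\<^sup>2 + \<zeta>)) \<and> (\<forall>\<omega>. t \<omega> powr k \<le> U \<omega>))) sequentially"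
proof -
  define p where "p = 2 * k"
  have p: "1 \<le> p" "0 < p" using k by (auto simp: p_def)
  have C: "v * (p * \<beta>)\<^sup>2 / 4 = \<beta>\<^sup>2 * v * k\<^sup>2" "v * (- (p * \<beta>))\<^sup>2 / 4 = \<beta>\<^sup>2 * v * k\<^sup>2"
    by (simp_all add: p_def power_mult_distrib)
  define C where "C = \<beta>\<^sup>2 * v * k\<^sup>2"
  have z2: "0 < \<zeta> / 2" using \<zeta> by simp
  have ep: "0 < \<epsilon> * p / 2" using \<epsilon> p by simp
  have q1: "1 \<le> q" using q by simp
  have t3: "0 \<le> 3 * p * \<beta>" using p \<beta>_pos by simp
  have e2: "0 < \<epsilon> / 2" using \<epsilon> by simp
  \<comment> \<open>The prefactor tends to 1 and the error to 0, so the bound drops below exp (C +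
    \<zeta>); the moment estimates have used only \<zeta> / 2.\<close>
  have lim: "(\<lambda>N. ((1 + exp (- (\<epsilon> / 2) * real N)) / (1 - exp (- \<epsilon> * real N))) powr p * (exp (C + \<zeta> / 2) + exp (- (\<epsilon> / 2) * real N)))
      \<longlonglongrightarrow> ((1 + 0) / (1 - 0)) powr p * (exp (C + \<zeta> / 2) + 0)"
    by (intro tendsto_intros tendsto_exp_minus_linear \<epsilon> e2) auto
  have "eventually (\<lambda>N. ((1 + exp (- (\<epsilon> / 2) * real N)) / (1 - exp (- \<epsilon> * real N))) powr p *
      (exp (C + \<zeta> / 2) + exp (- (\<epsilon> / 2) * real N)) < exp (C + \<zeta>)) sequentially"
    by (rule order_tendstoD(2)[OF lim]) (use \<zeta> in simp)
  then show ?thesis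
    using exp_moment_fluct[OF z2, of "p * \<beta>"] exp_moment_max_fluct[OF z2, of "- (p * \<beta>)"]
      exp_moment_max[OF ep q1 t3] eventually_ge_at_top[of "1::nat"]
  proof eventually_elim
    case (elim N)
    show ?case
    proof (intro allI impI)
      fix t0 V \<rho> E \<kappa> s t assume sw: "sandwich \<epsilon> N t0 V \<rho> E \<kappa> s t"
      define \<delta> where "\<delta> = exp (- \<epsilon> * real N)"
      \<comment> \<open>Half of the decay exp (- \<epsilon> N) becomes a small convex weight; the
        other half, raised to the power p, cancels the growth allowed to the moment of the maximal
        fluctuation.\<close>
      define \<kappa>0 where "\<kappa>0 = exp (- (\<epsilon> / 2) * real N)"
      have \<delta>: "0 < \<delta>" "\<delta> < 1" using \<epsilon> elim(5) by (auto simp: \<delta>_def)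
      have \<kappa>0: "0 < \<kappa>0" by (simp add: \<kappa>0_def)
      define R where "R = (1 + \<kappa>0) / (1 - \<delta>)"
      have R: "0 < R" using \<delta> \<kappa>0 by (simp add: R_def)
      let ?m = "\<lambda>e \<omega>. max (exp (- (p * \<beta>) * fluct N (fst e) \<omega>)) (exp (- (p * \<beta>) * fluct N (snd e) \<omega>))"
      define U where "U \<omega> = 1 / 2 * (R powr p * ((\<Sum>\<sigma>\<in>V. \<rho> \<sigma> * exp (p * \<beta> * fluct N \<sigma> \<omega>))
        + (\<kappa>0 * exp (- (\<epsilon> * p / 2) * real N)) * exp (3 * p * \<beta> * max_fluct q N \<omega>)) + (\<Sum>e\<in>E. \<kappa> e * ?m e \<omega>))" for \<omega>
      have S: "finite V" "(\<Sum>\<sigma>\<in>V. \<rho> \<sigma>) = 1" "\<And>\<sigma>. \<sigma> \<in> V \<Longrightarrow> 0 \<le> \<rho> \<sigma>"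
        "finite E" "(\<Sum>e\<in>E. \<kappa> e) = 1" "\<And>e. e \<in> E \<Longrightarrow> 0 \<le> \<kappa> e" "\<And>e. e \<in> E \<Longrightarrow> differ_once N (fst e) (snd e)"
        using sw unfolding sandwich_def by blast+
      have "mean_le U (1 / 2 * (R powr p * (exp (C + \<zeta> / 2) + (\<kappa>0 * exp (- (\<epsilon> * p / 2) * real N)) * exp (\<epsilon> * p / 2 * real N)) + exp (C + \<zeta> / 2)))"
        unfolding U_def
      proof (intro mean_le_cmult mean_le_add mean_le_sum S)
        show "mean_le (\<lambda>\<omega>. exp (p * \<beta> * fluct N \<sigma> \<omega>)) (exp (C + \<zeta> / 2))" for \<sigma>
          using elim(2) by (simp add: mean_le_def C C_def)
        show "mean_le (\<lambda>\<omega>. exp (3 * p * \<beta> * max_fluct q N \<omega>)) (exp (\<epsilon> * p / 2 * real N))"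
          using elim(4) q1 by (simp add: mean_le_def)
        show "mean_le (?m e) (exp (C + \<zeta> / 2))" if "e \<in> E" for e
          using elim(3) S(7)[OF that] by (simp add: mean_le_def C C_def differ_once_def max_def le_max_iff_disj)
      qed (use \<kappa>0 in auto)
      moreover have "1 / 2 * (R powr p * (exp (C + \<zeta> / 2) + (\<kappa>0 * exp (- (\<epsilon> * p / 2) * real N)) * exp (\<epsilon> * p / 2 * real N)) + exp (C + \<zeta> / 2))
        \<le> exp (C + \<zeta>)"
      proof -
        have K: "(\<kappa>0 * exp (- (\<epsilon> * p / 2) * real N)) * exp (\<epsilon> * p / 2 * real N) = \<kappa>0" by (simp add: mult.assoc exp_add[symmetric])
        have "R powr p * (exp (C + \<zeta> / 2) + \<kappa>0) \<le> exp (C + \<zeta>)" using elim(1) by (simp add: R_def \<kappa>0_def \<delta>_def)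
        moreover have "exp (C + \<zeta> / 2) \<le> exp (C + \<zeta>)" using \<zeta> by simp
        moreover have "1 / 2 * (x + y) \<le> z" if "x \<le> z" "y \<le> z" for x y z :: real using that by simp
        ultimately show ?thesis unfolding K by blast
      qed
      ultimately have "mean_le U (exp (C + \<zeta>))" by (rule mean_le_mono)
      moreover have "t \<omega> powr k \<le> U \<omega>" for \<omega>
      proof -
        let ?Q = "\<Sum>\<sigma>\<in>V. \<rho> \<sigma> * exp (\<beta> * fluct N \<sigma> \<omega>)"
        let ?m1 = "\<lambda>e. max (exp (- \<beta> * fluct N (fst e) \<omega>)) (exp (- \<beta> * fluct N (snd e) \<omega>))"
        let ?Y = "\<Sum>e\<in>E. \<kappa> e * ?m1 e"
        define Z where "Z = exp (3 * (\<beta> * max_fluct q N \<omega>) - \<epsilon> / 2 * real N)"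
        define X where "X = (?Q + exp (3 * (\<beta> * max_fluct q N \<omega>) - \<epsilon> * real N)) / (1 - \<delta>)"
        have t: "0 \<le> t \<omega>" "t \<omega> \<le> X * ?Y"
          using sw unfolding sandwich_def X_def \<delta>_def by blast+
        have Q0: "0 < ?Q"
        proof -
          have "(\<Sum>\<sigma>\<in>V. \<rho> \<sigma> * exp (\<beta> * fluct N \<sigma> \<omega>)) \<noteq> 0"
          proof
            assume "(\<Sum>\<sigma>\<in>V. \<rho> \<sigma> * exp (\<beta> * fluct N \<sigma> \<omega>)) = 0"
            then have "\<forall>\<sigma>\<in>V. \<rho> \<sigma> * exp (\<beta> * fluct N \<sigma> \<omega>) = 0" using S by (subst (asm) sum_nonneg_eq_0_iff) auto
            then have "(\<Sum>\<sigma>\<in>V. \<rho> \<sigma>) = 0" by (intro sum.neutral) auto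
            then show False using S(2) by simp
          qed
          moreover have "0 \<le> ?Q" using S by (intro sum_nonneg) auto
          ultimately show ?thesis by simp
        qed
        have Y0: "0 \<le> ?Y" using S by (intro sum_nonneg mult_nonneg_nonneg) (auto simp: le_max_iff_disj)
        have kZ: "exp (3 * (\<beta> * max_fluct q N \<omega>) - \<epsilon> * real N) = \<kappa>0 * Z"
          by (simp add: \<kappa>0_def Z_def exp_add[symmetric])
        have X0: "0 < X" using Q0 \<delta> by (simp add: X_def add_pos_pos)
        \<comment> \<open>Writing the sum as \<open>R\<close> times a convex combination lets the
          power pass inside with a constant tending to 1; a plain bound on the power of a sum would
          lose a fixed factor.\<close>
        have XR: "X = R * ((1 - \<kappa>0 / (1 + \<kappa>0)) * ?Q + \<kappa>0 / (1 + \<kappa>0) * Z)"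
        proof -
          have "(1 + \<kappa>0) * ((1 - \<kappa>0 / (1 + \<kappa>0)) * ?Q + \<kappa>0 / (1 + \<kappa>0) * Z) = ?Q + \<kappa>0 * Z"
          proof -
            have nz: "1 + \<kappa>0 \<noteq> 0" using \<kappa>0 by simp
            then have "1 - \<kappa>0 / (1 + \<kappa>0) = 1 / (1 + \<kappa>0)" by (simp add: field_simps)
            then show ?thesis using nz by (simp add: distrib_left)
          qed
          then show ?thesis unfolding X_def R_def kZ times_divide_eq_left[of "1 + \<kappa>0" "1 - \<delta>"] by (rule arg_cong2[where f = "(/)", OF sym refl])
        qed
        have cv: "((1 - \<kappa>0 / (1 + \<kappa>0)) * ?Q + \<kappa>0 / (1 + \<kappa>0) * Z) powr p
          \<le> (1 - \<kappa>0 / (1 + \<kappa>0)) * ?Q powr p + \<kappa>0 / (1 + \<kappa>0) * Z powr p"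
          using convex_onD[OF powr_convex[OF p(1)], of "\<kappa>0 / (1 + \<kappa>0)" ?Q Z] \<kappa>0 Q0 by (simp add: Z_def)
        have Qp: "?Q powr p \<le> (\<Sum>\<sigma>\<in>V. \<rho> \<sigma> * exp (p * \<beta> * fluct N \<sigma> \<omega>))"
        proof -
          have "?Q powr p \<le> (\<Sum>\<sigma>\<in>V. \<rho> \<sigma> * exp (\<beta> * fluct N \<sigma> \<omega>) powr p)"
            using S by (intro powr_sum_convex p) auto
          then show ?thesis by (simp add: exp_powr_real mult_ac)
        qed
        have Zp: "Z powr p = exp (- (\<epsilon> * p / 2) * real N) * exp (3 * p * \<beta> * max_fluct q N \<omega>)"
          by (simp add: Z_def exp_powr_real exp_add[symmetric] algebra_simps)
        have "X powr p \<le> R powr p * (?Q powr p + \<kappa>0 * Z powr p)"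
        proof -
          have "(1 - \<kappa>0 / (1 + \<kappa>0)) * ?Q powr p \<le> 1 * ?Q powr p" using \<kappa>0 by (intro mult_right_mono) auto
          moreover have "\<kappa>0 / (1 + \<kappa>0) * Z powr p \<le> \<kappa>0 * Z powr p" using \<kappa>0 by (intro mult_right_mono) (auto simp: field_simps)
          ultimately have "((1 - \<kappa>0 / (1 + \<kappa>0)) * ?Q + \<kappa>0 / (1 + \<kappa>0) * Z) powr p \<le> ?Q powr p + \<kappa>0 * Z powr p"
            using cv by linarith
          moreover have "0 \<le> (1 - \<kappa>0 / (1 + \<kappa>0)) * ?Q + \<kappa>0 / (1 + \<kappa>0) * Z"
            using \<kappa>0 Q0 by (intro add_nonneg_nonneg mult_nonneg_nonneg) (auto simp: Z_def)
          ultimately show ?thesis unfolding XR using R by (simp add: powr_mult mult_left_mono)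
        qed
        also have "\<dots> \<le> R powr p * ((\<Sum>\<sigma>\<in>V. \<rho> \<sigma> * exp (p * \<beta> * fluct N \<sigma> \<omega>)) + \<kappa>0 * Z powr p)"
          using Qp by (intro mult_left_mono add_right_mono) auto
        finally have Xp: "X powr p \<le> R powr p * ((\<Sum>\<sigma>\<in>V. \<rho> \<sigma> * exp (p * \<beta> * fluct N \<sigma> \<omega>))
           + (\<kappa>0 * exp (- (\<epsilon> * p / 2) * real N)) * exp (3 * p * \<beta> * max_fluct q N \<omega>))"
          unfolding Zp by (simp only: mult.assoc)
        have Yp: "?Y powr p \<le> (\<Sum>e\<in>E. \<kappa> e * ?m e \<omega>)"
        proof -
          have mono: "max (exp x) (exp y) powr p = max (exp (p * x)) (exp (p * y))" for x y
            using p by (auto simp: max_def exp_powr_real mult.commute)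
          have m: "?m1 e powr p = ?m e \<omega>" for e
            unfolding mono by (simp add: mult.assoc)
          have "?Y powr p \<le> (\<Sum>e\<in>E. \<kappa> e * ?m1 e powr p)"
            using S by (intro powr_sum_convex p) (auto simp: less_max_iff_disj)
          then show ?thesis unfolding m .
        qed
        have "t \<omega> powr k \<le> (X * ?Y) powr k" using t k by (intro powr_mono2) auto
        also have "\<dots> = X powr k * ?Y powr k" using X0 Y0 by (simp add: powr_mult)
        also have "\<dots> \<le> 1 / 2 * (X powr p + ?Y powr p)"
        proof -
          have sq: "x powr p = (x powr k)\<^sup>2" for x :: real by (simp add: p_def power2_eq_square flip: powr_add)
          have "0 \<le> (X powr k - ?Y powr k)\<^sup>2" by simp
          then show ?thesis unfolding sq power2_diff by simp
        qed
        also have "\<dots> \<le> U \<omega>" unfolding U_def using Xp Yp by (intro mult_left_mono add_mono) auto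
        finally show ?thesis .
      qed
      ultimately show "\<exists>U. mean_le U (exp (\<beta>\<^sup>2 * v * k\<^sup>2 + \<zeta>)) \<and> (\<forall>\<omega>. t \<omega> powr k \<le> U \<omega>)"
        unfolding C_def by blast
    qed
  qed
qed

text \<open>The number \<open>a\<close> is used both as the parameter l and as the point of tangency
  of x^k. It is the reciprocal of the bound on the mean of the capacity ratio, and then the linear
  lower bound has mean close to a^k.\<close>

lemma expectation_lower:
  assumes \<epsilon>: "0 < \<epsilon>" and k: "1 \<le> k" and \<zeta>: "0 < \<zeta>"
  shows "eventually (\<lambda>N. \<forall>t0 V \<rho> E \<kappa> s t. sandwich \<epsilon> N t0 V \<rho> E \<kappa> s t \<longrightarrow>
    (\<exists>L\<in>borel_measurable M. (\<forall>\<omega>. 0 \<le> L \<omega> \<and> L \<omega> \<le> t \<omega> powr k) \<and>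
      ennreal (exp (- (k * (\<beta>\<^sup>2 * v / 4) + \<zeta>))) \<le> (\<integral>\<^sup>+\<omega>. ennreal (L \<omega>) \<partial>M))) sequentially"
proof -
  \<comment> \<open>The k-th power of \<open>a\<close> then loses \<zeta> / 2; the remaining half
    covers the convergence of the bracket to 1.\<close>
  define \<zeta>1 where "\<zeta>1 = \<zeta> / (2 * k)"
  have z1: "0 < \<zeta>1" using \<zeta> k by (simp add: \<zeta>1_def)
  define a where "a = exp (- (v * \<beta>\<^sup>2 / 4 + \<zeta>1))"
  have a0: "0 < a" by (simp add: a_def)
  have ak: "a powr k = exp (- (k * (\<beta>\<^sup>2 * v / 4) + \<zeta> / 2))"
    using k by (simp add: a_def exp_powr_real \<zeta>1_def field_simps)
  have e4: "0 < \<epsilon> / 4" using \<epsilon> by simp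
  have q1: "1 \<le> q" using q by simp
  have t3: "0 \<le> 3 * \<beta> / 2" using \<beta>_pos by simp
  have lim: "(\<lambda>N. k * (2 * (1 - exp (- (\<epsilon> / 4) * real N)) / sqrt (1 + exp (- \<epsilon> * real N)) - 1) - (k - 1))
      \<longlonglongrightarrow> k * (2 * (1 - 0) / sqrt (1 + 0) - 1) - (k - 1)"
    by (intro tendsto_intros tendsto_exp_minus_linear \<epsilon> e4) auto
  have "eventually (\<lambda>N. exp (- (\<zeta> / 2)) < k * (2 * (1 - exp (- (\<epsilon> / 4) * real N)) / sqrt (1 + exp (- \<epsilon> * real N)) - 1) - (k - 1)) sequentially"
    by (rule order_tendstoD(1)[OF lim]) (use \<zeta> in simp)
  then show ?thesis
    using exp_moment_fluct[OF z1, of \<beta>] exp_moment_max[OF e4 q1 t3]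
  proof eventually_elim
    case (elim N)
    show ?case
    proof (intro allI impI)
      fix t0 V \<rho> E \<kappa> s t assume sw: "sandwich \<epsilon> N t0 V \<rho> E \<kappa> s t"
      define r where "r = sqrt (1 + exp (- \<epsilon> * real N))"
      define b0 where "b0 = exp (- (\<epsilon> / 4) * real N)"
      have r: "0 < r" by (simp add: r_def add_pos_pos)
      have S: "finite V" "(\<Sum>\<sigma>\<in>V. \<rho> \<sigma>) = 1" "\<And>\<sigma>. \<sigma> \<in> V \<Longrightarrow> 0 \<le> \<rho> \<sigma>"
        "finite E" "(\<Sum>e\<in>E. \<kappa> e) = 1" "\<And>e. e \<in> E \<Longrightarrow> 0 \<le> \<kappa> e"
        using sw unfolding sandwich_def by blast+
      let ?Q = "\<lambda>\<omega>. \<Sum>\<sigma>\<in>V. \<rho> \<sigma> * exp (\<beta> / 2 * fluct N \<sigma> \<omega>)"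
      let ?b = "\<lambda>\<omega>. exp ((3 * (\<beta> * max_fluct q N \<omega>) - \<epsilon> * real N) / 2)"
      let ?Y = "\<lambda>\<omega>. \<Sum>e\<in>E. \<kappa> e * exp (\<beta> * fluct N (s e) \<omega>)"
      define G where "G \<omega> = a powr k * (2 * k / r) * ?Q \<omega>" for \<omega>
      define g where "g \<omega> = a powr k * ((2 * k / r) * ?b \<omega> + ((k * a) * ?Y \<omega> + (k - 1)))" for \<omega>
      \<comment> \<open>\<open>G - g\<close> may be negative, while the integrals are of nonnegative
        functions; the two parts are integrated separately through G \<le> L + g.\<close>
      define L where "L \<omega> = max 0 (G \<omega> - g \<omega>)" for \<omega>
      have bb: "mean_le ?b b0"
      proof -
        have "mean_le (\<lambda>\<omega>. exp (- (\<epsilon> / 2) * real N) * exp (3 * \<beta> / 2 * max_fluct q N \<omega>))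
          (exp (- (\<epsilon> / 2) * real N) * exp (\<epsilon> / 4 * real N))"
          using elim(3) q1 by (intro mean_le_cmult) (auto simp: mean_le_def)
        moreover have "exp (- (\<epsilon> / 2) * real N) * exp (3 * \<beta> / 2 * max_fluct q N \<omega>) = ?b \<omega>" for \<omega>
          unfolding exp_add[symmetric] by (simp add: field_simps)
        moreover have "exp (- (\<epsilon> / 2) * real N) * exp (\<epsilon> / 4 * real N) = b0"
          unfolding exp_add[symmetric] b0_def by (simp add: field_simps)
        ultimately show ?thesis by simp
      qed
      have ag: "mean_le g (a powr k * ((2 * k / r) * b0 + ((k * a) * (1 / a) + (k - 1))))"
        unfolding g_def
      proof (intro mean_le_cmult mean_le_add mean_le_const bb mean_le_sum S)
        show "mean_le (\<lambda>\<omega>. exp (\<beta> * fluct N (s e) \<omega>)) (1 / a)" for e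
        proof -
          have "1 / a = exp (v * \<beta>\<^sup>2 / 4 + \<zeta>1)" unfolding a_def exp_minus inverse_eq_divide by (metis div_by_1 divide_divide_eq_right mult_1)
          then show ?thesis using elim(2) by (simp add: mean_le_def)
        qed
      qed (use k r a0 in auto)
      then have gm [measurable]: "g \<in> borel_measurable M" and g0: "\<And>\<omega>. 0 \<le> g \<omega>" by (auto simp: mean_le_def)
      have Gm [measurable]: "G \<in> borel_measurable M" unfolding G_def by measurable
      have Lm: "L \<in> borel_measurable M" unfolding L_def by measurable
      have le: "L \<omega> \<le> t \<omega> powr k" for \<omega>
      proof -
        have le0: "2 * a * (?Q \<omega> - ?b \<omega>) / r - a\<^sup>2 * ?Y \<omega> \<le> t \<omega>" and t0: "0 \<le> t \<omega>"
          using sw a0 unfolding sandwich_def r_def by blast+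
        have K: "a powr (k - 1) * a = a powr k" using a0 by (simp add: powr_diff)
        have "k * a powr (k - 1) * (2 * a * (?Q \<omega> - ?b \<omega>) / r - a\<^sup>2 * ?Y \<omega>) \<le> k * a powr (k - 1) * t \<omega>"
          using k le0 by (intro mult_left_mono) auto
        moreover have "k * a powr (k - 1) * (2 * a * (?Q \<omega> - ?b \<omega>) / r - a\<^sup>2 * ?Y \<omega>)
          = k * (a powr (k - 1) * a) * (2 * (?Q \<omega> - ?b \<omega>) / r - a * ?Y \<omega>)"
          by (simp add: algebra_simps power2_eq_square diff_divide_distrib)
        moreover have "k * a powr (k - 1) * t \<omega> - (k - 1) * a powr k \<le> t \<omega> powr k" by (rule powr_ge_tangent[OF a0 t0 k])
        ultimately have "k * a powr k * (2 * (?Q \<omega> - ?b \<omega>) / r - a * ?Y \<omega>) - (k - 1) * a powr k \<le> t \<omega> powr k"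
          unfolding K by linarith
        moreover have "k * a powr k * (2 * (?Q \<omega> - ?b \<omega>) / r - a * ?Y \<omega>) - (k - 1) * a powr k = G \<omega> - g \<omega>"
          unfolding G_def g_def using r by (simp add: field_simps)
        ultimately show ?thesis by (simp add: L_def)
      qed
      have "ennreal (a powr k * (2 * k / r)) \<le> (\<integral>\<^sup>+\<omega>. ennreal (G \<omega>) \<partial>M)"
      proof -
        have "(\<Sum>\<sigma>\<in>V. ennreal (\<rho> \<sigma>) * 1) \<le> (\<Sum>\<sigma>\<in>V. ennreal (\<rho> \<sigma>) * (\<integral>\<^sup>+\<omega>. ennreal (exp (\<beta> / 2 * fluct N \<sigma> \<omega>)) \<partial>M))"
          by (intro sum_mono mult_left_mono exp_moment_fluct_ge_1) auto
        also have "(\<Sum>\<sigma>\<in>V. ennreal (\<rho> \<sigma>) * 1) = 1" using S by (simp add: sum_ennreal)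
        also have "(\<Sum>\<sigma>\<in>V. ennreal (\<rho> \<sigma>) * (\<integral>\<^sup>+\<omega>. ennreal (exp (\<beta> / 2 * fluct N \<sigma> \<omega>)) \<partial>M)) = (\<integral>\<^sup>+\<omega>. ennreal (?Q \<omega>) \<partial>M)"
        proof -
          have "(\<integral>\<^sup>+\<omega>. ennreal (?Q \<omega>) \<partial>M) = (\<integral>\<^sup>+\<omega>. (\<Sum>\<sigma>\<in>V. ennreal (\<rho> \<sigma>) * ennreal (exp (\<beta> / 2 * fluct N \<sigma> \<omega>))) \<partial>M)"
            using S by (intro nn_integral_cong) (simp add: sum_ennreal flip: ennreal_mult)
          then show ?thesis by (simp add: nn_integral_sum nn_integral_cmult)
        qed
        finally have "1 \<le> (\<integral>\<^sup>+\<omega>. ennreal (?Q \<omega>) \<partial>M)" .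
        then have "ennreal (a powr k * (2 * k / r)) * 1 \<le> ennreal (a powr k * (2 * k / r)) * (\<integral>\<^sup>+\<omega>. ennreal (?Q \<omega>) \<partial>M)"
          by (intro mult_left_mono) auto
        also have "\<dots> = (\<integral>\<^sup>+\<omega>. ennreal (G \<omega>) \<partial>M)"
        proof -
          have "ennreal (G \<omega>) = ennreal (a powr k * (2 * k / r)) * ennreal (?Q \<omega>)" for \<omega>
            unfolding G_def using S k r by (intro ennreal_mult sum_nonneg) auto
          then show ?thesis by (simp add: nn_integral_cmult)
        qed
        finally show ?thesis by simp
      qed
      also have "\<dots> \<le> (\<integral>\<^sup>+\<omega>. ennreal (L \<omega>) + ennreal (g \<omega>) \<partial>M)"
        using g0 by (intro nn_integral_mono) (auto simp: L_def max_def simp flip: ennreal_plus intro: ennreal_leI)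
      also have "\<dots> = (\<integral>\<^sup>+\<omega>. ennreal (L \<omega>) \<partial>M) + (\<integral>\<^sup>+\<omega>. ennreal (g \<omega>) \<partial>M)"
        using Lm by (intro nn_integral_add) auto
      also have "\<dots> \<le> (\<integral>\<^sup>+\<omega>. ennreal (L \<omega>) \<partial>M) + ennreal (a powr k * ((2 * k / r) * b0 + ((k * a) * (1 / a) + (k - 1))))"
        using ag by (intro add_left_mono) (auto simp: mean_le_def)
      finally have I: "ennreal (a powr k * (2 * k / r)) \<le> (\<integral>\<^sup>+\<omega>. ennreal (L \<omega>) \<partial>M) + ennreal (a powr k * ((2 * k / r) * b0 + ((k * a) * (1 / a) + (k - 1))))" .
      let ?c = "a powr k * ((2 * k / r) * b0 + ((k * a) * (1 / a) + (k - 1)))"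
      have c0: "0 \<le> ?c" using ag by (simp add: mean_le_def)
      have "ennreal (a powr k * (2 * k / r) - ?c) \<le> (\<integral>\<^sup>+\<omega>. ennreal (L \<omega>) \<partial>M)"
      proof -
        have "ennreal (a powr k * (2 * k / r)) - ennreal ?c \<le> (\<integral>\<^sup>+\<omega>. ennreal (L \<omega>) \<partial>M)"
          using I by (simp add: ennreal_minus_le_iff add.commute)
        then show ?thesis using c0 by (simp add: ennreal_minus)
      qed
      moreover have "exp (- (k * (\<beta>\<^sup>2 * v / 4) + \<zeta>)) \<le> a powr k * (2 * k / r) - ?c"
      proof -
        have "a powr k * (2 * k / r) - ?c = a powr k * (k * (2 * (1 - b0) / r - 1) - (k - 1))"
          using a0 r by (simp add: field_simps)
        moreover have "a powr k * exp (- (\<zeta> / 2)) \<le> a powr k * (k * (2 * (1 - b0) / r - 1) - (k - 1))"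
          using elim(1) by (intro mult_left_mono) (auto simp: r_def b0_def)
        moreover have "a powr k * exp (- (\<zeta> / 2)) = exp (- (k * (\<beta>\<^sup>2 * v / 4) + \<zeta>))"
          unfolding ak by (simp add: exp_add[symmetric])
        ultimately show ?thesis by simp
      qed
      ultimately have "ennreal (exp (- (k * (\<beta>\<^sup>2 * v / 4) + \<zeta>))) \<le> (\<integral>\<^sup>+\<omega>. ennreal (L \<omega>) \<partial>M)"
        by (meson ennreal_leI order_trans)
      then show "\<exists>L\<in>borel_measurable M. (\<forall>\<omega>. 0 \<le> L \<omega> \<and> L \<omega> \<le> t \<omega> powr k) \<and>
        ennreal (exp (- (k * (\<beta>\<^sup>2 * v / 4) + \<zeta>))) \<le> (\<integral>\<^sup>+\<omega>. ennreal (L \<omega>) \<partial>M)"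
        using Lm le by (intro bexI[of _ L]) (auto simp: L_def)
    qed
  qed
qed

section \<open>The normalised moments and their limits\<close>

definition moment_ratio :: "real \<Rightarrow> nat \<Rightarrow> ennreal" where
  "moment_ratio k N = ennreal_powr (\<integral>\<^sup>+\<omega>. ennreal_powr (hit_mean N (hamiltonian N (\<lambda>i j. J i j \<omega>))) k \<partial>M) (1 / k)
     / hit_mean N (hamiltonian N (\<lambda>_ _. 1))"

lemma moment_ratio_bounds:
  assumes k: "1 \<le> k" and \<zeta>: "0 < \<zeta>"
  shows "eventually (\<lambda>N. ennreal (exp (- (\<beta>\<^sup>2 * v / 4) - \<zeta>)) \<le> moment_ratio k N \<and>
    moment_ratio k N \<le> ennreal (exp (\<beta>\<^sup>2 * v * k + \<zeta>))) sequentially"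
proof -
  obtain \<epsilon> where \<epsilon>: "0 < \<epsilon>" and ex: "eventually (\<lambda>N. \<exists>t0 V \<rho> E \<kappa> s t. sandwich \<epsilon> N t0 V \<rho> E \<kappa> s t) sequentially"
    using sandwich_exists by blast
  from ex expectation_upper[OF \<epsilon> k \<zeta>] expectation_lower[OF \<epsilon> k \<zeta>] show ?thesis
  proof eventually_elim
    case (elim N)
    obtain t0 V \<rho> E \<kappa> s t where sw: "sandwich \<epsilon> N t0 V \<rho> E \<kappa> s t" using elim(1) by blast
    obtain U where U: "mean_le U (exp (\<beta>\<^sup>2 * v * k\<^sup>2 + \<zeta>))" "\<And>\<omega>. t \<omega> powr k \<le> U \<omega>" using elim(2) sw by blast
    obtain L where L: "L \<in> borel_measurable M" "\<And>\<omega>. 0 \<le> L \<omega>" "\<And>\<omega>. L \<omega> \<le> t \<omega> powr k"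
      "ennreal (exp (- (k * (\<beta>\<^sup>2 * v / 4) + \<zeta>))) \<le> (\<integral>\<^sup>+\<omega>. ennreal (L \<omega>) \<partial>M)" using elim(3) sw by blast
    have t0: "0 < t0" "hit_mean N (hamiltonian N (\<lambda>_ _. 1)) = ennreal t0"
      and t: "\<And>\<omega>. 0 \<le> t \<omega>" "\<And>\<omega>. hit_mean N (hamiltonian N (\<lambda>i j. J i j \<omega>)) = ennreal (t0 * t \<omega>)"
      using sw unfolding sandwich_def by blast+
    define I where "I = (\<integral>\<^sup>+\<omega>. ennreal_powr (hit_mean N (hamiltonian N (\<lambda>i j. J i j \<omega>))) k \<partial>M)"
    have P: "ennreal_powr (hit_mean N (hamiltonian N (\<lambda>i j. J i j \<omega>))) k = ennreal (t0 powr k * t \<omega> powr k)" for \<omega>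
      unfolding t(2) using t(1)[of \<omega>] t0 by (simp add: ennreal_powr_ennreal powr_mult)
    have root: "(t0 powr k * exp c) powr (1 / k) = t0 * exp (c / k)" for c
      using t0 k by (simp add: powr_mult powr_powr exp_powr_real)
    have quot: "ennreal (t0 * x) / ennreal t0 = ennreal x" if "0 \<le> x" for x
      using that t0 by (simp add: divide_ennreal)
    have up: "I \<le> ennreal (t0 powr k * exp (\<beta>\<^sup>2 * v * k\<^sup>2 + \<zeta>))"
    proof -
      have "mean_le (\<lambda>\<omega>. t0 powr k * U \<omega>) (t0 powr k * exp (\<beta>\<^sup>2 * v * k\<^sup>2 + \<zeta>))" using U(1) by (intro mean_le_cmult) auto
      moreover have "I \<le> (\<integral>\<^sup>+\<omega>. ennreal (t0 powr k * U \<omega>) \<partial>M)"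
        unfolding I_def P using U(2) by (intro nn_integral_mono ennreal_leI mult_left_mono) auto
      ultimately show ?thesis unfolding mean_le_def by (meson order_trans)
    qed
    have lo: "ennreal (t0 powr k * exp (- (k * (\<beta>\<^sup>2 * v / 4) + \<zeta>))) \<le> I"
    proof -
      have "ennreal (t0 powr k * exp (- (k * (\<beta>\<^sup>2 * v / 4) + \<zeta>))) \<le> ennreal (t0 powr k) * (\<integral>\<^sup>+\<omega>. ennreal (L \<omega>) \<partial>M)"
        using L(4) by (simp add: ennreal_mult mult_left_mono)
      also have "\<dots> = (\<integral>\<^sup>+\<omega>. ennreal (t0 powr k * L \<omega>) \<partial>M)"
        using L(1,2) by (simp add: ennreal_mult nn_integral_cmult)
      also have "\<dots> \<le> I" unfolding I_def P using L(3) by (intro nn_integral_mono ennreal_leI mult_left_mono) auto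
      finally show ?thesis .
    qed
    have R: "moment_ratio k N = ennreal_powr I (1 / k) / ennreal t0" by (simp add: moment_ratio_def I_def t0(2))
    have zk: "\<zeta> / k \<le> \<zeta>" using k \<zeta> by (simp add: field_simps)
    have "ennreal_powr I (1 / k) / ennreal t0 \<le> ennreal (t0 * exp ((\<beta>\<^sup>2 * v * k\<^sup>2 + \<zeta>) / k)) / ennreal t0"
      unfolding root[symmetric] using up k by (intro divide_right_mono_ennreal ennreal_powr_le) auto
    also have "\<dots> = ennreal (exp ((\<beta>\<^sup>2 * v * k\<^sup>2 + \<zeta>) / k))" by (rule quot) simp
    also have "\<dots> \<le> ennreal (exp (\<beta>\<^sup>2 * v * k + \<zeta>))"
      using zk k by (intro ennreal_leI) (simp add: add_divide_distrib power2_eq_square)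
    finally have 1: "moment_ratio k N \<le> ennreal (exp (\<beta>\<^sup>2 * v * k + \<zeta>))" unfolding R .
    have "ennreal (exp (- (\<beta>\<^sup>2 * v / 4) - \<zeta>)) \<le> ennreal (exp (- (k * (\<beta>\<^sup>2 * v / 4) + \<zeta>) / k))"
      using zk k by (intro ennreal_leI) (simp add: add_divide_distrib diff_divide_distrib)
    also have "\<dots> = ennreal (t0 * exp (- (k * (\<beta>\<^sup>2 * v / 4) + \<zeta>) / k)) / ennreal t0" by (rule quot[symmetric]) simp
    also have "\<dots> \<le> ennreal_powr I (1 / k) / ennreal t0"
      unfolding root[symmetric] using lo k by (intro divide_right_mono_ennreal ennreal_powr_ge) auto
    finally show ?case using 1 unfolding R by blast
  qed
qed

lemma moment_ratio_limits:
  assumes k: "1 \<le> k"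
  shows "ennreal (exp (- (\<beta>\<^sup>2 * v / 4))) \<le> liminf (moment_ratio k)"
    and "limsup (moment_ratio k) \<le> ennreal (exp (\<beta>\<^sup>2 * v * k))"
proof -
  have z: "0 < 1 / real (Suc n)" for n by simp
  have lim0: "(\<lambda>n. 1 / real (Suc n)) \<longlonglongrightarrow> 0" using LIMSEQ_Suc[OF lim_1_over_n] .
  have l: "(\<lambda>n. ennreal (exp (- (\<beta>\<^sup>2 * v / 4) - 1 / real (Suc n)))) \<longlonglongrightarrow> ennreal (exp (- (\<beta>\<^sup>2 * v / 4) - 0))"
    by (intro tendsto_ennrealI tendsto_intros lim0)
  have b: "ennreal (exp (- (\<beta>\<^sup>2 * v / 4) - 1 / real (Suc n))) \<le> liminf (moment_ratio k)" for n
    by (rule Liminf_bounded, rule eventually_mono[OF moment_ratio_bounds[OF k z]]) blast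
  have "ennreal (exp (- (\<beta>\<^sup>2 * v / 4) - 0)) \<le> liminf (moment_ratio k)"
    by (rule LIMSEQ_le_const2[OF l]) (use b in blast)
  then show "ennreal (exp (- (\<beta>\<^sup>2 * v / 4))) \<le> liminf (moment_ratio k)" by simp
  have l: "(\<lambda>n. ennreal (exp (\<beta>\<^sup>2 * v * k + 1 / real (Suc n)))) \<longlonglongrightarrow> ennreal (exp (\<beta>\<^sup>2 * v * k + 0))"
    by (intro tendsto_ennrealI tendsto_intros lim0)
  have b: "limsup (moment_ratio k) \<le> ennreal (exp (\<beta>\<^sup>2 * v * k + 1 / real (Suc n)))" for n
    by (rule Limsup_bounded, rule eventually_mono[OF moment_ratio_bounds[OF k z]]) blast
  have "limsup (moment_ratio k) \<le> ennreal (exp (\<beta>\<^sup>2 * v * k + 0))"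
    by (rule LIMSEQ_le_const[OF l]) (use b in blast)
  then show "limsup (moment_ratio k) \<le> ennreal (exp (\<beta>\<^sup>2 * v * k))" by simp
qed

end

text \<open>In regimes (i) and (ii) the two families exhaust all indices. In (ii) the condition
  \<beta> < q makes m_0 a local minimizer. In (iii) the index 0 is left over, and \<beta> above
  \<open>\<beta>\<^sub>2\<close> makes m_0 strictly shallower than m_1.\<close>

lemma metastable_regime_wells:
  assumes q: "2 \<le> q" and \<beta>: "\<beta>\<^sub>1 q < \<beta>" and reg: "metastable_regime q \<beta> m A B"
  obtains IA IB FA where "wells q \<beta> IA IB FA"
    "A = (\<lambda>N. \<Union>i\<in>IA. level_set q N (m i N))" "B = (\<lambda>N. \<Union>i\<in>IB. level_set q N (m i N))"
proof -
  let ?F = "\<lambda>i. free_energy \<beta> q (minimizer q \<beta> i)"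
  have bp: "0 < \<beta>" by (rule largest_s_pos(1)[OF q \<beta>])
  have eq: "?F i = ?F 1" if "i \<in> {1..q}" for i using free_energy_minimizer_eq[OF q that, of 1] q by simp
  have q1: "1 \<in> {1..q}" "2 \<in> {2..q}" using q by auto
  from reg consider
    (1) "A = (\<lambda>N. \<Union>i\<in>{1..q}. level_set q N (m i N))" "B = (\<lambda>N. level_set q N (m 0 N))"
  | (2) "\<beta> < real q" "A = (\<lambda>N. level_set q N (m 0 N))" "B = (\<lambda>N. \<Union>i\<in>{1..q}. level_set q N (m i N))"
  | (3) "\<beta>\<^sub>2 q < \<beta>" "A = (\<lambda>N. level_set q N (m 1 N))" "B = (\<lambda>N. \<Union>i\<in>{2..q}. level_set q N (m i N))"
    unfolding metastable_regime_def by blast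
  then show thesis
  proof cases
    case 1
    have "wells q \<beta> {1..q} {0} (?F 1)"
    proof
      show "?F i = ?F 1" if "i \<in> {1..q}" for i using eq[OF that] .
    qed (use q \<beta> local_minimizer_spike[OF q \<beta>] in auto)
    then show ?thesis using 1 by (intro that[of "{1..q}" "{0}"]) auto
  next
    case 2
    have "wells q \<beta> {0} {1..q} (?F 0)"
      using q \<beta> local_minimizer_uniform[OF q bp 2(1)] by unfold_locales auto
    then show ?thesis using 2 by (intro that[of "{0}" "{1..q}"]) auto
  next
    case 3
    have "wells q \<beta> {1} {2..q} (?F 1)"
    proof
      fix i assume "i \<le> q" "i \<notin> {1} \<union> {2..q}"
      then have "i = 0" by auto
      then show "?F 1 < ?F i" using free_energy_minimizer_less[OF q bp 3(1)] by simp
    qed (use q \<beta> q1 local_minimizer_spike[OF q \<beta>] in auto)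
    then show ?thesis using 3 by (intro that[of "{1}" "{2..q}"]) auto
  qed
qed

theorem theorem1p14:
  fixes M :: "'a measure" and J :: "nat \<Rightarrow> nat \<Rightarrow> 'a \<Rightarrow> real"
    and v \<beta> k :: real and q :: nat
    and m :: "nat \<Rightarrow> nat \<Rightarrow> nat \<Rightarrow> real"
    and A B :: "nat \<Rightarrow> config set"
  assumes "prob_space M"
    and "0 < v"
    and "prob_space.indep_vars M (\<lambda>_. borel) (\<lambda>(i, j). J i j) {(i, j). 1 \<le> i \<and> i < j}"
    and "\<And>i j. 1 \<le> i \<Longrightarrow> i < j \<Longrightarrow> distr M borel (J i j) = distr M borel (J 1 2)"
    and "integrable M (J 1 2)" and "prob_space.expectation M (J 1 2) = 1"
    and "integrable M (\<lambda>\<omega>. (J 1 2 \<omega>)\<^sup>2)" and "prob_space.variance M (J 1 2) = v"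
    and "0 \<in> interior {l::real. integrable M (\<lambda>\<omega>. exp (l * J 1 2 \<omega>))}"
    and "2 \<le> q"
    and "\<beta>\<^sub>1 q < \<beta>"
    and "\<And>i N. i \<le> q \<Longrightarrow> 1 \<le> N \<Longrightarrow> closest_lattice_point q N (minimizer q \<beta> i) (m i N)"
    and "metastable_regime q \<beta> m A B"
    and "1 \<le> k"
  defines "T \<equiv> (\<lambda>N H. mean_hitting_time q N \<beta> H (last_exit_distr q N \<beta> H (A N) (B N)) (B N))"
  defines "R \<equiv> (\<lambda>N.
      ennreal_powr (\<integral>\<^sup>+\<omega>. ennreal_powr (T N (hamiltonian N (\<lambda>i j. J i j \<omega>))) k \<partial>M) (1 / k)
      / T N (hamiltonian N (\<lambda>_ _. 1)))"
  shows "ennreal (exp (- (\<beta>\<^sup>2 * v / 4))) \<le> liminf R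
    \<and> liminf R \<le> limsup R
    \<and> limsup R \<le> ennreal (exp (\<beta>\<^sup>2 * v * k))"
proof -
  obtain IA IB FA where wells: "wells q \<beta> IA IB FA"
    and A: "A = (\<lambda>N. \<Union>i\<in>IA. level_set q N (m i N))" and B: "B = (\<lambda>N. \<Union>i\<in>IB. level_set q N (m i N))"
    using metastable_regime_wells[OF assms(10,11,13)] by blast
  have disorder: "disorder M J v"
    using assms(1-9) unfolding disorder_def disorder_axioms_def by blast
  interpret metastable_disorder q \<beta> IA IB FA M J v m
    using wells disorder assms(12) by (simp add: metastable_disorder_def metastable_disorder_axioms_def)
  have "R = moment_ratio k"
    unfolding R_def T_def moment_ratio_def[abs_def] hit_mean_def well_union_def A B by simp
  then show ?thesis
    using moment_ratio_limits[OF assms(14)] Liminf_le_Limsup[of sequentially "moment_ratio k"] by simp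
qed

end
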